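(* In the setting of the context, put $$P(t,z,\epsilon,\partial_z,\sigma_q)=Q(\partial_z)\sigma_q-(\epsilon t)^{d_D}\sigma_q^{\frac{d_D}{k_2}+1}R_D(\partial_z)-\sum_{\ell=1}^{D-1}\Big(\sum_{\lambda\in I_\ell}t^{d_{\lambda,\ell}}\epsilon^{\Delta_{\lambda,\ell}}\sigma_q^{\delta_\ell}c_{\lambda,\ell}(z,\epsilon)R_\ell(\partial_z)\Big),$$ $$\mathbf{P}(t,z,\epsilon,\partial_z,\sigma_q)=\mathbf{Q}(\partial_z)\sigma_q-(\epsilon t)^{\mathbf{d}_{\mathbf{D}}}\sigma_q^{\frac{\mathbf{d}_{\mathbf{D}}}{k_1}+1}\mathbf{R}_{\mathbf{D}}(\partial_z)-\sum_{\ell=1}^{\mathbf{D}-1}\Big(\sum_{\lambda\in\mathbf{I}_\ell}t^{\mathbf{d}_{\lambda,\ell}}\epsilon^{\boldsymbol{\Delta}_{\lambda,\ell}}\sigma_q^{\boldsymbol{\delta}_\ell}\mathbf{c}_{\lambda,\ell}(z,\epsilon)\mathbf{R}_\ell(\partial_z)\Big).$$ Then the functions $u^{\mathfrak{d}_p}(t,z,\epsilon)$, $0\le p\le\varsigma-1$, constructed in the context solve the problem $$\mathbf{P}(t,z,\epsilon,\partial_z,\sigma_q)\,\sigma_q^{-1}\,P(t,z,\epsilon,\partial_z,\sigma_q)\,u^{\mathfrak{d}_p}(t,z,\epsilon)=\sigma_q\mathbf{f}(t,z,\epsilon),$$ whose coefficients and forcing term $\mathbf{f}$ are analytic functions on $D(0,r_{\mathcal{T}})\times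 H_{\beta'}\times D(0,\epsilon_0)$. Moreover, the formal power series $\hat u(t,z,\epsilon)$ of the context formally solves this equation, i.e. $\mathbf{P}\,\sigma_q^{-1}P\,\hat u(t,z,\epsilon)=\sigma_q\mathbf{f}(t,z,\epsilon)$.
   Context: Notation. $q>1$ is real. For $\gamma\in\mathbb{R}$, $\sigma_q^\gamma g(t)=g(q^\gamma t)$ whenever the right-hand side makes sense (acting on $t$, resp. $T$, $\tau$), $\sigma_q=\sigma_q^1$; equations are understood wherever all terms are defined. $D(0,r)$ is the open disc, $\overline D(0,r)$ its closure, $\mathbb{C}^\star=\mathbb{C}\setminus\{0\}$, and $c_k(n):=(q^{1/k})^{n(n-1)/2}$. $E_{(\beta,\mu)}$ is the Banach space of continuous $h:\mathbb{R}\to\mathbb{C}$ with $\|h\|_{(\beta,\mu)}=\sup_m(1+|m|)^\mu e^{\beta|m|}|h(m)|<\infty$. For $R\in\mathbb{C}[X]$, $(h_1\ast^Rh_2)(m)=\int_{-\infty}^\infty h_1(m-m_1)R(im_1)h_2(m_1)dm_1$ (acting in $m$ when other variables are present). $\mathcal{F}^{-1}(h)(z)=(2\pi)^{-1/2}\int_{-\infty}^\infty h(m)e^{izm}dm$, $H_\beta=\{z\in\mathbb{C}:|\Im z|<\beta\}$. For $k>0$: $\Theta_{q^{1/k}}(x)=\sum_{n\in\mathbb{Z}}q^{-n(n-1)/(2k)}x^n$, $\pi_{q^{1/k}}=\frac{\log q}{k}\prod_{n\ge0}(1-q^{-(n+1)/k})^{-1}$, and $\mathcal{L}^\gamma_{q;1/k}(f)(T)=\frac1{\pi_{q^{1/k}}}\int_{L_\gamma}\frac{f(u)}{\Theta_{q^{1/k}}(u/T)}\frac{du}{u}$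 with $L_\gamma=(0,\infty)e^{i\gamma}$; the value does not depend on the choice of $\gamma$ in the sector where $f$ is defined with suitable growth. Function spaces. For an unbounded sector $U_d$ with vertex $0$ and bisecting direction $d$, $\rho>0$, and $\delta>0$ with $\mathrm{dist}(U_d\cup D(0,\rho),-\delta)>0$, $\mathrm{Exp}^d_{(k,\beta,\mu,\alpha,\rho)}$ is the Banach space of continuous $h$ on $(U_d\cup\overline D(0,\rho))\times\mathbb{R}$, holomorphic in $\tau\in U_d\cup D(0,\rho)$, with norm $\sup(1+|m|)^\mu e^{\beta|m|}\exp(-\frac{k\log^2|\tau+\delta|}{2\log q}-\alpha\log|\tau+\delta|)|h(\tau,m)|<\infty$. For an infinite sector $S_d$ and a bounded domain $\mathcal{R}_d^b$, $\mathrm{Exp}^d_{(k,\beta,\mu,\nu)}$ is the Banach space of continuous $h$ on $(S_d\cup\overline{\mathcal{R}_d^b})\times\mathbb{R}$ (closure in $\mathbb{C}^\star$), holomorphic in $\tau\in S_d\cup\mathcal{R}_d^b$, with norm $\sup(1+|m|)^\mu e^{\beta|m|}\exp(-\frac{k\log^2|\tau|}{2\log q}-\nu\log|\tau|)|h(\tau,m)|<\infty$. Data. $1\le k_1<k_2$, $D\ge3$, $d_D\ge1$ are integers, $\frac1\kappa=\frac1{k_1}-\frac1{k_2}$. For $1\le\ell\le D-1$: $I_\ell$ is a finite nonempty set of nonnegative integers, $\delta_\ell\ge1$ an integer, and for $\lambda\in I_\ell$, $d_{\lambda,\ell}\ge1$, $\Delta_{\lambda,\ell}\ge0$ are integers.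 Assume $\delta_1=1$, $\delta_\ell<\delta_{\ell+1}$ ($1\le\ell\le D-2$), and for all $1\le\ell\le D-1$, $\lambda\in I_\ell$: $\Delta_{\lambda,\ell}\ge d_{\lambda,\ell}$, $\frac{d_{\lambda,\ell}}{k_2}+1\ge\delta_\ell$, $\frac{d_D-1}{k_2}+1\ge\delta_\ell$. $Q,R_1,\dots,R_D\in\mathbb{C}[X]$ with $\deg Q\ge\deg R_D\ge\deg R_\ell$ ($1\le\ell\le D-1$), $Q(im)\ne0$, $R_D(im)\neq0$ for $m\in\mathbb{R}$, and $\frac{Q(im)}{R_D(im)}\in S_{Q,R_D}=\{z:|z|\ge r_{Q,R_D},|\arg z-d_{Q,R_D}|\le\eta_{Q,R_D}\}$ for all $m\in\mathbb{R}$, with some $r_{Q,R_D},\eta_{Q,R_D}>0$, $d_{Q,R_D}\in\mathbb{R}$. Let $\beta>0$, $\mu>\deg(R_D)+1$, $\epsilon_0>0$. The maps $m\mapsto C_{\lambda,\ell}(m,\epsilon)$, $m\mapsto F_n(m,\epsilon)$ ($n\ge0$) lie in $E_{(\beta,\mu)}$, depend holomorphically on $\epsilon\in D(0,\epsilon_0)$, and $\|C_{\lambda,\ell}(\cdot,\epsilon)\|_{(\beta,\mu)}\le\tilde C_{\lambda,\ell}$, $\|F_n(\cdot,\epsilon)\|_{(\beta,\mu)}\le C_F\rho^{-n}q^{n(n-1)/(2k_1)}$ for all $\epsilon\in D(0,\epsilon_0)$. Put $c_{\lambda,\ell}(z,\epsilon)=\mathcal{F}^{-1}(m\mapsto C_{\lambda,\ell}(m,\epsilon))(z)$.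 Fix $0<\beta'<\beta$. Good covering. For an integer $\varsigma\ge2$, $(\mathcal{E}_p)_{0\le p\le\varsigma-1}$ is a good covering in $\mathbb{C}^\star$: each $\mathcal{E}_p$ is an open sector with vertex $0$ and radius $\epsilon_0$, $\mathcal{E}_j\cap\mathcal{E}_k\ne\emptyset$ iff $|j-k|\le1$ (indices cyclic, $\mathcal{E}_\varsigma:=\mathcal{E}_0$), and $\bigcup_p\mathcal{E}_p=\mathcal{U}\setminus\{0\}$ for a neighborhood $\mathcal{U}$ of $0$. All indices $p$ are cyclic mod $\varsigma$. Associated family. For each $p$, $U_{\mathfrak{d}_p}$ and $S_{\mathfrak{d}_p}$ are unbounded sectors with vertex $0$ and bisecting direction $\mathfrak{d}_p$; $\delta>0$ has positive distance from $-\delta$ to each $U_{\mathfrak{d}_p}\cup D(0,\rho)$; $\tilde\delta>0$; $\mathcal{R}_{\mathfrak{d}_p,\tilde\delta}=\{T\in\mathbb{C}^\star:|1+e^{i\mathfrak{d}_p}r/T|>\tilde\delta\ \forall r\ge0\}$; $\mathcal{T}$ is an open bounded sector with vertex $0$ and radius $r_{\mathcal{T}}>0$; $\mathcal{R}^b_{\mathfrak{d}_p}=\mathcal{R}_{\mathfrak{d}_p,\tilde\delta}\cap D(0,\epsilon_0r_{\mathcal{T}})\subseteq\overline D(0,\rho)$; $S_{\mathfrak{d}_p}\subseteq\mathcal{R}_{\mathfrak{d}_p,\tilde\delta}$. Assume $0<\epsilon_0,r_{\mathcal{T}}<1$, $\nu+\frac{k_2}{\log q}\log r_{\mathcal{T}}<0$,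 $\alpha+\frac{\kappa}{\log q}\log(\epsilon_0r_{\mathcal{T}})<0$, $\epsilon_0r_{\mathcal{T}}\le q^{(\frac12-\nu)/k_2}/2$ ($\alpha,\nu$ introduced below). Let $q_l(m)$, $0\le l\le d_D-1$, be the roots of $P_m(\tau)=\frac{Q(im)}{c_{k_2}(k_2)}-\frac{R_D(im)}{c_{k_2}(d_D+k_2)}\tau^{d_D}$. Assume: (1) there is $M_1>0$ with $|\tau-q_l(m)|\ge M_1(1+|\tau|)$ for all $l$, $m\in\mathbb{R}$, $p$, $\tau\in S_{\mathfrak{d}_p}\cup\overline D(0,\rho)$; (2) there are $M_2>0$ and $l_0$ with $|\tau-q_{l_0}(m)|\ge M_2|q_{l_0}(m)|$ for all $m$, $p$, $\tau\in S_{\mathfrak{d}_p}\cup\overline D(0,\rho)$; (3) $\mathcal{R}^b_{\mathfrak{d}_p}\cap\mathcal{R}^b_{\mathfrak{d}_{p+1}}\ne\emptyset$ and $\epsilon t\in\mathcal{R}^b_{\mathfrak{d}_p}$ for all $t\in\mathcal{T}$, $\epsilon\in\mathcal{E}_p$, all $p$. Forcing term. $\psi_{k_1}(\tau,m,\epsilon)=\sum_{n\ge0}F_n(m,\epsilon)\tau^n/c_{k_1}(n)$ (convergent on $D(0,\rho)$) extends analytically in $\tau$ to $U_{\mathfrak{d}_p}$ as $\psi_{k_1}^{\mathfrak{d}_p}\in\mathrm{Exp}^{\mathfrak{d}_p}_{(k_1,\beta,\mu,\alpha,\rho)}$ for some $\alpha>0$, with norm bounded by a constant $\zeta_{\psi_{k_1}}$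 independent of $\epsilon\in D(0,\epsilon_0)$. Then $\psi_{k_2}^{\mathfrak{d}_p}(\tau,m,\epsilon):=\mathcal{L}^{\mathfrak{d}_p}_{q;1/\kappa}(h\mapsto\psi_{k_1}^{\mathfrak{d}_p}(h,m,\epsilon))(\tau)$ lies in $\mathrm{Exp}^{\mathfrak{d}_p}_{(k_2,\beta,\mu,\nu)}$, uniformly in $\epsilon$, for some $\nu\in\mathbb{R}$ (depending only on $q,k_1,k_2,\alpha$), which is fixed. Put $F^{\mathfrak{d}_p}(T,m,\epsilon)=\mathcal{L}^{\mathfrak{d}_p}_{q;1/k_2}(\tau\mapsto\psi_{k_2}^{\mathfrak{d}_p}(\tau,m,\epsilon))(T)$ and $f^{\mathfrak{d}_p}(t,z,\epsilon)=\mathcal{F}^{-1}(m\mapsto F^{\mathfrak{d}_p}(\epsilon t,m,\epsilon))(z)$, bounded holomorphic on $\mathcal{T}\times H_{\beta'}\times\mathcal{E}_p$. Problem $(E_p)$: $$Q(\partial_z)\sigma_qu^{\mathfrak{d}_p}=(\epsilon t)^{d_D}\sigma_q^{\frac{d_D}{k_2}+1}R_D(\partial_z)u^{\mathfrak{d}_p}+\sum_{\ell=1}^{D-1}\Big(\sum_{\lambda\in I_\ell}t^{d_{\lambda,\ell}}\epsilon^{\Delta_{\lambda,\ell}}\sigma_q^{\delta_\ell}c_{\lambda,\ell}(z,\epsilon)R_\ell(\partial_z)u^{\mathfrak{d}_p}\Big)+\sigma_qf^{\mathfrak{d}_p}(t,z,\epsilon).$$ Construction of the solutions. It is assumed that $r_{Q,R_D}$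 is large enough, and that (depending on it) $\zeta_{\psi_{k_1}}$ and the $\tilde C_{\lambda,\ell}$ are small enough, so that for a fixed $\varpi>0$ and each $p$ and $\epsilon\in D(0,\epsilon_0)$: (i) the equation $Q(im)\frac{\tau^{k_1}}{c_{k_1}(k_1)}w=\frac{\tau^{d_D+k_1}}{c_{k_1}(d_D+k_1)}\sigma_q^{-d_D/\kappa}R_D(im)w+\sum_{\ell,\lambda}\frac{\epsilon^{\Delta_{\lambda,\ell}-d_{\lambda,\ell}}\tau^{d_{\lambda,\ell}+k_1}}{c_{k_1}(d_{\lambda,\ell}+k_1)}\sigma_q^{\delta_\ell-\frac{d_{\lambda,\ell}}{k_1}-1}\frac{1}{(2\pi)^{1/2}}(C_{\lambda,\ell}\ast^{R_\ell}w)+\frac{\tau^{k_1}}{c_{k_1}(k_1)}\psi_{k_1}^{\mathfrak{d}_p}$ has a unique solution $w_{k_1}^{\mathfrak{d}_p}$ in the closed ball of radius $\varpi$ of $\mathrm{Exp}^{\mathfrak{d}_p}_{(\kappa,\beta,\mu,\alpha,\rho)}$; (ii) the equation $Q(im)\frac{\tau^{k_2}}{c_{k_2}(k_2)}w=R_D(im)\frac{\tau^{d_D+k_2}}{c_{k_2}(d_D+k_2)}w+\sum_{\ell,\lambda}\frac{\epsilon^{\Delta_{\lambda,\ell}-d_{\lambda,\ell}}\tau^{d_{\lambda,\ell}+k_2}}{c_{k_2}(d_{\lambda,\ell}+k_2)}\sigma_q^{\delta_\ell-\frac{d_{\lambda,\ell}}{k_2}-1}\frac{1}{(2\pi)^{1/2}}(C_{\lambda,\ell}\ast^{R_\ell}w)+\frac{\tau^{k_2}}{c_{k_2}(k_2)}\psi_{k_2}^{\mathfrak{d}_p}$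 has a unique solution $w_{k_2}^{\mathfrak{d}_p}$ in $\mathrm{Exp}^{\mathfrak{d}_p}_{(k_2,\beta,\mu,\nu)}$, of norm $\le\varpi$; (iii) both are holomorphic in $\epsilon\in D(0,\epsilon_0)$, and $w_{k_2}^{\mathfrak{d}_p}$ is the analytic continuation in $\tau$ of $\mathcal{L}^{\mathfrak{d}_p}_{q;1/\kappa}(w_{k_1}^{\mathfrak{d}_p})(\tau,m,\epsilon)$. The solution of $(E_p)$ is $$u^{\mathfrak{d}_p}(t,z,\epsilon)=\frac1{(2\pi)^{1/2}}\frac1{\pi_{q^{1/k_2}}}\int_{-\infty}^\infty\int_{L_{\gamma_p}}\frac{w_{k_2}^{\mathfrak{d}_p}(u,m,\epsilon)}{\Theta_{q^{1/k_2}}(\frac u{\epsilon t})}\frac{du}ue^{izm}dm,$$ with a halfline $L_{\gamma_p}\subseteq S_{\mathfrak{d}_p}$ whose direction may depend on $\epsilon t$; it is bounded holomorphic on $\mathcal{T}\times H_{\beta'}\times\mathcal{E}_p$. Formal solution. $\mathbb{F}$ is the Banach space of bounded holomorphic functions on $\mathcal{T}\times H_{\beta'}$ with the supremum norm. A holomorphic $g:V\to\mathbb{F}$ on a bounded open sector $V$ with vertex $0$ admits $\hat g=\sum_{n\ge0}g_n\epsilon^n\in\mathbb{F}[[\epsilon]]$ as its $q$-Gevrey asymptotic expansion of order $1/k$ if for every open subsector $U$ with $\overline U\setminus\{0\}\subseteq V$ there are $A,C>0$ with $\|g(\epsilon)-\sum_{n=0}^Ng_n\epsilon^n\|_{\mathbb{F}}\le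 CA^{N+1}q^{\frac{N(N+1)}{2k}}|\epsilon|^{N+1}$ for all $\epsilon\in U$, $N\ge0$. $\hat u(t,z,\epsilon)\in\mathbb{F}[[\epsilon]]$ denotes the common $q$-Gevrey asymptotic expansion of order $1/k_1$ on $\mathcal{E}_p$ of $u^{\mathfrak{d}_p}$, $0\le p\le\varsigma-1$ (it exists). Functions holomorphic in $\epsilon$ near $0$ are identified with their Taylor expansions in formal equations. Additional data for this theorem (bold symbols). $\mathbf{D}\ge3$, $\mathbf{d}_{\mathbf{D}}\ge1$ are integers; for $1\le\ell\le\mathbf{D}-1$, $\mathbf{I}_\ell$ is a finite nonempty set of nonnegative integers, $\boldsymbol{\delta}_\ell\ge1$ an integer, and for $\lambda\in\mathbf{I}_\ell$, $\mathbf{d}_{\lambda,\ell}\ge1$, $\boldsymbol{\Delta}_{\lambda,\ell}\ge0$ are integers, with $\boldsymbol{\delta}_1=1$, $\boldsymbol{\delta}_\ell<\boldsymbol{\delta}_{\ell+1}$ ($1\le\ell\le\mathbf{D}-2$), $\boldsymbol{\Delta}_{\lambda,\ell}\ge\mathbf{d}_{\lambda,\ell}$, $\frac{\mathbf{d}_{\lambda,\ell}}{k_1}+1\ge\boldsymbol{\delta}_\ell$, $\frac{\mathbf{d}_{\mathbf{D}}-1}{k_1}+1\ge\boldsymbol{\delta}_\ell$. $\mathbf{Q},\mathbf{R}_1,\dots,\mathbf{R}_{\mathbf{D}}\in\mathbb{C}[X]$ satisfy $\deg\mathbf{Q}\ge\deg\mathbf{R}_{\mathbf{D}}\ge\deg\mathbf{R}_\ell$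 ($1\le\ell\le\mathbf{D}-1$), $\mathbf{Q}(im)\ne0$, $\mathbf{R}_{\mathbf{D}}(im)\ne0$ for $m\in\mathbb{R}$; also $\mu>\deg(\mathbf{Q})+1$. The functions $m\mapsto\mathbf{C}_{\lambda,\ell}(m,\epsilon)$ lie in $E_{(\beta,\mu)}$, depend holomorphically on $\epsilon\in D(0,\epsilon_0)$, with $\|\mathbf{C}_{\lambda,\ell}(\cdot,\epsilon)\|_{(\beta,\mu)}\le\tilde{\mathbf{C}}_{\lambda,\ell}$. $N_0\ge0$ is an integer and $\mathbf{F}(T,m,\epsilon)=\sum_{n=0}^{N_0}\mathbf{F}_n(m,\epsilon)T^n$ with $\mathbf{F}_n(\cdot,\epsilon)\in E_{(\beta,\mu)}$ holomorphic in $\epsilon\in D(0,\epsilon_0)$ and $\|\mathbf{F}_n(\cdot,\epsilon)\|_{(\beta,\mu)}\le\mathbf{K}_0\mathbf{T}_0^{-n}$ for some $\mathbf{K}_0,\mathbf{T}_0>0$; $\boldsymbol{\psi}_{k_1}(\tau,m,\epsilon)=\sum_{n=0}^{N_0}\mathbf{F}_n(m,\epsilon)\tau^n/c_{k_1}(n)$, which lies in $\mathrm{Exp}^{\mathfrak{d}_p}_{(k_1,\beta,\mu,\alpha,\rho)}$ with norm at most some $\mathbf{C}_{\boldsymbol{\psi}_{k_1}}$, for all $p$ and $\epsilon$. The formal series $F(T,m,\epsilon)=\sum_{n\ge0}F_n(m,\epsilon)T^n$ (with the $F_n$ above) is assumed to solve formally $$\mathbf{Q}(im)\sigma_qF=T^{\mathbf{d}_{\mathbf{D}}}\sigma_q^{\frac{\mathbf{d}_{\mathbf{D}}}{k_1}+1}\mathbf{R}_{\mathbf{D}}(im)F+\sum_{\ell=1}^{\mathbf{D}-1}\sum_{\lambda\in\mathbf{I}_\ell}T^{\mathbf{d}_{\lambda,\ell}}\epsilon^{\boldsymbol{\Delta}_{\lambda,\ell}-\mathbf{d}_{\lambda,\ell}}\frac1{(2\pi)^{1/2}}\int_{-\infty}^\infty\mathbf{C}_{\lambda,\ell}(m-m_1,\epsilon)\mathbf{R}_\ell(im_1)F(q^{\boldsymbol{\delta}_\ell}T,m_1,\epsilon)dm_1+\sigma_q\mathbf{F}.$$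 There are $r_{\mathbf{Q},\mathbf{R}_{\mathbf{D}}},\boldsymbol{\eta}_{\mathbf{Q},\mathbf{R}_{\mathbf{D}}}>0$, $d_{\mathbf{Q},\mathbf{R}_{\mathbf{D}}}\in\mathbb{R}$ with $\frac{\mathbf{Q}(im)}{\mathbf{R}_{\mathbf{D}}(im)}\in\{z:|z|\ge r_{\mathbf{Q},\mathbf{R}_{\mathbf{D}}},|\arg z-d_{\mathbf{Q},\mathbf{R}_{\mathbf{D}}}|\le\boldsymbol{\eta}_{\mathbf{Q},\mathbf{R}_{\mathbf{D}}}\}$ for $m\in\mathbb{R}$. The roots $\mathbf{q}_l(m)$, $0\le l\le\mathbf{d}_{\mathbf{D}}-1$, of $\mathbf{P}_m(\tau)=\frac{\mathbf{Q}(im)}{c_{k_1}(k_1)}-\frac{\mathbf{R}_{\mathbf{D}}(im)}{c_{k_1}(\mathbf{d}_{\mathbf{D}}+k_1)}\tau^{\mathbf{d}_{\mathbf{D}}}$ satisfy, for some $\mathbf{M}_1,\mathbf{M}_2>0$ and some $l_0$, $|\tau-\mathbf{q}_l(m)|\ge\mathbf{M}_1(1+|\tau|)$ for all $l$ and $|\tau-\mathbf{q}_{l_0}(m)|\ge\mathbf{M}_2|\mathbf{q}_{l_0}(m)|$, for all $m\in\mathbb{R}$, $p$, $\tau\in U_{\mathfrak{d}_p}\cup\overline D(0,\rho)$. The $\tilde{\mathbf{C}}_{\lambda,\ell}$ and $\mathbf{C}_{\boldsymbol{\psi}_{k_1}}$ are small enough that, for each $p$, the equation $\mathbf{Q}(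im)\frac{\tau^{k_1}}{c_{k_1}(k_1)}\psi=\frac{\tau^{\mathbf{d}_{\mathbf{D}}+k_1}}{c_{k_1}(\mathbf{d}_{\mathbf{D}}+k_1)}\mathbf{R}_{\mathbf{D}}(im)\psi+\sum_{\ell,\lambda}\frac{\epsilon^{\boldsymbol{\Delta}_{\lambda,\ell}-\mathbf{d}_{\lambda,\ell}}\tau^{\mathbf{d}_{\lambda,\ell}+k_1}}{c_{k_1}(\mathbf{d}_{\lambda,\ell}+k_1)}\sigma_q^{\boldsymbol{\delta}_\ell-\frac{\mathbf{d}_{\lambda,\ell}}{k_1}-1}\frac1{(2\pi)^{1/2}}(\mathbf{C}_{\lambda,\ell}\ast^{\mathbf{R}_\ell}\psi)+\frac{\tau^{k_1}}{c_{k_1}(k_1)}\boldsymbol{\psi}_{k_1}$ has a unique solution in $\mathrm{Exp}^{\mathfrak{d}_p}_{(k_1,\beta,\mu,\alpha,\rho)}$, holomorphic in $\epsilon$; this solution is the extension $\psi_{k_1}^{\mathfrak{d}_p}$ used above. Finally $\mathbf{c}_{\lambda,\ell}(z,\epsilon)=\mathcal{F}^{-1}(m\mapsto\mathbf{C}_{\lambda,\ell}(m,\epsilon))(z)$ and $\mathbf{f}(t,z,\epsilon)=\sum_{n=0}^{N_0}\mathcal{F}^{-1}(m\mapsto\mathbf{F}_n(m,\epsilon))(z)(t\epsilon)^n$.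
   Formalization: The constant π_{q^{1/k}} is taken as (log q)/k, without the printed product of (1−q^{-(n+1)/k})^{-1}: with that factor the q-Laplace transform does not send u^n to c_k(n)T^n, and the equation fails whenever the forcing term f is nonzero. *)

theory Defs
  imports "HOL-Complex_Analysis.Complex_Analysis"
begin

definition ray :: "real \<Rightarrow> complex set" where
  "ray s = {of_real r * cis s | r. r > 0}"

definition sector :: "real \<Rightarrow> real \<Rightarrow> complex set" where
  "sector d a = {of_real r * cis \<theta> | r \<theta>. r > 0 \<and> \<bar>\<theta> - d\<bar> < a}"

definition unbounded_sector :: "real \<Rightarrow> complex set \<Rightarrow> bool" where
  "unbounded_sector d S \<longleftrightarrow> (\<exists>a. 0 < a \<and> a \<le> pi \<and> S = sector d a)"

definition bounded_sector :: "real \<Rightarrow> complex set \<Rightarrow> bool" where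
  "bounded_sector r S \<longleftrightarrow> (\<exists>d a. 0 < a \<and> a \<le> pi \<and> S = sector d a \<inter> ball 0 r)"

definition strip :: "real \<Rightarrow> complex set" where
  "strip b = {z. \<bar>Im z\<bar> < b}"

definition good_covering :: "nat \<Rightarrow> real \<Rightarrow> (nat \<Rightarrow> complex set) \<Rightarrow> bool" where
  "good_covering n r E \<longleftrightarrow>
     n \<ge> 2 \<and> (\<forall>p<n. bounded_sector r (E p)) \<and>
     (\<forall>j<n. \<forall>k<n. E j \<inter> E k \<noteq> {} \<longleftrightarrow> j = k \<or> k = Suc j mod n \<or> j = Suc k mod n) \<and>
     (\<exists>U. 0 \<in> interior U \<and> (\<Union>p<n. E p) = U - {0})"

text \<open>Holomorphy of functions of several complex variables on an open set: Frechet
  differentiability with a complex-linear derivative.\<close>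

definition holomorphic2_on :: "(complex \<times> complex \<Rightarrow> complex) \<Rightarrow> (complex \<times> complex) set \<Rightarrow> bool" where
  "holomorphic2_on f A \<longleftrightarrow>
     (\<forall>x\<in>A. \<exists>a b. (f has_derivative (\<lambda>(h, k). a * h + b * k)) (at x))"

definition holomorphic3_on ::
  "(complex \<Rightarrow> complex \<Rightarrow> complex \<Rightarrow> complex) \<Rightarrow> (complex \<times> complex \<times> complex) set \<Rightarrow> bool" where
  "holomorphic3_on f A \<longleftrightarrow>
     (\<forall>x\<in>A. \<exists>a b c. ((\<lambda>(t, z, \<epsilon>). f t z \<epsilon>) has_derivative
                     (\<lambda>(h, k, l). a * h + b * k + c * l)) (at x))"

definition inv_fourier :: "(real \<Rightarrow> complex) \<Rightarrow> complex \<Rightarrow> complex" where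
  "inv_fourier h z = of_real (1 / sqrt (2 * pi)) * (LBINT m. h m * exp (\<i> * of_real m * z))"

definition conv :: "complex poly \<Rightarrow> (real \<Rightarrow> complex) \<Rightarrow> (real \<Rightarrow> complex) \<Rightarrow> real \<Rightarrow> complex" where
  "conv R h1 h2 m = (LBINT m1. h1 (m - m1) * poly R (\<i> * of_real m1) * h2 m1)"

definition cq :: "real \<Rightarrow> real \<Rightarrow> nat \<Rightarrow> real" where
  "cq q k n = (q powr (1 / k)) powr (real n * (real n - 1) / 2)"

text \<open>In the functions below the pair of arguments q, k stands for the base q^(1/k).\<close>

definition Theta :: "real \<Rightarrow> real \<Rightarrow> complex \<Rightarrow> complex" where
  "Theta q k x = (\<Sum>\<^sub>\<infinity>n\<in>(UNIV :: int set).
     of_real (q powr (- (of_int n * (of_int n - 1)) / (2 * k))) * x powi n)"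

text \<open>The constant in front of the q-Laplace transform is the value of the integral of
  1 / (u Theta(u)) over (0,\<infinity>), namely log q / k: summing the integrand over the dilations
  by powers of q^(1/k), with Theta (q^(1/k) x) = q^(1/k) x Theta x, gives 1 / u on one period.
  This is the normalisation for which the transform maps u^n to c_k(n) T^n. The additional
  factor prod (1 - q^(-(n+1)/k))^(-1) which is sometimes written in this constant does not go
  together with the Theta function normalised by the above series: it would multiply all
  transforms by prod (1 - q^(-(n+1)/k)).\<close>

definition pi_q :: "real \<Rightarrow> real \<Rightarrow> real" where
  "pi_q q k = ln q / k"

text \<open>On the halfline with direction s one has u = r * cis s and du / u = dr / r.\<close>

definition q_laplace :: "real \<Rightarrow> real \<Rightarrow> real \<Rightarrow> (complex \<Rightarrow> complex) \<Rightarrow> complex \<Rightarrow> complex" where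
  "q_laplace q k s f T = of_real (1 / pi_q q k) *
     (LBINT r:{0<..}. f (of_real r * cis s) / Theta q k (of_real r * cis s / T) / of_real r)"

definition q_shift :: "real \<Rightarrow> real \<Rightarrow> (complex \<Rightarrow> 'a) \<Rightarrow> complex \<Rightarrow> 'a" where
  "q_shift q \<gamma> g = (\<lambda>t. g (of_real (q powr \<gamma>) * t))"

definition kappa :: "nat \<Rightarrow> nat \<Rightarrow> real" where
  "kappa k1 k2 = 1 / (1 / real k1 - 1 / real k2)"

definition fourier_weight :: "real \<Rightarrow> real \<Rightarrow> real \<Rightarrow> real" where
  "fourier_weight \<beta> \<mu> m = (1 + \<bar>m\<bar>) powr \<mu> * exp (\<beta> * \<bar>m\<bar>)"

definition E_space :: "real \<Rightarrow> real \<Rightarrow> (real \<Rightarrow> complex) set" where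
  "E_space \<beta> \<mu> = {h. continuous_on UNIV h \<and> bdd_above (range (\<lambda>m. fourier_weight \<beta> \<mu> m * cmod (h m)))}"

definition E_norm :: "real \<Rightarrow> real \<Rightarrow> (real \<Rightarrow> complex) \<Rightarrow> real" where
  "E_norm \<beta> \<mu> h = (SUP m. fourier_weight \<beta> \<mu> m * cmod (h m))"

text \<open>The four-parameter and five-parameter spaces Exp share this shape: continuity on X \<times> \<real>,
  holomorphy in \<tau> on the open set Y only. They are Exp_sect with parameters (k, \<beta>, \<mu>, \<nu>),
  where the closure of the bounded domain Rb is taken in the punctured plane, and Exp_disc with
  parameters (k, \<beta>, \<mu>, \<alpha>, \<rho>).\<close>

definition weighted_norm ::
  "complex set \<Rightarrow> (complex \<Rightarrow> real) \<Rightarrow> real \<Rightarrow> real \<Rightarrow> (complex \<Rightarrow> real \<Rightarrow> complex) \<Rightarrow> real" where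
  "weighted_norm X W \<beta> \<mu> h = (SUP (\<tau>, m)\<in>X \<times> UNIV. fourier_weight \<beta> \<mu> m * W \<tau> * cmod (h \<tau> m))"

definition weighted_space ::
  "complex set \<Rightarrow> complex set \<Rightarrow> (complex \<Rightarrow> real) \<Rightarrow> real \<Rightarrow> real \<Rightarrow> (complex \<Rightarrow> real \<Rightarrow> complex) set" where
  "weighted_space X Y W \<beta> \<mu> = {h.
     continuous_on (X \<times> UNIV) (\<lambda>(\<tau>, m). h \<tau> m) \<and>
     (\<forall>m. (\<lambda>\<tau>. h \<tau> m) holomorphic_on Y) \<and>
     bdd_above ((\<lambda>(\<tau>, m). fourier_weight \<beta> \<mu> m * W \<tau> * cmod (h \<tau> m)) ` (X \<times> UNIV))}"

definition dom_disc :: "real \<Rightarrow> complex set \<Rightarrow> complex set" where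
  "dom_disc \<rho> U = U \<union> cball 0 \<rho>"

definition weight_disc :: "real \<Rightarrow> real \<Rightarrow> real \<Rightarrow> real \<Rightarrow> complex \<Rightarrow> real" where
  "weight_disc q k \<alpha> \<delta> \<tau> = exp (- (k * (ln (cmod (\<tau> + of_real \<delta>)))\<^sup>2 / (2 * ln q))
                               - \<alpha> * ln (cmod (\<tau> + of_real \<delta>)))"

definition Exp_disc ::
  "real \<Rightarrow> real \<Rightarrow> real \<Rightarrow> real \<Rightarrow> real \<Rightarrow> real \<Rightarrow> real \<Rightarrow> complex set \<Rightarrow> (complex \<Rightarrow> real \<Rightarrow> complex) set" where
  "Exp_disc q k \<beta> \<mu> \<alpha> \<rho> \<delta> U =
     weighted_space (dom_disc \<rho> U) (U \<union> ball 0 \<rho>) (weight_disc q k \<alpha> \<delta>) \<beta> \<mu>"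

definition Exp_disc_norm ::
  "real \<Rightarrow> real \<Rightarrow> real \<Rightarrow> real \<Rightarrow> real \<Rightarrow> real \<Rightarrow> real \<Rightarrow> complex set \<Rightarrow> (complex \<Rightarrow> real \<Rightarrow> complex) \<Rightarrow> real" where
  "Exp_disc_norm q k \<beta> \<mu> \<alpha> \<rho> \<delta> U h = weighted_norm (dom_disc \<rho> U) (weight_disc q k \<alpha> \<delta>) \<beta> \<mu> h"

definition dom_sect :: "complex set \<Rightarrow> complex set \<Rightarrow> complex set" where
  "dom_sect S Rb = S \<union> (closure Rb - {0})"

definition weight_sect :: "real \<Rightarrow> real \<Rightarrow> real \<Rightarrow> complex \<Rightarrow> real" where
  "weight_sect q k \<nu> \<tau> = exp (- (k * (ln (cmod \<tau>))\<^sup>2 / (2 * ln q)) - \<nu> * ln (cmod \<tau>))"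

definition Exp_sect ::
  "real \<Rightarrow> real \<Rightarrow> real \<Rightarrow> real \<Rightarrow> real \<Rightarrow> complex set \<Rightarrow> complex set \<Rightarrow> (complex \<Rightarrow> real \<Rightarrow> complex) set" where
  "Exp_sect q k \<beta> \<mu> \<nu> S Rb =
     weighted_space (dom_sect S Rb) (S \<union> Rb) (weight_sect q k \<nu>) \<beta> \<mu>"

definition Exp_sect_norm ::
  "real \<Rightarrow> real \<Rightarrow> real \<Rightarrow> real \<Rightarrow> real \<Rightarrow> complex set \<Rightarrow> complex set \<Rightarrow> (complex \<Rightarrow> real \<Rightarrow> complex) \<Rightarrow> real" where
  "Exp_sect_norm q k \<beta> \<mu> \<nu> S Rb h = weighted_norm (dom_sect S Rb) (weight_sect q k \<nu>) \<beta> \<mu> h"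

definition R_dom :: "real \<Rightarrow> real \<Rightarrow> complex set" where
  "R_dom d \<delta>' = {T. T \<noteq> 0 \<and> (\<forall>r\<ge>0. cmod (1 + cis d * of_real r / T) > \<delta>')}"

definition bounded_holo :: "(complex \<times> complex) set \<Rightarrow> (complex \<times> complex \<Rightarrow> complex) set" where
  "bounded_holo A = {g. holomorphic2_on g A \<and> bounded (g ` A)}"

definition sup_norm_on :: "(complex \<times> complex) set \<Rightarrow> (complex \<times> complex \<Rightarrow> complex) \<Rightarrow> real" where
  "sup_norm_on A g = (SUP x\<in>A. cmod (g x))"

definition holomorphic_valued ::
  "(complex \<times> complex) set \<Rightarrow> complex set \<Rightarrow> (complex \<Rightarrow> complex \<times> complex \<Rightarrow> complex) \<Rightarrow> bool" where
  "holomorphic_valued A V g \<longleftrightarrow>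
     (\<forall>\<epsilon>\<in>V. g \<epsilon> \<in> bounded_holo A) \<and>
     (\<forall>\<epsilon>\<in>V. \<exists>g'\<in>bounded_holo A.
        ((\<lambda>h. sup_norm_on A (\<lambda>x. (g (\<epsilon> + h) x - g \<epsilon> x) / h - g' x)) \<longlongrightarrow> 0) (at 0))"

definition q_Gevrey_expansion ::
  "real \<Rightarrow> real \<Rightarrow> (complex \<times> complex) set \<Rightarrow> complex set \<Rightarrow> (complex \<Rightarrow> complex \<times> complex \<Rightarrow> complex) \<Rightarrow>
   (nat \<Rightarrow> complex \<times> complex \<Rightarrow> complex) \<Rightarrow> bool" where
  "q_Gevrey_expansion q k A V g gh \<longleftrightarrow>
     holomorphic_valued A V g \<and> (\<forall>n. gh n \<in> bounded_holo A) \<and>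
     (\<forall>U r. bounded_sector r U \<and> closure U - {0} \<subseteq> V \<longrightarrow>
        (\<exists>K>0. \<exists>C>0. \<forall>\<epsilon>\<in>U. \<forall>N.
           sup_norm_on A (\<lambda>x. g \<epsilon> x - (\<Sum>n\<le>N. gh n x * \<epsilon> ^ n))
             \<le> C * K ^ (N + 1) * q powr (real N * (real N + 1) / (2 * k)) * cmod \<epsilon> ^ (N + 1)))"

text \<open>The data of one operator: D, d_D, the index sets I_l, the exponents \<delta>_l, d_(j,l) and
  \<Delta>_(j,l) (with arguments l, j), the polynomials Q and R_l (R_D being Rpol at D), and the
  functions C_(j,l)(m, \<epsilon>) (with arguments l, j, m, \<epsilon>).\<close>

record qdd_data =
  topD :: nat
  topd :: nat
  idx :: "nat \<Rightarrow> nat set"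
  qexp :: "nat \<Rightarrow> nat"
  texp :: "nat \<Rightarrow> nat \<Rightarrow> nat"
  eexp :: "nat \<Rightarrow> nat \<Rightarrow> nat"
  Qpol :: "complex poly"
  Rpol :: "nat \<Rightarrow> complex poly"
  Ccoef :: "nat \<Rightarrow> nat \<Rightarrow> real \<Rightarrow> complex \<Rightarrow> complex"

definition Qim :: "qdd_data \<Rightarrow> real \<Rightarrow> complex" where
  "Qim X m = poly (Qpol X) (\<i> * of_real m)"

definition RDim :: "qdd_data \<Rightarrow> real \<Rightarrow> complex" where
  "RDim X m = poly (Rpol X (topD X)) (\<i> * of_real m)"

definition admissible_exponents :: "real \<Rightarrow> qdd_data \<Rightarrow> bool" where
  "admissible_exponents k X \<longleftrightarrow>
     topD X \<ge> 3 \<and> topd X \<ge> 1 \<and>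
     qexp X 1 = 1 \<and> (\<forall>l\<in>{1..topD X - 2}. qexp X l < qexp X (Suc l)) \<and>
     (\<forall>l\<in>{1..<topD X}. finite (idx X l) \<and> idx X l \<noteq> {} \<and> qexp X l \<ge> 1 \<and>
        (real (topd X) - 1) / k + 1 \<ge> real (qexp X l) \<and>
        (\<forall>j\<in>idx X l. texp X l j \<ge> 1 \<and> eexp X l j \<ge> texp X l j \<and>
                      real (texp X l j) / k + 1 \<ge> real (qexp X l)))"

definition admissible_polynomials :: "qdd_data \<Rightarrow> bool" where
  "admissible_polynomials X \<longleftrightarrow>
     degree (Qpol X) \<ge> degree (Rpol X (topD X)) \<and>
     (\<forall>l\<in>{1..<topD X}. degree (Rpol X (topD X)) \<ge> degree (Rpol X l)) \<and>
     (\<forall>m. Qim X m \<noteq> 0 \<and> RDim X m \<noteq> 0) \<and>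
     (\<exists>r>0. \<exists>\<eta>>0. \<exists>d. \<forall>m. cmod (Qim X m / RDim X m) \<ge> r \<and>
        (\<exists>\<theta>. Qim X m / RDim X m = of_real (cmod (Qim X m / RDim X m)) * cis \<theta> \<and> \<bar>\<theta> - d\<bar> \<le> \<eta>))"

definition holomorphic_family :: "real \<Rightarrow> real \<Rightarrow> real \<Rightarrow> real \<Rightarrow> (real \<Rightarrow> complex \<Rightarrow> complex) \<Rightarrow> bool" where
  "holomorphic_family \<beta> \<mu> \<epsilon>0 B h \<longleftrightarrow>
     (\<forall>m. (\<lambda>\<epsilon>. h m \<epsilon>) holomorphic_on ball 0 \<epsilon>0) \<and>
     (\<forall>\<epsilon>\<in>ball 0 \<epsilon>0. (\<lambda>m. h m \<epsilon>) \<in> E_space \<beta> \<mu> \<and> E_norm \<beta> \<mu> (\<lambda>m. h m \<epsilon>) \<le> B)"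

definition admissible_coefficients :: "real \<Rightarrow> real \<Rightarrow> real \<Rightarrow> qdd_data \<Rightarrow> bool" where
  "admissible_coefficients \<beta> \<mu> \<epsilon>0 X \<longleftrightarrow>
     (\<forall>l\<in>{1..<topD X}. \<forall>j\<in>idx X l. \<exists>B. holomorphic_family \<beta> \<mu> \<epsilon>0 B (Ccoef X l j))"

text \<open>The family rt enumerates the roots of the polynomial P_m (d_D of them, since its
  constant and leading coefficients do not vanish).\<close>

definition root_enumeration :: "real \<Rightarrow> nat \<Rightarrow> qdd_data \<Rightarrow> (nat \<Rightarrow> real \<Rightarrow> complex) \<Rightarrow> bool" where
  "root_enumeration q k X rt \<longleftrightarrow>
     (\<forall>m. bij_betw (\<lambda>l. rt l m) {..<topd X}
        {\<tau>. Qim X m / of_real (cq q k k) - RDim X m / of_real (cq q k (topd X + k)) * \<tau> ^ topd X = 0})"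

definition roots_avoid :: "qdd_data \<Rightarrow> (nat \<Rightarrow> real \<Rightarrow> complex) \<Rightarrow> complex set \<Rightarrow> bool" where
  "roots_avoid X rt A \<longleftrightarrow>
     (\<exists>M1>0. \<forall>l<topd X. \<forall>m. \<forall>\<tau>\<in>A. cmod (\<tau> - rt l m) \<ge> M1 * (1 + cmod \<tau>)) \<and>
     (\<exists>M2>0. \<exists>l0<topd X. \<forall>m. \<forall>\<tau>\<in>A. cmod (\<tau> - rt l0 m) \<ge> M2 * cmod (rt l0 m))"

text \<open>The convolution equation on A with base order k; s is the power of the dilation in front
  of the term in R_D (s = 0 if there is none).\<close>

definition conv_equation ::
  "real \<Rightarrow> nat \<Rightarrow> real \<Rightarrow> qdd_data \<Rightarrow> complex \<Rightarrow> complex set \<Rightarrow>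
   (complex \<Rightarrow> real \<Rightarrow> complex) \<Rightarrow> (complex \<Rightarrow> real \<Rightarrow> complex) \<Rightarrow> bool" where
  "conv_equation q k s X \<epsilon> A \<psi> w \<longleftrightarrow> (\<forall>\<tau>\<in>A. \<forall>m.
     Qim X m * \<tau> ^ k / of_real (cq q k k) * w \<tau> m =
       \<tau> ^ (topd X + k) / of_real (cq q k (topd X + k)) * RDim X m * q_shift q s w \<tau> m
     + (\<Sum>l\<in>{1..<topD X}. \<Sum>j\<in>idx X l.
          \<epsilon> ^ (eexp X l j - texp X l j) * \<tau> ^ (texp X l j + k) / of_real (cq q k (texp X l j + k)) *
          q_shift q (real (qexp X l) - real (texp X l j) / real k - 1)
            (\<lambda>\<tau>. of_real (1 / sqrt (2 * pi)) * conv (Rpol X l) (\<lambda>m. Ccoef X l j m \<epsilon>) (w \<tau>) m) \<tau>)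
     + \<tau> ^ k / of_real (cq q k k) * \<psi> \<tau> m)"

definition unique_solution ::
  "(complex \<Rightarrow> real \<Rightarrow> complex) set \<Rightarrow> complex set \<Rightarrow> ((complex \<Rightarrow> real \<Rightarrow> complex) \<Rightarrow> bool) \<Rightarrow>
   (complex \<Rightarrow> real \<Rightarrow> complex) \<Rightarrow> bool" where
  "unique_solution V A eq w \<longleftrightarrow>
     w \<in> V \<and> eq w \<and> (\<forall>v\<in>V. eq v \<longrightarrow> (\<forall>\<tau>\<in>A. \<forall>m. v \<tau> m = w \<tau> m))"

definition dz :: "complex poly \<Rightarrow> (complex \<Rightarrow> complex) \<Rightarrow> complex \<Rightarrow> complex" where
  "dz R g z = (\<Sum>j\<le>degree R. coeff R j * (deriv ^^ j) g z)"

definition coef_c :: "qdd_data \<Rightarrow> nat \<Rightarrow> nat \<Rightarrow> complex \<Rightarrow> complex \<Rightarrow> complex" where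
  "coef_c X l j z \<epsilon> = inv_fourier (\<lambda>m. Ccoef X l j m \<epsilon>) z"

definition op_P ::
  "real \<Rightarrow> nat \<Rightarrow> qdd_data \<Rightarrow> (complex \<Rightarrow> complex \<Rightarrow> complex \<Rightarrow> complex) \<Rightarrow> complex \<Rightarrow> complex \<Rightarrow> complex \<Rightarrow> complex" where
  "op_P q k X u = (\<lambda>t z \<epsilon>.
     dz (Qpol X) (\<lambda>z. q_shift q 1 u t z \<epsilon>) z
     - (\<epsilon> * t) ^ topd X *
         q_shift q (real (topd X) / real k + 1) (\<lambda>t. dz (Rpol X (topD X)) (\<lambda>z. u t z \<epsilon>) z) t
     - (\<Sum>l\<in>{1..<topD X}. \<Sum>j\<in>idx X l.
          t ^ texp X l j * \<epsilon> ^ eexp X l j *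
          q_shift q (real (qexp X l)) (\<lambda>t. coef_c X l j z \<epsilon> * dz (Rpol X l) (\<lambda>z. u t z \<epsilon>) z) t))"

definition shifts :: "nat \<Rightarrow> qdd_data \<Rightarrow> real set" where
  "shifts k X = {1, real (topd X) / real k + 1} \<union> (\<lambda>l. real (qexp X l)) ` {1..<topD X}"

text \<open>The non-constant coefficients of the operator, together with the constant 1 in front of
  the term in Q.\<close>

definition op_coeffs :: "qdd_data \<Rightarrow> (complex \<Rightarrow> complex \<Rightarrow> complex \<Rightarrow> complex) set" where
  "op_coeffs X = {\<lambda>t z \<epsilon>. 1, \<lambda>t z \<epsilon>. (\<epsilon> * t) ^ topd X} \<union>
     {\<lambda>t z \<epsilon>. t ^ texp X l j * \<epsilon> ^ eexp X l j * coef_c X l j z \<epsilon> | l j. l \<in> {1..<topD X} \<and> j \<in> idx X l}"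

text \<open>Action of the same operator on formal power series in \<epsilon> whose coefficients are functions of
  (t, z); the functions coef_c are replaced by their Taylor expansions in \<epsilon>.\<close>

definition fps_dz ::
  "complex poly \<Rightarrow> (complex \<Rightarrow> complex fps) \<Rightarrow> complex \<Rightarrow> complex fps" where
  "fps_dz R g z = Abs_fps (\<lambda>n. dz R (\<lambda>z. fps_nth (g z) n) z)"

definition formal_op_P ::
  "real \<Rightarrow> nat \<Rightarrow> qdd_data \<Rightarrow> (complex \<Rightarrow> complex \<Rightarrow> complex fps) \<Rightarrow> complex \<Rightarrow> complex \<Rightarrow> complex fps" where
  "formal_op_P q k X u = (\<lambda>t z.
     fps_dz (Qpol X) (q_shift q 1 u t) z
     - (fps_X * fps_const t) ^ topd X *
         q_shift q (real (topd X) / real k + 1) (\<lambda>t. fps_dz (Rpol X (topD X)) (u t) z) t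
     - (\<Sum>l\<in>{1..<topD X}. \<Sum>j\<in>idx X l.
          fps_const (t ^ texp X l j) * fps_X ^ eexp X l j *
          q_shift q (real (qexp X l))
            (\<lambda>t. fps_expansion (coef_c X l j z) 0 * fps_dz (Rpol X l) (u t) z) t))"

definition fps_q_shift :: "real \<Rightarrow> real \<Rightarrow> complex fps \<Rightarrow> complex fps" where
  "fps_q_shift q \<gamma> f = Abs_fps (\<lambda>n. of_real (q powr (\<gamma> * real n)) * fps_nth f n)"

definition formal_T_equation ::
  "real \<Rightarrow> nat \<Rightarrow> qdd_data \<Rightarrow> nat \<Rightarrow> (nat \<Rightarrow> real \<Rightarrow> complex \<Rightarrow> complex) \<Rightarrow> (nat \<Rightarrow> real \<Rightarrow> complex \<Rightarrow> complex) \<Rightarrow>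
   complex \<Rightarrow> bool" where
  "formal_T_equation q k X N0 G F \<epsilon> \<longleftrightarrow> (\<forall>m.
     fps_const (Qim X m) * fps_q_shift q 1 (Abs_fps (\<lambda>n. F n m \<epsilon>)) =
       fps_X ^ topd X *
         fps_q_shift q (real (topd X) / real k + 1) (fps_const (RDim X m) * Abs_fps (\<lambda>n. F n m \<epsilon>))
     + (\<Sum>l\<in>{1..<topD X}. \<Sum>j\<in>idx X l.
          fps_X ^ texp X l j *
          fps_const (\<epsilon> ^ (eexp X l j - texp X l j) * of_real (1 / sqrt (2 * pi))) *
          Abs_fps (\<lambda>n. conv (Rpol X l) (\<lambda>m. Ccoef X l j m \<epsilon>)
            (\<lambda>m1. fps_nth (fps_q_shift q (real (qexp X l)) (Abs_fps (\<lambda>n. F n m1 \<epsilon>))) n) m))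
     + fps_q_shift q 1 (Abs_fps (\<lambda>n. if n \<le> N0 then G n m \<epsilon> else 0)))"

definition borel_poly ::
  "real \<Rightarrow> nat \<Rightarrow> nat \<Rightarrow> (nat \<Rightarrow> real \<Rightarrow> complex \<Rightarrow> complex) \<Rightarrow> complex \<Rightarrow> complex \<Rightarrow> real \<Rightarrow> complex" where
  "borel_poly q k N0 G \<epsilon> \<tau> m = (\<Sum>n\<le>N0. G n m \<epsilon> * \<tau> ^ n / of_real (cq q k n))"

definition forcing ::
  "nat \<Rightarrow> (nat \<Rightarrow> real \<Rightarrow> complex \<Rightarrow> complex) \<Rightarrow> complex \<Rightarrow> complex \<Rightarrow> complex \<Rightarrow> complex" where
  "forcing N0 G t z \<epsilon> = (\<Sum>n\<le>N0. inv_fourier (\<lambda>m. G n m \<epsilon>) z * (t * \<epsilon>) ^ n)"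

text \<open>A direction g for the halfline of integration is admissible at T if one can rotate the
  bisecting direction d of S to g inside S without the halfline meeting -T: the zeros of
  u \<mapsto> Theta (u / T) lie on the halfline through -T.\<close>

definition admissible_direction :: "complex set \<Rightarrow> real \<Rightarrow> complex \<Rightarrow> real \<Rightarrow> bool" where
  "admissible_direction S d T g \<longleftrightarrow> (\<forall>s\<in>closed_segment d g. ray s \<subseteq> S \<and> - T \<notin> ray s)"

definition solution ::
  "real \<Rightarrow> nat \<Rightarrow> (complex \<Rightarrow> real) \<Rightarrow> (complex \<Rightarrow> complex \<Rightarrow> real \<Rightarrow> complex) \<Rightarrow>
   complex \<Rightarrow> complex \<Rightarrow> complex \<Rightarrow> complex" where
  "solution q k g w t z \<epsilon> =
     inv_fourier (\<lambda>m. q_laplace q k (g (\<epsilon> * t)) (\<lambda>u. w \<epsilon> u m) (\<epsilon> * t)) z"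

end

theory Submission
  imports Defs "HOL-Analysis.Infinite_Set_Sum" "HOL-Real_Asymp.Real_Asymp"
begin

text \<open>With \<open>Q = q^(1/k)\<close> the theta function satisfies
  \<open>\<Theta> (Q^n x) = Q^(n(n+1)/2) x^n \<Theta> x\<close>. Since \<open>dr / r\<close> is invariant under dilations, this turns
  multiplication by \<open>\<tau>^n\<close> followed by a dilation into multiplication by \<open>c_k(n) T^n\<close> and another
  dilation after the q-Laplace transform of order k; likewise the inverse Fourier transform turns
  polynomials in im into derivatives and convolutions into products. Applied with order \<open>k2\<close> to the
  convolution equation for \<open>w2\<close> this gives \<open>P u = \<sigma>_q f\<close>. The transform of order \<open>\<kappa>\<close> turns the second
  convolution equation, for \<open>\<psi>1\<close>, into one for \<open>\<psi>2\<close>; because \<open>c_\<kappa>(n) c_k2(n) = c_k1(n)\<close>, the transform of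
  order \<open>k2\<close> then gives the equation of the second operator for f.

  Convergence at infinity comes from the Gaussian lower bound for theta away from its zeros, which
  lie on the negative axis by the triple product. Near 0 the norm of \<open>w2\<close> is of no use, since its
  weight tends to 0 there; instead \<open>w2\<close> is bounded because it is the transform of order \<open>\<kappa>\<close> of \<open>w1\<close>.
  The variable directions of integration are reduced to the bisecting one by Cauchy's theorem.

  For the formal statement it suffices to have Poincare expansions in \<open>\<epsilon>\<close> along one ray of one
  sector, locally uniformly in z: both operators act compatibly on functions and on expansions, and
  expansions are unique.\<close>

section \<open>Theta functions\<close>

text \<open>The growth permitted to \<open>w2\<close> has the same quadratic term in
  \<open>ln r\<close> as theta of order \<open>k2\<close>. In the quotient only a power of r
  survives, with exponent \<open>ln |T| / L + \<nu> - 1 / 2\<close>; it is negative for small T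
  only, and the upper bound for \<open>\<epsilon>0 * r\<^sub>T\<close> in terms of
  \<open>\<nu>\<close> ensures this. The growth of \<open>w1\<close> is critical in the same way for
  the order \<open>\<kappa>\<close>, and there the condition on \<open>\<alpha>\<close> makes the
  transform bounded near 0. By contrast \<open>\<psi>1\<close> has the order
  \<open>k1 < \<kappa>\<close>, so its transform exists on the whole ray, as is needed to transform
  its equation before the second transform is taken.

  The constants of the convolution equations leave factors \<open>q^(-n)\<close> after the
  transform. This is why all transforms are taken at \<open>T = q \<epsilon> t\<close>, where
  \<open>q^(-n) T^n = (\<epsilon> t)^n\<close>, and why a dilation by q appears on the right of both
  equations. In the composition, the inverse dilation between the operators removes it again, and u
  is evaluated at the points \<open>q^(a - 1 + b) t\<close>.\<close>

lemma has_sum_int_split: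
  fixes f :: "int \<Rightarrow> 'a::banach"
  assumes "summable (\<lambda>n. norm (f (int n)))" "summable (\<lambda>n. norm (f (- int (Suc n))))"
  shows "(f has_sum ((\<Sum>n. f (int n)) + (\<Sum>n. f (- int (Suc n))))) UNIV"
    and "(\<lambda>n. norm (f n)) summable_on UNIV"
proof -
  have "x \<in> range int \<union> range (\<lambda>n. - int (Suc n))" for x
    by (cases x rule: int_cases) blast+
  then have U: "UNIV = range int \<union> range (\<lambda>n. - int (Suc n))" "range int \<inter> range (\<lambda>n. - int (Suc n)) = {}"
    by auto
  have i: "inj int" "inj (\<lambda>n. - int (Suc n))" by (auto simp: inj_on_def)
  have "((\<lambda>n. f (int n)) has_sum (\<Sum>n. f (int n))) UNIV"
    "((\<lambda>n. f (- int (Suc n))) has_sum (\<Sum>n. f (- int (Suc n)))) UNIV"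
    using assms by (auto intro!: norm_summable_imp_has_sum summable_sums summable_norm_cancel)
  then have "(f has_sum (\<Sum>n. f (int n))) (range int)"
    "(f has_sum (\<Sum>n. f (- int (Suc n)))) (range (\<lambda>n. - int (Suc n)))"
    using i by (auto simp: has_sum_reindex o_def)
  from has_sum_Un_disjoint[OF this U(2)] show "(f has_sum ((\<Sum>n. f (int n)) + (\<Sum>n. f (- int (Suc n))))) UNIV"
    using U(1) by simp
  have "(\<lambda>n. norm (f (int n))) summable_on UNIV" "(\<lambda>n. norm (f (- int (Suc n)))) summable_on UNIV"
    using assms by (auto intro!: norm_summable_imp_summable_on)
  then have "(\<lambda>n. norm (f n)) summable_on (range int)" "(\<lambda>n. norm (f n)) summable_on (range (\<lambda>n. - int (Suc n)))"
    using i by (auto simp: summable_on_reindex o_def)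
  from summable_on_Un_disjoint[OF this U(2)] show "(\<lambda>n. norm (f n)) summable_on UNIV" using U(1) by simp
qed

text \<open>Tannery's theorem, obtained from dominated convergence for the counting measure. It is
  applied with the coefficients of a finite triple product and with the indicators of finite ranges
  of indices.\<close>

lemma infsum_dominated_LIMSEQ:
  fixes t :: "'i \<Rightarrow> complex" and c :: "nat \<Rightarrow> 'i \<Rightarrow> real"
  assumes t: "(\<lambda>n. norm (t n)) summable_on UNIV" and "\<And>n. (\<lambda>N. c N n) \<longlonglongrightarrow> C" "\<And>N n. \<bar>c N n\<bar> \<le> B"
  shows "(\<lambda>N. \<Sum>\<^sub>\<infinity>n. of_real (c N n) * t n) \<longlonglongrightarrow> of_real C * (\<Sum>\<^sub>\<infinity>n. t n)"
proof -
  have ts: "Infinite_Set_Sum.abs_summable_on t UNIV" using t by (simp add: abs_summable_equivalent)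
  then have ti: "integrable (count_space UNIV) t" by (simp add: Infinite_Set_Sum.abs_summable_on_def)
  have eq: "(\<integral>n. of_real (c N n) * t n \<partial>count_space UNIV) = (\<Sum>\<^sub>\<infinity>n. of_real (c N n) * t n)" for N
  proof -
    have "integrable (count_space UNIV) (\<lambda>n. of_real (c N n) * t n)"
      by (rule Bochner_Integration.integrable_bound[of _ "\<lambda>n. B * norm (t n)"])
        (use ti assms(3)[of N] in \<open>auto simp: norm_mult intro!: AE_I2 order.trans[OF mult_right_mono[OF assms(3)] abs_ge_self]\<close>)
    then have "Infinite_Set_Sum.abs_summable_on (\<lambda>n. of_real (c N n) * t n) UNIV"
      by (simp add: Infinite_Set_Sum.abs_summable_on_def)
    then show ?thesis by (subst infsetsum_infsum[symmetric]) (simp_all add: infsetsum_def)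
  qed
  have eq': "(\<integral>n. of_real C * t n \<partial>count_space UNIV) = of_real C * (\<Sum>\<^sub>\<infinity>n. t n)"
    using ti ts by (simp add: infsetsum_infsum[symmetric] infsetsum_def)
  have "(\<lambda>N. \<integral>n. of_real (c N n) * t n \<partial>count_space UNIV) \<longlonglongrightarrow> (\<integral>n. of_real C * t n \<partial>count_space UNIV)"
  proof (rule integral_dominated_convergence[where w = "\<lambda>n. B * norm (t n)"])
    show "AE x in count_space UNIV. (\<lambda>i. complex_of_real (c i x) * t x) \<longlonglongrightarrow> complex_of_real C * t x"
      by (intro AE_I2 tendsto_intros assms)
    show "\<And>i. AE x in count_space UNIV. cmod (complex_of_real (c i x) * t x) \<le> B * cmod (t x)"
      by (intro AE_I2) (auto simp: norm_mult intro!: mult_right_mono assms)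
  qed (use ti in auto)
  then show ?thesis by (simp only: eq eq')
qed

text \<open>Interpreted twice, with \<open>k2\<close> and with \<open>kappa k1 k2\<close>; the
  latter is the reason for a real order k. The base \<open>q^(1/k)\<close> of theta is
  \<open>exp L\<close>.\<close>

locale q_base =
  fixes q k :: real
  assumes q_gt_1: "q > 1" and k_pos: "k > 0"
begin

definition L :: real where "L = ln q / k"

text \<open>The coefficients \<open>q^(-n(n-1)/(2k))\<close>, also for real n.\<close>

definition theta_coeff :: "real \<Rightarrow> real" where "theta_coeff n = exp (- (L * n * (n - 1) / 2))"

lemma L_pos: "L > 0" using q_gt_1 k_pos by (simp add: L_def)

lemma theta_coeff_pos [simp]: "theta_coeff n > 0" by (simp add: theta_coeff_def)

lemma theta_coeff_0 [simp]: "theta_coeff 0 = 1" by (simp add: theta_coeff_def)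

lemma theta_coeff_Suc: "theta_coeff (n + 1) = theta_coeff n * exp (- (L * n))"
  by (simp add: theta_coeff_def flip: exp_add) (simp add: field_simps)

lemma powr_eq_theta_coeff: "q powr (- (n * (n - 1)) / (2 * k)) = theta_coeff n"
  using q_gt_1 k_pos by (simp add: theta_coeff_def powr_def L_def field_simps)

text \<open>Successive terms have the ratio \<open>exp (- L * n) * r\<close>, which tends to 0 for
  every r, so the power series with these coefficients is entire.\<close>

lemma summable_theta_coeff: "summable (\<lambda>n. theta_coeff (real n) * r ^ n)" if "r \<ge> 0"
proof -
  have "(\<lambda>n. exp (- (L * real n)) * r) \<longlonglongrightarrow> 0"
    using L_pos by real_asymp
  then have "eventually (\<lambda>n. exp (- (L * real n)) * r < 1/2) sequentially"
    by (rule order_tendstoD) simp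
  then obtain N where N: "\<And>n. n \<ge> N \<Longrightarrow> exp (- (L * real n)) * r < 1/2"
    by (auto simp: eventually_sequentially)
  show ?thesis
  proof (rule summable_ratio_test[of "1/2" N])
    fix n assume "N \<le> n"
    then have "(theta_coeff (real n) * r ^ n) * (exp (- (L * real n)) * r) \<le> (theta_coeff (real n) * r ^ n) * (1/2)"
      using N[of n] that by (intro mult_left_mono mult_nonneg_nonneg zero_le_power) (auto intro: less_imp_le)
    moreover have "theta_coeff (real (Suc n)) * r ^ Suc n = (theta_coeff (real n) * r ^ n) * (exp (- (L * real n)) * r)"
      using theta_coeff_Suc[of "real n"] by (simp add: add.commute)
    moreover have "theta_coeff (real (Suc n)) * r ^ Suc n \<ge> 0" "theta_coeff (real n) * r ^ n \<ge> 0"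
      using that by (auto intro!: mult_nonneg_nonneg less_imp_le[OF theta_coeff_pos] simp del: of_nat_Suc power_Suc)
    ultimately show "norm (theta_coeff (real (Suc n)) * r ^ Suc n) \<le> 1 / 2 * norm (theta_coeff (real n) * r ^ n)"
      by (simp only: real_norm_def abs_of_nonneg)
  qed simp
qed

text \<open>The part of theta with nonnegative exponents, an entire function. Under n -> -n the
  remaining part becomes its value at \<open>exp (- L) / x\<close> without the constant term 1;
  holomorphy of theta off 0 follows from this.\<close>

definition half_theta :: "complex \<Rightarrow> complex" where "half_theta x = (\<Sum>n. of_real (theta_coeff (real n)) * x ^ n)"

lemma half_theta_summable_norm: "summable (\<lambda>n. norm (of_real (theta_coeff (real n)) * (x::complex) ^ n))"
  using summable_theta_coeff[of "norm x"] by (simp add: norm_mult norm_power less_imp_le)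

lemma half_theta_holomorphic: "half_theta holomorphic_on A"
proof -
  have "(\<lambda>n. of_real (theta_coeff (real n)) * (w - 0) ^ n) sums half_theta w" for w
    using summable_sums[OF summable_norm_cancel[OF half_theta_summable_norm[of w]]] by (simp add: half_theta_def)
  then have "half_theta holomorphic_on ball 0 r" for r
    by (intro power_series_holomorphic[of 0 r "\<lambda>n. of_real (theta_coeff (real n))"])
  then have "half_theta field_differentiable at z" for z
    using holomorphic_on_imp_differentiable_at[of half_theta "ball 0 (norm z + 1)" z] by auto
  then show ?thesis by (simp add: holomorphic_on_def field_differentiable_at_within)
qed

definition theta_term :: "complex \<Rightarrow> int \<Rightarrow> complex" where "theta_term x n = of_real (theta_coeff (of_int n)) * x powi n"

lemma theta_term_neg: "x \<noteq> 0 \<Longrightarrow> theta_term x (- int (Suc n)) = of_real (theta_coeff (real (Suc n))) * (of_real (exp (- L)) / x) ^ Suc n"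
proof -
  have "theta_coeff (- real (Suc n)) = theta_coeff (real (Suc n)) * exp (- L) ^ Suc n"
    by (simp add: theta_coeff_def exp_of_nat_mult[symmetric] flip: exp_add) (simp add: field_simps)
  then show ?thesis if "x \<noteq> 0"
    using that by (simp add: theta_term_def power_int_minus power_divide field_simps power_int_def nat_add_distrib del: of_nat_Suc power_Suc)
qed

lemma theta_term_has_sum:
  assumes "x \<noteq> 0"
  shows "(theta_term x has_sum (half_theta x + half_theta (of_real (exp (- L)) / x) - 1)) UNIV" "(\<lambda>n. norm (theta_term x n)) summable_on UNIV"
proof -
  have 1: "theta_term x (int n) = of_real (theta_coeff (real n)) * x ^ n" for n by (simp add: theta_term_def)
  have s1: "summable (\<lambda>n. norm (theta_term x (int n)))" using half_theta_summable_norm[of x] by (simp only: 1)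
  have s2: "summable (\<lambda>n. norm (theta_term x (- int (Suc n))))"
    using half_theta_summable_norm[of "of_real (exp (- L)) / x"]
    by (simp only: theta_term_neg[OF assms] summable_Suc_iff[of "\<lambda>n. norm (of_real (theta_coeff (real n)) * (of_real (exp (- L)) / x :: complex) ^ n)"])
  have "(\<Sum>n. theta_term x (- int (Suc n))) = (\<Sum>n. of_real (theta_coeff (real (Suc n))) * (of_real (exp (- L)) / x) ^ Suc n)"
    by (simp only: theta_term_neg[OF assms])
  also have "\<dots> = half_theta (of_real (exp (- L)) / x) - 1"
    unfolding half_theta_def
    by (subst suminf_split_head[OF summable_norm_cancel[OF half_theta_summable_norm]]) simp
  finally have 2: "(\<Sum>n. theta_term x (- int (Suc n))) = half_theta (of_real (exp (- L)) / x) - 1" .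
  have "(\<Sum>n. theta_term x (int n)) = half_theta x" by (simp only: 1 half_theta_def)
  with has_sum_int_split[OF s1 s2] 2
  show "(theta_term x has_sum (half_theta x + half_theta (of_real (exp (- L)) / x) - 1)) UNIV" "(\<lambda>n. norm (theta_term x n)) summable_on UNIV"
    by (simp_all only: add_diff_eq)
qed

abbreviation TH :: "complex \<Rightarrow> complex" where "TH \<equiv> Theta q k"

lemma Theta_eq_infsum: "TH x = (\<Sum>\<^sub>\<infinity>n. theta_term x n)"
  unfolding Theta_def theta_term_def by (simp only: powr_eq_theta_coeff)

lemma Theta_has_sum: "x \<noteq> 0 \<Longrightarrow> (theta_term x has_sum TH x) UNIV"
  using theta_term_has_sum by (metis Theta_eq_infsum infsumI)

lemma Theta_holomorphic: "0 \<notin> A \<Longrightarrow> TH holomorphic_on A"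
proof -
  assume A: "0 \<notin> A"
  have "(\<lambda>x. half_theta x + half_theta (of_real (exp (- L)) / x) - 1) holomorphic_on A"
    using A by (auto intro!: holomorphic_intros half_theta_holomorphic holomorphic_on_compose_gen[OF _ half_theta_holomorphic, of _ _ UNIV, unfolded o_def])
  moreover have "TH x = half_theta x + half_theta (of_real (exp (- L)) / x) - 1" if "x \<in> A" for x
    using theta_term_has_sum(1)[of x] A that by (metis Theta_eq_infsum infsumI)
  ultimately show ?thesis by (simp cong: holomorphic_cong)
qed

lemma Theta_continuous: "0 \<notin> A \<Longrightarrow> continuous_on A TH"
  using Theta_holomorphic holomorphic_on_imp_continuous_on by blast

text \<open>The term of index n at \<open>exp L * x\<close> is \<open>exp L * x\<close> times the
  term of index n - 1 at x, and a bilateral series may be shifted.\<close>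

lemma Theta_step: "TH (of_real (exp L) * x) = of_real (exp L) * x * TH x" if "x \<noteq> 0"
proof -
  have e: "theta_term (of_real (exp L) * x) n = of_real (exp L) * x * theta_term x (n - 1)" for n
  proof -
    have "theta_coeff (of_int n) * exp L powi n = theta_coeff (of_int n - 1) * exp L"
      by (simp add: theta_coeff_def exp_power_int flip: exp_add) (simp add: field_simps)
    then have "complex_of_real (theta_coeff (of_int n)) * of_real (exp L) powi n = of_real (theta_coeff (of_int n - 1)) * of_real (exp L)"
      by (metis of_real_mult of_real_power_int)
    then have "complex_of_real (theta_coeff (of_int n)) * of_real (exp L) powi n * x powi n
       = of_real (theta_coeff (of_int n - 1)) * of_real (exp L) * (x powi (n - 1) * x)"
      using that by (simp add: power_int_minus_left power_int_diff)
    then show ?thesis by (simp only: theta_term_def power_int_mult_distrib of_int_diff of_int_1 mult_ac)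
  qed
  have "((\<lambda>n. theta_term x (n - 1)) has_sum TH x) UNIV"
    using Theta_has_sum[OF that]
    by (subst has_sum_reindex_bij_betw[of "\<lambda>n. n - 1" UNIV UNIV]) (auto intro!: bij_betwI[of _ _ _ "\<lambda>n. n + 1"])
  then have "((\<lambda>n. of_real (exp L) * x * theta_term x (n - 1)) has_sum (of_real (exp L) * x * TH x)) UNIV"
    by (rule has_sum_cmult_right)
  then show ?thesis
    using Theta_has_sum[of "of_real (exp L) * x"] that unfolding e[symmetric] by (intro has_sum_unique[of "theta_term (of_real (exp L) * x)"]) auto
qed

lemma theta_term_step:
  assumes "x \<noteq> 0"
  shows "theta_term x (- (n + 1)) * (of_real (exp L) * (of_real (exp (of_int n * L)) * x)) = theta_term x (- n)"
proof -
  have "x powi (- n) = x powi (- (n + 1)) * x"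
    using assms by (simp add: power_int_add power_int_diff power_int_minus field_simps)
  moreover have "theta_coeff (of_int (- n)) = theta_coeff (of_int (- (n + 1))) * exp L * exp (of_int n * L)"
    by (simp add: theta_coeff_def flip: exp_add) (simp add: field_simps)
  ultimately show ?thesis
    unfolding theta_term_def by (simp only: of_real_mult mult_ac)
qed

text \<open>The step is iterated in both directions from 0. The accumulated factor is again a term
  of the theta series at x; this coincidence is behind the value of the integral of 1 /
  theta.\<close>

lemma Theta_step_powi:
  assumes "x \<noteq> 0"
  shows "TH x = theta_term x (- n) * TH (of_real (exp (of_int n * L)) * x)"
proof -
  have *: "theta_term x (- (n + 1)) * TH (of_real (exp (of_int (n + 1) * L)) * x) = theta_term x (- n) * TH (of_real (exp (of_int n * L)) * x)" for n
  proof -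
    let ?y = "of_real (exp (of_int n * L)) * x"
    have "exp (of_int (n + 1) * L) = exp L * exp (of_int n * L)"
      by (simp add: algebra_simps flip: exp_add)
    then have "of_real (exp (of_int (n + 1) * L)) * x = of_real (exp L) * ?y"
      by (simp only: of_real_mult mult.assoc)
    then have "TH (of_real (exp (of_int (n + 1) * L)) * x) = of_real (exp L) * ?y * TH ?y"
      using Theta_step[of ?y] assms by (simp only:) simp
    then show ?thesis using theta_term_step[OF assms, of n] by (metis mult.assoc)
  qed
  show ?thesis
  proof (induction n rule: int_induct[where k = 0])
    case base
    then show ?case by (simp add: theta_term_def)
  next
    case (step1 i)
    then show ?case using *[of i] by simp
  next
    case (step2 i)
    then show ?case using *[of "i - 1"] by simp
  qed
qed

section \<open>Zeros of theta\<close>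

definition p :: real where "p = exp (- L)"

lemma p_bounds: "0 < p" "p < 1" using L_pos by (auto simp: p_def)

lemma theta_coeff_Suc': "theta_coeff (real (Suc j)) = theta_coeff (real j) * p ^ j"
  using theta_coeff_Suc[of "real j"] by (simp add: p_def add.commute exp_of_nat_mult[symmetric] mult.commute)

text \<open>Zeros of theta are located by the finite form of Jacobi's triple product, obtained from the
  q-binomial theorem by shifting the index; no factor of the limit vanishes off the negative axis.\<close>

definition qpoch :: "nat \<Rightarrow> real" where "qpoch n = (\<Prod>j<n. 1 - p ^ Suc j)"

lemma factor_pos: "1 - p ^ Suc j > 0"
  using p_bounds by (simp add: power_Suc_less_one del: power_Suc)

lemma qpoch_pos: "qpoch n > 0" unfolding qpoch_def by (intro prod_pos) (use factor_pos in auto)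

lemma qpoch_0 [simp]: "qpoch 0 = 1" by (simp add: qpoch_def)

lemma qpoch_Suc: "qpoch (Suc n) = qpoch n * (1 - p ^ Suc n)" by (simp add: qpoch_def)

text \<open>The Gaussian binomial coefficient in base p. Its value 0 beyond the diagonal makes
  Pascal's rule hold for j = M as well.\<close>

definition qbin :: "nat \<Rightarrow> nat \<Rightarrow> real" where
  "qbin M j = (if j \<le> M then qpoch M / (qpoch j * qpoch (M - j)) else 0)"

lemma qbin_Pascal:
  assumes "j \<le> M"
  shows "qbin (Suc M) (Suc j) = qbin M (Suc j) + qbin M j * p ^ (M - j)"
proof (cases "j = M")
  case True
  then show ?thesis using qpoch_pos[of M] qpoch_pos[of "Suc M"] by (simp add: qbin_def)
next
  case False
  then obtain i where i: "M = j + Suc i" using assms by (metis add_Suc_right le_iff_add less_imp_Suc_add nat_less_le)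
  have pos: "qpoch M \<noteq> 0" "qpoch j \<noteq> 0" "qpoch i \<noteq> 0" "1 - p ^ Suc j \<noteq> 0" "1 - p ^ Suc i \<noteq> 0"
    using qpoch_pos factor_pos by (metis less_irrefl)+
  \<comment> \<open>The top factor is split so that in each summand one factor of the denominator
    cancels.\<close>
  have e: "1 - p ^ Suc M = (1 - p ^ Suc i) + p ^ Suc i * (1 - p ^ Suc j)"
    by (simp add: i algebra_simps power_add)
  have "qbin (Suc M) (Suc j) = qpoch M * (1 - p ^ Suc M) / ((qpoch j * (1 - p ^ Suc j)) * (qpoch i * (1 - p ^ Suc i)))"
    by (simp add: qbin_def i qpoch_Suc del: power_Suc)
  also have "\<dots> = qpoch M / ((qpoch j * (1 - p ^ Suc j)) * qpoch i) + qpoch M / (qpoch j * (qpoch i * (1 - p ^ Suc i))) * p ^ Suc i"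
    unfolding e using pos by (simp add: divide_simps del: power_Suc) (simp add: algebra_simps)
  also have "\<dots> = qbin M (Suc j) + qbin M j * p ^ (M - j)"
    by (simp add: qbin_def i qpoch_Suc del: power_Suc)
  finally show ?thesis .
qed

text \<open>Induction on M. As \<open>theta_coeff (j + 1) = theta_coeff j * p ^ j\<close>, the
  powers \<open>p ^ (M - j)\<close> of Pascal's rule turn into \<open>p ^ M\<close>, which no longer
  depends on j; the recursion of the coefficients is thus multiplication by
  \<open>1 + y * p ^ M\<close>.\<close>

theorem q_binomial:
  fixes y :: complex
  shows "(\<Prod>j<M. 1 + y * of_real (p ^ j)) = (\<Sum>j\<le>M. of_real (qbin M j * theta_coeff (real j)) * y ^ j)"
proof (induction M)
  case 0
  then show ?case by (simp add: qbin_def qpoch_def)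
next
  case (Suc M)
  define a where "a M j = complex_of_real (qbin M j * theta_coeff (real j))" for M j
  have st: "a (Suc M) (Suc j) = a M (Suc j) + a M j * of_real (p ^ M)" if "j \<le> M" for j
  proof -
    have "p ^ (M - j) * p ^ j = p ^ M" using that by (simp flip: power_add)
    then have "qbin (Suc M) (Suc j) * theta_coeff (real (Suc j)) = qbin M (Suc j) * theta_coeff (real (Suc j)) + qbin M j * theta_coeff (real j) * p ^ M"
      by (simp only: qbin_Pascal[OF that] theta_coeff_Suc') (simp add: algebra_simps)
    then show ?thesis by (simp only: a_def of_real_add[symmetric] of_real_mult[symmetric])
  qed
  have a0: "a M 0 = 1" "a (Suc M) 0 = 1" and aM: "a M (Suc M) = 0"
    using qpoch_pos[of M] qpoch_pos[of "Suc M"] by (simp_all add: a_def qbin_def)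
  have "(\<Sum>j\<le>Suc M. a (Suc M) j * y ^ j) = 1 + (\<Sum>j\<le>M. a (Suc M) (Suc j) * y ^ Suc j)"
    by (subst sum.atMost_Suc_shift) (simp add: a0)
  also have "\<dots> = (1 + (\<Sum>j\<le>M. a M (Suc j) * y ^ Suc j)) + (\<Sum>j\<le>M. a M j * y ^ j) * (y * of_real (p ^ M))"
  proof -
    have "(\<Sum>j\<le>M. a (Suc M) (Suc j) * y ^ Suc j) = (\<Sum>j\<le>M. a M (Suc j) * y ^ Suc j + a M j * y ^ j * (y * of_real (p ^ M)))"
      by (intro sum.cong) (simp_all add: st algebra_simps)
    then show ?thesis by (simp add: sum.distrib sum_distrib_right)
  qed
  also have "1 + (\<Sum>j\<le>M. a M (Suc j) * y ^ Suc j) = (\<Sum>j\<le>Suc M. a M j * y ^ j)"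
    by (subst sum.atMost_Suc_shift) (simp add: a0)
  also have "\<dots> = (\<Sum>j\<le>M. a M j * y ^ j)" by (simp add: aM)
  finally show ?case using Suc.IH by (simp add: a_def algebra_simps)
qed

text \<open>The deviations of the factors from 1 form a geometric sequence, so the product converges
  absolutely, and such a product vanishes only if a factor does. The real case serves
  \<open>qpoch\<close>, the complex one the two products in x.\<close>

lemma prod_lim:
  fixes z :: "'a::{real_normed_field, banach}"
  assumes "\<And>j. 1 + z * of_real (p ^ j) \<noteq> 0"
  shows "\<exists>l. l \<noteq> 0 \<and> (\<lambda>n. \<Prod>j<n. 1 + z * of_real (p ^ j)) \<longlonglongrightarrow> l"
proof -
  have "summable (\<lambda>j. norm ((1 + z * of_real (p ^ j)) - 1))"
    using p_bounds by (auto simp: norm_mult norm_power intro!: summable_mult summable_geometric)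
  then have c: "convergent_prod (\<lambda>j. 1 + z * of_real (p ^ j))"
    by (intro abs_convergent_prod_imp_convergent_prod summable_imp_abs_convergent_prod)
  show ?thesis
    using convergent_prod_LIMSEQ[OF c] prodinf_nonzero[OF c] assms
    by (auto simp: LIMSEQ_lessThan_iff_atMost)
qed

text \<open>Besides the limit, the bounds for all n matter: they bound every q-binomial coefficient
  by \<open>1 / P^2\<close>, which is the domination needed in the limit of the triple
  product.\<close>

lemma qpoch_lim: "\<exists>P>0. qpoch \<longlonglongrightarrow> P \<and> (\<forall>n. P \<le> qpoch n \<and> qpoch n \<le> 1)"
proof -
  have "1 + (- p) * of_real (p ^ j) \<noteq> 0" for j
    using factor_pos[of j] by simp
  then obtain P where P: "P \<noteq> 0" "(\<lambda>n. \<Prod>j<n. 1 + (- p) * of_real (p ^ j)) \<longlonglongrightarrow> P"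
    using prod_lim[of "- p"] by blast
  have "(\<lambda>n. \<Prod>j<n. 1 + (- p) * of_real (p ^ j)) = qpoch" by (auto simp: qpoch_def fun_eq_iff)
  then have l: "qpoch \<longlonglongrightarrow> P" using P by simp
  have dec: "decseq qpoch"
    by (rule decseq_SucI) (use qpoch_pos p_bounds in \<open>auto simp: qpoch_Suc mult_le_cancel_left1 intro!: mult_left_le less_imp_le[OF qpoch_pos]\<close>)
  have "P \<le> qpoch n" for n using decseq_ge[OF dec l] .
  moreover have "qpoch n \<le> 1" for n using decseqD[OF dec, of 0 n] by (simp add: qpoch_def)
  moreover have "P \<ge> 0" using l by (rule LIMSEQ_le_const) (use qpoch_pos in \<open>auto intro: less_imp_le\<close>)
  ultimately show ?thesis using l P by (intro exI[of _ P]) auto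
qed

text \<open>Row 2 N, indexed from its middle. For fixed n and growing N the entries tend to a
  constant, so that in the limit only the theta series remains.\<close>

definition central_qbin :: "nat \<Rightarrow> int \<Rightarrow> real" where
  "central_qbin N n = (if \<bar>n\<bar> \<le> int N then qbin (2 * N) (nat (int N + n)) else 0)"

text \<open>This is the q-binomial theorem with 2 N factors at \<open>y = x / p^N\<close>. The last
  N factors form the first product. Each of the others, read backwards, is
  \<open>x / p^(j + 1)\<close> times a factor of the second product. What is extracted in this way,
  \<open>x^N E\<close>, also comes out of the sum when its index is moved by N, and cancels.\<close>

lemma finite_triple_product:
  assumes x: "x \<noteq> 0"
  shows "(\<Prod>j<N. 1 + x * of_real (p ^ j)) * (\<Prod>j<N. 1 + (of_real p / x) * of_real (p ^ j))
     = (\<Sum>\<^sub>\<infinity>n. of_real (central_qbin N n) * theta_term x n)"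
proof -
  define y where "y = x * of_real (exp (L * N))"
  define E where "E = exp (L * (real N * (real N + 1) / 2))"
  have "(\<Prod>j<2*N. 1 + y * of_real (p ^ j)) = (\<Prod>j<N. 1 + y * of_real (p ^ j)) * (\<Prod>j<N. 1 + y * of_real (p ^ (N + j)))"
    by (simp add: mult_2 prod.nat_group[symmetric] lessThan_atLeast0 prod.atLeastLessThan_concat[of 0 N "N + N", symmetric] prod.shift_bounds_nat_ivl[of _ 0 N N, simplified] add.commute)
  also have "(\<Prod>j<N. 1 + y * of_real (p ^ (N + j))) = (\<Prod>j<N. 1 + x * of_real (p ^ j))"
  proof (rule prod.cong)
    fix j
    have "exp (L * N) * p ^ (N + j) = p ^ j"
      by (simp add: p_def power_add exp_of_nat_mult[symmetric] mult.commute flip: exp_add)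
    then show "1 + y * of_real (p ^ (N + j)) = 1 + x * of_real (p ^ j)"
      by (metis y_def mult.assoc of_real_mult)
  qed simp
  also have "(\<Prod>j<N. 1 + y * of_real (p ^ j)) = x ^ N * of_real E * (\<Prod>j<N. 1 + (of_real p / x) * of_real (p ^ j))"
  proof -
    have "(\<Prod>j<N. 1 + y * of_real (p ^ j)) = (\<Prod>j<N. 1 + y * of_real (p ^ (N - Suc j)))"
      by (rule prod.nat_diff_reindex[symmetric])
    also have "\<dots> = (\<Prod>j<N. (x * of_real (exp (L * real (Suc j)))) * (1 + (of_real p / x) * of_real (p ^ j)))"
    proof (rule prod.cong)
      fix j assume "j \<in> {..<N}"
      then have "exp (L * N) * p ^ (N - Suc j) = exp (L * real (Suc j))"
        by (simp add: p_def exp_of_nat_mult[symmetric] of_nat_diff algebra_simps flip: exp_add)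
      then have 1: "y * of_real (p ^ (N - Suc j)) = x * of_real (exp (L * real (Suc j)))"
        by (metis y_def mult.assoc of_real_mult)
      have "exp (L * real (Suc j)) * (p * p ^ j) = 1"
        by (simp add: p_def exp_of_nat_mult[symmetric] algebra_simps flip: exp_add)
      then have "complex_of_real (exp (L * real (Suc j))) * (of_real p * of_real (p ^ j)) = 1"
        by (metis of_real_mult of_real_1)
      then show "1 + y * of_real (p ^ (N - Suc j)) = (x * of_real (exp (L * real (Suc j)))) * (1 + (of_real p / x) * of_real (p ^ j))"
        unfolding 1 using x by (simp add: algebra_simps)
    qed simp
    also have "\<dots> = x ^ N * of_real (\<Prod>j<N. exp (L * real (Suc j))) * (\<Prod>j<N. 1 + (of_real p / x) * of_real (p ^ j))"
      by (simp add: prod.distrib)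
    also have "(\<Prod>j<N. exp (L * real (Suc j))) = E"
      unfolding E_def by (induction N) (simp_all add: algebra_simps add_divide_distrib flip: exp_add)
    finally show ?thesis .
  qed
  finally have lhs: "(\<Prod>j<2*N. 1 + y * of_real (p ^ j)) = x ^ N * of_real E *
    ((\<Prod>j<N. 1 + x * of_real (p ^ j)) * (\<Prod>j<N. 1 + (of_real p / x) * of_real (p ^ j)))"
    by (simp add: mult_ac)
  have "(\<Sum>j\<le>2*N. of_real (qbin (2*N) j * theta_coeff (real j)) * y ^ j) = (\<Sum>n\<in>{- int N..int N}. x ^ N * of_real E * (of_real (central_qbin N n) * theta_term x n))"
  proof (rule sum.reindex_bij_witness[of _ "\<lambda>n. nat (n + int N)" "\<lambda>j. int j - int N"])
    fix j assume j: "j \<in> {..2*N}"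
    have "theta_coeff (real j) * exp (L * N) ^ j = E * theta_coeff (real j - real N)"
      by (simp add: theta_coeff_def E_def exp_of_nat_mult[symmetric] flip: exp_add) (simp add: field_simps)
    then have 1: "complex_of_real (theta_coeff (real j)) * of_real (exp (L * N)) ^ j = of_real E * of_real (theta_coeff (real j - real N))"
      by (metis of_real_mult of_real_power)
    have 2: "x ^ j = x ^ N * x powi (int j - int N)"
      using x by (simp add: power_int_diff)
    have 3: "central_qbin N (int j - int N) = qbin (2 * N) j" using j by (auto simp: central_qbin_def)
    have "of_real (qbin (2*N) j * theta_coeff (real j)) * y ^ j = of_real (qbin (2*N) j) * x ^ j * (complex_of_real (theta_coeff (real j)) * of_real (exp (L * N)) ^ j)"
      by (simp add: y_def power_mult_distrib mult_ac del: of_real_exp)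
    also have "\<dots> = x ^ N * of_real E * (of_real (central_qbin N (int j - int N)) * theta_term x (int j - int N))"
      unfolding 1 2 3 theta_term_def by (simp add: mult_ac)
    finally show "x ^ N * of_real E * (of_real (central_qbin N (int j - int N)) * theta_term x (int j - int N)) = of_real (qbin (2*N) j * theta_coeff (real j)) * y ^ j" ..
  qed auto
  also have "\<dots> = x ^ N * of_real E * (\<Sum>n\<in>{- int N..int N}. of_real (central_qbin N n) * theta_term x n)"
    by (simp add: sum_distrib_left)
  also have "(\<Sum>n\<in>{- int N..int N}. of_real (central_qbin N n) * theta_term x n) = (\<Sum>\<^sub>\<infinity>n\<in>{- int N..int N}. of_real (central_qbin N n) * theta_term x n)"
    by simp
  also have "\<dots> = (\<Sum>\<^sub>\<infinity>n. of_real (central_qbin N n) * theta_term x n)"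
    by (rule infsum_cong_neutral) (auto simp: central_qbin_def)
  finally have "x ^ N * of_real E * ((\<Prod>j<N. 1 + x * of_real (p ^ j)) * (\<Prod>j<N. 1 + (of_real p / x) * of_real (p ^ j)))
    = x ^ N * of_real E * (\<Sum>\<^sub>\<infinity>n. of_real (central_qbin N n) * theta_term x n)"
    by (simp only: lhs[symmetric] q_binomial[where y = y and M = "2 * N"])
  moreover have "E \<noteq> 0" unfolding E_def by (rule exp_not_eq_zero)
  ultimately show ?thesis using x by (simp only: mult_cancel_left mult_eq_0_iff of_real_eq_0_iff power_eq_0_iff) simp
qed

text \<open>The finite products tend to nonzero limits A and B, while the sums tend to theta divided
  by the limit P of \<open>qpoch\<close>. Hence theta is P A B.\<close>

theorem Theta_nonzero:
  assumes "x \<notin> \<real>\<^sub>\<le>\<^sub>0"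
  shows "TH x \<noteq> 0"
proof -
  have x: "x \<noteq> 0" using assms by auto
  obtain P where P: "P > 0" "qpoch \<longlonglongrightarrow> P" "\<And>n. P \<le> qpoch n" "\<And>n. qpoch n \<le> 1" using qpoch_lim by blast
  have nz: "1 + x * of_real s \<noteq> 0" if "s > 0" for s
  proof
    assume "1 + x * of_real s = 0"
    then have "x * of_real s = - 1" by (simp only: eq_neg_iff_add_eq_0 add.commute)
    then have "x = of_real (- 1 / s)" using that by (simp add: divide_simps)
    moreover have "complex_of_real (- 1 / s) \<in> \<real>\<^sub>\<le>\<^sub>0" using that by (subst nonpos_Reals_of_real_iff) simp
    ultimately show False using assms by simp
  qed
  have nz': "1 + (of_real p / x) * of_real s \<noteq> 0" if "s > 0" for s
  proof
    assume *: "1 + (of_real p / x) * of_real s = 0"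
    have "p * s > 0" using p_bounds that by simp
    moreover have "x + of_real (p * s) = 0" using * x by (simp add: field_simps)
    ultimately have "x = - of_real (p * s)" by (simp only: eq_neg_iff_add_eq_0)
    then have "1 + x * of_real (1 / (p * s)) = 0" using \<open>p * s > 0\<close> by auto
    then show False using nz[of "1 / (p * s)"] p_bounds that by simp
  qed
  obtain A where A: "A \<noteq> 0" "(\<lambda>n. \<Prod>j<n. 1 + x * of_real (p ^ j)) \<longlonglongrightarrow> A"
    using prod_lim[of x] nz p_bounds by (metis zero_less_power)
  obtain B where B: "B \<noteq> 0" "(\<lambda>n. \<Prod>j<n. 1 + (of_real p / x) * of_real (p ^ j)) \<longlonglongrightarrow> B"
    using prod_lim[of "of_real p / x"] nz' p_bounds by (metis zero_less_power)
  have lim1: "(\<lambda>N. \<Sum>\<^sub>\<infinity>n. of_real (central_qbin N n) * theta_term x n) \<longlonglongrightarrow> A * B"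
    using tendsto_mult[OF A(2) B(2)] by (simp only: finite_triple_product[OF x])
  \<comment> \<open>For fixed n all of 2 N, N + n and N - n tend to infinity, so the quotient tends
    to \<open>P / (P * P)\<close>.\<close>
  have c1: "(\<lambda>N. central_qbin N n) \<longlonglongrightarrow> 1 / P" for n
  proof -
    have e: "central_qbin N n = qpoch (2 * N) / (qpoch (nat (int N + n)) * qpoch (nat (int N - n)))" if "N \<ge> nat \<bar>n\<bar>" for N
    proof -
      have "2 * N - nat (int N + n) = nat (int N - n)" "nat (int N + n) \<le> 2 * N" using that by linarith+
      moreover have "\<bar>n\<bar> \<le> int N" using that by linarith
      ultimately show ?thesis by (simp add: central_qbin_def qbin_def)
    qed
    have sh: "filterlim (\<lambda>N. nat (int N + m)) sequentially sequentially" for m :: int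
      unfolding filterlim_at_top eventually_sequentially
    proof
      fix Z :: nat
      show "\<exists>N. \<forall>i\<ge>N. Z \<le> nat (int i + m)"
        by (rule exI[of _ "Z + nat \<bar>m\<bar>"]) linarith
    qed
    have l: "filterlim (\<lambda>N. 2 * N) sequentially sequentially" "filterlim (\<lambda>N. nat (int N + n)) sequentially sequentially"
      "filterlim (\<lambda>N. nat (int N - n)) sequentially sequentially"
      using sh[of n] sh[of "- n"] by (auto intro: mult_nat_left_at_top)
    have "(\<lambda>N. qpoch (2 * N) / (qpoch (nat (int N + n)) * qpoch (nat (int N - n)))) \<longlonglongrightarrow> P / (P * P)"
      using P by (intro tendsto_intros filterlim_compose[OF P(2)] l) auto
    then have "(\<lambda>N. central_qbin N n) \<longlonglongrightarrow> P / (P * P)"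
      by (rule Lim_transform_eventually) (rule eventually_sequentiallyI[of "nat \<bar>n\<bar>"], rule e[symmetric])
    then show ?thesis using P by simp
  qed
  have c2: "\<bar>central_qbin N n\<bar> \<le> 1 / P\<^sup>2" for N n
  proof -
    have "qpoch (2*N) / (qpoch i * qpoch j) \<le> 1 / (P * P)" for i j
      using P qpoch_pos by (intro frac_le mult_mono) (auto intro: less_imp_le)
    then show ?thesis using P(1) qpoch_pos by (auto simp: central_qbin_def qbin_def power2_eq_square less_imp_le abs_of_pos)
  qed
  have "(\<lambda>N. \<Sum>\<^sub>\<infinity>n. of_real (central_qbin N n) * theta_term x n) \<longlonglongrightarrow> of_real (1 / P) * (\<Sum>\<^sub>\<infinity>n. theta_term x n)"
    by (rule infsum_dominated_LIMSEQ[OF theta_term_has_sum(2)[OF x] c1 c2])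
  with lim1 have "A * B = of_real (1 / P) * TH x" unfolding Theta_eq_infsum by (rule LIMSEQ_unique)
  then show ?thesis using A B by auto
qed

text \<open>Theta grows like this function, up to a constant factor: both are multiplied by \<open>Q r\<close> when r is
  replaced by \<open>Q r\<close>.\<close>

definition env :: "real \<Rightarrow> real" where "env r = exp ((ln r)\<^sup>2 / (2 * L) + ln r / 2)"

lemma env_pos [simp]: "env r > 0" by (simp add: env_def)

text \<open>Completing the square: the exponents differ by
  \<open>(ln r + L * (s + 1/2))^2 / (2 * L)\<close>. The Gaussian thus dominates every power of r;
  later s = 1 serves near 0 and s = - 1 at infinity.\<close>

lemma env_ge: "r > 0 \<Longrightarrow> env r \<ge> exp (- L * (s + 1/2)\<^sup>2 / 2) * r powr (- s)"
proof -
  assume r: "r > 0"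
  have "(ln r)\<^sup>2 / (2 * L) + ln r / 2 + s * ln r + L * (s + 1/2)\<^sup>2 / 2 = (ln r + L * (s + 1/2))\<^sup>2 / (2 * L)"
    using L_pos by (simp add: field_simps power2_eq_square)
  also have "\<dots> \<ge> 0" using L_pos by simp
  finally have "- L * (s + 1/2)\<^sup>2 / 2 + - s * ln r \<le> (ln r)\<^sup>2 / (2 * L) + ln r / 2" by simp
  then show ?thesis
    using r by (simp add: env_def powr_def flip: exp_add)
qed

lemma env_scale: "r > 0 \<Longrightarrow> env (exp (of_int n * L) * r) * theta_coeff (- of_int n) = env r * r powi n"
proof -
  assume r: "r > 0"
  have "ln (exp (of_int n * L) * r) = of_int n * L + ln r" using r by (simp add: ln_mult)
  moreover have "r powi n = exp (of_int n * ln r)" using r exp_power_int[of "ln r" n] by simp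
  ultimately show ?thesis
    using L_pos by (simp add: env_def theta_coeff_def power2_eq_square flip: exp_add) (simp add: field_simps)
qed

text \<open>The quotient of \<open>|TH x|\<close> by \<open>env |x|\<close> is a function on the
  punctured plane modulo dilations by \<open>exp L\<close>, so it can be estimated on a compact
  annulus.\<close>

lemma norm_Theta_scale:
  assumes "x \<noteq> 0"
  shows "norm (TH (of_real (exp (of_int n * L)) * x)) / env (norm (of_real (exp (of_int n * L)) * x)) = norm (TH x) / env (norm x)"
proof -
  let ?r = "norm x"
  have r: "?r > 0" using assms by simp
  have "norm (TH x) = theta_coeff (- of_int n) * ?r powi (- n) * norm (TH (of_real (exp (of_int n * L)) * x))"
    by (subst Theta_step_powi[OF assms, of n]) (simp add: norm_mult theta_term_def norm_power_int abs_of_pos)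
  moreover have "env (exp (of_int n * L) * ?r) = env ?r * ?r powi n / theta_coeff (- of_int n)"
    using env_scale[OF r, of n] less_imp_neq[OF theta_coeff_pos[of "- of_int n"]] by (subst eq_divide_eq) auto
  moreover have "norm (of_real (exp (of_int n * L)) * x) = exp (of_int n * L) * ?r"
    by (simp add: norm_mult del: of_real_exp)
  moreover have "b / (e * P / t) = (t * inverse P * b) / e" if "P > 0" "t > 0" "e > 0" for b e P t :: real
    using that by (simp add: field_simps)
  ultimately show ?thesis
    using r by (simp only: power_int_minus zero_less_power_int theta_coeff_pos env_pos)
qed

lemma scale_to_period:
  assumes "r > 0"
  obtains n :: int where "exp (of_int n * L) * r \<in> {1..exp L}"
proof
  let ?n = "\<lceil>- ln r / L\<rceil>"
  have "(- ln r / L) * L \<le> of_int ?n * L" "(of_int ?n - 1) * L \<le> (- ln r / L) * L"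
    by (intro mult_right_mono; use L_pos ceiling_correct[of "- ln r / L"] in linarith)+
  then have "of_int ?n * L + ln r \<ge> 0" "of_int ?n * L + ln r \<le> L"
    using L_pos by (auto simp: algebra_simps)
  then have "exp (of_int ?n * L + ln r) \<ge> exp 0" "exp (of_int ?n * L + ln r) \<le> exp L"
    by (auto simp del: exp_zero)
  then show "exp (of_int ?n * L) * r \<in> {1..exp L}"
    using assms by (simp add: exp_add)
qed

text \<open>By invariance under dilations it is enough to consider the moduli of one period. With
  the directions in K they form a compact set, which avoids the negative axis because - 1 is not in
  K; there the quotient by \<open>env\<close> is continuous and positive.\<close>

theorem Theta_lower_bound:
  assumes "compact K" "K \<subseteq> sphere 0 1" "- 1 \<notin> K"
  shows "\<exists>c>0. \<forall>r>0. \<forall>w\<in>K. c * env r \<le> norm (TH (of_real r * w))"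
proof -
  define C where "C = (\<lambda>(r, w). complex_of_real r * w) ` ({1..exp L} \<times> K)"
  have cC: "compact C" unfolding C_def
    by (intro compact_continuous_image compact_Times assms) (auto intro!: continuous_intros simp: case_prod_unfold)
  have nr: "of_real r * w \<notin> \<real>\<^sub>\<le>\<^sub>0" if "r > 0" "w \<in> K" for r w
  proof
    assume "of_real r * w \<in> \<real>\<^sub>\<le>\<^sub>0"
    then obtain s where s: "of_real r * w = of_real s" "s \<le> 0" by (auto elim!: nonpos_Reals_cases)
    then have w: "w = of_real (s / r)" using that by (simp add: field_simps)
    moreover have "norm w = 1" using that assms by auto
    ultimately have "\<bar>s / r\<bar> = 1" by (metis norm_of_real)
    then have "s / r = - 1" using s that by (simp add: abs_if divide_simps split: if_splits)
    then show False using w that assms by simp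
  qed
  have C0: "x \<noteq> 0" "TH x \<noteq> 0" if "x \<in> C" for x
    using that nr by (auto simp: C_def intro!: Theta_nonzero) (metis less_le_trans zero_less_one nonpos_Reals_zero_I mult_eq_0_iff of_real_0)+
  have "continuous_on C (\<lambda>x. norm (TH x) / env (norm x))"
    unfolding env_def using C0 L_pos by (intro continuous_intros Theta_continuous) auto
  then obtain c where c: "c > 0" "\<And>x. x \<in> C \<Longrightarrow> c \<le> norm (TH x) / env (norm x)"
  proof (cases "C = {}")
    case True
    then show ?thesis using that[of 1] by auto
  next
    case False
    then obtain x0 where "x0 \<in> C" "\<And>x. x \<in> C \<Longrightarrow> norm (TH x0) / env (norm x0) \<le> norm (TH x) / env (norm x)"
      using continuous_attains_inf[OF cC False \<open>continuous_on C _\<close>] by blast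
    then show ?thesis using that[of "norm (TH x0) / env (norm x0)"] C0 by simp
  qed
  have "c * env r \<le> norm (TH (of_real r * w))" if rw: "r > 0" "w \<in> K" for r w
  proof -
    obtain n :: int where n: "exp (of_int n * L) * r \<in> {1..exp L}" using scale_to_period[OF rw(1)] .
    have w1: "norm w = 1" using rw assms by auto
    have "(of_real (exp (of_int n * L)) * (of_real r * w)) \<in> C"
      unfolding C_def using n rw by (intro image_eqI[of _ _ "(exp (of_int n * L) * r, w)"]) (auto simp: mult.assoc)
    from c(2)[OF this] have "c \<le> norm (TH (of_real r * w)) / env (norm (of_real r * w))"
      using rw w1 by (subst (asm) norm_Theta_scale) auto
    then show ?thesis using rw w1 by (simp add: norm_mult field_simps)
  qed
  then show ?thesis using c by blast
qed

lemma Theta_lower_bound_dir: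
  assumes "x \<notin> \<real>\<^sub>\<le>\<^sub>0"
  shows "\<exists>c>0. \<forall>r>0. c * env (r * norm x) \<le> norm (TH (of_real r * x))"
proof -
  have x: "x \<noteq> 0" using assms by auto
  have "- 1 \<notin> {sgn x}"
  proof
    assume "- 1 \<in> {sgn x}"
    then have "x = of_real (- norm x)" using x by (metis mult_minus1_right of_real_minus sgn_eq singletonD nonzero_eq_divide_eq norm_eq_zero of_real_eq_0_iff mult.commute)
    then show False using assms by (metis neg_le_0_iff_le nonpos_Reals_of_real_iff norm_ge_zero)
  qed
  then obtain c where c: "c > 0" "\<And>r. r > 0 \<Longrightarrow> c * env r \<le> norm (TH (of_real r * sgn x))"
    using Theta_lower_bound[of "{sgn x}"] x by (auto simp: norm_sgn)
  have "c * env (r * norm x) \<le> norm (TH (of_real r * x))" if "r > 0" for r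
    using c(2)[of "r * norm x"] that x by (simp add: sgn_eq)
  then show ?thesis using c by blast
qed

end

section \<open>The invariant measure dr / r on the halfline, and integrable majorants\<close>

lemma integrable_scaleR_iff:
  fixes f :: "'b \<Rightarrow> 'a::{banach, second_countable_topology}"
  shows "c \<noteq> 0 \<Longrightarrow> integrable M (\<lambda>x. c *\<^sub>R f x) \<longleftrightarrow> integrable M f"
  using integrable_scaleR_right[of "inverse c" M "\<lambda>x. c *\<^sub>R f x"] by auto

text \<open>Brings a dilated integrand into the shape \<open>c * g (0 + c * r)\<close> required by
  the affine change of variables; the division by r supplies the factor c.\<close>

lemma haar_eq:
  fixes h :: "real \<Rightarrow> 'a::{banach, second_countable_topology}"
  assumes "c > 0"
  shows "(\<lambda>r. indicator {0<..} r *\<^sub>R (h (c * r) /\<^sub>R r)) = (\<lambda>r. c *\<^sub>R (\<lambda>r. indicator {0<..} r *\<^sub>R (h r /\<^sub>R r)) (0 + c * r))"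
  using assms by (auto simp: fun_eq_iff indicator_def zero_less_mult_iff)

lemma haar_scale_integral:
  fixes h :: "real \<Rightarrow> 'a::{banach, second_countable_topology, real_normed_field}"
  assumes "c > 0"
  shows "(LBINT r:{0<..}. h (c * r) / of_real r) = (LBINT r:{0<..}. h r / of_real r)"
  using lborel_integral_real_affine[of c "\<lambda>r. indicator {0<..} r *\<^sub>R (h r /\<^sub>R r)" 0] haar_eq[OF assms, of h] assms
  by (simp add: set_lebesgue_integral_def scaleR_conv_of_real divide_inverse mult_ac)

lemma haar_scale_integrable:
  fixes h :: "real \<Rightarrow> 'a::{banach, second_countable_topology, real_normed_field}"
  assumes "c > 0"
  shows "set_integrable lborel {0<..} (\<lambda>r. h (c * r) / of_real r) \<longleftrightarrow> set_integrable lborel {0<..} (\<lambda>r. h r / of_real r)"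
proof -
  let ?g = "\<lambda>r. indicator {0<..} r *\<^sub>R (h r /\<^sub>R r)"
  have d: "h s / of_real r = h s /\<^sub>R r" for s r by (simp add: scaleR_conv_of_real divide_inverse mult.commute)
  have "integrable lborel (\<lambda>r. c *\<^sub>R ?g (0 + c * r)) \<longleftrightarrow> integrable lborel (\<lambda>r. ?g (0 + c * r))"
    using assms by (intro integrable_scaleR_iff) auto
  also have "\<dots> \<longleftrightarrow> integrable lborel ?g"
    using assms by (intro lborel_integrable_real_affine_iff) auto
  finally show ?thesis
    unfolding set_integrable_def d haar_eq[OF assms, of h] .
qed

lemma set_integrable_powr_at_top:
  assumes "a < - 1"
  shows "set_integrable lborel {1::real<..} (\<lambda>r. r powr a)"
proof -
  have "set_integrable lebesgue {1::real..} (\<lambda>r. r powr a)"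
  proof -
    have "(\<lambda>r. r powr a) integrable_on {1::real..}"
      using has_integral_powr_to_inf[of a 1] assms by (auto simp: integrable_on_def)
    then show ?thesis
      using absolutely_integrable_on_iff_nonneg[of "{1::real..}" "\<lambda>r. r powr a"] by (simp add: nonnegative_absolutely_integrable_1)
  qed
  then have "set_integrable lebesgue {1::real<..} (\<lambda>r. r powr a)"
    by (rule set_integrable_subset) auto
  then show ?thesis unfolding set_integrable_def
    by (subst (asm) integrable_completion) auto
qed

text \<open>The common majorant of the integrands below: constant near 0, where the growth of theta
  compensates the factor 1 / r, and a power at infinity.\<close>

definition tail_powr :: "real \<Rightarrow> real \<Rightarrow> real" where "tail_powr a r = (if r \<le> 1 then 1 else r powr a)"

lemma tail_powr_pos: "r > 0 \<Longrightarrow> tail_powr a r > 0" by (simp add: tail_powr_def)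

lemma set_integrable_tail_powr: "a < - 1 \<Longrightarrow> set_integrable lborel {0<..} (tail_powr a)"
proof -
  assume a: "a < - 1"
  have 1: "set_integrable lborel {0<..1} (tail_powr a)"
    by (subst set_integrable_cong[of lborel lborel "{0<..1}" "{0<..1}" _ "\<lambda>_. 1"]) (auto simp: tail_powr_def set_integrable_def)
  have 2: "set_integrable lborel {1<..} (tail_powr a)"
    by (subst set_integrable_cong[of lborel lborel "{1<..}" "{1<..}" _ "\<lambda>r. r powr a"])
      (auto simp: tail_powr_def intro: set_integrable_powr_at_top[OF a])
  have "{0<..} = {0<..1} \<union> {1::real<..}" by auto
  then show ?thesis using set_integrable_Un[OF 1 2] by simp
qed

lemma set_integrable_tail_powr_bound:
  fixes f :: "real \<Rightarrow> complex"
  assumes "set_borel_measurable borel {0<..} f" "a < - 1" "\<And>r. r > 0 \<Longrightarrow> norm (f r) \<le> C * tail_powr a r"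
  shows "set_integrable lborel {0<..} f"
proof (rule set_integrable_bound)
  show "set_integrable lborel {0<..} (\<lambda>r. C * tail_powr a r)"
    by (intro set_integrable_mult_right) (use set_integrable_tail_powr[OF assms(2)] in auto)
  show "set_borel_measurable lborel {0<..} f" using assms(1) by (simp add: set_borel_measurable_def)
  show "AE x in lborel. x \<in> {0<..} \<longrightarrow> cmod (f x) \<le> norm (C * tail_powr a x)"
    using assms(3) by (intro AE_I2) (auto intro: order.trans[OF _ abs_ge_self])
qed

lemma set_integral_sum':
  fixes f :: "'i \<Rightarrow> 'a \<Rightarrow> 'b::{banach, second_countable_topology}"
  assumes "\<And>i. i \<in> I \<Longrightarrow> set_integrable M A (f i)"
  shows "(LINT x:A|M. \<Sum>i\<in>I. f i x) = (\<Sum>i\<in>I. LINT x:A|M. f i x)"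
    and "set_integrable M A (\<lambda>x. \<Sum>i\<in>I. f i x)"
  using assms unfolding set_lebesgue_integral_def set_integrable_def scaleR_sum_right by auto

section \<open>The integral of 1 / theta over a halfline\<close>

context q_base begin

lemma inverse_env_tail_powr: "x > 0 \<Longrightarrow> \<exists>C>0. \<forall>r>0. 1 / (env (r * x) * r) \<le> C * tail_powr (- 2) r"
proof -
  assume x: "x > 0"
  define c1 where "c1 = exp (- L * (1 + 1/2)\<^sup>2 / 2)"
  define c2 where "c2 = exp (- L * (- 1 + 1/2)\<^sup>2 / 2)"
  have c: "c1 > 0" "c2 > 0" by (auto simp: c1_def c2_def)
  define C where "C = x / c1 + 1 / (c2 * x)"
  have "1 / (env (r * x) * r) \<le> C * tail_powr (- 2) r" if r: "r > 0" for r
  proof (cases "r \<le> 1")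
    case True
    have "env (r * x) \<ge> c1 / (r * x)"
    proof -
      have "(r * x) powr (- 1) = 1 / (r * x)" using r x by (simp add: powr_minus_divide)
      then show ?thesis using env_ge[of "r * x" 1] r x by (simp only: c1_def) simp
    qed
    then have "env (r * x) * r \<ge> c1 / (r * x) * r" using r by (intro mult_right_mono) auto
    then have "env (r * x) * r \<ge> c1 / x" using r x by simp
    then have "1 / (env (r * x) * r) \<le> x / c1"
      using c r x frac_le[of 1 1 "c1 / x" "env (r * x) * r"] by simp
    also have "\<dots> \<le> C" using c x by (simp add: C_def)
    finally show ?thesis using True by (simp add: tail_powr_def)
  next
    case False
    have "env (r * x) \<ge> c2 * (r * x)"
      using env_ge[of "r * x" "- 1"] r x by (simp add: c2_def)
    then have "env (r * x) * r \<ge> c2 * (r * x) * r" using r by (intro mult_right_mono) auto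
    then have "env (r * x) * r \<ge> c2 * x * r\<^sup>2" by (simp add: power2_eq_square mult_ac)
    then have "1 / (env (r * x) * r) \<le> 1 / (c2 * x * r\<^sup>2)"
      using c r x by (intro frac_le) auto
    also have "\<dots> = 1 / (c2 * x) * r powr (- 2)"
      using r by (simp add: powr_minus divide_inverse)
    also have "\<dots> \<le> C * r powr (- 2)" using c x r by (intro mult_right_mono) (auto simp: C_def)
    finally show ?thesis using False by (simp add: tail_powr_def)
  qed
  moreover have "C > 0" using c x by (simp add: C_def add_pos_pos)
  ultimately show ?thesis by blast
qed

lemma ray_notin_nonpos: "x \<notin> \<real>\<^sub>\<le>\<^sub>0 \<Longrightarrow> r > 0 \<Longrightarrow> complex_of_real r * x \<notin> \<real>\<^sub>\<le>\<^sub>0"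
proof
  assume *: "x \<notin> \<real>\<^sub>\<le>\<^sub>0" "r > 0" "of_real r * x \<in> \<real>\<^sub>\<le>\<^sub>0"
  then obtain s where s: "of_real r * x = of_real s" "s \<le> 0" by (auto elim!: nonpos_Reals_cases)
  then have "x = of_real (s / r)" using * by (simp add: field_simps)
  moreover have "s / r \<le> 0" using s * by (simp add: divide_nonpos_pos)
  ultimately show False using * by (metis nonpos_Reals_of_real_iff)
qed

lemma inverse_Theta_integrable:
  assumes "x \<notin> \<real>\<^sub>\<le>\<^sub>0"
  shows "set_integrable lborel {0<..} (\<lambda>r. 1 / TH (of_real r * x) / of_real r)"
proof -
  have x: "norm x > 0" using assms by auto
  obtain c where c: "c > 0" "\<And>r. r > 0 \<Longrightarrow> c * env (r * norm x) \<le> norm (TH (of_real r * x))"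
    using Theta_lower_bound_dir[OF assms] by blast
  obtain C where C: "\<And>r. r > 0 \<Longrightarrow> 1 / (env (r * norm x) * r) \<le> C * tail_powr (- 2) r"
    using inverse_env_tail_powr[OF x] by blast
  show ?thesis
  proof (rule set_integrable_tail_powr_bound)
    have "continuous_on {0<..} (\<lambda>r. TH (of_real r * x))"
      by (rule continuous_on_compose2[OF Theta_continuous[of "- {0}"]]) (use x in \<open>auto intro!: continuous_intros\<close>)
    then show "set_borel_measurable borel {0<..} (\<lambda>r. 1 / TH (of_real r * x) / of_real r)"
      using Theta_nonzero[OF ray_notin_nonpos[OF assms]]
      by (intro set_measurable_continuous_on) (auto intro!: continuous_intros)
    fix r :: real assume r: "r > 0"
    have "norm (1 / TH (of_real r * x) / of_real r) = 1 / (norm (TH (of_real r * x)) * r)"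
      using r by (simp add: norm_divide norm_mult)
    also have "\<dots> \<le> 1 / ((c * env (r * norm x)) * r)"
      using r c by (intro frac_le mult_right_mono) auto
    also have "\<dots> = 1 / c * (1 / (env (r * norm x) * r))" by simp
    also have "\<dots> \<le> 1 / c * (C * tail_powr (- 2) r)" using c C[OF r] by (intro mult_left_mono) auto
    finally show "norm (1 / TH (of_real r * x) / of_real r) \<le> (1 / c * C) * tail_powr (- 2) r" by simp
  qed simp
qed

text \<open>Cutting the halfline into the periods \<open>(Q^n, Q^(n+1)]\<close> and moving them to the first one, the
  functional equation makes the integrands the terms of the series of theta, divided by theta.\<close>

theorem integral_inverse_Theta:
  assumes x: "x \<notin> \<real>\<^sub>\<le>\<^sub>0"
  shows "(LBINT r:{0<..}. 1 / TH (of_real r * x) / of_real r) = of_real L"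
proof -
  define h where "h r = 1 / TH (of_real r * x)" for r :: real
  define J where "J n = {exp (of_int n * L)<..exp (of_int (n + 1) * L)}" for n :: int
  \<comment> \<open>The range stops before N because period n ends at the exponent n + 1; these
    periods fill \<open>(exp (- N * L), exp (N * L)]\<close>.\<close>
  define I where "I N = {- int N..<int N}" for N
  have x0: "x \<noteq> 0" using x by auto
  have hi: "set_integrable lborel {0<..} (\<lambda>r. h r / of_real r)"
    using inverse_Theta_integrable[OF x] by (simp add: h_def)
  have Ji: "set_integrable lborel {0<..} (\<lambda>r. (indicator (J n) r * h r) / of_real r)" for n
  proof -
    have "set_integrable lborel ({0<..} \<inter> J n) (\<lambda>r. h r / of_real r)"
      by (rule set_integrable_subset[OF hi]) (auto simp: J_def)
    moreover have "(\<lambda>r. indicator ({0<..} \<inter> J n) r *\<^sub>R (h r / of_real r)) = (\<lambda>r. indicator {0<..} r *\<^sub>R (indicator (J n) r * h r / of_real r))"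
      by (auto simp: fun_eq_iff indicator_def)
    ultimately show ?thesis unfolding set_integrable_def by simp
  qed
  have hsc: "h (exp (of_int n * L) * r) = theta_term (of_real r * x) (- n) / TH (of_real r * x)" if "r > 0" for n r
  proof -
    have "of_real r * x \<noteq> 0" using that x0 by simp
    from Theta_step_powi[OF this, of n] Theta_nonzero[OF ray_notin_nonpos[OF x that]]
    moreover have "1 / b = t / a" if "a = t * b" "a \<noteq> 0" for a b t :: complex
      using that by auto
    ultimately show ?thesis by (simp only: h_def of_real_mult mult.assoc not_False_eq_True)
  qed
  have J0: "(exp (of_int n * L) * r \<in> J n) = (r \<in> J 0)" for n r
    by (simp add: J_def distrib_right exp_add)
  have I0: "set_integrable lborel {0<..} (\<lambda>r. indicator (J 0) r * (theta_term (of_real r * x) (- n) / TH (of_real r * x)) / of_real r)"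
    and Jn: "(LBINT r:{0<..}. (indicator (J n) r * h r) / of_real r)
      = (LBINT r:{0<..}. indicator (J 0) r * (theta_term (of_real r * x) (- n) / TH (of_real r * x)) / of_real r)" for n
  proof -
    let ?g = "\<lambda>r. indicator (J n) r * h r"
    have e: "?g (exp (of_int n * L) * r) / of_real r = indicator (J 0) r * (theta_term (of_real r * x) (- n) / TH (of_real r * x)) / of_real r" if "r \<in> {0<..}" for r
      using that hsc[of r n] J0[of n r] by (simp add: indicator_def)
    show "(LBINT r:{0<..}. (indicator (J n) r * h r) / of_real r)
      = (LBINT r:{0<..}. indicator (J 0) r * (theta_term (of_real r * x) (- n) / TH (of_real r * x)) / of_real r)"
      unfolding haar_scale_integral[of "exp (of_int n * L)" ?g, OF exp_gt_zero, symmetric]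
      by (intro set_lebesgue_integral_cong allI impI e) simp_all
    show "set_integrable lborel {0<..} (\<lambda>r. indicator (J 0) r * (theta_term (of_real r * x) (- n) / TH (of_real r * x)) / of_real r)"
      using haar_scale_integrable[of "exp (of_int n * L)" ?g, OF exp_gt_zero] Ji[of n]
      by (subst (asm) set_integrable_cong[OF refl refl e]) blast+
  qed
  have U: "(\<Sum>n\<in>I N. indicator (J n) r) = (indicator {exp (- real N * L)<..exp (real N * L)} r :: complex)" for N r
  proof (induction N)
    case 0
    then show ?case by (simp add: I_def)
  next
    case (Suc N)
    have "I (Suc N) = insert (- int (Suc N)) (insert (int N) (I N))" by (auto simp: I_def)
    then have "(\<Sum>n\<in>I (Suc N). indicator (J n) r) = indicator (J (- int (Suc N))) r + indicator (J (int N)) r + (\<Sum>n\<in>I N. indicator (J n) r :: complex)"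
      by (simp add: I_def)
    also have "\<dots> = indicator {exp (- real (Suc N) * L)<..exp (real (Suc N) * L)} r"
    proof -
      have "exp (- real (Suc N) * L) \<le> exp (- real N * L)" "exp (- real N * L) \<le> exp (real N * L)" "exp (real N * L) \<le> exp (real (Suc N) * L)"
        using L_pos by (auto simp: algebra_simps)
      moreover have "J (- int (Suc N)) = {exp (- real (Suc N) * L)<..exp (- real N * L)}"
        "J (int N) = {exp (real N * L)<..exp (real (Suc N) * L)}"
        by (simp_all add: J_def add.commute)
      moreover have "indicator {a<..b} r + indicator {c<..d} r + indicator {b<..c} r = (indicator {a<..d} r :: complex)"
        if "a \<le> b" "b \<le> c" "c \<le> d" for a b c d
        using that by (auto simp: indicator_def)
      ultimately show ?thesis unfolding Suc.IH by (simp only:)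
    qed
    finally show ?case .
  qed
  have s1: "(\<Sum>n\<in>I N. LBINT r:{0<..}. (indicator (J n) r * h r) / of_real r)
     = (LBINT r:{0<..}. (indicator {exp (- real N * L)<..exp (real N * L)} r * h r) / of_real r)" for N
    by (subst set_integral_sum'(1)[symmetric]) (rule Ji, simp only: U[symmetric] sum_distrib_right sum_divide_distrib)
  have s2: "(\<Sum>n\<in>I N. LBINT r:{0<..}. (indicator (J n) r * h r) / of_real r)
     = (LBINT r:{0<..}. indicator (J 0) r * ((\<Sum>n\<in>I N. theta_term (of_real r * x) (- n)) / TH (of_real r * x)) / of_real r)" for N
    unfolding Jn by (subst set_integral_sum'(1)[symmetric]) (rule I0, simp only: sum_distrib_left sum_divide_distrib)
  \<comment> \<open>The sums over periods are evaluated twice: here as truncated integrals, which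
    tend to the whole integral, and in \<open>l2\<close> after all periods have been moved to the
    first one, where the numerators tend to theta and cancel the denominator.\<close>
  have l1: "(\<lambda>N. LBINT r:{0<..}. (indicator {exp (- real N * L)<..exp (real N * L)} r * h r) / of_real r)
     \<longlonglongrightarrow> (LBINT r:{0<..}. h r / of_real r)"
    unfolding set_lebesgue_integral_def
  proof (rule integral_dominated_convergence[where w = "\<lambda>r. norm (indicator {0<..} r *\<^sub>R (h r / of_real r))"])
    have hm: "(\<lambda>r. indicator {0<..} r *\<^sub>R (h r / of_real r)) \<in> borel_measurable lborel"
      using hi by (simp add: set_integrable_def borel_measurable_integrable)
    then show "(\<lambda>r. indicator {0<..} r *\<^sub>R (h r / of_real r)) \<in> borel_measurable lborel" .
    show "(\<lambda>r. indicator {0<..} r *\<^sub>R ((indicator {exp (- real N * L)<..exp (real N * L)} r * h r) / of_real r)) \<in> borel_measurable lborel" for N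
    proof -
      have "(\<lambda>r. indicator {exp (- real N * L)<..exp (real N * L)} r *\<^sub>R (indicator {0<..} r *\<^sub>R (h r / of_real r))) \<in> borel_measurable lborel"
        using hm by measurable
      then show ?thesis by (rule measurable_cong[THEN iffD1, rotated]) (simp add: indicator_def)
    qed
    show "integrable lborel (\<lambda>r. norm (indicator {0<..} r *\<^sub>R (h r / of_real r)))"
      using hi unfolding set_integrable_def by (rule integrable_norm)
    show "AE r in lborel. (\<lambda>N. indicator {0<..} r *\<^sub>R ((indicator {exp (- real N * L)<..exp (real N * L)} r * h r) / of_real r))
      \<longlonglongrightarrow> indicator {0<..} r *\<^sub>R (h r / of_real r)"
    proof (intro AE_I2)
      fix r :: real
      show "(\<lambda>N. indicator {0<..} r *\<^sub>R ((indicator {exp (- real N * L)<..exp (real N * L)} r * h r) / of_real r))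
      \<longlonglongrightarrow> indicator {0<..} r *\<^sub>R (h r / of_real r)"
      proof (cases "r > 0")
        case True
        obtain N0 where N0: "real N0 * L > \<bar>ln r\<bar>" using L_pos reals_Archimedean3 by blast
        have "r \<in> {exp (- real N * L)<..exp (real N * L)}" if "N \<ge> N0" for N
        proof -
          have "real N0 * L \<le> real N * L" using that L_pos by (intro mult_right_mono) auto
          then have "- real N * L < ln r" "ln r \<le> real N * L" using N0 by auto
          then have "exp (- real N * L) < exp (ln r)" "exp (ln r) \<le> exp (real N * L)" by (simp_all only: exp_less_cancel_iff exp_le_cancel_iff)
          then show ?thesis using True by simp
        qed
        then have "eventually (\<lambda>N. indicator {0<..} r *\<^sub>R (h r / of_real r) = indicator {0<..} r *\<^sub>R ((indicator {exp (- real N * L)<..exp (real N * L)} r * h r) / of_real r)) sequentially"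
          by (intro eventually_sequentiallyI[of N0]) simp
        then show ?thesis by (rule Lim_transform_eventually[OF tendsto_const])
      qed simp
    qed
    show "AE r in lborel. norm (indicator {0<..} r *\<^sub>R ((indicator {exp (- real N * L)<..exp (real N * L)} r * h r) / of_real r)) \<le> norm (indicator {0<..} r *\<^sub>R (h r / of_real r))" for N
      by (intro AE_I2) (simp add: indicator_def)
  qed
  have l2: "(\<lambda>N. LBINT r:{0<..}. indicator (J 0) r * ((\<Sum>n\<in>I N. theta_term (of_real r * x) (- n)) / TH (of_real r * x)) / of_real r)
     \<longlonglongrightarrow> (LBINT r:{0<..}. indicator (J 0) r * 1 / of_real r)"
    unfolding set_lebesgue_integral_def
  proof -
    \<comment> \<open>For r in one period, \<open>r^n\<close> is at most 1 or at most
      \<open>exp L ^ n\<close>, according to the sign of n. The terms at the two ends of the period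
      therefore dominate all terms in between.\<close>
    define B where "B = (\<Sum>\<^sub>\<infinity>n. norm (theta_term x n) + norm (theta_term (of_real (exp L) * x) n))"
    have sm: "(\<lambda>n. norm (theta_term x n) + norm (theta_term (of_real (exp L) * x) n)) summable_on UNIV"
      using x0 by (intro summable_on_add theta_term_has_sum) auto
    have bd: "norm (\<Sum>n\<in>I N. theta_term (of_real r * x) (- n)) \<le> B" if "r \<in> J 0" for r N
    proof -
      have r: "1 \<le> r" "r \<le> exp L" using that by (auto simp: J_def)
      have "norm (theta_term (of_real r * x) n) \<le> norm (theta_term x n) + norm (theta_term (of_real (exp L) * x) n)" for n
      proof -
        have "r powi n \<le> 1 + exp L powi n"
        proof (cases "n \<ge> 0")
          case True
          then have "r powi n \<le> exp L powi n" using r by (intro power_int_mono) auto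
          then show ?thesis by simp
        next
          case False
          then have "1 \<le> r powi (- n)" using r power_int_mono[of 1 r "- n"] by simp
          then have "inverse (r powi (- n)) \<le> inverse 1" by (intro le_imp_inverse_le) auto
          then have "r powi n \<le> 1" by (simp add: power_int_minus)
          then show ?thesis using zero_less_power_int[of "exp L" n] by (smt (verit) exp_gt_zero)
        qed
        then have "theta_coeff (of_int n) * norm x powi n * (r powi n) \<le> theta_coeff (of_int n) * norm x powi n * (1 + exp L powi n)"
          by (intro mult_left_mono mult_nonneg_nonneg) (auto intro: less_imp_le)
        then show ?thesis using r by (simp add: theta_term_def norm_mult norm_power_int power_int_mult_distrib abs_of_pos algebra_simps)
      qed
      then have "norm (\<Sum>n\<in>I N. theta_term (of_real r * x) (- n)) \<le> (\<Sum>n\<in>I N. norm (theta_term x (- n)) + norm (theta_term (of_real (exp L) * x) (- n)))"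
        by (intro norm_sum[THEN order.trans] sum_mono)
      also have "\<dots> = (\<Sum>n\<in>uminus ` I N. norm (theta_term x n) + norm (theta_term (of_real (exp L) * x) n))"
        by (subst sum.reindex) (auto simp: inj_on_def)
      also have "\<dots> \<le> B" unfolding B_def
        by (intro finite_sum_le_infsum sm) (auto simp: I_def)
      finally show ?thesis .
    qed
    show "(\<lambda>N. \<integral>r. indicator {0<..} r *\<^sub>R (indicator (J 0) r * ((\<Sum>n\<in>I N. theta_term (of_real r * x) (- n)) / TH (of_real r * x)) / of_real r) \<partial>lborel)
     \<longlonglongrightarrow> (\<integral>r. indicator {0<..} r *\<^sub>R (indicator (J 0) r * 1 / of_real r) \<partial>lborel)"
    proof (rule integral_dominated_convergence[where w = "\<lambda>r. B * norm (indicator {0<..} r *\<^sub>R (h r / of_real r))"])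
      show "(\<lambda>r. indicator {0<..} r *\<^sub>R (indicator (J 0) r * 1 / complex_of_real r)) \<in> borel_measurable lborel"
        unfolding J_def by measurable
      show "(\<lambda>r. indicator {0<..} r *\<^sub>R (indicator (J 0) r * ((\<Sum>n\<in>I N. theta_term (of_real r * x) (- n)) / TH (of_real r * x)) / of_real r)) \<in> borel_measurable lborel" for N
      proof -
        have "(\<lambda>r. \<Sum>n\<in>I N. indicator {0<..} r *\<^sub>R (indicator (J 0) r * (theta_term (of_real r * x) (- n) / TH (of_real r * x)) / of_real r)) \<in> borel_measurable lborel"
          using I0 by (intro borel_measurable_sum) (auto simp: set_integrable_def dest: borel_measurable_integrable)
        then show ?thesis by (simp add: sum_distrib_left sum_divide_distrib scaleR_sum_right)
      qed
      show "integrable lborel (\<lambda>r. B * norm (indicator {0<..} r *\<^sub>R (h r / of_real r)))"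
        using hi unfolding set_integrable_def by (intro integrable_mult_right integrable_norm)
      show "AE r in lborel. norm (indicator {0<..} r *\<^sub>R (indicator (J 0) r * ((\<Sum>n\<in>I N. theta_term (of_real r * x) (- n)) / TH (of_real r * x)) / of_real r))
        \<le> B * norm (indicator {0<..} r *\<^sub>R (h r / of_real r))" for N
      proof (intro AE_I2)
        fix r
        have "B \<ge> 0" unfolding B_def by (rule infsum_nonneg) auto
        show "norm (indicator {0<..} r *\<^sub>R (indicator (J 0) r * ((\<Sum>n\<in>I N. theta_term (of_real r * x) (- n)) / TH (of_real r * x)) / of_real r))
        \<le> B * norm (indicator {0<..} r *\<^sub>R (h r / of_real r))"
          using bd[of r N] \<open>B \<ge> 0\<close> by (cases "r \<in> J 0"; cases "r > 0") (auto simp: h_def norm_mult norm_divide divide_right_mono)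
      qed
      show "AE r in lborel. (\<lambda>N. indicator {0<..} r *\<^sub>R (indicator (J 0) r * ((\<Sum>n\<in>I N. theta_term (of_real r * x) (- n)) / TH (of_real r * x)) / of_real r))
        \<longlonglongrightarrow> indicator {0<..} r *\<^sub>R (indicator (J 0) r * 1 / of_real r)"
      proof (intro AE_I2)
        fix r :: real
        show "(\<lambda>N. indicator {0<..} r *\<^sub>R (indicator (J 0) r * ((\<Sum>n\<in>I N. theta_term (of_real r * x) (- n)) / TH (of_real r * x)) / of_real r))
        \<longlonglongrightarrow> indicator {0<..} r *\<^sub>R (indicator (J 0) r * 1 / of_real r)"
        proof (cases "r > 0")
          case True
          have rx: "of_real r * x \<noteq> 0" using True x0 by simp
          define c :: "nat \<Rightarrow> int \<Rightarrow> real" where "c N n = (if - n \<in> I N then 1 else 0)" for N n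
          have "(\<lambda>N. \<Sum>\<^sub>\<infinity>n. of_real (c N n) * theta_term (of_real r * x) n) \<longlonglongrightarrow> of_real 1 * (\<Sum>\<^sub>\<infinity>n. theta_term (of_real r * x) n)"
          proof (rule infsum_dominated_LIMSEQ[OF theta_term_has_sum(2)[OF rx], where B = 1])
            fix n
            have "eventually (\<lambda>N. 1 = c N n) sequentially"
              by (rule eventually_sequentiallyI[of "nat \<bar>n\<bar> + 1"]) (auto simp: c_def I_def)
            then show "(\<lambda>N. c N n) \<longlonglongrightarrow> 1" by (rule Lim_transform_eventually[OF tendsto_const])
          qed (auto simp: c_def)
          moreover have "(\<Sum>\<^sub>\<infinity>n. of_real (c N n) * theta_term (of_real r * x) n) = (\<Sum>n\<in>I N. theta_term (of_real r * x) (- n))" for N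
          proof -
            have minus_in: "n \<in> uminus ` I N \<longleftrightarrow> - n \<in> I N" for n
              by (auto intro: image_eqI[of _ _ "- n"])
            have "(\<Sum>\<^sub>\<infinity>n. of_real (c N n) * theta_term (of_real r * x) n) = (\<Sum>\<^sub>\<infinity>n\<in>uminus ` I N. theta_term (of_real r * x) n)"
              by (rule infsum_cong_neutral) (use minus_in in \<open>auto simp: c_def\<close>)
            also have "\<dots> = (\<Sum>n\<in>uminus ` I N. theta_term (of_real r * x) n)" by (simp add: I_def)
            also have "\<dots> = (\<Sum>n\<in>I N. theta_term (of_real r * x) (- n))"
              by (subst sum.reindex) (auto simp: inj_on_def)
            finally show ?thesis .
          qed
          ultimately have "(\<lambda>N. \<Sum>n\<in>I N. theta_term (of_real r * x) (- n)) \<longlonglongrightarrow> TH (of_real r * x)"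
            by (simp add: Theta_eq_infsum)
          then have "(\<lambda>N. indicator {0<..} r *\<^sub>R (indicator (J 0) r * ((\<Sum>n\<in>I N. theta_term (of_real r * x) (- n)) / TH (of_real r * x)) / of_real r))
        \<longlonglongrightarrow> indicator {0<..} r *\<^sub>R (indicator (J 0) r * (TH (of_real r * x) / TH (of_real r * x)) / of_real r)"
            using True Theta_nonzero[OF ray_notin_nonpos[OF x True]] by (intro tendsto_intros) auto
          then show ?thesis using Theta_nonzero[OF ray_notin_nonpos[OF x True]] by simp
        qed simp
      qed
    qed
  qed
  have "(LBINT r:{0<..}. h r / of_real r) = (LBINT r:{0<..}. indicator (J 0) r * 1 / of_real r)"
    using l1 l2 unfolding s1[symmetric] s2[symmetric] by (rule LIMSEQ_unique)
  \<comment> \<open>What is left is 1 / r on the period from 1 to \<open>exp L\<close>, with the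
    logarithm as primitive.\<close>
  also have "\<dots> = (LBINT r:{1<..exp L}. complex_of_real (1 / r))"
    unfolding set_lebesgue_integral_def J_def
    by (intro Bochner_Integration.integral_cong) (auto simp: indicator_def)
  also have "\<dots> = (LBINT r=1..exp L. complex_of_real (1 / r))"
    using L_pos interval_integral_Ioc[of 1 "exp L" "\<lambda>r. complex_of_real (1 / r)"] by (simp add: one_ereal_def)
  also have "\<dots> = of_real (ln (exp L)) - of_real (ln 1)"
    unfolding one_ereal_def using L_pos
    by (intro interval_integral_FTC_finite) (auto intro!: continuous_intros has_vector_derivative_of_real derivative_eq_intros simp: divide_inverse has_real_derivative_iff_has_vector_derivative[symmetric] min_def)
  finally show ?thesis by (simp add: h_def)
qed

end

section \<open>The inverse Fourier transform\<close>

text \<open>Cauchy's inequality on discs of radius r / 2 bounds the derivatives of the integrands by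
  \<open>2 * g m / r\<close>. The difference quotients near z have the same bound, so dominated
  convergence gives the derivative of the integral.\<close>

lemma holomorphic_integral:
  fixes f :: "'a \<Rightarrow> complex \<Rightarrow> complex"
  assumes "open A" and meas: "\<And>z. z \<in> A \<Longrightarrow> (\<lambda>m. f m z) \<in> borel_measurable M"
    and holo: "\<And>m. m \<in> space M \<Longrightarrow> f m holomorphic_on A"
    and bound: "\<And>m z. m \<in> space M \<Longrightarrow> z \<in> A \<Longrightarrow> norm (f m z) \<le> g m" and g: "integrable M g"
    and z: "z \<in> A"
  shows "((\<lambda>z. \<integral>m. f m z \<partial>M) has_field_derivative (\<integral>m. deriv (f m) z \<partial>M)) (at z)"
proof -
  obtain r where r: "r > 0" "cball z r \<subseteq> A" using assms(1) z open_contains_cball by blast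
  have int: "integrable M (\<lambda>m. f m w)" if "w \<in> A" for w
    by (rule Bochner_Integration.integrable_bound[OF g meas[OF that]])
      (use bound[OF _ that] in \<open>auto intro!: AE_I2 order.trans[OF _ abs_ge_self]\<close>)
  have quot: "norm ((f m w - f m z) / (w - z)) \<le> 2 * g m / r" if m: "m \<in> space M" and w: "w \<in> ball z (r/2)" "w \<noteq> z" for m w
  proof -
    have d: "norm (deriv (f m) x) \<le> 2 * g m / r" if x: "x \<in> ball z (r/2)" for x
    proof -
      have sub: "cball x (r/2) \<subseteq> A"
      proof
        fix y assume "y \<in> cball x (r/2)"
        then have "dist z y \<le> r" using x dist_triangle[of z y x] by (auto simp: dist_commute)
        then show "y \<in> A" using r by auto
      qed
      have "norm ((deriv ^^ 1) (f m) x) \<le> fact 1 * g m / (r/2) ^ 1"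
      proof (rule Cauchy_inequality)
        show "f m holomorphic_on ball x (r/2)" using holo[OF m] sub by (rule holomorphic_on_subset[OF _ subset_trans[OF ball_subset_cball]])
        show "continuous_on (cball x (r/2)) (f m)"
          by (rule holomorphic_on_imp_continuous_on[OF holomorphic_on_subset[OF holo[OF m] sub]])
        show "norm (f m y) \<le> g m" if "norm (x - y) = r / 2" for y
          using that sub by (intro bound[OF m]) (auto simp: dist_norm)
      qed (use r in simp)
      then show ?thesis by (simp add: mult.commute)
    qed
    have "norm (f m w - f m z) \<le> 2 * g m / r * norm (w - z)"
    proof (rule field_differentiable_bound[of "ball z (r/2)"])
      show "(f m has_field_derivative deriv (f m) x) (at x within ball z (r/2))" if "x \<in> ball z (r/2)" for x
      proof -
        have "x \<in> A" using that r by (auto simp: subset_iff)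
        then have "(f m has_field_derivative deriv (f m) x) (at x)"
          by (rule holomorphic_derivI[OF holo[OF m] assms(1)])
        then show ?thesis by (rule has_field_derivative_at_within)
      qed
    qed (use d w r in auto)
    then show ?thesis using w by (simp add: norm_divide divide_le_eq)
  qed
  have "((\<lambda>w. ((\<integral>m. f m w \<partial>M) - (\<integral>m. f m z \<partial>M)) / (w - z)) \<longlongrightarrow> (\<integral>m. deriv (f m) z \<partial>M)) (at z within ball z (r/2))"
    unfolding tendsto_at_iff_sequentially
  proof (intro allI impI)
    fix X assume X: "\<forall>i. X i \<in> ball z (r/2) - {z}" "X \<longlonglongrightarrow> z"
    then have XA: "X i \<in> A" for i
  proof -
    have "dist z (X i) < r / 2" using X(1) by auto
    then show ?thesis using r by (intro subsetD[OF r(2)]) simp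
  qed
    have lim: "(\<lambda>i. (f m (X i) - f m z) / (X i - z)) \<longlonglongrightarrow> deriv (f m) z" if "m \<in> space M" for m
    proof -
      have "((\<lambda>w. (f m w - f m z) / (w - z)) \<longlongrightarrow> deriv (f m) z) (at z)"
        using holomorphic_derivI[OF holo[OF that] assms(1) z] by (simp add: has_field_derivative_iff)
      then show ?thesis
        using X unfolding tendsto_at_iff_sequentially by (auto simp: o_def)
    qed
    have "(\<lambda>i. \<integral>m. (f m (X i) - f m z) / (X i - z) \<partial>M) \<longlonglongrightarrow> (\<integral>m. deriv (f m) z \<partial>M)"
    proof (rule integral_dominated_convergence[where w = "\<lambda>m. 2 * g m / r"])
      show *: "(\<lambda>m. (f m (X i) - f m z) / (X i - z)) \<in> borel_measurable M" for i
        using meas[OF XA] meas[OF z] by measurable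
      show "(\<lambda>m. deriv (f m) z) \<in> borel_measurable M"
        using lim by (intro borel_measurable_LIMSEQ_metric[OF *])
    qed (use g lim quot X in auto)
    then show "((\<lambda>w. ((\<integral>m. f m w \<partial>M) - (\<integral>m. f m z \<partial>M)) / (w - z)) \<circ> X) \<longlonglongrightarrow> (\<integral>m. deriv (f m) z \<partial>M)"
      using int[OF XA] int[OF z] by (simp add: o_def Bochner_Integration.integral_diff)
  qed
  moreover have "at z within ball z (r/2) = at z" using r by (intro at_within_open) auto
  ultimately show ?thesis by (simp add: has_field_derivative_iff)
qed

lemma holomorphic_integral_on:
  fixes f :: "'a \<Rightarrow> complex \<Rightarrow> complex"
  assumes "open A" "\<And>z. z \<in> A \<Longrightarrow> (\<lambda>m. f m z) \<in> borel_measurable M"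
    "\<And>m. m \<in> space M \<Longrightarrow> f m holomorphic_on A"
    "\<And>m z. m \<in> space M \<Longrightarrow> z \<in> A \<Longrightarrow> norm (f m z) \<le> g m" "integrable M g"
  shows "(\<lambda>z. \<integral>m. f m z \<partial>M) holomorphic_on A"
  using holomorphic_integral[OF assms] assms(1) by (auto simp: holomorphic_on_open)

section \<open>Fourier integrals of exponentially decaying functions\<close>

lemma integrable_exp_abs: "b > 0 \<Longrightarrow> integrable lborel (\<lambda>m::real. exp (- b * \<bar>m\<bar>))"
proof -
  assume b: "b > 0"
  have "set_integrable lebesgue {0::real..} (\<lambda>m. exp (- b * m))"
    using integrable_on_exp_minus_to_infinity[OF b, of 0] by (intro nonnegative_absolutely_integrable_1) auto
  then have 1: "set_integrable lborel {0::real..} (\<lambda>m. exp (- b * m))"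
    unfolding set_integrable_def by (subst (asm) integrable_completion) auto
  have 2: "set_integrable lborel {0::real..} (\<lambda>m. exp (- b * \<bar>m\<bar>))"
    using 1 by (subst set_integrable_cong[of lborel lborel "{0..}" "{0..}" _ "\<lambda>m. exp (- b * m)"]) auto
  have "integrable lborel (\<lambda>x. indicator {0..} (0 + - 1 * x) *\<^sub>R exp (- b * \<bar>0 + - 1 * x\<bar>))"
    using 2 unfolding set_integrable_def by (intro lborel_integrable_real_affine) auto
  then have 3: "set_integrable lborel {..0::real} (\<lambda>m. exp (- b * \<bar>m\<bar>))"
    unfolding set_integrable_def by (rule Bochner_Integration.integrable_cong[THEN iffD1, rotated 2]) (auto simp: indicator_def)
  have "{0..} \<union> {..0} = (UNIV :: real set)" by auto
  then show ?thesis using set_integrable_Un[OF 2 3] by (simp add: set_integrable_def)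
qed

text \<open>Only decay with every rate below b is required, so that multiplication by polynomials
  preserves the class.\<close>

definition decay :: "real \<Rightarrow> (real \<Rightarrow> complex) \<Rightarrow> bool" where
  "decay b h \<longleftrightarrow> h \<in> borel_measurable borel \<and> (\<forall>b'<b. \<exists>K. \<forall>m. norm (h m) \<le> K * exp (- b' * \<bar>m\<bar>))"

lemma decayI: "h \<in> borel_measurable borel \<Longrightarrow> (\<And>m. norm (h m) \<le> K * exp (- b * \<bar>m\<bar>)) \<Longrightarrow> decay b h"
proof -
  assume h: "h \<in> borel_measurable borel" "\<And>m. norm (h m) \<le> K * exp (- b * \<bar>m\<bar>)"
  have "norm (h m) \<le> K * exp (- b' * \<bar>m\<bar>)" if "b' < b" for b' m
  proof -
    have "K \<ge> 0" using h(2)[of 0] by (auto intro: order.trans[OF norm_ge_zero])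
    moreover have "- b * \<bar>m\<bar> \<le> - b' * \<bar>m\<bar>" using that by (simp add: mult_right_mono)
    ultimately have "K * exp (- b * \<bar>m\<bar>) \<le> K * exp (- b' * \<bar>m\<bar>)" by (intro mult_left_mono) (auto simp del: minus_mult_left[symmetric])
    then show ?thesis using h(2)[of m] by linarith
  qed
  then show ?thesis using h(1) unfolding decay_def by blast
qed

lemma decay_measurable: "decay b h \<Longrightarrow> h \<in> borel_measurable borel" by (simp add: decay_def)

lemma decayE:
  assumes "decay b h" "b' < b"
  obtains K where "K \<ge> 0" "\<And>m. norm (h m) \<le> K * exp (- b' * \<bar>m\<bar>)"
proof -
  obtain K where K: "\<And>m. norm (h m) \<le> K * exp (- b' * \<bar>m\<bar>)" using assms unfolding decay_def by blast
  moreover have "K \<ge> 0" using K[of 0] by (auto intro: order.trans[OF norm_ge_zero])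
  ultimately show ?thesis using that by blast
qed

text \<open>Induction on the coefficients: half of the rate goes to the polynomial of smaller
  degree, the other half absorbs the new factor m.\<close>

lemma poly_exp_bound:
  fixes R :: "complex poly"
  assumes "c > 0"
  shows "\<exists>K\<ge>0. \<forall>m. norm (poly R (\<i> * of_real m)) \<le> K * exp (c * \<bar>m\<bar>)"
  using assms
proof (induction R arbitrary: c)
  case 0
  then show ?case by (intro exI[of _ 0]) auto
next
  case (pCons a R)
  obtain K where K: "K \<ge> 0" "\<And>m. norm (poly R (\<i> * of_real m)) \<le> K * exp (c / 2 * \<bar>m\<bar>)"
    using pCons.IH[of "c / 2"] pCons.prems by auto
  have "norm (poly (pCons a R) (\<i> * of_real m)) \<le> (norm a + 2 / c * K) * exp (c * \<bar>m\<bar>)" for m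
  proof -
    have "c / 2 * \<bar>m\<bar> \<le> exp (c / 2 * \<bar>m\<bar>)" using exp_ge_add_one_self[of "c / 2 * \<bar>m\<bar>"] by linarith
    then have m: "\<bar>m\<bar> \<le> 2 / c * exp (c / 2 * \<bar>m\<bar>)" using pCons.prems by (simp add: field_simps)
    have "norm (poly (pCons a R) (\<i> * of_real m)) \<le> norm a + \<bar>m\<bar> * norm (poly R (\<i> * of_real m))"
      using norm_triangle_ineq[of a "\<i> * of_real m * poly R (\<i> * of_real m)"] by (simp add: norm_mult)
    also have "\<dots> \<le> norm a * exp (c * \<bar>m\<bar>) + (2 / c * exp (c / 2 * \<bar>m\<bar>)) * (K * exp (c / 2 * \<bar>m\<bar>))"
      using m K pCons.prems by (intro add_mono mult_mono) (auto simp: mult_le_cancel_left1 mult_nonneg_nonneg)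
    also have "(2 / c * exp (c / 2 * \<bar>m\<bar>)) * (K * exp (c / 2 * \<bar>m\<bar>)) = 2 / c * K * exp (c * \<bar>m\<bar>)"
      by (simp add: mult_exp_exp flip: exp_add)
    finally show ?thesis by (simp add: algebra_simps)
  qed
  then show ?case using K pCons.prems by (intro exI[of _ "norm a + 2 / c * K"]) auto
qed

lemma decay_poly:
  assumes "decay b h"
  shows "decay b (\<lambda>m. poly R (\<i> * of_real m) * h m)"
  unfolding decay_def
proof (intro conjI allI impI)
  have "(\<lambda>m. poly R (\<i> * complex_of_real m)) \<in> borel_measurable borel"
    by (intro borel_measurable_continuous_onI continuous_intros)
  then show "(\<lambda>m. poly R (\<i> * of_real m) * h m) \<in> borel_measurable borel"
    using decay_measurable[OF assms] by measurable
  fix b' assume "b' < b"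
  \<comment> \<open>The gap between b' and b is shared: the polynomial costs c, and h still decays
    at the rate b' + c below b.\<close>
  define c where "c = (b - b') / 2"
  have c: "c > 0" "b' + c < b" using \<open>b' < b\<close> by (simp_all add: c_def field_simps)
  obtain K1 where K1: "K1 \<ge> 0" "\<And>m. norm (poly R (\<i> * of_real m)) \<le> K1 * exp (c * \<bar>m\<bar>)"
    using poly_exp_bound[OF c(1)] by blast
  obtain K2 where K2: "K2 \<ge> 0" "\<And>m. norm (h m) \<le> K2 * exp (- (b' + c) * \<bar>m\<bar>)"
    using decayE[OF assms c(2)] by blast
  have "norm (poly R (\<i> * of_real m) * h m) \<le> (K1 * K2) * exp (- b' * \<bar>m\<bar>)" for m
  proof -
    have "norm (poly R (\<i> * of_real m) * h m) \<le> (K1 * exp (c * \<bar>m\<bar>)) * (K2 * exp (- (b' + c) * \<bar>m\<bar>))"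
      unfolding norm_mult using K1 K2 by (intro mult_mono) auto
    also have "\<dots> = (K1 * K2) * exp (c * \<bar>m\<bar> + - (b' + c) * \<bar>m\<bar>)" by (simp only: exp_add mult_ac)
    also have "c * \<bar>m\<bar> + - (b' + c) * \<bar>m\<bar> = - b' * \<bar>m\<bar>" by (simp add: algebra_simps)
    finally show ?thesis .
  qed
  then show "\<exists>K. \<forall>m. norm (poly R (\<i> * of_real m) * h m) \<le> K * exp (- b' * \<bar>m\<bar>)" by blast
qed

lemma decay_add:
  assumes "decay b f" "decay b g"
  shows "decay b (\<lambda>m. f m + g m)"
  unfolding decay_def
proof (intro conjI allI impI)
  show "(\<lambda>m. f m + g m) \<in> borel_measurable borel" using assms decay_measurable by auto
  fix b' assume "b' < b"
  obtain K1 where "\<And>m. norm (f m) \<le> K1 * exp (- b' * \<bar>m\<bar>)" using decayE[OF assms(1) \<open>b' < b\<close>] by blast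
  moreover obtain K2 where "\<And>m. norm (g m) \<le> K2 * exp (- b' * \<bar>m\<bar>)" using decayE[OF assms(2) \<open>b' < b\<close>] by blast
  ultimately have "norm (f m + g m) \<le> (K1 + K2) * exp (- b' * \<bar>m\<bar>)" for m
    using norm_triangle_ineq[of "f m" "g m"] by (smt (verit) distrib_right)
  then show "\<exists>K. \<forall>m. norm (f m + g m) \<le> K * exp (- b' * \<bar>m\<bar>)" by blast
qed

lemma decay_cmult: "decay b f \<Longrightarrow> decay b (\<lambda>m. c * f m)"
  using decay_poly[of b f "[:c:]"] by simp

lemma decay_0: "decay b (\<lambda>m. 0)" by (rule decayI[where K = 0]) auto

lemma decay_sum: "(\<And>i. i \<in> I \<Longrightarrow> decay b (f i)) \<Longrightarrow> decay b (\<lambda>m. \<Sum>i\<in>I. f i m)"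
  by (induction I rule: infinite_finite_induct) (auto intro: decay_0 decay_add)

lemma decay_integrable: "decay b h \<Longrightarrow> b > 0 \<Longrightarrow> integrable lborel h"
proof -
  assume h: "decay b h" "b > 0"
  obtain K where K: "K \<ge> 0" "\<And>m. norm (h m) \<le> K * exp (- (b / 2) * \<bar>m\<bar>)"
    using decayE[OF h(1), of "b / 2"] h by auto
  show ?thesis
    by (rule Bochner_Integration.integrable_bound[of _ "\<lambda>m. K * exp (- (b / 2) * \<bar>m\<bar>)"])
      (use K h integrable_exp_abs[of "b / 2"] decay_measurable[OF h(1)] in \<open>auto simp: abs_mult\<close>)
qed

lemma norm_exp_le: "\<bar>Im z\<bar> \<le> a \<Longrightarrow> norm (exp (\<i> * of_real m * z)) \<le> exp (a * \<bar>m\<bar>)"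
proof -
  assume "\<bar>Im z\<bar> \<le> a"
  then have "\<bar>Im z\<bar> * \<bar>m\<bar> \<le> a * \<bar>m\<bar>" by (intro mult_right_mono) auto
  then have "- (m * Im z) \<le> a * \<bar>m\<bar>" by (metis abs_le_D2 abs_mult mult.commute)
  then show ?thesis by (simp add: norm_exp_eq_Re)
qed

text \<open>One majorant serves a whole closed strip, so that derivatives in z may be taken under
  the integral sign.\<close>

lemma decay_exp_bound:
  assumes "decay b h" "a < b"
  obtains g where "integrable lborel g" "\<And>m z. \<bar>Im z\<bar> \<le> a \<Longrightarrow> norm (h m * exp (\<i> * of_real m * z)) \<le> g m"
proof -
  define c where "c = (b - a) / 2"
  have c: "c > 0" "a + c < b" using assms(2) by (simp_all add: c_def field_simps)
  obtain K where K: "K \<ge> 0" "\<And>m. norm (h m) \<le> K * exp (- (a + c) * \<bar>m\<bar>)"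
    using decayE[OF assms(1) c(2)] by blast
  show ?thesis
  proof
    show "integrable lborel (\<lambda>m. K * exp (- c * \<bar>m\<bar>))" using integrable_exp_abs[OF c(1)] by auto
    fix m z assume z: "\<bar>Im z\<bar> \<le> a"
    have "norm (h m * exp (\<i> * of_real m * z)) \<le> (K * exp (- (a + c) * \<bar>m\<bar>)) * exp (a * \<bar>m\<bar>)"
      unfolding norm_mult using K norm_exp_le[OF z, of m] by (intro mult_mono) auto
    also have "\<dots> = K * exp (- (a + c) * \<bar>m\<bar> + a * \<bar>m\<bar>)" by (simp only: exp_add mult_ac)
    also have "- (a + c) * \<bar>m\<bar> + a * \<bar>m\<bar> = - c * \<bar>m\<bar>" by (simp add: algebra_simps)
    finally show "norm (h m * exp (\<i> * of_real m * z)) \<le> K * exp (- c * \<bar>m\<bar>)" .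
  qed
qed

lemma decay_exp_measurable: "decay b h \<Longrightarrow> (\<lambda>m. h m * exp (\<i> * of_real m * z)) \<in> borel_measurable borel"
  using decay_measurable[of b h] by measurable

lemma decay_exp_integrable:
  assumes "decay b h" "z \<in> strip b"
  shows "integrable lborel (\<lambda>m. h m * exp (\<i> * of_real m * z))"
proof -
  have "\<bar>Im z\<bar> < b" using assms(2) by (simp add: strip_def)
  then obtain g where g: "integrable lborel g"
    "\<And>m z'. \<bar>Im z'\<bar> \<le> \<bar>Im z\<bar> \<Longrightarrow> norm (h m * exp (\<i> * of_real m * z')) \<le> g m"
    using decay_exp_bound[OF assms(1)] by blast
  show ?thesis
    by (rule Bochner_Integration.integrable_bound[OF g(1)])
      (use g(2) decay_exp_measurable[OF assms(1)] in \<open>auto intro!: AE_I2 order.trans[OF _ abs_ge_self]\<close>)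
qed

lemma open_strip: "open (strip b)"
proof -
  have "strip b = Im -` {- b<..<b}" by (auto simp: strip_def)
  then show ?thesis by (auto intro!: open_vimage continuous_intros)
qed

lemma inv_fourier_has_derivative:
  assumes "decay b h" "z \<in> strip b"
  shows "(inv_fourier h has_field_derivative inv_fourier (\<lambda>m. \<i> * of_real m * h m) z) (at z)"
proof -
  obtain a where a: "\<bar>Im z\<bar> < a" "a < b" using assms(2) dense by (auto simp: strip_def)
  obtain g where g: "integrable lborel g" "\<And>m z. \<bar>Im z\<bar> \<le> a \<Longrightarrow> norm (h m * exp (\<i> * of_real m * z)) \<le> g m"
    using decay_exp_bound[OF assms(1) a(2)] by blast
  have "((\<lambda>z. LBINT m. h m * exp (\<i> * of_real m * z)) has_field_derivative (LBINT m. deriv (\<lambda>z. h m * exp (\<i> * of_real m * z)) z)) (at z)"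
    by (rule holomorphic_integral[OF open_strip[of a], where g = g])
      (use a g decay_exp_measurable[OF assms(1)] in \<open>auto simp: strip_def intro!: holomorphic_intros\<close>)
  moreover have "deriv (\<lambda>z. h m * exp (\<i> * of_real m * z)) z = (\<i> * of_real m * h m) * exp (\<i> * of_real m * z)" for m
    by (rule DERIV_imp_deriv) (auto intro!: derivative_eq_intros simp: algebra_simps)
  ultimately show ?thesis
    unfolding inv_fourier_def by (auto intro!: derivative_eq_intros)
qed

lemma inv_fourier_holomorphic: "decay b h \<Longrightarrow> inv_fourier h holomorphic_on strip b"
  using inv_fourier_has_derivative open_strip by (auto simp: holomorphic_on_open)

lemma inv_fourier_higher_deriv:
  assumes "decay b h" "z \<in> strip b"
  shows "(deriv ^^ j) (inv_fourier h) z = inv_fourier (\<lambda>m. (\<i> * of_real m) ^ j * h m) z"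
  using assms
proof (induction j arbitrary: z)
  case (Suc j)
  have d: "decay b (\<lambda>m. (\<i> * of_real m) ^ j * h m)"
    using decay_poly[OF Suc.prems(1), of "monom 1 j"] by (simp add: poly_monom)
  have "(deriv ^^ Suc j) (inv_fourier h) z = deriv ((deriv ^^ j) (inv_fourier h)) z" by simp
  also have "\<dots> = deriv (inv_fourier (\<lambda>m. (\<i> * of_real m) ^ j * h m)) z"
    using Suc open_strip by (intro deriv_cong_ev eventually_nhds_in_open[THEN eventually_mono]) auto
  also have "\<dots> = inv_fourier (\<lambda>m. \<i> * of_real m * ((\<i> * of_real m) ^ j * h m)) z"
    by (rule DERIV_imp_deriv[OF inv_fourier_has_derivative[OF d Suc.prems(2)]])
  finally show ?case by (simp add: mult.assoc)
qed simp

lemma inv_fourier_add: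
  assumes "decay b f" "decay b g" "z \<in> strip b"
  shows "inv_fourier (\<lambda>m. f m + g m) z = inv_fourier f z + inv_fourier g z"
  using decay_exp_integrable[OF assms(1,3)] decay_exp_integrable[OF assms(2,3)]
  by (simp add: inv_fourier_def distrib_right distrib_left)

lemma inv_fourier_cmult: "inv_fourier (\<lambda>m. c * f m) z = c * inv_fourier f z"
  by (simp add: inv_fourier_def mult.assoc mult.left_commute)

lemma inv_fourier_0: "inv_fourier (\<lambda>m. 0) z = 0" by (simp add: inv_fourier_def)

lemma inv_fourier_sum:
  assumes "\<And>i. i \<in> I \<Longrightarrow> decay b (f i)" "z \<in> strip b"
  shows "inv_fourier (\<lambda>m. \<Sum>i\<in>I. f i m) z = (\<Sum>i\<in>I. inv_fourier (f i) z)"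
  using assms
proof (induction I rule: infinite_finite_induct)
  case (insert i I)
  then have "inv_fourier (\<lambda>m. f i m + (\<Sum>i\<in>I. f i m)) z = inv_fourier (f i) z + inv_fourier (\<lambda>m. \<Sum>i\<in>I. f i m) z"
    by (intro inv_fourier_add[where b = b] decay_sum) auto
  then show ?case using insert by simp
qed (auto simp: inv_fourier_0)

lemma dz_inv_fourier:
  assumes "decay b h" "z \<in> strip b"
  shows "dz R (inv_fourier h) z = inv_fourier (\<lambda>m. poly R (\<i> * of_real m) * h m) z"
proof -
  have d: "decay b (\<lambda>m. coeff R j * ((\<i> * of_real m) ^ j * h m))" for j
    using decay_poly[OF assms(1), of "monom (coeff R j) j"] by (simp add: poly_monom mult.assoc)
  have "dz R (inv_fourier h) z = (\<Sum>j\<le>degree R. inv_fourier (\<lambda>m. coeff R j * ((\<i> * of_real m) ^ j * h m)) z)"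
    by (simp add: dz_def inv_fourier_higher_deriv[OF assms] inv_fourier_cmult)
  also have "\<dots> = inv_fourier (\<lambda>m. \<Sum>j\<le>degree R. coeff R j * ((\<i> * of_real m) ^ j * h m)) z"
    by (rule inv_fourier_sum[symmetric, OF d assms(2)])
  finally show ?thesis by (simp add: poly_altdef sum_distrib_right mult.assoc)
qed

text \<open>By translation invariance the integral of \<open>|\<phi> (m - x)|\<close> over m does
  not depend on x, so the iterated integral of the norms is a constant times that of
  \<open>|\<gamma>|\<close>.\<close>

lemma integrable_shift_product:
  fixes \<phi> \<gamma> :: "real \<Rightarrow> complex"
  assumes \<phi>: "integrable lborel \<phi>" and \<gamma>: "integrable lborel \<gamma>"
  shows "integrable (lborel \<Otimes>\<^sub>M lborel) (\<lambda>(x, m). \<phi> (m - x) * \<gamma> x)"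
proof (rule lborel_pair.Fubini_integrable)
  have [measurable]: "\<phi> \<in> borel_measurable borel" "\<gamma> \<in> borel_measurable borel"
    using assms borel_measurable_integrable by auto
  show "(\<lambda>(x, m). \<phi> (m - x) * \<gamma> x) \<in> borel_measurable (lborel \<Otimes>\<^sub>M lborel)" by measurable
  have s: "integrable lborel (\<lambda>m. \<phi> (m - x))" for x
    using lborel_integrable_real_affine[OF \<phi>, of 1 "- x"] by (simp add: algebra_simps)
  have n: "(LBINT m. norm (\<phi> (m - x))) = (LBINT m. norm (\<phi> m))" for x
    using lborel_integral_real_affine[of 1 "\<lambda>m. norm (\<phi> m)" "- x"] by (simp add: algebra_simps)
  have "(\<lambda>x. LBINT m. norm (case (x, m) of (x, m) \<Rightarrow> \<phi> (m - x) * \<gamma> x)) = (\<lambda>x. (LBINT m. norm (\<phi> m)) * norm (\<gamma> x))"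
    using n by (simp add: norm_mult fun_eq_iff)
  then show "integrable lborel (\<lambda>x. LBINT m. norm (case (x, m) of (x, m) \<Rightarrow> \<phi> (m - x) * \<gamma> x))"
    using \<gamma> by simp
  show "AE x in lborel. integrable lborel (\<lambda>m. case (x, m) of (x, m) \<Rightarrow> \<phi> (m - x) * \<gamma> x)"
    using s by (intro AE_I2) simp
qed

lemma conv_decay:
  assumes C: "decay b C" and h: "decay b h" and b: "b > 0"
  shows "decay b (conv R C h)"
  unfolding decay_def
proof (intro conjI allI impI)
  define g where "g m = poly R (\<i> * of_real m) * h m" for m
  have g: "decay b g" using decay_poly[OF h, of R] by (simp add: g_def[abs_def])
  have [measurable]: "C \<in> borel_measurable borel" "g \<in> borel_measurable borel"
    using C g decay_measurable by auto
  have cv: "conv R C h = (\<lambda>m. LBINT m1. C (m - m1) * g m1)" by (simp add: conv_def g_def fun_eq_iff mult.assoc)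
  show "conv R C h \<in> borel_measurable borel" unfolding cv
  proof -
    have "(\<lambda>(m, m1). C (m - m1) * g m1) \<in> borel_measurable (borel \<Otimes>\<^sub>M lborel)" by measurable
    then show "(\<lambda>m. LBINT m1. C (m - m1) * g m1) \<in> borel_measurable borel"
      by (rule lborel.borel_measurable_lebesgue_integral)
  qed
  fix b' assume b': "b' < b"
  \<comment> \<open>A nonnegative rate is needed, since the estimate rests on
    \<open>c * |m| \<le> c * |m - x| + c * |x|\<close>. The surplus rate e of g makes the integral
    over x converge.\<close>
  define c where "c = max 0 b'"
  define e where "e = (b - c) / 2"
  have c: "0 \<le> c" "b' \<le> c" "c < b" using b b' by (auto simp: c_def)
  have e: "e > 0" "c + e < b" using c by (simp_all add: e_def field_simps)
  obtain K1 where K1: "K1 \<ge> 0" "\<And>m. norm (C m) \<le> K1 * exp (- c * \<bar>m\<bar>)" using decayE[OF C c(3)] by blast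
  obtain K2 where K2: "K2 \<ge> 0" "\<And>m. norm (g m) \<le> K2 * exp (- (c + e) * \<bar>m\<bar>)" using decayE[OF g e(2)] by blast
  define E where "E = (LBINT m. exp (- e * \<bar>m\<bar>))"
  have "norm (conv R C h m) \<le> (K1 * K2 * E) * exp (- b' * \<bar>m\<bar>)" for m
  proof -
    have bd: "norm (C (m - x) * g x) \<le> (K1 * K2 * exp (- c * \<bar>m\<bar>)) * exp (- e * \<bar>x\<bar>)" for x
    proof -
      have "norm (C (m - x) * g x) \<le> (K1 * exp (- c * \<bar>m - x\<bar>)) * (K2 * exp (- (c + e) * \<bar>x\<bar>))"
        unfolding norm_mult using K1 K2 by (intro mult_mono) auto
      also have "\<dots> = K1 * K2 * exp (- c * \<bar>m - x\<bar> + - (c + e) * \<bar>x\<bar>)" by (simp only: exp_add mult_ac)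
      finally have *: "norm (C (m - x) * g x) \<le> K1 * K2 * exp (- c * \<bar>m - x\<bar> + - (c + e) * \<bar>x\<bar>)" .
      have "- c * \<bar>m - x\<bar> + - (c + e) * \<bar>x\<bar> \<le> - c * \<bar>m\<bar> + - e * \<bar>x\<bar>"
      proof -
        have "c * \<bar>m\<bar> \<le> c * (\<bar>m - x\<bar> + \<bar>x\<bar>)" using c by (intro mult_left_mono) auto
        then show ?thesis by (simp add: algebra_simps)
      qed
      then have "K1 * K2 * exp (- c * \<bar>m - x\<bar> + - (c + e) * \<bar>x\<bar>) \<le> K1 * K2 * exp (- c * \<bar>m\<bar> + - e * \<bar>x\<bar>)"
        using K1 K2 by (intro mult_left_mono) (auto simp: exp_le_cancel_iff)
      with * show ?thesis by (simp only: exp_add mult_ac)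
    qed
    have i: "integrable lborel (\<lambda>x. (K1 * K2 * exp (- c * \<bar>m\<bar>)) * exp (- e * \<bar>x\<bar>))"
      using integrable_exp_abs[OF e(1)] by (rule integrable_mult_right)
    have "norm (conv R C h m) \<le> (LBINT x. (K1 * K2 * exp (- c * \<bar>m\<bar>)) * exp (- e * \<bar>x\<bar>))"
      unfolding cv by (rule Bochner_Integration.integral_norm_bound_integral[OF _ i bd])
        (rule Bochner_Integration.integrable_bound[OF i], simp, intro AE_I2, simp only: real_norm_def, rule order.trans[OF bd abs_ge_self])
    also have "\<dots> = (K1 * K2 * E) * exp (- c * \<bar>m\<bar>)" by (simp add: E_def mult_ac)
    also have "\<dots> \<le> (K1 * K2 * E) * exp (- b' * \<bar>m\<bar>)"
    proof (intro mult_left_mono)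
      have "b' * \<bar>m\<bar> \<le> c * \<bar>m\<bar>" using c by (intro mult_right_mono) auto
      then show "exp (- c * \<bar>m\<bar>) \<le> exp (- b' * \<bar>m\<bar>)" by simp
      show "0 \<le> K1 * K2 * E" using K1 K2 by (auto simp: E_def intro!: mult_nonneg_nonneg integral_nonneg)
    qed
    finally show ?thesis .
  qed
  then show "\<exists>K. \<forall>m. norm (conv R C h m) \<le> K * exp (- b' * \<bar>m\<bar>)" by blast
qed

text \<open>The exponential splits along m = (m - x) + x, and Fubini's theorem with translation
  invariance factorises the double integral. The constant in front of the convolution is the second
  normalising constant on the right.\<close>

theorem inv_fourier_conv:
  assumes C: "decay b C" and h: "decay b h" and z: "z \<in> strip b"
  shows "inv_fourier (\<lambda>m. of_real (1 / sqrt (2 * pi)) * conv R C h m) z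
     = inv_fourier C z * inv_fourier (\<lambda>m. poly R (\<i> * of_real m) * h m) z"
proof -
  define g where "g m = poly R (\<i> * of_real m) * h m" for m
  define s where "s = complex_of_real (1 / sqrt (2 * pi))"
  have g: "decay b g" using decay_poly[OF h, of R] by (simp add: g_def[abs_def])
  define \<phi> where "\<phi> m = C m * exp (\<i> * of_real m * z)" for m
  define \<gamma> where "\<gamma> m = g m * exp (\<i> * of_real m * z)" for m
  have \<phi>: "integrable lborel \<phi>" and \<gamma>: "integrable lborel \<gamma>"
    using decay_exp_integrable[OF C z] decay_exp_integrable[OF g z] by (simp_all add: \<phi>_def[abs_def] \<gamma>_def[abs_def])
  have sh: "(LBINT m. \<phi> (m - x)) = (LBINT m. \<phi> m)" for x
    using lborel_integral_real_affine[of 1 \<phi> "- x"] by (simp add: algebra_simps)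
  have "(LBINT m. conv R C h m * exp (\<i> * of_real m * z)) = (LBINT m. LBINT x. \<phi> (m - x) * \<gamma> x)"
  proof (rule Bochner_Integration.integral_cong)
    fix m
    have "conv R C h m * exp (\<i> * of_real m * z) = (LBINT x. C (m - x) * g x * exp (\<i> * of_real m * z))"
      unfolding conv_def g_def by (subst integral_mult_left_zero[symmetric]) (simp add: mult.assoc)
    also have "\<dots> = (LBINT x. \<phi> (m - x) * \<gamma> x)"
    proof (rule Bochner_Integration.integral_cong)
      fix x
      have "exp (\<i> * of_real m * z) = exp (\<i> * of_real (m - x) * z) * exp (\<i> * of_real x * z)"
        by (simp add: algebra_simps flip: exp_add)
      then show "C (m - x) * g x * exp (\<i> * of_real m * z) = \<phi> (m - x) * \<gamma> x"
        by (simp only: \<phi>_def \<gamma>_def mult_ac)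
    qed simp
    finally show "conv R C h m * exp (\<i> * of_real m * z) = (LBINT x. \<phi> (m - x) * \<gamma> x)" .
  qed simp
  also have "\<dots> = (LBINT x. LBINT m. \<phi> (m - x) * \<gamma> x)"
    using lborel_pair.Fubini_integral[of "\<lambda>x m. \<phi> (m - x) * \<gamma> x"] integrable_shift_product[OF \<phi> \<gamma>] by simp
  also have "\<dots> = (LBINT m. \<phi> m) * (LBINT x. \<gamma> x)" by (simp add: sh)
  finally have 1: "(LBINT m. conv R C h m * exp (\<i> * of_real m * z)) = (LBINT m. \<phi> m) * (LBINT x. \<gamma> x)" .
  have 2: "(LBINT m. s * conv R C h m * exp (\<i> * of_real m * z)) = s * (LBINT m. conv R C h m * exp (\<i> * of_real m * z))"
    by (simp add: mult.assoc)
  show ?thesis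
    unfolding inv_fourier_def s_def[symmetric] g_def[symmetric] 2 1 \<phi>_def[symmetric] \<gamma>_def[symmetric]
    by (simp only: mult_ac)
qed

section \<open>The q-Laplace transform\<close>

context q_base begin

lemma pi_q_eq: "pi_q q k = L" by (simp add: pi_q_def L_def)

lemma cq_theta_coeff: "cq q k n * theta_coeff (real n) = 1"
  using q_gt_1 k_pos by (simp add: cq_def theta_coeff_def powr_def L_def flip: exp_add)

text \<open>Extended by 0, so that transforms become integrals over the whole line, to which the
  affine change of variables and Fubini's theorem apply directly.\<close>

definition laplace_ker :: "real \<Rightarrow> complex \<Rightarrow> real \<Rightarrow> complex" where
  "laplace_ker d T r = (if r > 0 then 1 / TH (of_real r * cis d / T) / of_real r else 0)"

lemma q_laplace_eq_ker: "q_laplace q k d f T = of_real (1 / L) * (LBINT r. laplace_ker d T r * f (of_real r * cis d))"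
  unfolding q_laplace_def pi_q_eq set_lebesgue_integral_def
  by (intro arg_cong2[of _ _ _ _ "(*)"] refl Bochner_Integration.integral_cong) (auto simp: laplace_ker_def indicator_def)

lemma laplace_ker_measurable [measurable]:
  assumes "T \<noteq> 0"
  shows "laplace_ker d T \<in> borel_measurable borel"
proof -
  have "(\<lambda>r. indicator {0<..} r *\<^sub>R TH (of_real r * cis d / T)) \<in> borel_measurable borel"
    by (rule borel_measurable_continuous_on_indicator, simp, rule continuous_on_compose2[OF Theta_continuous[of "- {0}"]])
      (use assms in \<open>auto intro!: continuous_intros\<close>)
  then have "(\<lambda>r. 1 / (indicator {0<..} r *\<^sub>R TH (of_real r * cis d / T)) / of_real r) \<in> borel_measurable borel"
    by measurable
  moreover have "(\<lambda>r. 1 / (indicator {0<..} r *\<^sub>R TH (of_real r * cis d / T)) / of_real r) = laplace_ker d T"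
    by (auto simp: fun_eq_iff laplace_ker_def indicator_def)
  ultimately show ?thesis by simp
qed

lemma Theta_shift:
  assumes "x \<noteq> 0"
  shows "1 / TH (of_real (q powr (- real n / k)) * x) = of_real (theta_coeff (real n)) * x ^ n / TH x"
proof -
  have "q powr (- real n / k) = exp (of_int (- int n) * L)"
    using q_gt_1 by (simp add: powr_def L_def)
  moreover have "theta_term x (int n) = of_real (theta_coeff (real n)) * x ^ n" by (simp add: theta_term_def)
  moreover have "theta_term x (int n) \<noteq> 0" using assms by (simp add: theta_term_def less_imp_neq[OF theta_coeff_pos, symmetric])
  moreover have "1 / b = t / a" if "a = t * b" "t \<noteq> 0" for a b t :: complex
    using that by auto
  ultimately show ?thesis using Theta_step_powi[OF assms, of "- int n"] by simp
qed

text \<open>The functional equation trades a power for a dilation of T: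
  \<open>u^n / TH (u / T)\<close> is \<open>c_k(n) T^n / TH (u / (q^(n/k) T))\<close>. Taking
  \<open>q^s r\<close> as the new variable then removes the dilation of f at the price of another
  factor \<open>q^s\<close> in front of T.\<close>

lemma laplace_integrand_scale:
  assumes T: "T \<noteq> 0" and r: "r > 0"
  shows "laplace_ker d T r * ((of_real r * cis d) ^ n * f (of_real (q powr s) * (of_real r * cis d)))
    = of_real (cq q k n) * T ^ n * (of_real (q powr s) * (laplace_ker d (of_real (q powr (real n / k + s)) * T) (q powr s * r) * f (of_real (q powr s * r) * cis d)))"
proof -
  define x where "x = of_real r * cis d / T"
  have x: "x \<noteq> 0" using T r by (simp add: x_def)
  have qs: "q powr s > 0" using q_gt_1 by simp
  have e: "of_real (q powr s * r) * cis d / (of_real (q powr (real n / k + s)) * T) = of_real (q powr (- real n / k)) * x"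
    using q_gt_1 qs T by (simp add: x_def powr_add powr_minus field_simps)
  have "of_real (cq q k n) * T ^ n * (of_real (theta_coeff (real n)) * x ^ n / TH x) = (of_real (cq q k n * theta_coeff (real n))) * (T * x) ^ n / TH x"
    by (simp add: power_mult_distrib mult_ac)
  also have "\<dots> = (of_real r * cis d) ^ n / TH x"
    unfolding cq_theta_coeff using T by (simp add: x_def)
  finally have *: "of_real (cq q k n) * T ^ n * (of_real (theta_coeff (real n)) * x ^ n / TH x) = (of_real r * cis d) ^ n / TH x" .
  have "of_real (cq q k n) * T ^ n * (of_real (q powr s) * (laplace_ker d (of_real (q powr (real n / k + s)) * T) (q powr s * r) * f (of_real (q powr s * r) * cis d)))
    = (of_real (cq q k n) * T ^ n * (of_real (theta_coeff (real n)) * x ^ n / TH x)) * (of_real (q powr s) / of_real (q powr s * r)) * f (of_real (q powr s * r) * cis d)"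
    using r qs unfolding laplace_ker_def e Theta_shift[OF x] by (simp add: mult_ac)
  also have "\<dots> = (of_real r * cis d) ^ n / TH x / of_real r * f (of_real (q powr s) * (of_real r * cis d))"
    unfolding * using qs by (simp add: mult.assoc)
  also have "\<dots> = laplace_ker d T r * ((of_real r * cis d) ^ n * f (of_real (q powr s) * (of_real r * cis d)))"
    using r by (simp add: laplace_ker_def x_def)
  finally show ?thesis ..
qed

lemma laplace_integrand_scale':
  assumes T: "T \<noteq> 0"
  shows "(\<lambda>r. laplace_ker d T r * ((of_real r * cis d) ^ n * f (of_real (q powr s) * (of_real r * cis d))))
    = (\<lambda>r. of_real (cq q k n) * T ^ n * (of_real (q powr s) * (\<lambda>r. laplace_ker d (of_real (q powr (real n / k + s)) * T) r * f (of_real r * cis d)) (0 + q powr s * r)))"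
proof
  fix r
  have "q powr s > 0" using q_gt_1 by simp
  then show "laplace_ker d T r * ((of_real r * cis d) ^ n * f (of_real (q powr s) * (of_real r * cis d)))
    = of_real (cq q k n) * T ^ n * (of_real (q powr s) * (\<lambda>r. laplace_ker d (of_real (q powr (real n / k + s)) * T) r * f (of_real r * cis d)) (0 + q powr s * r))"
  proof (cases "r > 0")
    case True
    then show ?thesis using laplace_integrand_scale[OF assms True, of d n f s] by simp
  next
    case False
    then have "\<not> q powr s * r > 0" using \<open>q powr s > 0\<close> by (simp add: zero_less_mult_iff)
    then show ?thesis using False by (simp add: laplace_ker_def)
  qed
qed

text \<open>An identity of Bochner integrals by change of variables; if one side is not integrable,
  neither is the other, and both have the value 0.\<close>

theorem q_laplace_power_shift:
  assumes T: "T \<noteq> 0"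
  shows "q_laplace q k d (\<lambda>\<tau>. \<tau> ^ n * f (of_real (q powr s) * \<tau>)) T
    = of_real (cq q k n) * T ^ n * q_laplace q k d f (of_real (q powr (real n / k + s)) * T)"
proof -
  have qs: "q powr s > 0" using q_gt_1 by simp
  show ?thesis
    unfolding q_laplace_eq_ker laplace_integrand_scale'[OF T]
    using lborel_integral_real_affine[of "q powr s" "\<lambda>r. laplace_ker d (of_real (q powr (real n / k + s)) * T) r * f (of_real r * cis d)" 0] qs
    by (simp add: scaleR_conv_of_real mult_ac)
qed

lemma integrable_power_shift:
  assumes T: "T \<noteq> 0" and i: "integrable lborel (\<lambda>r. laplace_ker d (of_real (q powr (real n / k + s)) * T) r * f (of_real r * cis d))"
  shows "integrable lborel (\<lambda>r. laplace_ker d T r * ((of_real r * cis d) ^ n * f (of_real (q powr s) * (of_real r * cis d))))"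
proof -
  have "q powr s \<noteq> 0" using q_gt_1 by simp
  from lborel_integrable_real_affine[OF i this, of 0] show ?thesis
    unfolding laplace_integrand_scale'[OF T] by (intro integrable_mult_right) simp
qed

lemma laplace_ker_eq_const:
  assumes "T \<noteq> 0" "cis d / T \<notin> \<real>\<^sub>\<le>\<^sub>0"
  shows "integrable lborel (laplace_ker d T)" "(LBINT r. laplace_ker d T r) = of_real L"
proof -
  have e: "(\<lambda>r. indicator {0<..} r *\<^sub>R (1 / TH (of_real r * (cis d / T)) / of_real r)) = laplace_ker d T"
    by (auto simp: fun_eq_iff laplace_ker_def)
  show "integrable lborel (laplace_ker d T)" "(LBINT r. laplace_ker d T r) = of_real L"
    using inverse_Theta_integrable[OF assms(2)] integral_inverse_Theta[OF assms(2)]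
    unfolding set_integrable_def set_lebesgue_integral_def e by auto
qed

lemma not_nonpos_scale: "c > 0 \<Longrightarrow> x \<notin> \<real>\<^sub>\<le>\<^sub>0 \<Longrightarrow> x / complex_of_real c \<notin> \<real>\<^sub>\<le>\<^sub>0"
  using ray_notin_nonpos[of x "1 / c"] by simp

lemma monomial_integrable:
  assumes "T \<noteq> 0" "cis d / T \<notin> \<real>\<^sub>\<le>\<^sub>0"
  shows "integrable lborel (\<lambda>r. laplace_ker d T r * (of_real r * cis d) ^ n)"
proof -
  have q: "q powr (real n / k) > 0" using q_gt_1 by simp
  have "cis d / (of_real (q powr (real n / k)) * T) \<notin> \<real>\<^sub>\<le>\<^sub>0"
    using not_nonpos_scale[OF q assms(2)] by (simp add: mult.commute)
  then have "integrable lborel (laplace_ker d (of_real (q powr (real n / k)) * T))"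
    using q assms by (intro laplace_ker_eq_const) auto
  then show ?thesis using integrable_power_shift[OF assms(1), of d n 0 "\<lambda>_. 1"] by simp
qed

text \<open>The constant 1 has the transform 1, by the value of the integral of 1 / theta. Powers
  follow from \<open>q_laplace_power_shift\<close> with f = 1 and s = 0.\<close>

theorem q_laplace_polynomial:
  assumes "T \<noteq> 0" "cis d / T \<notin> \<real>\<^sub>\<le>\<^sub>0"
  shows "q_laplace q k d (\<lambda>\<tau>. \<Sum>n\<le>N. a n * \<tau> ^ n) T = (\<Sum>n\<le>N. a n * of_real (cq q k n) * T ^ n)"
proof -
  have m: "of_real (1 / L) * (LBINT r. laplace_ker d T r * (of_real r * cis d) ^ n) = of_real (cq q k n) * T ^ n" for n
  proof -
    have q: "q powr (real n / k) > 0" using q_gt_1 by simp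
    have "cis d / (of_real (q powr (real n / k)) * T) \<notin> \<real>\<^sub>\<le>\<^sub>0"
      using not_nonpos_scale[OF q assms(2)] by (simp add: mult.commute)
    then have "q_laplace q k d (\<lambda>_. 1) (of_real (q powr (real n / k)) * T) = 1"
      unfolding q_laplace_eq_ker using q assms L_pos by (subst mult_1_right, subst laplace_ker_eq_const(2)) auto
    then show ?thesis
      using q_laplace_power_shift[OF assms(1), of d n "\<lambda>_. 1" 0] by (simp add: q_laplace_eq_ker)
  qed
  have "q_laplace q k d (\<lambda>\<tau>. \<Sum>n\<le>N. a n * \<tau> ^ n) T = of_real (1 / L) * (LBINT r. \<Sum>n\<le>N. a n * (laplace_ker d T r * (of_real r * cis d) ^ n))"
    by (simp add: q_laplace_eq_ker sum_distrib_left mult_ac)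
  also have "\<dots> = (\<Sum>n\<le>N. a n * (of_real (1 / L) * (LBINT r. laplace_ker d T r * (of_real r * cis d) ^ n)))"
    using monomial_integrable[OF assms]
    by (subst Bochner_Integration.integral_sum) (auto simp: sum_distrib_left mult_ac)
  finally show ?thesis unfolding m by (simp add: mult.assoc)
qed

text \<open>Sufficient for the transform of order k of \<open>\<lambda>\<tau>. f \<tau> m\<close> at T to exist and to commute with
  convolutions in m, by Fubini's theorem.\<close>

definition laplace_dom :: "real \<Rightarrow> real \<Rightarrow> (complex \<Rightarrow> real \<Rightarrow> complex) \<Rightarrow> complex \<Rightarrow> bool" where
  "laplace_dom d b f T \<longleftrightarrow> T \<noteq> 0 \<and> (\<lambda>(r, m). indicator {0<..} r *\<^sub>R f (of_real r * cis d) m) \<in> borel_measurable (borel \<Otimes>\<^sub>M borel) \<and>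
     (\<exists>g. set_integrable lborel {0<..} g \<and> (\<forall>r>0. \<forall>m. norm (laplace_ker d T r * f (of_real r * cis d) m) \<le> g r * exp (- b * \<bar>m\<bar>)))"

lemma laplace_domD:
  assumes "laplace_dom d b f T"
  shows "T \<noteq> 0"
    and "(\<lambda>(r, m). laplace_ker d T r * f (of_real r * cis d) m) \<in> borel_measurable (borel \<Otimes>\<^sub>M borel)"
    and "\<exists>g. integrable lborel g \<and> (\<forall>r m. norm (laplace_ker d T r * f (of_real r * cis d) m) \<le> g r * exp (- b * \<bar>m\<bar>))"
proof -
  show T: "T \<noteq> 0" using assms by (simp add: laplace_dom_def)
  have [measurable]: "(\<lambda>(r, m). indicator {0<..} r *\<^sub>R f (of_real r * cis d) m) \<in> borel_measurable (borel \<Otimes>\<^sub>M borel)"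
    using assms by (simp add: laplace_dom_def)
  note laplace_ker_measurable[OF T, of d, measurable]
  have "(\<lambda>(r, m). laplace_ker d T r * (case (r, m) of (r, m) \<Rightarrow> indicator {0<..} r *\<^sub>R f (of_real r * cis d) m)) \<in> borel_measurable (borel \<Otimes>\<^sub>M borel)"
    by measurable
  moreover have "(\<lambda>(r, m). laplace_ker d T r * (case (r, m) of (r, m) \<Rightarrow> indicator {0<..} r *\<^sub>R f (of_real r * cis d) m)) = (\<lambda>(r, m). laplace_ker d T r * f (of_real r * cis d) m)"
    by (auto simp: fun_eq_iff laplace_ker_def)
  ultimately show "(\<lambda>(r, m). laplace_ker d T r * f (of_real r * cis d) m) \<in> borel_measurable (borel \<Otimes>\<^sub>M borel)" by simp
  obtain g where g: "set_integrable lborel {0<..} g" "\<And>r m. r > 0 \<Longrightarrow> norm (laplace_ker d T r * f (of_real r * cis d) m) \<le> g r * exp (- b * \<bar>m\<bar>)"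
    using assms unfolding laplace_dom_def by blast
  have "norm (laplace_ker d T r * f (of_real r * cis d) m) \<le> (indicator {0<..} r *\<^sub>R g r) * exp (- b * \<bar>m\<bar>)" for r m
    using g(2)[of r m] by (cases "r > 0") (auto simp: laplace_ker_def)
  then show "\<exists>g. integrable lborel g \<and> (\<forall>r m. norm (laplace_ker d T r * f (of_real r * cis d) m) \<le> g r * exp (- b * \<bar>m\<bar>))"
    using g(1) unfolding set_integrable_def by blast
qed

lemma laplace_dom_integrable:
  assumes "laplace_dom d b f T"
  shows "integrable lborel (\<lambda>r. laplace_ker d T r * f (of_real r * cis d) m)"
proof -
  obtain g where g: "integrable lborel g" "\<And>r m. norm (laplace_ker d T r * f (of_real r * cis d) m) \<le> g r * exp (- b * \<bar>m\<bar>)"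
    using laplace_domD(3)[OF assms] by blast
  show ?thesis
  proof (rule Bochner_Integration.integrable_bound)
    show "integrable lborel (\<lambda>r. g r * exp (- b * \<bar>m\<bar>))" using g by simp
    have "(\<lambda>r. (case (r, m) of (r, m) \<Rightarrow> laplace_ker d T r * f (of_real r * cis d) m)) \<in> borel_measurable borel"
      by (rule measurable_compose[OF _ laplace_domD(2)[OF assms]]) simp
    then show "(\<lambda>r. laplace_ker d T r * f (of_real r * cis d) m) \<in> borel_measurable lborel" by simp
    show "AE r in lborel. norm (laplace_ker d T r * f (of_real r * cis d) m) \<le> norm (g r * exp (- b * \<bar>m\<bar>))"
      by (intro AE_I2, simp only: real_norm_def, rule order.trans[OF g(2) abs_ge_self])
  qed
qed

lemma laplace_dom_decay:
  assumes "laplace_dom d b f T"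
  shows "decay b (\<lambda>m. q_laplace q k d (\<lambda>\<tau>. f \<tau> m) T)"
proof -
  obtain g where g: "integrable lborel g" "\<And>r m. norm (laplace_ker d T r * f (of_real r * cis d) m) \<le> g r * exp (- b * \<bar>m\<bar>)"
    using laplace_domD(3)[OF assms] by blast
  show ?thesis
  proof (rule decayI)
    have "(\<lambda>(m, r). laplace_ker d T r * f (of_real r * cis d) m) \<in> borel_measurable (borel \<Otimes>\<^sub>M lborel)"
      using measurable_compose[OF measurable_pair_swap' laplace_domD(2)[OF assms]]
      by (simp add: case_prod_unfold cong: measurable_cong_sets)
    then have "(\<lambda>m. LBINT r. laplace_ker d T r * f (of_real r * cis d) m) \<in> borel_measurable borel"
      by (rule lborel.borel_measurable_lebesgue_integral)
    then show "(\<lambda>m. q_laplace q k d (\<lambda>\<tau>. f \<tau> m) T) \<in> borel_measurable borel"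
      unfolding q_laplace_eq_ker by measurable
    fix m
    have "norm (LBINT r. laplace_ker d T r * f (of_real r * cis d) m) \<le> (LBINT r. g r * exp (- b * \<bar>m\<bar>))"
      using g laplace_dom_integrable[OF assms] by (intro Bochner_Integration.integral_norm_bound_integral) auto
    then have "1 / L * norm (LBINT r. laplace_ker d T r * f (of_real r * cis d) m) \<le> 1 / L * (LBINT r. g r * exp (- b * \<bar>m\<bar>))"
      using L_pos by (intro mult_left_mono) auto
    then show "norm (q_laplace q k d (\<lambda>\<tau>. f \<tau> m) T) \<le> (1 / L * (LBINT r. g r)) * exp (- b * \<bar>m\<bar>)"
      unfolding q_laplace_eq_ker norm_mult using L_pos by (simp add: norm_divide)
  qed
qed

text \<open>In the double integral C is bounded, and the decay of f in m1 absorbs the polynomial.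
  The integrand is therefore dominated by a product \<open>G m1 * g r\<close> of integrable
  functions of one variable each.\<close>

lemma laplace_dom_conv:
  assumes f: "laplace_dom d b f T" and b: "b > 0" and C: "C \<in> borel_measurable borel" "\<And>m. norm (C m) \<le> B"
  shows "q_laplace q k d (\<lambda>\<tau>. conv R C (f \<tau>) m) T = conv R C (\<lambda>m. q_laplace q k d (\<lambda>\<tau>. f \<tau> m) T) m"
    and "integrable lborel (\<lambda>r. laplace_ker d T r * conv R C (f (of_real r * cis d)) m)"
proof -
  obtain g where g: "integrable lborel g" "\<And>r m. norm (laplace_ker d T r * f (of_real r * cis d) m) \<le> g r * exp (- b * \<bar>m\<bar>)"
    using laplace_domD(3)[OF f] by blast
  define c where "c m1 = C (m - m1) * poly R (\<i> * of_real m1)" for m1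
  define e where "e m1 = complex_of_real (exp (- b * \<bar>m1\<bar>))" for m1
  have polm: "(\<lambda>m1. poly R (\<i> * complex_of_real m1)) \<in> borel_measurable borel"
    by (intro borel_measurable_continuous_onI continuous_intros)
  have cm [measurable]: "c \<in> borel_measurable borel"
    unfolding c_def using C(1) polm by measurable
  define F where "F = (\<lambda>(r, m1). laplace_ker d T r * f (of_real r * cis d) m1)"
  have Fm [measurable]: "F \<in> borel_measurable (borel \<Otimes>\<^sub>M borel)" using laplace_domD(2)[OF f] by (simp add: F_def)
  have "decay b e" by (rule decayI[where K = 1]) (auto simp: e_def[abs_def])
  then have "decay b (\<lambda>m1. poly R (\<i> * of_real m1) * e m1)" by (rule decay_poly)
  then have i1: "integrable lborel (\<lambda>m1. poly R (\<i> * of_real m1) * e m1)" using b by (rule decay_integrable)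
  define G where "G m1 = B * norm (poly R (\<i> * of_real m1) * e m1)" for m1
  have G: "integrable lborel G" unfolding G_def using i1 by simp
  have gm [measurable]: "g \<in> borel_measurable borel" "G \<in> borel_measurable borel" using g(1) G borel_measurable_integrable by auto
  have bd: "norm (c m1 * F (r, m1)) \<le> G m1 * g r" for r m1
  proof -
    have "norm (c m1) \<le> B * norm (poly R (\<i> * of_real m1))"
      unfolding c_def norm_mult using C(2) by (intro mult_right_mono) auto
    then have "norm (c m1 * F (r, m1)) \<le> (B * norm (poly R (\<i> * of_real m1))) * (g r * exp (- b * \<bar>m1\<bar>))"
      unfolding norm_mult using g(2)[of r m1] by (intro mult_mono) (auto simp: F_def intro: order.trans[OF norm_ge_zero])
    then show ?thesis by (simp add: G_def e_def norm_mult mult_ac)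
  qed
  have int: "integrable (lborel \<Otimes>\<^sub>M lborel) (\<lambda>(r, m1). c m1 * F (r, m1))"
  proof (rule Bochner_Integration.integrable_bound)
    show "integrable (lborel \<Otimes>\<^sub>M lborel) (\<lambda>(r, m1). G m1 * g r)"
    proof (rule lborel_pair.Fubini_integrable)
      show "(\<lambda>(r, m1). G m1 * g r) \<in> borel_measurable (lborel \<Otimes>\<^sub>M lborel)" by measurable
      show "integrable lborel (\<lambda>x. LBINT y. norm (case (x, y) of (r, m1) \<Rightarrow> G m1 * g r))"
        using g(1) by (simp add: abs_mult)
      show "AE x in lborel. integrable lborel (\<lambda>y. case (x, y) of (r, m1) \<Rightarrow> G m1 * g r)"
        using G by (intro AE_I2) simp
    qed
    show "(\<lambda>(r, m1). c m1 * F (r, m1)) \<in> borel_measurable (lborel \<Otimes>\<^sub>M lborel)" by measurable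
    show "AE x in lborel \<Otimes>\<^sub>M lborel. norm (case x of (r, m1) \<Rightarrow> c m1 * F (r, m1)) \<le> norm (case x of (r, m1) \<Rightarrow> G m1 * g r)"
      using bd by (intro AE_I2) (auto intro: order.trans[OF _ abs_ge_self])
  qed
  have e1: "laplace_ker d T r * conv R C (f (of_real r * cis d)) m = (LBINT m1. c m1 * F (r, m1))" for r
    unfolding conv_def by (subst integral_mult_right_zero[symmetric]) (simp add: c_def F_def mult_ac)
  show "integrable lborel (\<lambda>r. laplace_ker d T r * conv R C (f (of_real r * cis d)) m)"
    unfolding e1 using lborel_pair.integrable_fst'[OF int] by simp
  have "(LBINT r. LBINT m1. c m1 * F (r, m1)) = (LBINT m1. LBINT r. c m1 * F (r, m1))"
    using lborel_pair.Fubini_integral[of "\<lambda>r m1. c m1 * F (r, m1)"] int by simp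
  then have "of_real (1 / L) * (LBINT r. laplace_ker d T r * conv R C (f (of_real r * cis d)) m) = of_real (1 / L) * (LBINT m1. c m1 * (LBINT r. F (r, m1)))"
    unfolding e1 by simp
  also have "\<dots> = conv R C (\<lambda>m. q_laplace q k d (\<lambda>\<tau>. f \<tau> m) T) m"
    unfolding conv_def q_laplace_eq_ker by (subst integral_mult_right_zero[symmetric]) (simp add: c_def F_def mult_ac)
  finally show "q_laplace q k d (\<lambda>\<tau>. conv R C (f \<tau>) m) T = conv R C (\<lambda>m. q_laplace q k d (\<lambda>\<tau>. f \<tau> m) T) m"
    unfolding q_laplace_eq_ker .
qed

end

section \<open>Transforms of convolution equations, and rotation of the halfline\<close>

lemma contour_integral_linepath_horizontal:
  assumes "a \<le> b" and c: "continuous_on {a..b} (\<lambda>x. F (of_real x + \<i> * of_real s))"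
  shows "contour_integral (linepath (of_real a + \<i> * of_real s) (of_real b + \<i> * of_real s)) F
    = integral {a..b} (\<lambda>x. F (of_real x + \<i> * of_real s))"
proof (rule contour_integral_unique, subst has_contour_integral_linepath)
  let ?G = "\<lambda>x. F (of_real x + \<i> * of_real s)"
  have "((\<lambda>t. (b - a) *\<^sub>R ?G (a + (b - a) * t)) has_integral integral {a + (b - a) * 0..a + (b - a) * 1} ?G) {0..1}"
  proof (rule has_integral_substitution[where c = a and d = b])
    show "(\<lambda>t. a + (b - a) * t) ` {0..1} \<subseteq> {a..b}"
    proof safe
      fix t :: real assume t: "t \<in> {0..1}"
      then have "(b - a) * t \<ge> 0" "(b - a) * t \<le> (b - a) * 1" using assms(1) by (auto intro!: mult_left_le)
      then show "a + (b - a) * t \<in> {a..b}" by simp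
    qed
  qed (use assms in \<open>auto intro!: derivative_eq_intros\<close>)
  moreover have "(b - a) *\<^sub>R ?G (a + (b - a) * t)
    = F (linepath (of_real a + \<i> * of_real s) (of_real b + \<i> * of_real s) t) * (of_real b + \<i> * of_real s - (of_real a + \<i> * of_real s))" for t
  proof -
    have "linepath (of_real a + \<i> * of_real s) (of_real b + \<i> * of_real s) t = of_real (a + (b - a) * t) + \<i> * of_real s"
      by (simp add: linepath_def scaleR_conv_of_real algebra_simps)
    then show ?thesis by (simp add: scaleR_conv_of_real)
  qed
  ultimately show "((\<lambda>t. F (linepath (of_real a + \<i> * of_real s) (of_real b + \<i> * of_real s) t) * (of_real b + \<i> * of_real s - (of_real a + \<i> * of_real s))) has_integral integral {a..b} ?G) {0..1}"
    by simp
qed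

context q_base begin

text \<open>The equation is read as an expression for H: along the ray H is a linear combination of
  terms that are integrable against the kernel, so its transform is found by linearity. With order
  \<open>k2\<close> this handles \<open>w2\<close> and \<open>\<psi>2\<close>, with order
  \<open>kappa k1 k2\<close> it handles \<open>\<psi>1\<close>.\<close>

theorem q_laplace_equation:
  fixes f H :: "complex \<Rightarrow> real \<Rightarrow> complex" and C :: "'l \<Rightarrow> 'j \<Rightarrow> real \<Rightarrow> complex"
  assumes eq: "\<And>\<tau> m. \<tau> \<in> ray d \<Longrightarrow> a m * f \<tau> m
      = cD * (\<tau> ^ nD * (rD m * f (of_real (q powr sD) * \<tau>) m))
      + (\<Sum>l\<in>A. \<Sum>j\<in>I l. c l j * (\<tau> ^ n l j * conv (R l) (C l j) (f (of_real (q powr s l j) * \<tau>)) m)) + H \<tau> m"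
    and b: "b > 0"
    and T: "laplace_dom d b f T" "laplace_dom d b f (of_real (q powr (real nD / k + sD)) * T)"
      "\<And>l j. l \<in> A \<Longrightarrow> j \<in> I l \<Longrightarrow> laplace_dom d b f (of_real (q powr (real (n l j) / k + s l j)) * T)"
    and C: "\<And>l j. l \<in> A \<Longrightarrow> j \<in> I l \<Longrightarrow> C l j \<in> borel_measurable borel \<and> (\<exists>B. \<forall>m. norm (C l j m) \<le> B)"
  defines "W \<equiv> \<lambda>T m. q_laplace q k d (\<lambda>\<tau>. f \<tau> m) T"
  shows "a m * W T m
      = cD * of_real (cq q k nD) * (T ^ nD * (rD m * W (of_real (q powr (real nD / k + sD)) * T) m))
      + (\<Sum>l\<in>A. \<Sum>j\<in>I l. c l j * of_real (cq q k (n l j)) * (T ^ n l j * conv (R l) (C l j) (W (of_real (q powr (real (n l j) / k + s l j)) * T)) m))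
      + q_laplace q k d (\<lambda>\<tau>. H \<tau> m) T"
proof -
  have T0: "T \<noteq> 0" using T(1) laplace_domD(1) by blast
  define g0 where "g0 r = laplace_ker d T r * f (of_real r * cis d) m" for r
  define g1 where "g1 r = laplace_ker d T r * ((of_real r * cis d) ^ nD * (rD m * f (of_real (q powr sD) * (of_real r * cis d)) m))" for r
  define g2 where "g2 l j r = laplace_ker d T r * ((of_real r * cis d) ^ n l j * conv (R l) (C l j) (f (of_real (q powr s l j) * (of_real r * cis d))) m)" for l j r
  define P where "P = complex_of_real (1 / L)"
  have i0: "integrable lborel g0" unfolding g0_def by (rule laplace_dom_integrable[OF T(1)])
  have i1: "integrable lborel g1"
    unfolding g1_def
    by (rule integrable_power_shift[OF T0, where f = "\<lambda>\<tau>. rD m * f \<tau> m"])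
      (use laplace_dom_integrable[OF T(2), of m] in \<open>auto simp: mult.left_commute\<close>)
  have w0: "P * (LBINT r. g0 r) = W T m" by (simp add: P_def W_def q_laplace_eq_ker g0_def)
  have w1: "P * (LBINT r. g1 r) = of_real (cq q k nD) * (T ^ nD * (rD m * W (of_real (q powr (real nD / k + sD)) * T) m))"
  proof -
    have "P * (LBINT r. g1 r) = q_laplace q k d (\<lambda>\<tau>. \<tau> ^ nD * (\<lambda>\<tau>. rD m * f \<tau> m) (of_real (q powr sD) * \<tau>)) T"
      by (simp add: q_laplace_eq_ker g1_def P_def)
    also have "\<dots> = of_real (cq q k nD) * T ^ nD * q_laplace q k d (\<lambda>\<tau>. rD m * f \<tau> m) (of_real (q powr (real nD / k + sD)) * T)"
      by (rule q_laplace_power_shift[OF T0])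
    also have "q_laplace q k d (\<lambda>\<tau>. rD m * f \<tau> m) (of_real (q powr (real nD / k + sD)) * T) = rD m * W (of_real (q powr (real nD / k + sD)) * T) m"
      by (simp add: q_laplace_eq_ker W_def mult.left_commute)
    finally show ?thesis by (simp add: mult.assoc)
  qed
  have w2: "P * (LBINT r. g2 l j r) = of_real (cq q k (n l j)) * (T ^ n l j * conv (R l) (C l j) (W (of_real (q powr (real (n l j) / k + s l j)) * T)) m)"
    and i2: "integrable lborel (g2 l j)" if lj: "l \<in> A" "j \<in> I l" for l j
  proof -
    obtain B where B: "C l j \<in> borel_measurable borel" "\<And>m. norm (C l j m) \<le> B" using C[OF lj] by blast
    have "P * (LBINT r. g2 l j r) = q_laplace q k d (\<lambda>\<tau>. \<tau> ^ n l j * (\<lambda>\<tau>. conv (R l) (C l j) (f \<tau>) m) (of_real (q powr s l j) * \<tau>)) T"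
      by (simp add: q_laplace_eq_ker g2_def P_def)
    also have "\<dots> = of_real (cq q k (n l j)) * T ^ n l j * q_laplace q k d (\<lambda>\<tau>. conv (R l) (C l j) (f \<tau>) m) (of_real (q powr (real (n l j) / k + s l j)) * T)"
      by (rule q_laplace_power_shift[OF T0])
    also have "q_laplace q k d (\<lambda>\<tau>. conv (R l) (C l j) (f \<tau>) m) (of_real (q powr (real (n l j) / k + s l j)) * T)
      = conv (R l) (C l j) (W (of_real (q powr (real (n l j) / k + s l j)) * T)) m"
      unfolding W_def by (rule laplace_dom_conv(1)[OF T(3)[OF lj] b B])
    finally show "P * (LBINT r. g2 l j r) = of_real (cq q k (n l j)) * (T ^ n l j * conv (R l) (C l j) (W (of_real (q powr (real (n l j) / k + s l j)) * T)) m)"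
      by (simp add: mult.assoc)
    show "integrable lborel (g2 l j)"
      unfolding g2_def
      by (rule integrable_power_shift[OF T0 laplace_dom_conv(2)[OF T(3)[OF lj] b B]])
  qed
  have i2': "integrable lborel (\<lambda>r. \<Sum>j\<in>I l. c l j * g2 l j r)" if "l \<in> A" for l
    by (intro Bochner_Integration.integrable_sum integrable_mult_right i2 that)
  have e: "laplace_ker d T r * H (of_real r * cis d) m = a m * g0 r - cD * g1 r - (\<Sum>l\<in>A. \<Sum>j\<in>I l. c l j * g2 l j r)" for r
  proof (cases "r > 0")
    case True
    then have "of_real r * cis d \<in> ray d" by (auto simp: ray_def)
    from eq[OF this, of m] have "laplace_ker d T r * H (of_real r * cis d) m = laplace_ker d T r * (a m * f (of_real r * cis d) m
      - cD * ((of_real r * cis d) ^ nD * (rD m * f (of_real (q powr sD) * (of_real r * cis d)) m))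
      - (\<Sum>l\<in>A. \<Sum>j\<in>I l. c l j * ((of_real r * cis d) ^ n l j * conv (R l) (C l j) (f (of_real (q powr s l j) * (of_real r * cis d))) m)))"
      by simp
    then show ?thesis
      by (simp only: g0_def g1_def g2_def right_diff_distrib sum_distrib_left mult.left_commute)
  qed (simp add: laplace_ker_def g0_def g1_def g2_def)
  have "q_laplace q k d (\<lambda>\<tau>. H \<tau> m) T = P * (LBINT r. a m * g0 r - cD * g1 r - (\<Sum>l\<in>A. \<Sum>j\<in>I l. c l j * g2 l j r))"
    unfolding q_laplace_eq_ker e P_def ..
  also have "(LBINT r. a m * g0 r - cD * g1 r - (\<Sum>l\<in>A. \<Sum>j\<in>I l. c l j * g2 l j r))
     = a m * (LBINT r. g0 r) - cD * (LBINT r. g1 r) - (\<Sum>l\<in>A. \<Sum>j\<in>I l. c l j * (LBINT r. g2 l j r))"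
    using i0 i1 i2 i2' by (simp add: Bochner_Integration.integral_sum)
  also have "P * \<dots> = a m * (P * (LBINT r. g0 r)) - cD * (P * (LBINT r. g1 r)) - (\<Sum>l\<in>A. \<Sum>j\<in>I l. c l j * (P * (LBINT r. g2 l j r)))"
    by (simp only: right_diff_distrib sum_distrib_left mult.left_commute)
  also have "(\<Sum>l\<in>A. \<Sum>j\<in>I l. c l j * (P * (LBINT r. g2 l j r))) = (\<Sum>l\<in>A. \<Sum>j\<in>I l. c l j * (of_real (cq q k (n l j)) * (T ^ n l j * conv (R l) (C l j) (W (of_real (q powr (real (n l j) / k + s l j)) * T)) m)))"
    by (intro sum.cong refl) (simp add: w2)
  finally show ?thesis unfolding w0 w1 by (simp only: mult.assoc) simp
qed

text \<open>Cauchy's theorem for the integrand in the variable \<open>w = log u\<close>, on rectangles whose vertical sides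
  move to infinity.\<close>

theorem q_laplace_rotate:
  assumes f: "f holomorphic_on S" and T: "T \<noteq> 0"
    and dir: "\<And>s. s \<in> closed_segment d g \<Longrightarrow> ray s \<subseteq> S \<and> - T \<notin> ray s"
    and a: "a < - 1"
    and bound: "\<And>s r. s \<in> closed_segment d g \<Longrightarrow> r > 0 \<Longrightarrow>
      norm (f (of_real r * cis s) / TH (of_real r * cis s / T)) \<le> B * (r * tail_powr a r)"
  shows "q_laplace q k g f T = q_laplace q k d f T"
proof -
  define h where "h \<tau> = f \<tau> / TH (\<tau> / T)" for \<tau>
  define V where "V = {w. Im w \<in> closed_segment d g}"
  have ex: "exp w = of_real (exp (Re w)) * cis (Im w)" for w
    by (metis exp_eq_polar)
  have inr: "exp w \<in> ray (Im w)" for w unfolding ex ray_def by (auto intro!: exI[of _ "exp (Re w)"])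
  \<comment> \<open>A value of \<open>exp w / T\<close> on the negative axis would place - T on the
    ray with argument \<open>Im w\<close>, which the choice of directions excludes.\<close>
  have nz: "exp w / T \<notin> \<real>\<^sub>\<le>\<^sub>0" if "w \<in> V" for w
  proof
    assume "exp w / T \<in> \<real>\<^sub>\<le>\<^sub>0"
    then obtain x where x: "exp w / T = of_real x" "x \<le> 0" by (auto elim!: nonpos_Reals_cases)
    then have e: "exp w = of_real x * T" using T by (simp add: field_simps)
    then have "x \<noteq> 0" by auto
    then have x0: "x < 0" using x by simp
    have "- T = of_real (exp (Re w) / (- x)) * cis (Im w)"
      using e x0 unfolding ex by (simp add: field_simps)
    then have "- T \<in> ray (Im w)" unfolding ray_def using x0 by (auto intro!: exI[of _ "exp (Re w) / (- x)"] divide_pos_neg simp: zero_less_divide_iff)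
    then show False using dir[of "Im w"] that by (simp add: V_def)
  qed
  have "convex (closed_segment d g)" by simp
  then have cV: "convex V" unfolding V_def
    by (intro convex_linear_vimage[of Im "closed_segment d g", unfolded vimage_def]) (auto simp: bounded_linear.linear bounded_linear_Im)
  have holH: "(\<lambda>w. h (exp w)) holomorphic_on V"
  proof -
    have "(\<lambda>w. f (exp w)) holomorphic_on V"
      using dir inr by (intro holomorphic_on_compose_gen[OF _ f, unfolded o_def]) (auto simp: V_def intro!: holomorphic_intros)
    moreover have "(\<lambda>w. TH (exp w / T)) holomorphic_on V"
      using T by (intro holomorphic_on_compose_gen[OF _ Theta_holomorphic[of "- {0}"], unfolded o_def]) (auto intro!: holomorphic_intros)
    ultimately show ?thesis unfolding h_def
      using Theta_nonzero[OF nz] by (intro holomorphic_on_divide) auto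
  qed
  \<comment> \<open>Truncation to \<open>[exp (- N), exp N]\<close> becomes a segment from - N to N
    in the logarithmic variable, a horizontal side of the rectangle.\<close>
  define P where "P s N = (LBINT r. indicator {exp (- real N)..exp (real N)} r *\<^sub>R (laplace_ker s T r * f (of_real r * cis s)))" for s N
  have P_eq: "P s N = integral {- real N..real N} (\<lambda>x. h (exp (of_real x + \<i> * of_real s)))"
    and P_lim: "P s \<longlonglongrightarrow> (LBINT r. laplace_ker s T r * f (of_real r * cis s))" if s: "s \<in> closed_segment d g" for s N
  proof -
    have kf: "laplace_ker s T r * f (of_real r * cis s) = h (of_real r * cis s) / of_real r" if "r > 0" for r
      using that by (simp add: laplace_ker_def h_def)
    have lg: "of_real r * cis s = exp (of_real (ln r) + \<i> * of_real s)" if "r > 0" for r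
      using that unfolding ex by simp
    have cont: "continuous_on {0<..} (\<lambda>r. h (of_real r * cis s))"
    proof -
      have "continuous_on {0<..} (\<lambda>r. h (exp (of_real (ln r) + \<i> * of_real s)))"
        by (rule continuous_on_compose2[OF holomorphic_on_imp_continuous_on[OF holH]])
          (use s in \<open>auto intro!: continuous_intros simp: V_def\<close>)
      then show ?thesis by (rule continuous_on_cong[THEN iffD1, rotated 2]) (auto simp: lg)
    qed
    have si: "set_integrable lborel {0<..} (\<lambda>r. h (of_real r * cis s) / of_real r)"
    proof (rule set_integrable_tail_powr_bound[OF _ a])
      show "set_borel_measurable borel {0<..} (\<lambda>r. h (of_real r * cis s) / of_real r)"
        by (intro set_measurable_continuous_on continuous_intros cont) auto
      fix r :: real assume r: "r > 0"
      show "norm (h (of_real r * cis s) / of_real r) \<le> B * tail_powr a r"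
      proof -
        have "norm (h (of_real r * cis s)) \<le> (B * tail_powr a r) * r" using bound[OF s r] by (simp add: h_def mult_ac)
        moreover have "norm (h (of_real r * cis s) / of_real r) = norm (h (of_real r * cis s)) / r" using r by (simp add: norm_divide)
        ultimately show ?thesis using r by (simp add: pos_divide_le_eq)
      qed
    qed
    have ind: "(\<lambda>r. laplace_ker s T r * f (of_real r * cis s)) = (\<lambda>r. indicator {0<..} r *\<^sub>R (h (of_real r * cis s) / of_real r))"
      by (auto simp: fun_eq_iff h_def indicator_def laplace_ker_def)
    have int: "integrable lborel (\<lambda>r. laplace_ker s T r * f (of_real r * cis s))"
      unfolding ind using si by (simp add: set_integrable_def)
    have cI: "continuous_on {exp (- real N)..exp (real N)} (\<lambda>r. h (of_real r * cis s) / of_real r)" for N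
      by (intro continuous_intros continuous_on_subset[OF cont]) (auto intro: less_le_trans[OF exp_gt_zero])
    have "P s N = (LBINT r:{exp (- real N)..exp (real N)}. h (of_real r * cis s) / of_real r)"
      unfolding P_def set_lebesgue_integral_def
      by (rule Bochner_Integration.integral_cong) (auto simp: indicator_def kf less_le_trans[OF exp_gt_zero])
    also have "\<dots> = integral {exp (- real N)..exp (real N)} (\<lambda>r. h (of_real r * cis s) / of_real r)"
      by (rule set_borel_integral_eq_integral) (use borel_integrable_atLeastAtMost'[OF cI] in \<open>simp add: set_integrable_def\<close>)
    also have "\<dots> = integral {- real N..real N} (\<lambda>x. exp x *\<^sub>R (h (of_real (exp x) * cis s) / of_real (exp x)))"
      by (rule sym, rule integral_unique, rule has_integral_substitution[where c = "exp (- real N)" and d = "exp (real N)"])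
        (use cI in \<open>auto intro!: derivative_eq_intros simp: has_real_derivative_iff_has_vector_derivative[symmetric]\<close>)
    also have "\<dots> = integral {- real N..real N} (\<lambda>x. h (exp (of_real x + \<i> * of_real s)))"
      unfolding ex by (intro integral_cong) (simp add: scaleR_conv_of_real)
    finally show "P s N = integral {- real N..real N} (\<lambda>x. h (exp (of_real x + \<i> * of_real s)))" .
    show "P s \<longlonglongrightarrow> (LBINT r. laplace_ker s T r * f (of_real r * cis s))"
      unfolding P_def
    proof (rule integral_dominated_convergence[where w = "\<lambda>r. norm (laplace_ker s T r * f (of_real r * cis s))"])
      show "(\<lambda>r. laplace_ker s T r * f (of_real r * cis s)) \<in> borel_measurable lborel" using int by (rule borel_measurable_integrable)
      then show "(\<lambda>r. indicator {exp (- real i)..exp (real i)} r *\<^sub>R (laplace_ker s T r * f (of_real r * cis s))) \<in> borel_measurable lborel" for i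
        by measurable
      show "integrable lborel (\<lambda>r. norm (laplace_ker s T r * f (of_real r * cis s)))" using int by (rule integrable_norm)
      show "AE r in lborel. norm (indicator {exp (- real i)..exp (real i)} r *\<^sub>R (laplace_ker s T r * f (of_real r * cis s))) \<le> norm (laplace_ker s T r * f (of_real r * cis s))" for i
        by (intro AE_I2) (simp add: indicator_def)
      show "AE r in lborel. (\<lambda>i. indicator {exp (- real i)..exp (real i)} r *\<^sub>R (laplace_ker s T r * f (of_real r * cis s))) \<longlonglongrightarrow> laplace_ker s T r * f (of_real r * cis s)"
      proof (intro AE_I2)
        fix r :: real
        show "(\<lambda>i. indicator {exp (- real i)..exp (real i)} r *\<^sub>R (laplace_ker s T r * f (of_real r * cis s))) \<longlonglongrightarrow> laplace_ker s T r * f (of_real r * cis s)"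
        proof (cases "r > 0")
          case True
          have "eventually (\<lambda>i. laplace_ker s T r * f (of_real r * cis s) = indicator {exp (- real i)..exp (real i)} r *\<^sub>R (laplace_ker s T r * f (of_real r * cis s))) sequentially"
          proof (rule eventually_sequentiallyI)
            fix i assume i: "nat \<lceil>\<bar>ln r\<bar>\<rceil> \<le> i"
            then have "- real i \<le> ln r" "ln r \<le> real i" by linarith+
            then have "exp (- real i) \<le> exp (ln r)" "exp (ln r) \<le> exp (real i)" by (simp_all only: exp_le_cancel_iff)
            then show "laplace_ker s T r * f (of_real r * cis s) = indicator {exp (- real i)..exp (real i)} r *\<^sub>R (laplace_ker s T r * f (of_real r * cis s))"
              using True by simp
          qed
          then show ?thesis by (rule Lim_transform_eventually[OF tendsto_const])
        qed (simp add: laplace_ker_def)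
      qed
    qed
  qed
  \<comment> \<open>Bounds the integrand on the two vertical sides, which have length
    \<open>|g - d|\<close>. On the right it tends to 0 like \<open>exp ((1 + a) * N)\<close> as a <
    - 1, on the left through the factor r of the bound.\<close>
  define e where "e N = B * (exp (real N) * tail_powr a (exp (real N))) + B * (exp (- real N) * tail_powr a (exp (- real N)))" for N
  have dN: "norm (P d N - P g N) \<le> e N * \<bar>g - d\<bar>" if N: "N > 0" for N
  proof -
    define z1 where "z1 = - of_real (real N) + \<i> * of_real d"
    define z2 where "z2 = of_real (real N) + \<i> * of_real d"
    define z3 where "z3 = of_real (real N) + \<i> * of_real g"
    define z4 where "z4 = - of_real (real N) + \<i> * of_real g"
    define F where "F w = h (exp w)" for w
    note zd = z1_def z2_def z3_def z4_def
    have zV: "z1 \<in> V" "z2 \<in> V" "z3 \<in> V" "z4 \<in> V" by (auto simp: zd V_def)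
    have seg: "closed_segment x y \<subseteq> V" if "x \<in> V" "y \<in> V" for x y
      using that cV by (simp add: closed_segment_subset)
    have ci: "F contour_integrable_on linepath x y" if "x \<in> V" "y \<in> V" for x y
      unfolding F_def using holomorphic_on_imp_continuous_on[OF holomorphic_on_subset[OF holH seg[OF that]]]
      by (rule contour_integrable_continuous_linepath)
    let ?g = "linepath z1 z2 +++ linepath z2 z3 +++ linepath z3 z4 +++ linepath z4 z1"
    have "(F has_contour_integral 0) ?g"
    proof -
      have "path_image ?g \<subseteq> V" using seg[OF zV(1,2)] seg[OF zV(2,3)] seg[OF zV(3,4)] seg[OF zV(4,1)] by (simp add: path_image_join)
      then show ?thesis unfolding F_def by (intro Cauchy_theorem_convex_simple[OF holH cV]) auto
    qed
    moreover have "(F has_contour_integral (contour_integral (linepath z1 z2) F + (contour_integral (linepath z2 z3) F + (contour_integral (linepath z3 z4) F + contour_integral (linepath z4 z1) F)))) ?g"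
      using zV by (intro has_contour_integral_join has_contour_integral_integral ci) auto
    ultimately have s0: "contour_integral (linepath z1 z2) F + (contour_integral (linepath z2 z3) F + (contour_integral (linepath z3 z4) F + contour_integral (linepath z4 z1) F)) = 0"
      using contour_integral_unique by metis
    have hz: "contour_integral (linepath (of_real (- real N) + \<i> * of_real s) (of_real (real N) + \<i> * of_real s)) F = P s N"
      if s: "s \<in> closed_segment d g" for s
      unfolding P_eq[OF s] F_def[symmetric]
    proof (rule contour_integral_linepath_horizontal)
      show "continuous_on {- real N..real N} (\<lambda>x. F (of_real x + \<i> * of_real s))"
        unfolding F_def by (rule continuous_on_compose2[OF holomorphic_on_imp_continuous_on[OF holH]])
          (use s in \<open>auto intro!: continuous_intros simp: V_def\<close>)
    qed simp
    have h1: "contour_integral (linepath z1 z2) F = P d N" using hz[of d] by (simp add: zd)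
    have "contour_integral (linepath z4 z3) F = P g N" using hz[of g] by (simp add: zd)
    then have h3: "contour_integral (linepath z3 z4) F = - P g N"
      using contour_integral_reversepath[of "linepath z4 z3" F] by simp
    have vert: "norm (contour_integral (linepath x y) F) \<le> B * (exp t * tail_powr a (exp t)) * norm (y - x)"
      if xy: "x \<in> V" "y \<in> V" "Re x = t" "Re y = t" for x y t
    proof (rule contour_integral_bound_linepath[OF ci[OF xy(1,2)]])
      have b: "norm (F z) \<le> B * (exp t * tail_powr a (exp t))" if "Im z \<in> closed_segment d g" "Re z = t" for z
        using bound[OF that(1), of "exp t"] that by (simp add: F_def h_def ex)
      then show "norm (F z) \<le> B * (exp t * tail_powr a (exp t))" if "z \<in> closed_segment x y" for z
      proof -
        obtain u where "z = (1 - u) *\<^sub>R x + u *\<^sub>R y" using \<open>z \<in> closed_segment x y\<close> by (auto simp: closed_segment_def)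
        then have "Re z = (1 - u) * t + u * t" using xy(3,4) by simp
        then have "Re z = t" by (simp add: algebra_simps)
        moreover have "Im z \<in> closed_segment d g" using that seg[OF xy(1,2)] by (auto simp: V_def)
        ultimately show ?thesis using b by blast
      qed
      show "0 \<le> B * (exp t * tail_powr a (exp t))" using order.trans[OF norm_ge_zero b[of x]] xy by (simp add: V_def)
    qed
    have "norm (contour_integral (linepath z2 z3) F) \<le> B * (exp (real N) * tail_powr a (exp (real N))) * norm (z3 - z2)"
      using zV by (intro vert) (auto simp: zd)
    moreover have "norm (contour_integral (linepath z4 z1) F) \<le> B * (exp (- real N) * tail_powr a (exp (- real N))) * norm (z1 - z4)"
      using zV by (intro vert) (auto simp: zd)
    moreover have "norm (z3 - z2) = \<bar>g - d\<bar>" "norm (z1 - z4) = \<bar>g - d\<bar>"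
    proof -
      have "z3 - z2 = \<i> * of_real (g - d)" "z1 - z4 = \<i> * of_real (d - g)" by (simp_all add: zd algebra_simps)
      then show "norm (z3 - z2) = \<bar>g - d\<bar>" "norm (z1 - z4) = \<bar>g - d\<bar>" by (simp_all only: norm_mult norm_of_real norm_ii) auto
    qed
    moreover have "P d N - P g N = - contour_integral (linepath z2 z3) F - contour_integral (linepath z4 z1) F"
      using s0 unfolding h1 h3 by (simp add: algebra_simps eq_neg_iff_add_eq_0)
    ultimately show ?thesis
      using norm_triangle_ineq4[of "- contour_integral (linepath z2 z3) F" "contour_integral (linepath z4 z1) F"]
      by (simp add: e_def distrib_right)
  qed
  have "e \<longlonglongrightarrow> B * 0 + B * 0"
    unfolding e_def
  proof (intro tendsto_intros)
    have "(\<lambda>N. exp (real N) * exp (a * real N)) \<longlonglongrightarrow> 0" using a by real_asymp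
    then show "(\<lambda>N. exp (real N) * tail_powr a (exp (real N))) \<longlonglongrightarrow> 0"
    proof (rule Lim_transform_eventually)
      show "eventually (\<lambda>N. exp (real N) * exp (a * real N) = exp (real N) * tail_powr a (exp (real N))) sequentially"
        by (rule eventually_sequentiallyI[of 1]) (auto simp: tail_powr_def powr_def)
    qed
    have "(\<lambda>N. exp (- real N) * 1) \<longlonglongrightarrow> 0" by real_asymp
    then show "(\<lambda>N. exp (- real N) * tail_powr a (exp (- real N))) \<longlonglongrightarrow> 0" by (simp add: tail_powr_def)
  qed
  then have "(\<lambda>N. e N * \<bar>g - d\<bar>) \<longlonglongrightarrow> 0" by (auto intro: tendsto_mult_left_zero)
  then have "(\<lambda>N. P d N - P g N) \<longlonglongrightarrow> 0"
    by (rule Lim_null_comparison[rotated]) (use dN in \<open>auto simp: eventually_sequentially intro!: exI[of _ 1]\<close>)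
  moreover have "(\<lambda>N. P d N - P g N) \<longlonglongrightarrow> (LBINT r. laplace_ker d T r * f (of_real r * cis d)) - (LBINT r. laplace_ker g T r * f (of_real r * cis g))"
    by (intro tendsto_diff P_lim) auto
  ultimately show ?thesis unfolding q_laplace_eq_ker using LIMSEQ_unique by fastforce
qed

end

section \<open>Estimates from the growth permitted by the weights\<close>

lemma disc_weight_bound:
  assumes q: "q > 1" and k: "k > 0" and \<alpha>: "\<alpha> > 0" and \<delta>: "\<delta> > 0"
    and nz: "\<And>r. r \<ge> 0 \<Longrightarrow> of_real r * cis d + of_real \<delta> \<noteq> 0"
  shows "\<exists>M>0. \<forall>r>0. 1 / weight_disc q k \<alpha> \<delta> (of_real r * cis d)
    \<le> M * (1 + (if r \<ge> 1 then exp (k / (2 * ln q) * (ln r)\<^sup>2 + \<alpha> * ln r) else 0))"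
proof -
  define A where "A = k / (2 * ln q)"
  have A: "A > 0" using q k by (simp add: A_def)
  define u where "u r = norm (of_real r * cis d + complex_of_real \<delta>)" for r
  have up: "u r > 0" if "r \<ge> 0" for r using nz[OF that] by (simp add: u_def)
  have w: "1 / weight_disc q k \<alpha> \<delta> (of_real r * cis d) = exp (A * (ln (u r))\<^sup>2 + \<alpha> * ln (u r))" for r
  proof -
    have "1 / exp (- x - y) = exp (x + y)" for x y :: real
    proof -
      have "- x - y = - (x + y)" by simp
      then show ?thesis by (simp only: exp_minus inverse_eq_divide[symmetric] inverse_inverse_eq)
    qed
    from this[of "k * (ln (u r))\<^sup>2 / (2 * ln q)" "\<alpha> * ln (u r)"] show ?thesis
      unfolding weight_disc_def u_def[symmetric] by (simp only: A_def times_divide_eq_left)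
  qed
  have "continuous_on {0..1 + \<delta>} (\<lambda>r. exp (A * (ln (u r))\<^sup>2 + \<alpha> * ln (u r)))"
    using up nz unfolding u_def by (intro continuous_intros) auto
  then have "compact ((\<lambda>r. exp (A * (ln (u r))\<^sup>2 + \<alpha> * ln (u r))) ` {0..1 + \<delta>})"
    by (rule compact_continuous_image) simp
  then have "bdd_above ((\<lambda>r. exp (A * (ln (u r))\<^sup>2 + \<alpha> * ln (u r))) ` {0..1 + \<delta>})"
    by (intro bounded_imp_bdd_above compact_imp_bounded)
  then obtain M0 where "\<forall>x\<in>(\<lambda>r. exp (A * (ln (u r))\<^sup>2 + \<alpha> * ln (u r))) ` {0..1 + \<delta>}. x \<le> M0"
    unfolding bdd_above_def ..
  then have M0: "\<And>r. r \<in> {0..1 + \<delta>} \<Longrightarrow> exp (A * (ln (u r))\<^sup>2 + \<alpha> * ln (u r)) \<le> M0"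
    by (rule bspec) (rule imageI)
  \<comment> \<open>The cost of replacing \<open>|\<tau> + \<delta>|\<close> by r for large r. The
    logarithm changes by at most \<open>\<delta> / r\<close>, hence its square by at most
    \<open>2 * ln r * \<delta> / r + (\<delta> / r)^2\<close>, which is bounded because
    \<open>ln r \<le> r\<close>.\<close>
  define M1 where "M1 = exp (A * (2 * \<delta> + \<delta>\<^sup>2) + \<alpha> * \<delta>)"
  define M where "M = max M0 M1"
  have M: "M > 0" by (simp add: M_def M1_def less_max_iff_disj)
  have "exp (A * (ln (u r))\<^sup>2 + \<alpha> * ln (u r)) \<le> M * (1 + (if r \<ge> 1 then exp (A * (ln r)\<^sup>2 + \<alpha> * ln r) else 0))" if r: "r > 0" for r
  \<comment> \<open>Beyond \<open>1 + \<delta>\<close> the modulus \<open>u r\<close> is at least 1,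
    so its logarithm is nonnegative and an upper bound for it may be squared. The rest is compact
    and covered by M0.\<close>
  proof (cases "r \<le> 1 + \<delta>")
    case True
    then have "exp (A * (ln (u r))\<^sup>2 + \<alpha> * ln (u r)) \<le> M" using M0[of r] r by (simp add: M_def)
    also have "M * 1 \<le> M * (1 + (if r \<ge> 1 then exp (A * (ln r)\<^sup>2 + \<alpha> * ln r) else 0))"
      using M by (intro mult_left_mono) auto
    finally show ?thesis by simp
  next
    case False
    then have r1: "r \<ge> 1" "r > 1 + \<delta>" using \<delta> by auto
    have "u r \<ge> r - \<delta>" using norm_diff_ineq[of "of_real r * cis d" "complex_of_real \<delta>"] r \<delta> by (simp add: u_def norm_mult)
    then have u1: "u r \<ge> 1" using r1 by simp
    have "u r \<le> r + \<delta>" using norm_triangle_ineq[of "of_real r * cis d" "complex_of_real \<delta>"] r \<delta> by (simp add: u_def norm_mult)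
    also have "r + \<delta> = r * (1 + \<delta> / r)" using r by (simp add: field_simps)
    finally have "ln (u r) \<le> ln (r * (1 + \<delta> / r))" using u1 by (intro ln_mono) auto
    also have "\<dots> = ln r + ln (1 + \<delta> / r)"
    proof -
      have "1 + \<delta> / r > 0" using r \<delta> by (intro add_pos_pos) auto
      then show ?thesis using r by (rule ln_mult_pos[rotated])
    qed
    also have "ln (1 + \<delta> / r) \<le> \<delta> / r" using r \<delta> by (intro ln_add_one_self_le_self) auto
    finally have l1: "ln (u r) \<le> ln r + \<delta> / r" by simp
    have dr: "0 \<le> \<delta> / r" "\<delta> / r \<le> \<delta>" using r1 \<delta> by (auto simp: divide_le_eq mult_left_le_one_le field_simps)
    have lr: "0 \<le> ln r" "ln r \<le> r" using r1 ln_bound[of r] by auto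
    have lu: "0 \<le> ln (u r)" using u1 by simp
    have "(ln (u r))\<^sup>2 \<le> (ln r + \<delta> / r)\<^sup>2" using l1 lu by (intro power_mono)
    also have "\<dots> = (ln r)\<^sup>2 + 2 * (ln r * (\<delta> / r)) + (\<delta> / r)\<^sup>2" by (simp add: power2_sum)
    also have "ln r * (\<delta> / r) \<le> r * (\<delta> / r)" using lr dr by (intro mult_right_mono) auto
    also have "r * (\<delta> / r) = \<delta>" using r by simp
    also have "(\<delta> / r)\<^sup>2 \<le> \<delta>\<^sup>2" using dr by (intro power_mono) auto
    finally have "(ln (u r))\<^sup>2 \<le> (ln r)\<^sup>2 + (2 * \<delta> + \<delta>\<^sup>2)" by simp
    then have "A * (ln (u r))\<^sup>2 \<le> A * ((ln r)\<^sup>2 + (2 * \<delta> + \<delta>\<^sup>2))" using A by (intro mult_left_mono) auto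
    moreover have "\<alpha> * ln (u r) \<le> \<alpha> * (ln r + \<delta>)" using l1 dr \<alpha> by (intro mult_left_mono) auto
    ultimately have "A * (ln (u r))\<^sup>2 + \<alpha> * ln (u r) \<le> (A * (2 * \<delta> + \<delta>\<^sup>2) + \<alpha> * \<delta>) + (A * (ln r)\<^sup>2 + \<alpha> * ln r)"
      by (simp add: algebra_simps)
    then have "exp (A * (ln (u r))\<^sup>2 + \<alpha> * ln (u r)) \<le> exp ((A * (2 * \<delta> + \<delta>\<^sup>2) + \<alpha> * \<delta>) + (A * (ln r)\<^sup>2 + \<alpha> * ln r))"
      by (simp only: exp_le_cancel_iff)
    also have "\<dots> = M1 * exp (A * (ln r)\<^sup>2 + \<alpha> * ln r)" by (simp only: exp_add M1_def)
    also have "\<dots> \<le> M * exp (A * (ln r)\<^sup>2 + \<alpha> * ln r)" by (intro mult_right_mono) (auto simp: M_def)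
    also have "\<dots> \<le> M * (1 + exp (A * (ln r)\<^sup>2 + \<alpha> * ln r))" using M by simp
    finally show ?thesis using r1 by simp
  qed
  then show ?thesis unfolding w A_def[symmetric] using M by blast
qed

context q_base begin

lemma weight_sect_eq: "weight_sect q k \<nu> \<tau> = exp (- ((ln (norm \<tau>))\<^sup>2 / (2 * L)) - \<nu> * ln (norm \<tau>))"
  using q_gt_1 k_pos by (simp add: weight_sect_def L_def mult.commute)

text \<open>Here y stands for the modulus of a function and \<open>\<theta>\<close> for that of
  theta. The weight and \<open>env\<close> have opposite quadratic terms in \<open>ln r\<close>, and
  what remains of their product is \<open>r powr (- a)\<close>; this is useful at infinity because a
  < 0. Near 0 it is not, and there the bound K' is combined with
  \<open>env (r / t) \<ge> c1 * t / r\<close>. No variable m appears, so that constants uniform in m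
  can be obtained.\<close>

lemma sect_bound:
  assumes c: "c > 0" and \<rho>: "\<rho> > 0" and t: "t > 0" and a: "ln t / L + \<nu> - 1 / 2 < 0"
  shows "\<exists>C\<ge>0. \<forall>r>0. \<forall>y \<theta>. 0 \<le> y \<longrightarrow> y * weight_sect q k \<nu> (of_real r * cis s) \<le> K \<longrightarrow> (r < \<rho> \<longrightarrow> y \<le> K') \<longrightarrow> c * env (r / t) \<le> \<theta>
    \<longrightarrow> y / \<theta> \<le> C * (r * tail_powr (ln t / L + \<nu> - 1 / 2 - 1) r)"
proof -
  define a where "a = ln t / L + \<nu> - 1 / 2"
  define E where "E = exp ((ln t)\<^sup>2 / (2 * L) - ln t / 2)"
  define C1 where "C1 = \<bar>K\<bar> / (c * E)"
  define c1 where "c1 = exp (- L * (1 + 1/2)\<^sup>2 / 2)"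
  define C2 where "C2 = \<bar>K'\<bar> / (c * (c1 * t))"
  define C where "C = C1 + C2 + C1 * \<rho> powr a / \<rho>"
  have a0: "a < 0" using a by (simp add: a_def)
  have E: "E > 0" "c1 > 0" by (auto simp: E_def c1_def)
  have C12: "C1 \<ge> 0" "C2 \<ge> 0" "C1 * \<rho> powr a / \<rho> \<ge> 0" using E c t \<rho> by (auto simp: C1_def C2_def)
  have "y / \<theta> \<le> C * (r * tail_powr (a - 1) r)"
    if r: "r > 0" and y: "0 \<le> y" "y * weight_sect q k \<nu> (of_real r * cis s) \<le> K" "r < \<rho> \<Longrightarrow> y \<le> K'" and \<theta>: "c * env (r / t) \<le> \<theta>" for r y \<theta>
  proof -
    define w where "w = weight_sect q k \<nu> (of_real r * cis s)"
    have w0: "w > 0" by (simp add: w_def weight_sect_eq)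
    have we: "w * env (r / t) = E * r powr (- a)"
    proof -
      have "- ((ln r)\<^sup>2 / (2 * L)) - \<nu> * ln r + ((ln r - ln t)\<^sup>2 / (2 * L) + (ln r - ln t) / 2)
        = ((ln t)\<^sup>2 / (2 * L) - ln t / 2) + - a * ln r"
        using L_pos by (simp add: a_def field_simps power2_eq_square)
      then show ?thesis
        using r t by (simp add: w_def weight_sect_eq env_def E_def norm_mult ln_div powr_def flip: exp_add)
    qed
    have th: "y / \<theta> \<le> y / (c * env (r / t))"
    proof -
      have "0 < c * env (r / t)" using c by simp
      then have "0 < \<theta> * (c * env (r / t))" using \<theta> by (intro mult_pos_pos[of \<theta>]) linarith+
      then show ?thesis using \<theta> y by (intro divide_left_mono)
    qed
    also have "\<dots> = (y * w) / (c * (w * env (r / t)))" using w0 by (simp add: field_simps)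
    also have "\<dots> \<le> \<bar>K\<bar> / (c * (w * env (r / t)))" using y w0 c by (intro divide_right_mono mult_nonneg_nonneg) (auto simp: w_def less_imp_le)
    also have "\<dots> = C1 * r powr a" unfolding we using r by (simp add: C1_def powr_minus field_simps)
    finally have b1: "y / \<theta> \<le> C1 * r powr a" .
    \<comment> \<open>In the middle range the power is still used, but r stays away from 0 and
      \<open>r powr a\<close> is at most \<open>\<rho> powr a\<close>.\<close>
    consider "r > 1" | "r \<le> 1" "r < \<rho>" | "r \<le> 1" "\<rho> \<le> r" by linarith
    then show ?thesis
    proof cases
      case 1
      have "C1 * r powr a \<le> C * r powr a" using C12 by (intro mult_right_mono) (auto simp: C_def)
      moreover have "C * r powr a = C * (r * tail_powr (a - 1) r)" using r 1 by (simp add: powr_diff tail_powr_def)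
      ultimately show ?thesis using b1 by linarith
    next
      case 2
      have "env (r / t) \<ge> c1 * (r / t) powr (- 1)" using env_ge[of "r / t" 1] r t by (simp add: c1_def)
      also have "(r / t) powr (- 1) = t / r" using r t by (simp add: powr_minus)
      finally have "c * env (r / t) \<ge> c * (c1 * (t / r))" using c by (intro mult_left_mono) auto
      then have "y / (c * env (r / t)) \<le> \<bar>K'\<bar> / (c * (c1 * (t / r)))"
        using y(1) y(3)[OF 2(2)] c E r t by (intro frac_le) auto
      also have "\<dots> = C2 * r" using r by (simp add: C2_def)
      also have "\<dots> \<le> C * r" using C12 r by (intro mult_right_mono) (auto simp: C_def)
      finally show ?thesis using th 2 by (simp add: tail_powr_def)
    next
      case 3
      have "C1 * r powr a \<le> C1 * \<rho> powr a" using C12 3 \<rho> a0 by (intro mult_left_mono powr_mono2') auto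
      also have "\<dots> = C1 * \<rho> powr a / \<rho> * \<rho>" using \<rho> by simp
      also have "\<dots> \<le> C1 * \<rho> powr a / \<rho> * r" using C12 3 by (intro mult_left_mono) auto
      also have "\<dots> \<le> C * r" using C12 r by (intro mult_right_mono) (auto simp: C_def)
      finally show ?thesis using b1 3 by (simp add: tail_powr_def)
    qed
  qed
  then have "\<forall>r>0. \<forall>y \<theta>. 0 \<le> y \<longrightarrow> y * weight_sect q k \<nu> (of_real r * cis s) \<le> K \<longrightarrow> (r < \<rho> \<longrightarrow> y \<le> K') \<longrightarrow> c * env (r / t) \<le> \<theta>
    \<longrightarrow> y / \<theta> \<le> C * (r * tail_powr (a - 1) r)" by blast
  moreover have "C \<ge> 0" using C12 by (simp add: C_def)
  ultimately show ?thesis unfolding a_def by blast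
qed

lemma quadratic_exp_bound:
  assumes "a > (0::real)"
  shows "- a * x\<^sup>2 + b * x \<le> b\<^sup>2 / (4 * a)"
proof -
  have "b\<^sup>2 / (4 * a) - (- a * x\<^sup>2 + b * x) = (2 * a * x - b)\<^sup>2 / (4 * a)"
    using assms by (simp add: field_simps power2_eq_square)
  also have "\<dots> \<ge> 0" using assms by simp
  finally show ?thesis by simp
qed

text \<open>If the quadratic coefficient is strictly below that of theta, a Gaussian
  \<open>exp (- a * (ln r)^2 + b * ln r)\<close> is left, which is bounded for every b. Hence t may
  be any positive number. This is the situation of \<open>\<psi>1\<close> in the transform of order
  \<open>kappa k1 k2\<close>.\<close>

lemma slow_growth_bound:
  assumes t: "t > 0" and A: "A < 1 / (2 * L)"
  shows "\<exists>C\<ge>0. \<forall>r>0. (1 + (if r \<ge> 1 then exp (A * (ln r)\<^sup>2 + \<alpha> * ln r) else 0)) / (env (r / t) * r) \<le> C * tail_powr (- 2) r"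
proof -
  obtain C0 where C0: "C0 > 0" "\<And>r. r > 0 \<Longrightarrow> 1 / (env (r * (1 / t)) * r) \<le> C0 * tail_powr (- 2) r"
    using inverse_env_tail_powr[of "1 / t"] t by auto
  define a where "a = 1 / (2 * L) - A"
  define b where "b = ln t / L + \<alpha> + 1 / 2"
  have a: "a > 0" using A by (simp add: a_def)
  define C1 where "C1 = exp (b\<^sup>2 / (4 * a) - (ln t)\<^sup>2 / (2 * L) + ln t / 2)"
  have "(1 + (if r \<ge> 1 then exp (A * (ln r)\<^sup>2 + \<alpha> * ln r) else 0)) / (env (r / t) * r) \<le> (C0 + C1) * tail_powr (- 2) r" if r: "r > 0" for r
  proof -
    have "(if r \<ge> 1 then exp (A * (ln r)\<^sup>2 + \<alpha> * ln r) else 0) / (env (r / t) * r) \<le> C1 * tail_powr (- 2) r"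
    proof (cases "r \<ge> 1")
      case True
      have "exp (A * (ln r)\<^sup>2 + \<alpha> * ln r) / (env (r / t) * r) = exp ((A * (ln r)\<^sup>2 + \<alpha> * ln r) - ((ln r - ln t)\<^sup>2 / (2 * L) + (ln r - ln t) / 2 + ln r))"
        using r t by (simp add: env_def ln_div exp_diff exp_add)
      also have "(A * (ln r)\<^sup>2 + \<alpha> * ln r) - ((ln r - ln t)\<^sup>2 / (2 * L) + (ln r - ln t) / 2 + ln r)
        = (- a * (ln r)\<^sup>2 + b * ln r) - (ln t)\<^sup>2 / (2 * L) + ln t / 2 + (- 2) * ln r"
        using L_pos by (simp add: a_def b_def field_simps power2_eq_square)
      also have "\<dots> \<le> (b\<^sup>2 / (4 * a) - (ln t)\<^sup>2 / (2 * L) + ln t / 2) + (- 2) * ln r"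
        using quadratic_exp_bound[OF a, of "ln r" b] by simp
      finally have "exp (A * (ln r)\<^sup>2 + \<alpha> * ln r) / (env (r / t) * r) \<le> exp ((b\<^sup>2 / (4 * a) - (ln t)\<^sup>2 / (2 * L) + ln t / 2) + (- 2) * ln r)"
        by (simp only: exp_le_cancel_iff)
      also have "\<dots> = C1 * r powr (- 2)" unfolding exp_add C1_def using r by (simp add: powr_def)
      also have "\<dots> \<le> C1 * tail_powr (- 2) r" using True by (auto simp: tail_powr_def C1_def)
      finally show ?thesis using True by simp
    next
      case False
      then show ?thesis using tail_powr_pos[OF r, of "- 2"] by (simp add: C1_def)
    qed
    then show ?thesis using C0(2)[OF r] by (simp add: add_divide_distrib distrib_right)
  qed
  then show ?thesis using C0(1) by (intro exI[of _ "C0 + C1"]) (auto simp: C1_def add_nonneg_nonneg)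
qed

lemma inverse_env_integrable: "x > 0 \<Longrightarrow> set_integrable lborel {0<..} (\<lambda>r. 1 / env (r * x) / r)"
proof -
  assume x: "x > 0"
  obtain C where C: "C > 0" "\<And>r. r > 0 \<Longrightarrow> 1 / (env (r * x) * r) \<le> C * tail_powr (- 2) r"
    using inverse_env_tail_powr[OF x] by auto
  show ?thesis
  proof (rule set_integrable_bound)
    show "set_integrable lborel {0<..} (\<lambda>r. C * tail_powr (- 2) r)"
      by (intro set_integrable_mult_right) (use set_integrable_tail_powr[of "- 2"] in auto)
    have "set_borel_measurable borel {0<..} (\<lambda>r. 1 / env (r * x) / r)"
      unfolding env_def using x L_pos by (intro set_measurable_continuous_on continuous_intros) auto
    then show "set_borel_measurable lborel {0<..} (\<lambda>r. 1 / env (r * x) / r)" by (simp add: set_borel_measurable_def)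
    show "AE r in lborel. r \<in> {0<..} \<longrightarrow> norm (1 / env (r * x) / r) \<le> norm (C * tail_powr (- 2) r)"
    proof (intro AE_I2 impI)
      fix r :: real assume "r \<in> {0<..}"
      then show "norm (1 / env (r * x) / r) \<le> norm (C * tail_powr (- 2) r)"
        using C(2)[of r] C(1) tail_powr_pos[of r "- 2"] env_pos[of "r * x"] by (simp add: abs_of_pos)
    qed
  qed
qed

text \<open>Now the quadratic terms cancel exactly. What remains is
  \<open>(\<alpha> + ln t / L) * ln r\<close> and terms that are nonpositive for t \<le> 1, which
  gives a bound uniform in small \<open>\<tau>\<close>. For the bounded part of f, the dilation
  invariance of dr / r turns the integral of \<open>1 / env (r / t)\<close> into I0, which does not
  depend on t.\<close>

theorem q_laplace_disc_bounded:
  assumes c: "c > 0"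
  shows "\<exists>B\<ge>0. \<forall>\<tau> f y. \<tau> \<noteq> 0 \<longrightarrow> norm \<tau> \<le> 1 \<longrightarrow> \<alpha> + ln (norm \<tau>) / L \<le> 0 \<longrightarrow> 0 \<le> y
    \<longrightarrow> (\<forall>r>0. c * env (r / norm \<tau>) \<le> norm (TH (of_real r * cis d / \<tau>)))
    \<longrightarrow> (\<forall>r>0. norm (f (of_real r * cis d)) \<le> y * (1 + (if r \<ge> 1 then exp ((ln r)\<^sup>2 / (2 * L) + \<alpha> * ln r) else 0)))
    \<longrightarrow> norm (q_laplace q k d f \<tau>) \<le> y * B"
proof -
  define I0 where "I0 = (LBINT r:{0<..}. 1 / env r / r)"
  \<comment> \<open>Of the exponent, 1 comes from dr / r and 1/2 from the linear term in
    \<open>env\<close>.\<close>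
  define I1 where "I1 = (LBINT r:{0<..}. tail_powr (- 3/2) r)"
  define B where "B = 1 / L * (1 / c * (I0 + I1))"
  have I: "I0 \<ge> 0" "I1 \<ge> 0" unfolding I0_def I1_def set_lebesgue_integral_def
    by (auto intro!: integral_nonneg simp: indicator_def tail_powr_pos less_imp_le)
  have B: "B \<ge> 0" using I c L_pos by (simp add: B_def)
  have "norm (q_laplace q k d f \<tau>) \<le> y * B"
    if \<tau>: "\<tau> \<noteq> 0" "norm \<tau> \<le> 1" "\<alpha> + ln (norm \<tau>) / L \<le> 0" and y: "0 \<le> y"
      and th: "\<And>r. r > 0 \<Longrightarrow> c * env (r / norm \<tau>) \<le> norm (TH (of_real r * cis d / \<tau>))"
      and f: "\<And>r. r > 0 \<Longrightarrow> norm (f (of_real r * cis d)) \<le> y * (1 + (if r \<ge> 1 then exp ((ln r)\<^sup>2 / (2 * L) + \<alpha> * ln r) else 0))"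
    for \<tau> f y
  proof -
    define t where "t = norm \<tau>"
    have t: "t > 0" "t \<le> 1" "\<alpha> + ln t / L \<le> 0" using \<tau> by (auto simp: t_def)
    define G where "G r = y / c * (1 / env (r * (1 / t)) / r + tail_powr (- 3/2) r)" for r
    have Gi: "set_integrable lborel {0<..} G"
      unfolding G_def using inverse_env_integrable[of "1 / t"] set_integrable_tail_powr[of "- 3/2"] t
      by (intro set_integrable_mult_right set_integral_add(1)) auto
    have GI: "(LBINT r:{0<..}. G r) = y / c * (I0 + I1)"
    proof -
      have "(LBINT r:{0<..}. G r) = y / c * ((LBINT r:{0<..}. 1 / env (r * (1 / t)) / r) + I1)"
        unfolding G_def I1_def using inverse_env_integrable[of "1 / t"] set_integrable_tail_powr[of "- 3/2"] t
        by (subst set_integral_mult_right, subst set_integral_add(2)) auto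
      also have "(LBINT r:{0<..}. 1 / env (r * (1 / t)) / r) = I0"
        unfolding I0_def using haar_scale_integral[of "1 / t" "\<lambda>r. 1 / env r"] t by (simp add: mult.commute)
      finally show ?thesis .
    qed
    have bd: "norm (laplace_ker d \<tau> r * f (of_real r * cis d)) \<le> indicator {0<..} r *\<^sub>R G r" for r
    proof (cases "r > 0")
      case True
      define Y where "Y = (if r \<ge> 1 then exp ((ln r)\<^sup>2 / (2 * L) + \<alpha> * ln r) else 0)"
      have Yb: "Y / (env (r / t) * r) \<le> tail_powr (- 3/2) r"
      proof (cases "r \<ge> 1")
        case r1: True
        have "Y / (env (r / t) * r) = exp (((ln r)\<^sup>2 / (2 * L) + \<alpha> * ln r) - ((ln r - ln t)\<^sup>2 / (2 * L) + (ln r - ln t) / 2 + ln r))"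
          using True t r1 by (simp add: Y_def env_def ln_div exp_diff exp_add)
        also have "((ln r)\<^sup>2 / (2 * L) + \<alpha> * ln r) - ((ln r - ln t)\<^sup>2 / (2 * L) + (ln r - ln t) / 2 + ln r)
          = (\<alpha> + ln t / L) * ln r - (ln t)\<^sup>2 / (2 * L) + ln t / 2 + (- 3/2) * ln r"
          using L_pos by (simp add: field_simps power2_eq_square)
        also have "\<dots> \<le> (- 3/2) * ln r"
        proof -
          have "(\<alpha> + ln t / L) * ln r \<le> 0" using t r1 by (intro mult_nonpos_nonneg) auto
          moreover have "(ln t)\<^sup>2 / (2 * L) \<ge> 0" using L_pos by simp
          moreover have "ln t \<le> 0" using t by simp
          ultimately show ?thesis by linarith
        qed
        finally have "Y / (env (r / t) * r) \<le> exp ((- 3/2) * ln r)" by (simp only: exp_le_cancel_iff)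
        then show ?thesis using True r1 by (auto simp: tail_powr_def powr_def)
      next
        case False
        then show ?thesis using tail_powr_pos[OF True, of "- 3/2"] by (simp add: Y_def)
      qed
      have cp: "c * env (r / t) > 0" using c by simp
      have "norm (laplace_ker d \<tau> r * f (of_real r * cis d)) = norm (f (of_real r * cis d)) / (norm (TH (of_real r * cis d / \<tau>)) * r)"
        using True by (simp add: laplace_ker_def norm_mult norm_divide)
      also have "\<dots> \<le> (y * (1 + Y)) / ((c * env (r / t)) * r)"
        using f[OF True] th[OF True] True cp y by (intro frac_le mult_right_mono) (auto simp: Y_def t_def)
      also have "\<dots> = y / c * (1 / env (r * (1 / t)) / r + Y / (env (r / t) * r))"
        by (simp add: add_divide_distrib distrib_left)
      also have "\<dots> \<le> G r" unfolding G_def using y c Yb by (intro mult_left_mono add_left_mono) auto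
      finally show ?thesis using True by simp
    qed (simp add: laplace_ker_def)
    have "norm (LBINT r. laplace_ker d \<tau> r * f (of_real r * cis d)) \<le> (LBINT r:{0<..}. G r)"
    proof (cases "integrable lborel (\<lambda>r. laplace_ker d \<tau> r * f (of_real r * cis d))")
      case True
      show ?thesis unfolding set_lebesgue_integral_def
        by (rule Bochner_Integration.integral_norm_bound_integral[OF True _ bd]) (use Gi in \<open>simp add: set_integrable_def\<close>)
    next
      \<comment> \<open>The integral of a non-integrable function is 0 by convention, which
        satisfies the bound.\<close>
      case False
      then show ?thesis unfolding GI using y c I by (simp add: not_integrable_integral_eq)
    qed
    then have "1 / L * norm (LBINT r. laplace_ker d \<tau> r * f (of_real r * cis d)) \<le> 1 / L * (y / c * (I0 + I1))"
      unfolding GI using L_pos by (intro mult_left_mono) auto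
    then show ?thesis unfolding q_laplace_eq_ker norm_mult B_def using L_pos by (simp add: norm_divide)
  qed
  then show ?thesis using B by blast
qed

lemma laplace_domI:
  assumes T: "T \<noteq> 0" and a: "a < - 1" and f: "continuous_on (ray d \<times> UNIV) (\<lambda>(\<tau>, m). f \<tau> m)"
    and bound: "\<And>r m. r > 0 \<Longrightarrow> norm (laplace_ker d T r * f (of_real r * cis d) m) \<le> C * tail_powr a r * exp (- b * \<bar>m\<bar>)"
  shows "laplace_dom d b f T"
  unfolding laplace_dom_def
proof (intro conjI exI[of _ "\<lambda>r. C * tail_powr a r"] allI impI)
  have "continuous_on ({0<..} \<times> UNIV) (\<lambda>x. case (of_real (fst x) * cis d, snd x) of (\<tau>, m) \<Rightarrow> f \<tau> m)"
    by (rule continuous_on_compose2[OF f]) (auto intro!: continuous_intros simp: ray_def)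
  then have "(\<lambda>x. indicator ({0<..} \<times> UNIV) x *\<^sub>R (case (of_real (fst x) * cis d, snd x) of (\<tau>, m) \<Rightarrow> f \<tau> m)) \<in> borel_measurable borel"
    by (rule borel_measurable_continuous_on_indicator[rotated]) (auto intro!: borel_open open_Times)
  moreover have "(\<lambda>x. indicator ({0<..} \<times> UNIV) x *\<^sub>R (case (of_real (fst x) * cis d, snd x) of (\<tau>, m) \<Rightarrow> f \<tau> m))
     = (\<lambda>(r, m). indicator {0<..} r *\<^sub>R f (of_real r * cis d) m)"
    by (auto simp: fun_eq_iff indicator_def)
  ultimately show "(\<lambda>(r, m). indicator {0<..} r *\<^sub>R f (of_real r * cis d) m) \<in> borel_measurable (borel \<Otimes>\<^sub>M borel)"
    by (simp add: borel_prod)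
  show "set_integrable lborel {0<..} (\<lambda>r. C * tail_powr a r)"
    by (intro set_integrable_mult_right) (use set_integrable_tail_powr[OF a] in auto)
qed (use T bound in auto)

text \<open>Made non-strict, the condition defining \<open>R_dom\<close> is a closed condition on
  the unit vector \<open>cis d * |\<tau>| / \<tau>\<close>, and r = \<open>|\<tau>|\<close> shows
  that it excludes - 1. The bound for compact sets of directions thus holds uniformly on the whole
  domain.\<close>

lemma Theta_lower_R_dom:
  assumes "\<delta> > 0"
  shows "\<exists>c>0. \<forall>\<tau>\<in>R_dom d \<delta>. \<forall>r>0. c * env (r / norm \<tau>) \<le> norm (TH (of_real r * cis d / \<tau>))"
proof -
  define K where "K = sphere (0::complex) 1 \<inter> (\<Inter>s\<in>{0..}. {w. \<delta> \<le> norm (1 + of_real s * w)})"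
  have cK: "compact K" unfolding K_def
    by (intro compact_Int_closed closed_INT ballI closed_Collect_le continuous_intros) auto
  have nK: "- 1 \<notin> K" using assms by (auto simp: K_def intro!: bexI[of _ 1])
  have sK: "K \<subseteq> sphere 0 1" by (auto simp: K_def)
  obtain c where c: "c > 0" "\<And>r w. r > 0 \<Longrightarrow> w \<in> K \<Longrightarrow> c * env r \<le> norm (TH (of_real r * w))"
    using Theta_lower_bound[OF cK sK nK] by blast
  have "c * env (r / norm \<tau>) \<le> norm (TH (of_real r * cis d / \<tau>))" if \<tau>: "\<tau> \<in> R_dom d \<delta>" and r: "r > 0" for \<tau> r
  proof -
    have t: "\<tau> \<noteq> 0" "\<And>r. r \<ge> 0 \<Longrightarrow> norm (1 + cis d * of_real r / \<tau>) > \<delta>" using \<tau> by (auto simp: R_dom_def)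
    define w where "w = cis d * of_real (norm \<tau>) / \<tau>"
    have "\<delta> \<le> norm (1 + of_real s * w)" if "s \<ge> 0" for s
      using t(2)[of "s * norm \<tau>"] that by (simp add: w_def mult_ac)
    then have "w \<in> K" using t(1) by (simp add: K_def w_def norm_mult norm_divide)
    moreover have "of_real (r / norm \<tau>) * w = of_real r * cis d / \<tau>" using t(1) by (simp add: w_def)
    ultimately show ?thesis using c(2)[of "r / norm \<tau>" w] r t(1) by simp
  qed
  then show ?thesis using c(1) by blast
qed

text \<open>Again compactness of a set of directions, here of those swept while the halfline is
  rotated from d to g; - 1 is excluded as no such halfline meets - T.\<close>

lemma Theta_lower_segment:
  assumes T: "T \<noteq> 0" and dir: "\<And>s. s \<in> closed_segment d g \<Longrightarrow> - T \<notin> ray s"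
  shows "\<exists>c>0. \<forall>s\<in>closed_segment d g. \<forall>r>0. c * env (r / norm T) \<le> norm (TH (of_real r * cis s / T))"
proof -
  define K where "K = (\<lambda>s. cis s * of_real (norm T) / T) ` closed_segment d g"
  have cK: "compact K" unfolding K_def
    using T by (intro compact_continuous_image continuous_intros) auto
  have nK: "- 1 \<notin> K"
  proof
    assume "- 1 \<in> K"
    then obtain s where s: "s \<in> closed_segment d g" "cis s * of_real (norm T) / T = - 1" by (auto simp: K_def)
    then have "- T = of_real (norm T) * cis s" using T by (simp add: field_simps)
    then have "- T \<in> ray s" using T by (auto simp: ray_def)
    then show False using dir[OF s(1)] by simp
  qed
  have sK: "K \<subseteq> sphere 0 1" using T by (auto simp: K_def norm_mult norm_divide)
  obtain c where c: "c > 0" "\<And>r w. r > 0 \<Longrightarrow> w \<in> K \<Longrightarrow> c * env r \<le> norm (TH (of_real r * w))"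
    using Theta_lower_bound[OF cK sK nK] by blast
  have "c * env (r / norm T) \<le> norm (TH (of_real r * cis s / T))" if s: "s \<in> closed_segment d g" and r: "r > 0" for s r
  proof -
    have "of_real (r / norm T) * (cis s * of_real (norm T) / T) = of_real r * cis s / T" using T by simp
    then show ?thesis using c(2)[of "r / norm T" "cis s * of_real (norm T) / T"] s r T by (auto simp: K_def)
  qed
  then show ?thesis using c(1) by blast
qed

end

section \<open>From the norms of the function spaces to existence of the transforms\<close>

lemma fourier_weight_ge: "\<mu> \<ge> 0 \<Longrightarrow> exp (\<beta> * \<bar>m\<bar>) \<le> fourier_weight \<beta> \<mu> m"
  by (simp add: fourier_weight_def ge_one_powr_ge_zero)

lemma le_exp_neg: "y * exp (b * x) \<le> K \<Longrightarrow> y \<le> K * exp (- b * (x::real))"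
  by (simp add: exp_minus field_simps)

lemma E_space_decay:
  assumes "h \<in> E_space \<beta> \<mu>" "\<mu> \<ge> 0"
  shows "\<exists>K. \<forall>m. norm (h m) \<le> K * exp (- \<beta> * \<bar>m\<bar>)" "decay \<beta> h"
proof -
  obtain K where K: "\<And>m. fourier_weight \<beta> \<mu> m * norm (h m) \<le> K"
    using assms(1) by (auto simp: E_space_def bdd_above_def)
  have b: "norm (h m) \<le> K * exp (- \<beta> * \<bar>m\<bar>)" for m
  proof (rule le_exp_neg)
    have "exp (\<beta> * \<bar>m\<bar>) * norm (h m) \<le> fourier_weight \<beta> \<mu> m * norm (h m)"
      using fourier_weight_ge[OF assms(2)] by (intro mult_right_mono) auto
    then show "norm (h m) * exp (\<beta> * \<bar>m\<bar>) \<le> K" using K[of m] by (simp add: mult.commute)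
  qed
  then show "\<exists>K. \<forall>m. norm (h m) \<le> K * exp (- \<beta> * \<bar>m\<bar>)" by blast
  have "h \<in> borel_measurable borel"
    using assms(1) by (intro borel_measurable_continuous_onI) (simp add: E_space_def)
  then show "decay \<beta> h" using b by (rule decayI)
qed

text \<open>The polynomial factor of the Fourier weight is at least 1 and is given up; what is kept
  is the exponential rate in m and the weight in \<open>\<tau>\<close>.\<close>

lemma weighted_space_bound:
  assumes "h \<in> weighted_space X Y W \<beta> \<mu>" "\<mu> \<ge> 0" "\<And>\<tau>. W \<tau> > 0"
  obtains K where "K \<ge> 0" "\<And>\<tau> m. \<tau> \<in> X \<Longrightarrow> norm (h \<tau> m) * W \<tau> \<le> K * exp (- \<beta> * \<bar>m\<bar>)"
proof -
  obtain K where K: "\<And>\<tau> m. \<tau> \<in> X \<Longrightarrow> fourier_weight \<beta> \<mu> m * W \<tau> * norm (h \<tau> m) \<le> K"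
    using assms(1) by (force simp: weighted_space_def bdd_above_def)
  have "norm (h \<tau> m) * W \<tau> \<le> \<bar>K\<bar> * exp (- \<beta> * \<bar>m\<bar>)" if "\<tau> \<in> X" for \<tau> m
  proof (rule le_exp_neg)
    have "exp (\<beta> * \<bar>m\<bar>) * (W \<tau> * norm (h \<tau> m)) \<le> fourier_weight \<beta> \<mu> m * (W \<tau> * norm (h \<tau> m))"
      using fourier_weight_ge[OF assms(2)] assms(3)[of \<tau>] by (intro mult_right_mono mult_nonneg_nonneg) auto
    then show "norm (h \<tau> m) * W \<tau> * exp (\<beta> * \<bar>m\<bar>) \<le> \<bar>K\<bar>" using K[OF that, of m] by (simp add: mult_ac)
  qed
  then show ?thesis using that[of "\<bar>K\<bar>"] by simp
qed

lemma decay_bound_measurable: "decay b h \<Longrightarrow> b > 0 \<Longrightarrow> h \<in> borel_measurable borel \<and> (\<exists>B. \<forall>m. norm (h m) \<le> B)"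
  using decayE[of b h 0] decay_measurable[of b h] by auto

context q_base begin

lemma laplace_dom_sect:
  assumes f: "f \<in> Exp_sect q k b \<mu> \<nu> S Rb" and \<mu>: "\<mu> \<ge> 0" and S: "ray d \<subseteq> S" and \<rho>: "\<rho> > 0"
    and near: "\<And>r m. 0 < r \<Longrightarrow> r < \<rho> \<Longrightarrow> norm (f (of_real r * cis d) m) \<le> K' * exp (- b * \<bar>m\<bar>)"
    and T: "T \<in> R_dom d \<delta>" "\<delta> > 0" and a: "ln (norm T) / L + \<nu> - 1 / 2 < 0"
  shows "laplace_dom d b f T"
proof -
  have T0: "T \<noteq> 0" using T by (simp add: R_dom_def)
  obtain c where c: "c > 0" "\<And>r. r > 0 \<Longrightarrow> c * env (r / norm T) \<le> norm (TH (of_real r * cis d / T))"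
    using Theta_lower_R_dom[OF T(2)] T(1) by blast
  have f': "f \<in> weighted_space (dom_sect S Rb) (S \<union> Rb) (weight_sect q k \<nu>) b \<mu>" using f by (simp add: Exp_sect_def)
  have wp: "weight_sect q k \<nu> \<tau> > 0" for \<tau> by (simp add: weight_sect_def)
  obtain K where K: "K \<ge> 0" "\<And>\<tau> m. \<tau> \<in> dom_sect S Rb \<Longrightarrow> norm (f \<tau> m) * weight_sect q k \<nu> \<tau> \<le> K * exp (- b * \<bar>m\<bar>)"
    using weighted_space_bound[OF f' \<mu> wp] by blast
  have nT: "norm T > 0" using T0 by simp
  obtain C where C: "C \<ge> 0" "\<And>r y \<theta>. r > 0 \<Longrightarrow> 0 \<le> y \<Longrightarrow> y * weight_sect q k \<nu> (of_real r * cis d) \<le> K \<Longrightarrow> (r < \<rho> \<Longrightarrow> y \<le> K') \<Longrightarrow> c * env (r / norm T) \<le> \<theta>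
    \<Longrightarrow> y / \<theta> \<le> C * (r * tail_powr (ln (norm T) / L + \<nu> - 1 / 2 - 1) r)"
    using sect_bound[OF c(1) \<rho> nT a, of d K K'] by blast
  show ?thesis
  proof (rule laplace_domI[OF T0])
    show "ln (norm T) / L + \<nu> - 1 / 2 - 1 < - 1" using a by linarith
    have "ray d \<times> UNIV \<subseteq> dom_sect S Rb \<times> (UNIV :: real set)" using S by (auto simp: dom_sect_def)
    then show "continuous_on (ray d \<times> UNIV) (\<lambda>(\<tau>, m). f \<tau> m)"
      using f' continuous_on_subset unfolding weighted_space_def by blast
    fix r m assume r: "(r::real) > 0"
    \<comment> \<open>The decay in m is moved into y, so that \<open>sect_bound\<close> applies with
      constants independent of m.\<close>
    define y where "y = norm (f (of_real r * cis d) m) * exp (b * \<bar>m\<bar>)"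
    have em: "exp (- b * \<bar>m\<bar>) * exp (b * \<bar>m\<bar>) = 1" by (simp flip: exp_add)
    have "of_real r * cis d \<in> dom_sect S Rb" using S r by (auto simp: dom_sect_def ray_def)
    from K(2)[OF this, of m] have "(norm (f (of_real r * cis d) m) * weight_sect q k \<nu> (of_real r * cis d)) * exp (b * \<bar>m\<bar>) \<le> (K * exp (- b * \<bar>m\<bar>)) * exp (b * \<bar>m\<bar>)"
      by (intro mult_right_mono) auto
    moreover have "(K * exp (- b * \<bar>m\<bar>)) * exp (b * \<bar>m\<bar>) = K" by (simp only: mult.assoc em mult_1_right)
    moreover have "(norm (f (of_real r * cis d) m) * weight_sect q k \<nu> (of_real r * cis d)) * exp (b * \<bar>m\<bar>) = y * weight_sect q k \<nu> (of_real r * cis d)"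
      by (simp only: y_def mult_ac)
    ultimately have y1: "y * weight_sect q k \<nu> (of_real r * cis d) \<le> K" by (simp only:)
    have y2: "y \<le> K'" if "r < \<rho>"
    proof -
      have "y \<le> (K' * exp (- b * \<bar>m\<bar>)) * exp (b * \<bar>m\<bar>)" unfolding y_def by (intro mult_right_mono near r that) auto
      then show ?thesis using em by (simp add: mult_ac)
    qed
    have "y / norm (TH (of_real r * cis d / T)) \<le> C * (r * tail_powr (ln (norm T) / L + \<nu> - 1 / 2 - 1) r)"
      using C(2)[OF r _ y1 y2 c(2)[OF r]] by (simp add: y_def)
    then have "y / norm (TH (of_real r * cis d / T)) / r \<le> C * tail_powr (ln (norm T) / L + \<nu> - 1 / 2 - 1) r"
      unfolding pos_divide_le_eq[OF r] by (simp only: mult_ac)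
    moreover have "norm (laplace_ker d T r * f (of_real r * cis d) m) * exp (b * \<bar>m\<bar>) = y / norm (TH (of_real r * cis d / T)) / r"
      using r by (simp add: laplace_ker_def norm_mult norm_divide y_def)
    ultimately show "norm (laplace_ker d T r * f (of_real r * cis d) m) \<le> C * tail_powr (ln (norm T) / L + \<nu> - 1 / 2 - 1) r * exp (- b * \<bar>m\<bar>)"
      by (intro le_exp_neg) simp
  qed
qed

lemma q_laplace_sect_rotate:
  assumes f: "f \<in> Exp_sect q k b \<mu> \<nu> S Rb" and \<mu>: "\<mu> \<ge> 0" and \<rho>: "\<rho> > 0"
    and dir: "admissible_direction S d T g"
    and near: "\<And>\<tau>. \<tau> \<in> S \<Longrightarrow> norm \<tau> < \<rho> \<Longrightarrow> norm (f \<tau> m) \<le> K'"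
    and T0: "T \<noteq> 0" and a: "ln (norm T) / L + \<nu> - 1 / 2 < 0"
  shows "q_laplace q k g (\<lambda>\<tau>. f \<tau> m) T = q_laplace q k d (\<lambda>\<tau>. f \<tau> m) T"
proof -
  have dir': "ray s \<subseteq> S \<and> - T \<notin> ray s" if "s \<in> closed_segment d g" for s
    using dir that by (auto simp: admissible_direction_def)
  obtain c where c: "c > 0" "\<And>r s. s \<in> closed_segment d g \<Longrightarrow> r > 0 \<Longrightarrow> c * env (r / norm T) \<le> norm (TH (of_real r * cis s / T))"
    using Theta_lower_segment[OF T0 conjunct2[OF dir']] by blast
  have f': "f \<in> weighted_space (dom_sect S Rb) (S \<union> Rb) (weight_sect q k \<nu>) b \<mu>" using f by (simp add: Exp_sect_def)
  have wp: "weight_sect q k \<nu> \<tau> > 0" for \<tau> by (simp add: weight_sect_def)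
  obtain K where K: "K \<ge> 0" "\<And>\<tau> m. \<tau> \<in> dom_sect S Rb \<Longrightarrow> norm (f \<tau> m) * weight_sect q k \<nu> \<tau> \<le> K * exp (- b * \<bar>m\<bar>)"
    using weighted_space_bound[OF f' \<mu> wp] by blast
  have nT: "norm T > 0" using T0 by simp
  \<comment> \<open>The weight depends on the modulus only, so one use of \<open>sect_bound\<close>
    covers every direction of the segment.\<close>
  have ws: "weight_sect q k \<nu> (of_real r * cis s) = weight_sect q k \<nu> (of_real r * cis d)" for r s
    by (simp add: weight_sect_def norm_mult)
  obtain C where C: "C \<ge> 0" "\<And>r y \<theta>. r > 0 \<Longrightarrow> 0 \<le> y \<Longrightarrow> y * weight_sect q k \<nu> (of_real r * cis d) \<le> K * exp (- b * \<bar>m\<bar>) \<Longrightarrow> (r < \<rho> \<Longrightarrow> y \<le> K') \<Longrightarrow> c * env (r / norm T) \<le> \<theta>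
    \<Longrightarrow> y / \<theta> \<le> C * (r * tail_powr (ln (norm T) / L + \<nu> - 1 / 2 - 1) r)"
    using sect_bound[OF c(1) \<rho> nT a, of d "K * exp (- b * \<bar>m\<bar>)" K'] by blast
  show ?thesis
  proof (rule q_laplace_rotate[OF _ T0 dir'])
    show "(\<lambda>\<tau>. f \<tau> m) holomorphic_on S"
      using f' unfolding weighted_space_def by (auto intro: holomorphic_on_subset)
    show "ln (norm T) / L + \<nu> - 1 / 2 - 1 < - 1" using a by linarith
    fix s r assume s: "s \<in> closed_segment d g" and r: "(r::real) > 0"
    have inS: "of_real r * cis s \<in> S" using dir'[OF s] r by (auto simp: ray_def)
    have h1: "norm (f (of_real r * cis s) m) * weight_sect q k \<nu> (of_real r * cis d) \<le> K * exp (- b * \<bar>m\<bar>)"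
      using K(2)[of "of_real r * cis s" m] inS by (simp add: dom_sect_def ws[of r s])
    have h2: "norm (f (of_real r * cis s) m) \<le> K'" if "r < \<rho>" using near[OF inS] r that by (simp add: norm_mult)
    show "norm (f (of_real r * cis s) m / TH (of_real r * cis s / T)) \<le> C * (r * tail_powr (ln (norm T) / L + \<nu> - 1 / 2 - 1) r)"
      unfolding norm_divide by (rule C(2)[OF r norm_ge_zero h1 h2 c(2)[OF s r]])
  qed
qed

lemma q_laplace_disc_bounded':
  assumes \<delta>: "\<delta> > 0" and A: "A \<le> 1 / (2 * L)" and K: "K \<ge> 0"
    and f: "\<And>r m. r > 0 \<Longrightarrow> norm (f (of_real r * cis d) m) \<le> K * exp (- b * \<bar>m\<bar>) * (1 + (if r \<ge> 1 then exp (A * (ln r)\<^sup>2 + \<alpha> * ln r) else 0))"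
  obtains B where "\<And>\<tau> m. \<tau> \<in> R_dom d \<delta> \<Longrightarrow> norm \<tau> \<le> 1 \<Longrightarrow> \<alpha> + ln (norm \<tau>) / L \<le> 0 \<Longrightarrow>
     norm (q_laplace q k d (\<lambda>u. f u m) \<tau>) \<le> B * exp (- b * \<bar>m\<bar>)"
proof -
  obtain c where c: "c > 0" "\<And>r \<tau>. \<tau> \<in> R_dom d \<delta> \<Longrightarrow> r > 0 \<Longrightarrow> c * env (r / norm \<tau>) \<le> norm (TH (of_real r * cis d / \<tau>))"
    using Theta_lower_R_dom[OF \<delta>] by blast
  obtain B where B: "B \<ge> 0" "\<And>\<tau> f y. \<tau> \<noteq> 0 \<Longrightarrow> norm \<tau> \<le> 1 \<Longrightarrow> \<alpha> + ln (norm \<tau>) / L \<le> 0 \<Longrightarrow> 0 \<le> y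
    \<Longrightarrow> (\<forall>r>0. c * env (r / norm \<tau>) \<le> norm (TH (of_real r * cis d / \<tau>)))
    \<Longrightarrow> (\<forall>r>0. norm (f (of_real r * cis d)) \<le> y * (1 + (if r \<ge> 1 then exp ((ln r)\<^sup>2 / (2 * L) + \<alpha> * ln r) else 0)))
    \<Longrightarrow> norm (q_laplace q k d f \<tau>) \<le> y * B"
    using q_laplace_disc_bounded[OF c(1), of \<alpha> d] by blast
  have "norm (q_laplace q k d (\<lambda>u. f u m) \<tau>) \<le> (K * B) * exp (- b * \<bar>m\<bar>)"
    if \<tau>: "\<tau> \<in> R_dom d \<delta>" "norm \<tau> \<le> 1" "\<alpha> + ln (norm \<tau>) / L \<le> 0" for \<tau> m
  proof -
    have "norm (q_laplace q k d (\<lambda>u. f u m) \<tau>) \<le> (K * exp (- b * \<bar>m\<bar>)) * B"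
    proof (rule B(2)[OF _ \<tau>(2,3)])
      show "\<tau> \<noteq> 0" using \<tau> by (simp add: R_dom_def)
      show "0 \<le> K * exp (- b * \<bar>m\<bar>)" using K by simp
      show "\<forall>r>0. c * env (r / norm \<tau>) \<le> norm (TH (of_real r * cis d / \<tau>))" using c(2)[OF \<tau>(1)] by blast
      show "\<forall>r>0. norm (f (of_real r * cis d) m) \<le> K * exp (- b * \<bar>m\<bar>) * (1 + (if r \<ge> 1 then exp ((ln r)\<^sup>2 / (2 * L) + \<alpha> * ln r) else 0))"
      proof (intro allI impI)
        fix r :: real assume r: "r > 0"
        have "A * (ln r)\<^sup>2 \<le> 1 / (2 * L) * (ln r)\<^sup>2" using A by (intro mult_right_mono) auto
        then have "exp (A * (ln r)\<^sup>2 + \<alpha> * ln r) \<le> exp ((ln r)\<^sup>2 / (2 * L) + \<alpha> * ln r)" by simp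
        then have "K * exp (- b * \<bar>m\<bar>) * (1 + (if r \<ge> 1 then exp (A * (ln r)\<^sup>2 + \<alpha> * ln r) else 0))
          \<le> K * exp (- b * \<bar>m\<bar>) * (1 + (if r \<ge> 1 then exp ((ln r)\<^sup>2 / (2 * L) + \<alpha> * ln r) else 0))"
          using K by (intro mult_left_mono) auto
        then show "norm (f (of_real r * cis d) m) \<le> K * exp (- b * \<bar>m\<bar>) * (1 + (if r \<ge> 1 then exp ((ln r)\<^sup>2 / (2 * L) + \<alpha> * ln r) else 0))"
          using f[OF r, of m] by linarith
      qed
    qed
    then show ?thesis by (simp add: mult_ac)
  qed
  then show ?thesis using that by blast
qed

text \<open>As T lies on the halfline of integration itself, theta is evaluated at positive numbers,
  far from its zeros.\<close>

lemma laplace_dom_slow: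
  assumes T: "T \<in> ray d" and A: "A < 1 / (2 * L)" and K: "K \<ge> 0"
    and cont: "continuous_on (ray d \<times> UNIV) (\<lambda>(\<tau>, m). f \<tau> m)"
    and f: "\<And>r m. r > 0 \<Longrightarrow> norm (f (of_real r * cis d) m) \<le> K * exp (- b * \<bar>m\<bar>) * (1 + (if r \<ge> 1 then exp (A * (ln r)\<^sup>2 + \<alpha> * ln r) else 0))"
  shows "laplace_dom d b f T"
proof -
  obtain t where t: "t > 0" "T = of_real t * cis d" using T by (auto simp: ray_def)
  have T0: "T \<noteq> 0" using t by simp
  have xT: "of_real r * cis d / T = of_real r * of_real (1 / t)" for r using t by simp
  have "complex_of_real (1 / t) \<notin> \<real>\<^sub>\<le>\<^sub>0" using t by (subst nonpos_Reals_of_real_iff) simp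
  then obtain c where c: "c > 0" "\<And>r. r > 0 \<Longrightarrow> c * env (r * norm (complex_of_real (1 / t))) \<le> norm (TH (of_real r * complex_of_real (1 / t)))"
    using Theta_lower_bound_dir by blast
  obtain C where C: "C \<ge> 0" "\<And>r. r > 0 \<Longrightarrow> (1 + (if r \<ge> 1 then exp (A * (ln r)\<^sup>2 + \<alpha> * ln r) else 0)) / (env (r / t) * r) \<le> C * tail_powr (- 2) r"
    using slow_growth_bound[OF t(1) A, of \<alpha>] by blast
  show ?thesis
  proof (rule laplace_domI[OF T0 _ cont])
    fix r m assume r: "(r::real) > 0"
    define Y where "Y = 1 + (if r \<ge> 1 then exp (A * (ln r)\<^sup>2 + \<alpha> * ln r) else 0)"
    have Y: "Y \<ge> 0" by (simp add: Y_def)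
    have th: "c * env (r / t) \<le> norm (TH (of_real r * cis d / T))"
      using c(2)[OF r] t by (simp add: xT norm_divide)
    have "norm (laplace_ker d T r * f (of_real r * cis d) m) = norm (f (of_real r * cis d) m) / (norm (TH (of_real r * cis d / T)) * r)"
      using r by (simp add: laplace_ker_def norm_mult norm_divide)
    also have "\<dots> \<le> (K * exp (- b * \<bar>m\<bar>) * Y) / (c * env (r / t) * r)"
      using f[OF r, of m] th r c(1) K Y by (intro frac_le mult_right_mono) (auto simp: Y_def)
    also have "\<dots> = (K * exp (- b * \<bar>m\<bar>) / c) * (Y / (env (r / t) * r))" by simp
    also have "\<dots> \<le> (K * exp (- b * \<bar>m\<bar>) / c) * (C * tail_powr (- 2) r)"
      using C(2)[OF r] K c(1) by (intro mult_left_mono) (auto simp: Y_def)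
    finally show "norm (laplace_ker d T r * f (of_real r * cis d) m) \<le> (K / c * C) * tail_powr (- 2) r * exp (- b * \<bar>m\<bar>)" by (simp add: mult_ac)
  qed simp
qed

end

lemma ray_scale: "\<tau> \<in> ray d \<Longrightarrow> c > 0 \<Longrightarrow> of_real c * \<tau> \<in> ray d"
proof -
  assume "\<tau> \<in> ray d" "c > 0"
  then obtain r where "r > 0" "\<tau> = of_real r * cis d" by (auto simp: ray_def)
  then show ?thesis using \<open>c > 0\<close> unfolding ray_def by (intro CollectI exI[of _ "c * r"]) (simp add: mult_ac)
qed

lemma Exp_disc_growth:
  assumes f: "f \<in> Exp_disc q k b \<mu> \<alpha> \<rho> \<delta> U" and "q > 1" "k > 0" "\<alpha> > 0" "\<delta> > 0" "\<mu> \<ge> 0" and U: "ray d \<subseteq> U"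
    and dist: "infdist (- of_real \<delta>) (U \<union> ball 0 \<rho>) > 0"
  obtains K where "K \<ge> 0" "\<And>r m. r > 0 \<Longrightarrow> norm (f (of_real r * cis d) m) \<le> K * exp (- b * \<bar>m\<bar>) * (1 + (if r \<ge> 1 then exp (k / (2 * ln q) * (ln r)\<^sup>2 + \<alpha> * ln r) else 0))"
    and "continuous_on (ray d \<times> UNIV) (\<lambda>(\<tau>, m). f \<tau> m)"
proof -
  \<comment> \<open>Otherwise \<open>- \<delta>\<close> would lie on the ray, hence in U, against
    its positive distance from U.\<close>
  have nz: "of_real r * cis d + of_real \<delta> \<noteq> 0" if r: "r \<ge> 0" for r
  proof
    assume "of_real r * cis d + of_real \<delta> = 0"
    then have e: "of_real r * cis d = - of_real \<delta>" by (simp add: eq_neg_iff_add_eq_0)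
    then have "r > 0" using r \<open>\<delta> > 0\<close> by (cases "r = 0") auto
    then have "- complex_of_real \<delta> \<in> U \<union> ball 0 \<rho>" using U e by (auto simp: ray_def)
    then show False using dist by simp
  qed
  obtain M where M: "M > 0" "\<And>r. r > 0 \<Longrightarrow> 1 / weight_disc q k \<alpha> \<delta> (of_real r * cis d)
    \<le> M * (1 + (if r \<ge> 1 then exp (k / (2 * ln q) * (ln r)\<^sup>2 + \<alpha> * ln r) else 0))"
    using disc_weight_bound[of q k \<alpha> \<delta> d] assms nz by blast
  have f': "f \<in> weighted_space (dom_disc \<rho> U) (U \<union> ball 0 \<rho>) (weight_disc q k \<alpha> \<delta>) b \<mu>" using f by (simp add: Exp_disc_def)
  have wp: "weight_disc q k \<alpha> \<delta> \<tau> > 0" for \<tau> by (simp add: weight_disc_def)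
  obtain K where K: "K \<ge> 0" "\<And>\<tau> m. \<tau> \<in> dom_disc \<rho> U \<Longrightarrow> norm (f \<tau> m) * weight_disc q k \<alpha> \<delta> \<tau> \<le> K * exp (- b * \<bar>m\<bar>)"
    using weighted_space_bound[OF f' \<open>\<mu> \<ge> 0\<close> wp] by blast
  show ?thesis
  proof (rule that[of "K * M"])
    show "0 \<le> K * M" using K M by simp
    have "ray d \<times> UNIV \<subseteq> dom_disc \<rho> U \<times> (UNIV :: real set)" using U by (auto simp: dom_disc_def)
    then show "continuous_on (ray d \<times> UNIV) (\<lambda>(\<tau>, m). f \<tau> m)"
      using f' continuous_on_subset unfolding weighted_space_def by blast
    fix r m assume r: "(r::real) > 0"
    define Y where "Y = 1 + (if r \<ge> 1 then exp (k / (2 * ln q) * (ln r)\<^sup>2 + \<alpha> * ln r) else 0)"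
    define w where "w = weight_disc q k \<alpha> \<delta> (of_real r * cis d)"
    have "of_real r * cis d \<in> dom_disc \<rho> U" using U r by (auto simp: dom_disc_def ray_def)
    from K(2)[OF this, of m] have "norm (f (of_real r * cis d) m) \<le> (K * exp (- b * \<bar>m\<bar>)) * (1 / w)"
      using wp[of "of_real r * cis d"] by (simp add: w_def pos_le_divide_eq)
    also have "\<dots> \<le> (K * exp (- b * \<bar>m\<bar>)) * (M * Y)"
      using M(2)[OF r] K by (intro mult_left_mono) (auto simp: w_def Y_def)
    finally show "norm (f (of_real r * cis d) m) \<le> K * M * exp (- b * \<bar>m\<bar>) * (1 + (if r \<ge> 1 then exp (k / (2 * ln q) * (ln r)\<^sup>2 + \<alpha> * ln r) else 0))"
      unfolding Y_def by (simp only: mult_ac)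
  qed
qed

section \<open>The solutions of the q-difference-differential equations\<close>

lemma dz_cong:
  assumes "open Z" "z \<in> Z" "\<And>z. z \<in> Z \<Longrightarrow> f z = g z"
  shows "dz R f z = dz R g z"
proof -
  have "eventually (\<lambda>z. f z = g z) (nhds z)"
    using assms by (auto intro: eventually_mono[OF eventually_nhds_in_open[of Z z]])
  then show ?thesis unfolding dz_def by (intro sum.cong refl arg_cong2[of _ _ _ _ "(*)"] higher_deriv_cong_ev)
qed

lemma op_P_eq:
  "op_P q k X u t z \<epsilon> =
     dz (Qpol X) (\<lambda>z. u (of_real (q powr 1) * t) z \<epsilon>) z
     - (\<epsilon> * t) ^ topd X * dz (Rpol X (topD X)) (\<lambda>z. u (of_real (q powr (real (topd X) / real k + 1)) * t) z \<epsilon>) z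
     - (\<Sum>l\<in>{1..<topD X}. \<Sum>j\<in>idx X l. t ^ texp X l j * \<epsilon> ^ eexp X l j *
          (coef_c X l j z \<epsilon> * dz (Rpol X l) (\<lambda>z. u (of_real (q powr real (qexp X l)) * t) z \<epsilon>) z))"
  by (simp only: op_P_def q_shift_def)

lemma shifts_mem:
  "1 \<in> shifts k X" "real (topd X) / real k + 1 \<in> shifts k X" "l \<in> {1..<topD X} \<Longrightarrow> real (qexp X l) \<in> shifts k X"
  by (auto simp: shifts_def)

text \<open>The operator differentiates in z but only dilates t, so agreement on an open set of z is
  needed for the finitely many dilations of one t.\<close>

lemma op_P_cong:
  assumes "open Z" "z \<in> Z" "\<And>s z. s \<in> shifts k X \<Longrightarrow> z \<in> Z \<Longrightarrow> u (of_real (q powr s) * t) z \<epsilon> = v (of_real (q powr s) * t) z \<epsilon>"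
  shows "op_P q k X u t z \<epsilon> = op_P q k X v t z \<epsilon>"
proof -
  have "dz R (\<lambda>z. u (of_real (q powr s) * t) z \<epsilon>) z = dz R (\<lambda>z. v (of_real (q powr s) * t) z \<epsilon>) z" if "s \<in> shifts k X" for s R
    using assms that by (intro dz_cong[of Z]) auto
  note * = this[OF shifts_mem(1)] this[OF shifts_mem(2)] this[OF shifts_mem(3)]
  show ?thesis unfolding op_P_eq
    by (intro arg_cong2[of _ _ _ _ "(-)"] arg_cong2[of _ _ _ _ "(*)"] sum.cong refl *)
qed

lemma inv_fourier_diff:
  assumes "decay b f" "decay b g" "z \<in> strip b"
  shows "inv_fourier (\<lambda>m. f m - g m) z = inv_fourier f z - inv_fourier g z"
  using inv_fourier_add[OF assms(1) decay_cmult[OF assms(2), of "- 1"] assms(3)] inv_fourier_cmult[of "- 1" g z] by simp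

text \<open>The equation expresses H through terms that decay in m. The inverse Fourier transform is
  applied to these, turning polynomials in im into derivatives and convolutions into products with
  \<open>coef_c\<close>.\<close>

lemma op_P_inv_fourier:
  assumes b: "b > 0" and z: "z \<in> strip b"
    and W: "\<And>s. s \<in> shifts k X \<Longrightarrow> decay b (W (of_real (q powr s) * (\<epsilon> * t)))"
    and C: "\<And>l j. l \<in> {1..<topD X} \<Longrightarrow> j \<in> idx X l \<Longrightarrow> decay b (\<lambda>m. Ccoef X l j m \<epsilon>)"
    and ex: "\<And>l j. l \<in> {1..<topD X} \<Longrightarrow> j \<in> idx X l \<Longrightarrow> texp X l j \<le> eexp X l j"
    and u: "\<And>s z. s \<in> shifts k X \<Longrightarrow> z \<in> strip b \<Longrightarrow> u (of_real (q powr s) * t) z \<epsilon> = inv_fourier (W (of_real (q powr s) * (\<epsilon> * t))) z"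
    and eq: "\<And>m. Qim X m * W (of_real (q powr 1) * (\<epsilon> * t)) m
      = (\<epsilon> * t) ^ topd X * (RDim X m * W (of_real (q powr (real (topd X) / real k + 1)) * (\<epsilon> * t)) m)
      + (\<Sum>l\<in>{1..<topD X}. \<Sum>j\<in>idx X l. (\<epsilon> ^ (eexp X l j - texp X l j) * (\<epsilon> * t) ^ texp X l j) *
          (of_real (1 / sqrt (2 * pi)) * conv (Rpol X l) (\<lambda>m. Ccoef X l j m \<epsilon>) (W (of_real (q powr real (qexp X l)) * (\<epsilon> * t))) m)) + H m"
  shows "op_P q k X u t z \<epsilon> = inv_fourier H z"
proof -
  define V where "V s = W (of_real (q powr s) * (\<epsilon> * t))" for s
  define cv where "cv l j m = of_real (1 / sqrt (2 * pi)) * conv (Rpol X l) (\<lambda>m. Ccoef X l j m \<epsilon>) (V (real (qexp X l))) m" for l j m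
  have V: "decay b (V s)" if "s \<in> shifts k X" for s using W[OF that] by (simp add: V_def)
  have dzu: "dz R (\<lambda>z. u (of_real (q powr s) * t) z \<epsilon>) z = inv_fourier (\<lambda>m. poly R (\<i> * of_real m) * V s m) z" if "s \<in> shifts k X" for s R
  proof -
    have "dz R (\<lambda>z. u (of_real (q powr s) * t) z \<epsilon>) z = dz R (inv_fourier (V s)) z"
      using u[OF that] by (intro dz_cong[OF open_strip z]) (simp add: V_def)
    then show ?thesis using dz_inv_fourier[OF V[OF that] z] by simp
  qed
  have cvd: "decay b (cv l j)" if "l \<in> {1..<topD X}" "j \<in> idx X l" for l j
    unfolding cv_def[abs_def] by (intro decay_cmult conv_decay C V shifts_mem that b)
  have cvi: "inv_fourier (cv l j) z = coef_c X l j z \<epsilon> * inv_fourier (\<lambda>m. poly (Rpol X l) (\<i> * of_real m) * V (real (qexp X l)) m) z"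
    if "l \<in> {1..<topD X}" "j \<in> idx X l" for l j
    unfolding cv_def[abs_def] coef_c_def by (rule inv_fourier_conv[OF C[OF that] V[OF shifts_mem(3)[OF that(1)]] z])
  define sD where "sD = real (topd X) / real k + 1"
  define A where "A m = Qim X m * V 1 m" for m
  define B where "B m = (\<epsilon> * t) ^ topd X * (RDim X m * V sD m)" for m
  define S where "S m = (\<Sum>l\<in>{1..<topD X}. \<Sum>j\<in>idx X l. (\<epsilon> ^ (eexp X l j - texp X l j) * (\<epsilon> * t) ^ texp X l j) * cv l j m)" for m
  have dA: "decay b A" unfolding A_def[abs_def] Qim_def by (intro decay_poly V shifts_mem)
  have dB: "decay b B" unfolding B_def[abs_def] RDim_def sD_def by (intro decay_cmult decay_poly V shifts_mem)
  have dS: "decay b S" unfolding S_def[abs_def] by (intro decay_sum decay_cmult cvd)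
  have dAB: "decay b (\<lambda>m. A m - B m)" using decay_add[OF dA decay_cmult[OF dB, of "- 1"]] by simp
  have H: "H = (\<lambda>m. A m - B m - S m)"
    using eq by (simp add: fun_eq_iff A_def B_def S_def cv_def V_def sD_def)
  have "inv_fourier H z = inv_fourier A z - inv_fourier B z - inv_fourier S z"
    unfolding H by (simp add: inv_fourier_diff[OF dAB dS z] inv_fourier_diff[OF dA dB z])
  also have "inv_fourier A z = dz (Qpol X) (\<lambda>z. u (of_real (q powr 1) * t) z \<epsilon>) z"
    unfolding dzu[OF shifts_mem(1)] A_def[abs_def] Qim_def ..
  also have "inv_fourier B z = (\<epsilon> * t) ^ topd X * dz (Rpol X (topD X)) (\<lambda>z. u (of_real (q powr (real (topd X) / real k + 1)) * t) z \<epsilon>) z"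
    unfolding dzu[OF shifts_mem(2)] B_def[abs_def] RDim_def sD_def inv_fourier_cmult ..
  also have "inv_fourier S z = (\<Sum>l\<in>{1..<topD X}. \<Sum>j\<in>idx X l. (\<epsilon> ^ (eexp X l j - texp X l j) * (\<epsilon> * t) ^ texp X l j) * inv_fourier (cv l j) z)"
    unfolding S_def[abs_def]
    by (subst inv_fourier_sum[OF _ z], intro decay_sum decay_cmult cvd, assumption+, intro sum.cong refl, subst inv_fourier_sum[OF _ z])
      (auto intro!: decay_cmult cvd simp: inv_fourier_cmult)
  also have "\<dots> = (\<Sum>l\<in>{1..<topD X}. \<Sum>j\<in>idx X l. t ^ texp X l j * \<epsilon> ^ eexp X l j *
          (coef_c X l j z \<epsilon> * dz (Rpol X l) (\<lambda>z. u (of_real (q powr real (qexp X l)) * t) z \<epsilon>) z))"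
  proof (intro sum.cong refl)
    fix l j assume lj: "l \<in> {1..<topD X}" "j \<in> idx X l"
    \<comment> \<open>Here \<open>texp X l j \<le> eexp X l j\<close> matters: the exponent of
      \<open>\<epsilon>\<close> is a difference of natural numbers, which would otherwise be cut off
      at 0.\<close>
    have "\<epsilon> ^ (eexp X l j - texp X l j) * (\<epsilon> * t) ^ texp X l j = t ^ texp X l j * \<epsilon> ^ eexp X l j"
      using ex[OF lj] by (simp add: power_mult_distrib mult_ac flip: power_add)
    then show "(\<epsilon> ^ (eexp X l j - texp X l j) * (\<epsilon> * t) ^ texp X l j) * inv_fourier (cv l j) z = t ^ texp X l j * \<epsilon> ^ eexp X l j *
          (coef_c X l j z \<epsilon> * dz (Rpol X l) (\<lambda>z. u (of_real (q powr real (qexp X l)) * t) z \<epsilon>) z)"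
      unfolding cvi[OF lj] dzu[OF shifts_mem(3)[OF lj(1)]] by (simp only:)
  qed
  finally show ?thesis unfolding op_P_eq ..
qed

text \<open>The order k of the transform and the order k' in the operator differ for the second
  operator, where they are \<open>k2\<close> and \<open>k1\<close>. The missing parts of the
  constants and dilations then sit in cD, c, sD and s, contributed by the earlier transform of order
  \<open>kappa k1 k2\<close>.\<close>

lemma (in q_base) op_P_laplace:
  assumes b: "b > 0" and z: "z \<in> strip b"
    and f: "\<And>s. s \<in> shifts k' X \<Longrightarrow> laplace_dom d b f (of_real (q powr s) * (\<epsilon> * t))"
    and C: "\<And>l j. l \<in> {1..<topD X} \<Longrightarrow> j \<in> idx X l \<Longrightarrow> decay b (\<lambda>m. Ccoef X l j m \<epsilon>)"
    and ex: "\<And>l j. l \<in> {1..<topD X} \<Longrightarrow> j \<in> idx X l \<Longrightarrow> texp X l j \<le> eexp X l j"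
    and u: "\<And>s z. s \<in> shifts k' X \<Longrightarrow> z \<in> strip b \<Longrightarrow> u (of_real (q powr s) * t) z \<epsilon> = inv_fourier (\<lambda>m. q_laplace q k d (\<lambda>\<tau>. f \<tau> m) (of_real (q powr s) * (\<epsilon> * t))) z"
    and eq: "\<And>\<tau> m. \<tau> \<in> ray d \<Longrightarrow> Qim X m * f \<tau> m = cD * (\<tau> ^ topd X * (RDim X m * f (of_real (q powr sD) * \<tau>) m))
      + (\<Sum>l\<in>{1..<topD X}. \<Sum>j\<in>idx X l. c l j * (\<tau> ^ texp X l j * conv (Rpol X l) (\<lambda>m. Ccoef X l j m \<epsilon>) (f (of_real (q powr s l j) * \<tau>)) m)) + H \<tau> m"
    and cD: "cD * of_real (cq q k (topd X)) = of_real (q powr - real (topd X))" "real (topd X) / k + sD = real (topd X) / real k'"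
    and c: "\<And>l j. l \<in> {1..<topD X} \<Longrightarrow> j \<in> idx X l \<Longrightarrow> c l j * of_real (cq q k (texp X l j)) = \<epsilon> ^ (eexp X l j - texp X l j) * of_real (1 / sqrt (2 * pi)) * of_real (q powr - real (texp X l j))"
      "\<And>l j. l \<in> {1..<topD X} \<Longrightarrow> j \<in> idx X l \<Longrightarrow> real (texp X l j) / k + s l j = real (qexp X l) - 1"
  shows "op_P q k' X u t z \<epsilon> = inv_fourier (\<lambda>m. q_laplace q k d (\<lambda>\<tau>. H \<tau> m) (of_real (q powr 1) * (\<epsilon> * t))) z"
proof (rule op_P_inv_fourier[where W = "\<lambda>T m. q_laplace q k d (\<lambda>\<tau>. f \<tau> m) T" and b = b])
  show "b > 0" "z \<in> strip b" by fact+
  show "\<And>l j. l \<in> {1..<topD X} \<Longrightarrow> j \<in> idx X l \<Longrightarrow> decay b (\<lambda>m. Ccoef X l j m \<epsilon>)" by (rule C)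
  show "\<And>l j. l \<in> {1..<topD X} \<Longrightarrow> j \<in> idx X l \<Longrightarrow> texp X l j \<le> eexp X l j" by (rule ex)
  show "\<And>s z. s \<in> shifts k' X \<Longrightarrow> z \<in> strip b \<Longrightarrow> u (of_real (q powr s) * t) z \<epsilon> = inv_fourier (\<lambda>m. q_laplace q k d (\<lambda>\<tau>. f \<tau> m) (of_real (q powr s) * (\<epsilon> * t))) z"
    by (rule u)
  show "decay b (\<lambda>m. q_laplace q k d (\<lambda>\<tau>. f \<tau> m) (of_real (q powr s) * (\<epsilon> * t)))" if "s \<in> shifts k' X" for s
    by (rule laplace_dom_decay[OF f[OF that]])
  fix m
  \<comment> \<open>The extra factor q raises every dilation by 1, as the exponents in
    \<open>shifts\<close> require, and its powers cancel the factors \<open>q powr - n\<close> of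
    the constants.\<close>
  define T where "T = of_real (q powr 1) * (\<epsilon> * t)"
  have sh: "of_real (q powr x) * T = of_real (q powr (x + 1)) * (\<epsilon> * t)" for x
    by (simp only: T_def powr_add of_real_mult mult.assoc)
  have e1: "of_real (q powr (real (topd X) / k + sD)) * T = of_real (q powr (real (topd X) / real k' + 1)) * (\<epsilon> * t)"
    by (simp only: cD sh)
  have e2: "of_real (q powr (real (texp X l j) / k + s l j)) * T = of_real (q powr real (qexp X l)) * (\<epsilon> * t)"
    if "l \<in> {1..<topD X}" "j \<in> idx X l" for l j
    by (simp only: c(2)[OF that] sh diff_add_cancel)
  have pw: "of_real (q powr - real n) * T ^ n = (\<epsilon> * t) ^ n" for n
  proof -
    have "q powr - real n * (q powr 1) ^ n = 1"
      using q_gt_1 by (simp add: powr_minus powr_realpow)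
    then have "complex_of_real (q powr - real n) * of_real (q powr 1) ^ n = 1" by (metis of_real_1 of_real_mult of_real_power)
    then show ?thesis unfolding T_def power_mult_distrib[of "of_real (q powr 1)"] by (simp only: mult.assoc[symmetric] mult_1_left)
  qed
  have "Qim X m * q_laplace q k d (\<lambda>\<tau>. f \<tau> m) T
      = cD * of_real (cq q k (topd X)) * (T ^ topd X * (RDim X m * q_laplace q k d (\<lambda>\<tau>. f \<tau> m) (of_real (q powr (real (topd X) / k + sD)) * T)))
      + (\<Sum>l\<in>{1..<topD X}. \<Sum>j\<in>idx X l. c l j * of_real (cq q k (texp X l j)) * (T ^ texp X l j * conv (Rpol X l) (\<lambda>m. Ccoef X l j m \<epsilon>) (\<lambda>m. q_laplace q k d (\<lambda>\<tau>. f \<tau> m) (of_real (q powr (real (texp X l j) / k + s l j)) * T)) m))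
      + q_laplace q k d (\<lambda>\<tau>. H \<tau> m) T"
  proof (rule q_laplace_equation[OF eq b])
    show "laplace_dom d b f T" unfolding T_def by (rule f[OF shifts_mem(1)])
    show "laplace_dom d b f (of_real (q powr (real (topd X) / k + sD)) * T)" unfolding e1 by (rule f[OF shifts_mem(2)])
    fix l j assume lj: "l \<in> {1..<topD X}" "j \<in> idx X l"
    show "laplace_dom d b f (of_real (q powr (real (texp X l j) / k + s l j)) * T)" unfolding e2[OF lj] by (rule f[OF shifts_mem(3)[OF lj(1)]])
    show "(\<lambda>m. Ccoef X l j m \<epsilon>) \<in> borel_measurable borel \<and> (\<exists>B. \<forall>m. norm (Ccoef X l j m \<epsilon>) \<le> B)"
      by (rule decay_bound_measurable[OF C[OF lj] b])
  qed
  also have "cD * of_real (cq q k (topd X)) * (T ^ topd X * (RDim X m * q_laplace q k d (\<lambda>\<tau>. f \<tau> m) (of_real (q powr (real (topd X) / k + sD)) * T)))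
    = (\<epsilon> * t) ^ topd X * (RDim X m * q_laplace q k d (\<lambda>\<tau>. f \<tau> m) (of_real (q powr (real (topd X) / real k' + 1)) * (\<epsilon> * t)))"
    unfolding cD(1) e1 by (simp only: mult.assoc[symmetric] pw)
  also have "(\<Sum>l\<in>{1..<topD X}. \<Sum>j\<in>idx X l. c l j * of_real (cq q k (texp X l j)) * (T ^ texp X l j * conv (Rpol X l) (\<lambda>m. Ccoef X l j m \<epsilon>) (\<lambda>m. q_laplace q k d (\<lambda>\<tau>. f \<tau> m) (of_real (q powr (real (texp X l j) / k + s l j)) * T)) m))
    = (\<Sum>l\<in>{1..<topD X}. \<Sum>j\<in>idx X l. (\<epsilon> ^ (eexp X l j - texp X l j) * (\<epsilon> * t) ^ texp X l j) *
          (of_real (1 / sqrt (2 * pi)) * conv (Rpol X l) (\<lambda>m. Ccoef X l j m \<epsilon>) (\<lambda>m. q_laplace q k d (\<lambda>\<tau>. f \<tau> m) (of_real (q powr real (qexp X l)) * (\<epsilon> * t))) m))"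
  proof (intro sum.cong refl)
    fix l j assume lj: "l \<in> {1..<topD X}" "j \<in> idx X l"
    show "c l j * of_real (cq q k (texp X l j)) * (T ^ texp X l j * conv (Rpol X l) (\<lambda>m. Ccoef X l j m \<epsilon>) (\<lambda>m. q_laplace q k d (\<lambda>\<tau>. f \<tau> m) (of_real (q powr (real (texp X l j) / k + s l j)) * T)) m)
     = (\<epsilon> ^ (eexp X l j - texp X l j) * (\<epsilon> * t) ^ texp X l j) *
          (of_real (1 / sqrt (2 * pi)) * conv (Rpol X l) (\<lambda>m. Ccoef X l j m \<epsilon>) (\<lambda>m. q_laplace q k d (\<lambda>\<tau>. f \<tau> m) (of_real (q powr real (qexp X l)) * (\<epsilon> * t))) m)"
      unfolding c(1)[OF lj] e2[OF lj] pw[of "texp X l j", symmetric] by (simp only: mult_ac)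
  qed
  finally show "Qim X m * q_laplace q k d (\<lambda>\<tau>. f \<tau> m) (of_real (q powr 1) * (\<epsilon> * t))
      = (\<epsilon> * t) ^ topd X * (RDim X m * q_laplace q k d (\<lambda>\<tau>. f \<tau> m) (of_real (q powr (real (topd X) / real k' + 1)) * (\<epsilon> * t)))
      + (\<Sum>l\<in>{1..<topD X}. \<Sum>j\<in>idx X l. (\<epsilon> ^ (eexp X l j - texp X l j) * (\<epsilon> * t) ^ texp X l j) *
          (of_real (1 / sqrt (2 * pi)) * conv (Rpol X l) (\<lambda>m. Ccoef X l j m \<epsilon>) (\<lambda>m. q_laplace q k d (\<lambda>\<tau>. f \<tau> m) (of_real (q powr real (qexp X l)) * (\<epsilon> * t))) m))
      + q_laplace q k d (\<lambda>\<tau>. H \<tau> m) (of_real (q powr 1) * (\<epsilon> * t))"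
    by (simp only: T_def)
qed

text \<open>Division by \<open>\<tau> ^ k / cq q k k\<close> brings the equation into the form that
  \<open>q_laplace_equation\<close> accepts, with powers of \<open>\<tau>\<close> that no longer
  contain k.\<close>

lemma conv_equation_ray:
  assumes eq: "conv_equation q k s X \<epsilon> A \<psi> w" and \<tau>: "\<tau> \<in> A" "\<tau> \<noteq> 0" and q: "q > 1"
  shows "Qim X m * w \<tau> m = of_real (cq q k k / cq q k (topd X + k)) * (\<tau> ^ topd X * (RDim X m * w (of_real (q powr s) * \<tau>) m))
      + (\<Sum>l\<in>{1..<topD X}. \<Sum>j\<in>idx X l. (\<epsilon> ^ (eexp X l j - texp X l j) * of_real (1 / sqrt (2 * pi)) * of_real (cq q k k / cq q k (texp X l j + k)))
         * (\<tau> ^ texp X l j * conv (Rpol X l) (\<lambda>m. Ccoef X l j m \<epsilon>) (w (of_real (q powr (real (qexp X l) - real (texp X l j) / real k - 1)) * \<tau>)) m))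
      + \<psi> \<tau> m"
proof -
  define g where "g = \<tau> ^ k / of_real (cq q k k)"
  have cp: "cq q (real k) n > 0" for n using q by (simp add: cq_def)
  have g0: "g \<noteq> 0" using \<tau> cp[of k] by (simp add: g_def)
  have ps: "\<tau> ^ (n + k) / of_real (cq q k (n + k)) = g * (of_real (cq q k k / cq q k (n + k)) * \<tau> ^ n)" for n
    using cp[of k] by (simp add: g_def power_add)
  have "g * (Qim X m * w \<tau> m) = Qim X m * \<tau> ^ k / of_real (cq q k k) * w \<tau> m" by (simp add: g_def)
  also have "\<dots> = \<tau> ^ (topd X + k) / of_real (cq q k (topd X + k)) * RDim X m * q_shift q s w \<tau> m
     + (\<Sum>l\<in>{1..<topD X}. \<Sum>j\<in>idx X l.
          \<epsilon> ^ (eexp X l j - texp X l j) * \<tau> ^ (texp X l j + k) / of_real (cq q k (texp X l j + k)) *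
          q_shift q (real (qexp X l) - real (texp X l j) / real k - 1)
            (\<lambda>\<tau>. of_real (1 / sqrt (2 * pi)) * conv (Rpol X l) (\<lambda>m. Ccoef X l j m \<epsilon>) (w \<tau>) m) \<tau>)
     + \<tau> ^ k / of_real (cq q k k) * \<psi> \<tau> m"
    using eq \<tau>(1) unfolding conv_equation_def by blast
  also have "\<dots> = g * (of_real (cq q k k / cq q k (topd X + k)) * (\<tau> ^ topd X * (RDim X m * w (of_real (q powr s) * \<tau>) m))
      + (\<Sum>l\<in>{1..<topD X}. \<Sum>j\<in>idx X l. (\<epsilon> ^ (eexp X l j - texp X l j) * of_real (1 / sqrt (2 * pi)) * of_real (cq q k k / cq q k (texp X l j + k)))
         * (\<tau> ^ texp X l j * conv (Rpol X l) (\<lambda>m. Ccoef X l j m \<epsilon>) (w (of_real (q powr (real (qexp X l) - real (texp X l j) / real k - 1)) * \<tau>)) m))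
      + \<psi> \<tau> m)"
    unfolding times_divide_eq_right[symmetric] ps q_shift_def g_def[symmetric] distrib_left sum_distrib_left by (simp only: mult_ac)
  finally show ?thesis by (rule mult_left_cancel[OF g0, THEN iffD1])
qed

text \<open>The quadratic parts cancel:
  \<open>k (k - 1) - (n + k) (n + k - 1) + n (n - 1) = - 2 n k\<close>, and the base
  \<open>q^(1/k)\<close> leaves \<open>q^(-n)\<close>.\<close>

lemma cq_ratio: "cq q k k / cq q k (n + k) * cq q k n = q powr - real n" if "q > 1" "k > 0" for k :: nat
proof -
  have l: "ln q / real k * (real k * x) = ln q * x" for x using that by simp
  have "cq q k j = exp (ln q / real k * (real j * (real j - 1) / 2))" for j
    using that by (simp add: cq_def powr_def mult_ac)
  then have "cq q k k / cq q k (n + k) * cq q k n = exp (ln q / real k * (real k * (real k - 1) / 2) - ln q / real k * (real (n + k) * (real (n + k) - 1) / 2) + ln q / real k * (real n * (real n - 1) / 2))"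
    by (simp only: exp_add exp_diff)
  also have "ln q / real k * (real k * (real k - 1) / 2) - ln q / real k * (real (n + k) * (real (n + k) - 1) / 2) + ln q / real k * (real n * (real n - 1) / 2)
    = ln q / real k * (real k * (- real n))"
  proof -
    have "e * (x * (x - 1) / 2) - e * ((y + x) * (y + x - 1) / 2) + e * (y * (y - 1) / 2) = e * (x * (- y))" for e x y :: real
      by (simp add: field_simps)
    then show ?thesis by (simp only: of_nat_add)
  qed
  also have "\<dots> = - real n * ln q" using l by simp
  finally show ?thesis using that by (simp add: powr_def)
qed

text \<open>For fixed n the exponent of q is linear in 1 / k, and
  \<open>1 / \<kappa> + 1 / k2 = 1 / k1\<close>.\<close>

lemma cq_kappa:
  assumes "q > 1" "1 \<le> k1" "k1 < k2"
  shows "cq q (kappa k1 k2) n * cq q (real k2) n = cq q (real k1) n"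
proof -
  have "cq q k j = exp (ln q * (1 / k) * (real j * (real j - 1) / 2))" for j k
    using assms by (simp add: cq_def powr_def mult_ac)
  moreover have "1 / kappa k1 k2 = 1 / real k1 - 1 / real k2" by (simp add: kappa_def)
  moreover have "l * (a - b) * x + l * b * x = l * a * x" for l a b x :: real
    by (simp add: algebra_simps)
  ultimately show ?thesis by (simp only: exp_add[symmetric])
qed

lemma kappa_gt: "1 \<le> k1 \<Longrightarrow> k1 < k2 \<Longrightarrow> real k1 < kappa k1 k2"
  by (simp add: kappa_def field_simps)

lemma R_dom_not_nonpos:
  assumes "T \<in> R_dom d \<delta>" "\<delta> > 0"
  shows "cis d / T \<notin> \<real>\<^sub>\<le>\<^sub>0"
proof
  assume "cis d / T \<in> \<real>\<^sub>\<le>\<^sub>0"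
  then obtain s where s: "cis d / T = of_real s" "s \<le> 0" by (auto elim!: nonpos_Reals_cases)
  have T: "T \<noteq> 0" "\<And>r. r \<ge> 0 \<Longrightarrow> cmod (1 + cis d * of_real r / T) > \<delta>" using assms(1) by (auto simp: R_dom_def)
  have s0: "s \<noteq> 0" using s(1) T(1) by auto
  have "1 + cis d * of_real (- 1 / s) / T = 1 + (cis d / T) * of_real (- 1 / s)" by simp
  also have "\<dots> = 0" unfolding s(1) of_real_mult[symmetric] using s0 by simp
  finally have "\<not> cmod (1 + cis d * of_real (- 1 / s) / T) > \<delta>" using assms(2) by (simp only: norm_zero)
  moreover have "- 1 / s \<ge> 0" using s(2) s0 by (simp add: divide_nonpos_neg)
  ultimately show False using T(2) by blast
qed

lemma unbounded_sector_ray: "unbounded_sector d S \<Longrightarrow> ray d \<subseteq> S"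
  unfolding unbounded_sector_def sector_def ray_def by (force intro: exI[of _ d])

theorem solution_solves:
  fixes w2 :: "complex \<Rightarrow> complex \<Rightarrow> real \<Rightarrow> complex"
  assumes q: "q > 1" and k: "1 \<le> k1" "k1 < k2" and \<beta>: "\<beta> > 0" and \<mu>: "\<mu> \<ge> 0" and pos: "\<alpha> > 0" "\<delta> > 0" "\<delta>' > 0"
    and R: "0 < R" "R \<le> 1" "\<alpha> + kappa k1 k2 / ln q * ln R < 0" "R \<le> q powr ((1/2 - \<nu>) / real k2) / 2"
    and S: "ray d \<subseteq> S" "S \<subseteq> R_dom d \<delta>'"
    and U: "ray d \<subseteq> U" "infdist (- of_real \<delta>) (U \<union> ball 0 \<rho>) > 0"
    and Rb: "Rb = R_dom d \<delta>' \<inter> ball 0 R"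
    and \<psi>1: "\<psi>1 \<in> Exp_disc q (real k1) \<beta> \<mu> \<alpha> \<rho> \<delta> U"
    and \<psi>2_def: "\<psi>2 = (\<lambda>\<tau> m. q_laplace q (kappa k1 k2) d (\<lambda>h. \<psi>1 h m) \<tau>)"
    and \<psi>2: "\<psi>2 \<in> Exp_sect q (real k2) \<beta> \<mu> \<nu> S Rb"
    and w1: "w1 \<in> Exp_disc q (kappa k1 k2) \<beta> \<mu> \<alpha> \<rho> \<delta> U"
    and w2: "w2 \<epsilon> \<in> Exp_sect q (real k2) \<beta> \<mu> \<nu> S Rb"
    and w12: "\<And>m \<tau>. \<tau> \<in> Rb \<Longrightarrow> w2 \<epsilon> \<tau> m = q_laplace q (kappa k1 k2) d (\<lambda>h. w1 h m) \<tau>"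
    and eqX: "conv_equation q k2 0 X \<epsilon> (dom_sect S Rb) \<psi>2 (w2 \<epsilon>)"
    and eqY: "conv_equation q k1 0 Y \<epsilon> (dom_disc \<rho> U) (borel_poly q k1 N0 G \<epsilon>) \<psi>1"
    and CX: "\<And>l j. l \<in> {1..<topD X} \<Longrightarrow> j \<in> idx X l \<Longrightarrow> decay \<beta> (\<lambda>m. Ccoef X l j m \<epsilon>)"
    and CY: "\<And>l j. l \<in> {1..<topD Y} \<Longrightarrow> j \<in> idx Y l \<Longrightarrow> decay \<beta> (\<lambda>m. Ccoef Y l j m \<epsilon>)"
    and G: "\<And>n. n \<le> N0 \<Longrightarrow> decay \<beta> (\<lambda>m. G n m \<epsilon>)"
    and exX: "\<And>l j. l \<in> {1..<topD X} \<Longrightarrow> j \<in> idx X l \<Longrightarrow> texp X l j \<le> eexp X l j"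
    and exY: "\<And>l j. l \<in> {1..<topD Y} \<Longrightarrow> j \<in> idx Y l \<Longrightarrow> texp Y l j \<le> eexp Y l j"
    and D: "\<And>t. t \<in> \<T> \<Longrightarrow> \<epsilon> * t \<in> Rb \<and> admissible_direction S d (\<epsilon> * t) (\<gamma> (\<epsilon> * t))"
    and t: "\<And>a b. a \<in> shifts k1 Y \<Longrightarrow> b \<in> shifts k2 X \<Longrightarrow> of_real (q powr (a - 1 + b)) * t \<in> \<T>"
    and z: "z \<in> strip \<beta>"
  shows "op_P q k1 Y (q_shift q (- 1) (op_P q k2 X (solution q k2 \<gamma> w2))) t z \<epsilon> = q_shift q 1 (forcing N0 G) t z \<epsilon>"
proof -
  have k2p: "real k2 > 0" and k1p: "real k1 > 0" using k by auto
  have \<kappa>: "kappa k1 k2 > real k1" by (rule kappa_gt[OF k])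
  then have \<kappa>p: "kappa k1 k2 > 0" using k1p by simp
  interpret K2: q_base q "real k2" by unfold_locales (use q k2p in auto)
  interpret KA: q_base q "kappa k1 k2" by unfold_locales (use q \<kappa>p in auto)
  have lnq: "ln q > 0" using q by simp
  have RbD: "\<tau> \<in> R_dom d \<delta>'" "norm \<tau> < R" "\<tau> \<noteq> 0" if "\<tau> \<in> Rb" for \<tau>
    using that by (auto simp: Rb R_dom_def)
  \<comment> \<open>In the transform of order \<open>kappa k1 k2\<close> the growth of
    \<open>w1\<close> is exactly critical, that of \<open>\<psi>1\<close> strictly below.\<close>
  have A2: "kappa k1 k2 / (2 * ln q) = 1 / (2 * KA.L)" "real k1 / (2 * ln q) < 1 / (2 * KA.L)"
    using lnq \<kappa> \<kappa>p by (auto simp: KA.L_def divide_strict_right_mono)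
  \<comment> \<open>The two smallness conditions on R are used separately: this one for transforms
    of order \<open>kappa k1 k2\<close> near 0, \<open>RbB\<close> for those of order
    \<open>k2\<close>.\<close>
  have RbA: "norm \<tau> \<le> 1" "\<alpha> + ln (norm \<tau>) / KA.L \<le> 0" if "\<tau> \<in> Rb" for \<tau>
  proof -
    have "norm \<tau> > 0" using RbD[OF that] by simp
    then have "ln (norm \<tau>) \<le> ln R" using RbD(2)[OF that] by (intro ln_mono) auto
    then have "kappa k1 k2 / ln q * ln (norm \<tau>) \<le> kappa k1 k2 / ln q * ln R"
      using \<kappa>p lnq by (intro mult_left_mono) auto
    moreover have "ln (norm \<tau>) / KA.L = kappa k1 k2 / ln q * ln (norm \<tau>)" by (simp add: KA.L_def)
    ultimately show "\<alpha> + ln (norm \<tau>) / KA.L \<le> 0" using R(3) by linarith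
    show "norm \<tau> \<le> 1" using RbD(2)[OF that] R by linarith
  qed
  have RbB: "ln (norm T) / K2.L + \<nu> - 1 / 2 < 0" if "T \<in> Rb" for T
  proof -
    have T0: "norm T > 0" using RbD[OF that] by simp
    have "norm T < q powr ((1/2 - \<nu>) / real k2) / 2" using RbD(2)[OF that] R(4) by linarith
    also have "\<dots> < q powr ((1/2 - \<nu>) / real k2)" using q by simp
    finally have "ln (norm T) < ln (q powr ((1/2 - \<nu>) / real k2))" using T0 q by (subst ln_less_cancel_iff) auto
    also have "\<dots> = (1/2 - \<nu>) / real k2 * ln q" using q by (simp add: ln_powr)
    also have "\<dots> = (1/2 - \<nu>) * K2.L" by (simp add: K2.L_def)
    finally have "ln (norm T) / K2.L < 1/2 - \<nu>" using K2.L_pos by (simp add: pos_divide_less_eq)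
    then show ?thesis by linarith
  qed
  have rayU: "ray d \<subseteq> dom_disc \<rho> U" using U by (auto simp: dom_disc_def)
  obtain Kw where Kw: "Kw \<ge> 0" "\<And>r m. r > 0 \<Longrightarrow> norm (w1 (of_real r * cis d) m) \<le> Kw * exp (- \<beta> * \<bar>m\<bar>) * (1 + (if r \<ge> 1 then exp (kappa k1 k2 / (2 * ln q) * (ln r)\<^sup>2 + \<alpha> * ln r) else 0))"
    and "continuous_on (ray d \<times> UNIV) (\<lambda>(\<tau>, m). w1 \<tau> m)"
    by (rule Exp_disc_growth[OF w1 q \<kappa>p pos(1,2) \<mu> U]) (rule that)
  obtain Kp where Kp: "Kp \<ge> 0" "\<And>r m. r > 0 \<Longrightarrow> norm (\<psi>1 (of_real r * cis d) m) \<le> Kp * exp (- \<beta> * \<bar>m\<bar>) * (1 + (if r \<ge> 1 then exp (real k1 / (2 * ln q) * (ln r)\<^sup>2 + \<alpha> * ln r) else 0))"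
    and Kpc: "continuous_on (ray d \<times> UNIV) (\<lambda>(\<tau>, m). \<psi>1 \<tau> m)"
    by (rule Exp_disc_growth[OF \<psi>1 q k1p pos(1,2) \<mu> U]) (rule that)
  obtain Bw where "\<And>\<tau> m. \<tau> \<in> R_dom d \<delta>' \<Longrightarrow> norm \<tau> \<le> 1 \<Longrightarrow> \<alpha> + ln (norm \<tau>) / KA.L \<le> 0 \<Longrightarrow>
     norm (q_laplace q (kappa k1 k2) d (\<lambda>u. w1 u m) \<tau>) \<le> Bw * exp (- \<beta> * \<bar>m\<bar>)"
    by (rule KA.q_laplace_disc_bounded'[OF pos(3) eq_refl[OF A2(1)] Kw]) (assumption | rule that)+
  then have Bw: "norm (w2 \<epsilon> \<tau> m) \<le> Bw * exp (- \<beta> * \<bar>m\<bar>)" if "\<tau> \<in> Rb" for \<tau> m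
    using RbD[OF that] RbA[OF that] w12[OF that, of m] by simp
  obtain Bp where "\<And>\<tau> m. \<tau> \<in> R_dom d \<delta>' \<Longrightarrow> norm \<tau> \<le> 1 \<Longrightarrow> \<alpha> + ln (norm \<tau>) / KA.L \<le> 0 \<Longrightarrow>
     norm (q_laplace q (kappa k1 k2) d (\<lambda>u. \<psi>1 u m) \<tau>) \<le> Bp * exp (- \<beta> * \<bar>m\<bar>)"
    by (rule KA.q_laplace_disc_bounded'[OF pos(3) less_imp_le[OF A2(2)] Kp]) (assumption | rule that)+
  then have Bp: "norm (\<psi>2 \<tau> m) \<le> Bp * exp (- \<beta> * \<bar>m\<bar>)" if "\<tau> \<in> Rb" for \<tau> m
    using RbD[OF that] RbA[OF that] by (simp add: \<psi>2_def)
  \<comment> \<open>Since S lies in \<open>R_dom\<close>, all its points of modulus below R belong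
    to \<open>Rb\<close>. The bounds near 0 are thus available along every direction used in the
    rotation.\<close>
  have SRb: "\<tau> \<in> Rb" if "\<tau> \<in> S" "norm \<tau> < R" for \<tau> using that S by (auto simp: Rb)
  have rayRb: "of_real r * cis d \<in> Rb" if "0 < r" "r < R" for r
    using that S by (intro SRb) (auto simp: ray_def norm_mult)
  have lw: "K2.laplace_dom d \<beta> (w2 \<epsilon>) T" if "T \<in> Rb" for T
    by (rule K2.laplace_dom_sect[OF w2 \<mu> S(1) R(1) Bw[OF rayRb] RbD(1)[OF that] pos(3) RbB[OF that]])
  have lp: "K2.laplace_dom d \<beta> \<psi>2 T" if "T \<in> Rb" for T
    by (rule K2.laplace_dom_sect[OF \<psi>2 \<mu> S(1) R(1) Bp[OF rayRb] RbD(1)[OF that] pos(3) RbB[OF that]])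
  have l1: "KA.laplace_dom d \<beta> \<psi>1 \<tau>" if "\<tau> \<in> ray d" for \<tau>
    by (rule KA.laplace_dom_slow[OF that A2(2) Kp(1) Kpc Kp(2)])
  \<comment> \<open>The direction in the definition of the solution may vary with
    \<open>\<epsilon> * t\<close>, whereas the operator relates its values at several dilations of
    t. All of them are first moved to the bisecting direction d.\<close>
  have rot: "q_laplace q (real k2) (\<gamma> (\<epsilon> * t)) (\<lambda>\<tau>. w2 \<epsilon> \<tau> m) (\<epsilon> * t) = q_laplace q (real k2) d (\<lambda>\<tau>. w2 \<epsilon> \<tau> m) (\<epsilon> * t)"
    if "t \<in> \<T>" for t m
  proof (rule K2.q_laplace_sect_rotate[OF w2 \<mu> R(1)])
    show "admissible_direction S d (\<epsilon> * t) (\<gamma> (\<epsilon> * t))" using D[OF that] by blast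
    show "norm (w2 \<epsilon> \<tau> m) \<le> Bw * exp (- \<beta> * \<bar>m\<bar>)" if "\<tau> \<in> S" "norm \<tau> < R" for \<tau> by (rule Bw[OF SRb[OF that]])
    show "\<epsilon> * t \<noteq> 0" "ln (norm (\<epsilon> * t)) / K2.L + \<nu> - 1 / 2 < 0" using D[OF that] RbD(3) RbB by blast+
  qed
  have PX: "op_P q k2 X (solution q k2 \<gamma> w2) t z \<epsilon> = inv_fourier (\<lambda>m. q_laplace q (real k2) d (\<lambda>\<tau>. \<psi>2 \<tau> m) (of_real (q powr 1) * (\<epsilon> * t))) z"
    if tS: "\<And>b. b \<in> shifts k2 X \<Longrightarrow> of_real (q powr b) * t \<in> \<T>" and z: "z \<in> strip \<beta>" for t z
  proof (rule K2.op_P_laplace[OF \<beta> z _ CX exX])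
    fix s assume s: "s \<in> shifts k2 X"
    have e: "of_real (q powr s) * (\<epsilon> * t) = \<epsilon> * (of_real (q powr s) * t)" by (simp only: mult.left_commute)
    show "K2.laplace_dom d \<beta> (w2 \<epsilon>) (of_real (q powr s) * (\<epsilon> * t))" unfolding e using D[OF tS[OF s]] lw by blast
    show "solution q k2 \<gamma> w2 (of_real (q powr s) * t) z \<epsilon> = inv_fourier (\<lambda>m. q_laplace q (real k2) d (\<lambda>\<tau>. w2 \<epsilon> \<tau> m) (of_real (q powr s) * (\<epsilon> * t))) z" for z
      unfolding e solution_def rot[OF tS[OF s]] ..
  next
    fix \<tau> m assume "\<tau> \<in> ray d"
    then have "\<tau> \<in> dom_sect S Rb" "\<tau> \<noteq> 0" using S by (auto simp: dom_sect_def ray_def)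
    from conv_equation_ray[OF eqX this q, of m]
    show "Qim X m * w2 \<epsilon> \<tau> m = of_real (cq q k2 k2 / cq q k2 (topd X + k2)) * (\<tau> ^ topd X * (RDim X m * w2 \<epsilon> (of_real (q powr 0) * \<tau>) m))
      + (\<Sum>l\<in>{1..<topD X}. \<Sum>j\<in>idx X l. (\<epsilon> ^ (eexp X l j - texp X l j) * of_real (1 / sqrt (2 * pi)) * of_real (cq q k2 k2 / cq q k2 (texp X l j + k2)))
         * (\<tau> ^ texp X l j * conv (Rpol X l) (\<lambda>m. Ccoef X l j m \<epsilon>) (w2 \<epsilon> (of_real (q powr (real (qexp X l) - real (texp X l j) / real k2 - 1)) * \<tau>)) m))
      + \<psi>2 \<tau> m" .
  next
    show "complex_of_real (cq q k2 k2 / cq q k2 (topd X + k2)) * of_real (cq q k2 (topd X)) = of_real (q powr - real (topd X))"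
      unfolding of_real_mult[symmetric] by (subst cq_ratio) (use q k in auto)
    show "\<epsilon> ^ (eexp X l j - texp X l j) * of_real (1 / sqrt (2 * pi)) * of_real (cq q k2 k2 / cq q k2 (texp X l j + k2)) * of_real (cq q k2 (texp X l j))
      = \<epsilon> ^ (eexp X l j - texp X l j) * of_real (1 / sqrt (2 * pi)) * of_real (q powr - real (texp X l j))" for l j
      unfolding mult.assoc of_real_mult[symmetric] by (subst cq_ratio) (use q k in auto)
  qed auto
  define v where "v t z \<epsilon> = inv_fourier (\<lambda>m. q_laplace q (real k2) d (\<lambda>\<tau>. \<psi>2 \<tau> m) (\<epsilon> * t)) z" for t z and \<epsilon> :: complex
  \<comment> \<open>As 1 is a shift of the first operator, the exponents \<open>s - 1 + 1\<close>
    cover all shifts of the second one.\<close>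
  have Yt: "of_real (q powr s) * t \<in> \<T>" if "s \<in> shifts k1 Y" for s using t[OF that shifts_mem(1)] by simp
  have "op_P q k1 Y (q_shift q (- 1) (op_P q k2 X (solution q k2 \<gamma> w2))) t z \<epsilon> = op_P q k1 Y v t z \<epsilon>"
  proof (rule op_P_cong[OF open_strip z])
    fix s z assume s: "s \<in> shifts k1 Y" and z: "z \<in> strip \<beta>"
    \<comment> \<open>The inverse dilation between the operators: the first one is applied at t' and
      reaches the points \<open>q^(s - 1 + b) t\<close>.\<close>
    define t' where "t' = of_real (q powr - 1) * (of_real (q powr s) * t)"
    have t'e: "t' = of_real (q powr (s - 1)) * t" by (simp add: t'_def powr_diff powr_minus divide_inverse mult_ac)
    have "op_P q k2 X (solution q k2 \<gamma> w2) t' z \<epsilon> = inv_fourier (\<lambda>m. q_laplace q (real k2) d (\<lambda>\<tau>. \<psi>2 \<tau> m) (of_real (q powr 1) * (\<epsilon> * t'))) z"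
    proof (rule PX[OF _ z])
      fix b assume b: "b \<in> shifts k2 X"
      have "of_real (q powr b) * t' = of_real (q powr (s - 1 + b)) * t"
        unfolding t'e powr_add by (simp add: mult_ac)
      then show "of_real (q powr b) * t' \<in> \<T>" using t[OF s b] by simp
    qed
    also have "of_real (q powr 1) * (\<epsilon> * t') = \<epsilon> * (of_real (q powr s) * t)"
      using q by (simp add: t'_def powr_minus)
    finally show "q_shift q (- 1) (op_P q k2 X (solution q k2 \<gamma> w2)) (of_real (q powr s) * t) z \<epsilon> = v (of_real (q powr s) * t) z \<epsilon>"
      by (simp only: q_shift_def t'_def v_def)
  qed
  also have "op_P q k1 Y v t z \<epsilon> = inv_fourier (\<lambda>m. q_laplace q (real k2) d (\<lambda>\<tau>. q_laplace q (kappa k1 k2) d (\<lambda>\<tau>. borel_poly q k1 N0 G \<epsilon> \<tau> m) \<tau>) (of_real (q powr 1) * (\<epsilon> * t))) z"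
  proof (rule K2.op_P_laplace[OF \<beta> z _ CY exY])
    fix s assume s: "s \<in> shifts k1 Y"
    have e: "of_real (q powr s) * (\<epsilon> * t) = \<epsilon> * (of_real (q powr s) * t)" by (simp only: mult.left_commute)
    show "K2.laplace_dom d \<beta> \<psi>2 (of_real (q powr s) * (\<epsilon> * t))" unfolding e using D[OF Yt[OF s]] lp by blast
    show "v (of_real (q powr s) * t) z \<epsilon> = inv_fourier (\<lambda>m. q_laplace q (real k2) d (\<lambda>\<tau>. \<psi>2 \<tau> m) (of_real (q powr s) * (\<epsilon> * t))) z" for z
      unfolding e v_def ..
  next
    fix \<tau> m assume \<tau>: "\<tau> \<in> ray d"
    have sc: "of_real (q powr x) * \<tau> \<in> ray d" for x by (rule ray_scale[OF \<tau>]) (use q in simp)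
    \<comment> \<open>The equation for \<open>\<psi>2\<close> is the transform of order
      \<open>kappa k1 k2\<close> of the one for \<open>\<psi>1\<close>. A power n adds the factor
      \<open>cq q (kappa k1 k2) n\<close> to its coefficient and \<open>n / kappa k1 k2\<close> to
      the exponent of its dilation.\<close>
    show "Qim Y m * \<psi>2 \<tau> m = (of_real (cq q k1 k1 / cq q k1 (topd Y + k1)) * of_real (cq q (kappa k1 k2) (topd Y)))
          * (\<tau> ^ topd Y * (RDim Y m * \<psi>2 (of_real (q powr (real (topd Y) / kappa k1 k2 + 0)) * \<tau>) m))
      + (\<Sum>l\<in>{1..<topD Y}. \<Sum>j\<in>idx Y l. ((\<epsilon> ^ (eexp Y l j - texp Y l j) * of_real (1 / sqrt (2 * pi)) * of_real (cq q k1 k1 / cq q k1 (texp Y l j + k1))) * of_real (cq q (kappa k1 k2) (texp Y l j)))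
         * (\<tau> ^ texp Y l j * conv (Rpol Y l) (\<lambda>m. Ccoef Y l j m \<epsilon>) (\<psi>2 (of_real (q powr (real (texp Y l j) / kappa k1 k2 + (real (qexp Y l) - real (texp Y l j) / real k1 - 1))) * \<tau>)) m))
      + q_laplace q (kappa k1 k2) d (\<lambda>\<tau>. borel_poly q k1 N0 G \<epsilon> \<tau> m) \<tau>"
      unfolding \<psi>2_def
    proof (rule KA.q_laplace_equation[where f = \<psi>1 and b = \<beta>])
      show "\<beta> > 0" by fact
      show "Qim Y m * \<psi>1 \<tau> m = of_real (cq q k1 k1 / cq q k1 (topd Y + k1)) * (\<tau> ^ topd Y * (RDim Y m * \<psi>1 (of_real (q powr 0) * \<tau>) m))
      + (\<Sum>l\<in>{1..<topD Y}. \<Sum>j\<in>idx Y l. (\<epsilon> ^ (eexp Y l j - texp Y l j) * of_real (1 / sqrt (2 * pi)) * of_real (cq q k1 k1 / cq q k1 (texp Y l j + k1)))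
         * (\<tau> ^ texp Y l j * conv (Rpol Y l) (\<lambda>m. Ccoef Y l j m \<epsilon>) (\<psi>1 (of_real (q powr (real (qexp Y l) - real (texp Y l j) / real k1 - 1)) * \<tau>)) m))
      + borel_poly q k1 N0 G \<epsilon> \<tau> m" if \<tau>: "\<tau> \<in> ray d" for \<tau> m
      proof -
        have "\<tau> \<in> dom_disc \<rho> U" "\<tau> \<noteq> 0" using rayU \<tau> by (auto simp: ray_def)
        from conv_equation_ray[OF eqY this q, of m] show ?thesis .
      qed
      show "KA.laplace_dom d \<beta> \<psi>1 \<tau>" by (rule l1[OF \<tau>])
    next
      fix l j assume lj: "l \<in> {1..<topD Y}" "j \<in> idx Y l"
      show "(\<lambda>m. Ccoef Y l j m \<epsilon>) \<in> borel_measurable borel \<and> (\<exists>B. \<forall>m. norm (Ccoef Y l j m \<epsilon>) \<le> B)"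
        by (rule decay_bound_measurable[OF CY[OF lj] \<beta>])
    qed (rule l1[OF sc])+
  next
    have i: "1 / kappa k1 k2 = 1 / real k1 - 1 / real k2" by (simp add: kappa_def)
    have kk: "x / kappa k1 k2 = x / real k1 - x / real k2" for x :: real
      using arg_cong[OF i, of "\<lambda>y. x * y"] by (simp add: right_diff_distrib)
    show "real (topd Y) / real k2 + (real (topd Y) / kappa k1 k2 + 0) = real (topd Y) / real k1" by (simp add: kk)
    show "real (texp Y l j) / real k2 + (real (texp Y l j) / kappa k1 k2 + (real (qexp Y l) - real (texp Y l j) / real k1 - 1)) = real (qexp Y l) - 1" for l j
      by (simp add: kk)
    \<comment> \<open>The constants contributed by the two transforms combine to
      \<open>cq q k1 n\<close>, so that \<open>cq_ratio\<close> applies with the order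
      \<open>k1\<close>.\<close>
    have r: "cq q k1 k1 / cq q k1 (n + k1) * cq q (kappa k1 k2) n * cq q k2 n = q powr - real n" for n
      unfolding mult.assoc cq_kappa[OF q k] by (rule cq_ratio) (use q k in auto)
    show "complex_of_real (cq q k1 k1 / cq q k1 (topd Y + k1)) * of_real (cq q (kappa k1 k2) (topd Y)) * of_real (cq q k2 (topd Y)) = of_real (q powr - real (topd Y))"
      unfolding of_real_mult[symmetric] r ..
    show "\<epsilon> ^ (eexp Y l j - texp Y l j) * of_real (1 / sqrt (2 * pi)) * of_real (cq q k1 k1 / cq q k1 (texp Y l j + k1)) * of_real (cq q (kappa k1 k2) (texp Y l j)) * of_real (cq q k2 (texp Y l j))
      = \<epsilon> ^ (eexp Y l j - texp Y l j) * of_real (1 / sqrt (2 * pi)) * of_real (q powr - real (texp Y l j))" for l j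
      unfolding r[of "texp Y l j", symmetric] of_real_mult by (simp only: mult.assoc)
  qed
  also have "\<dots> = inv_fourier (\<lambda>m. \<Sum>n\<le>N0. (of_real (q powr 1) * (\<epsilon> * t)) ^ n * G n m \<epsilon>) z"
  proof -
    define T where "T = of_real (q powr 1) * (\<epsilon> * t)"
    have "\<epsilon> * (of_real (q powr 1) * t) \<in> Rb" using D[OF Yt[OF shifts_mem(1)]] by blast
    then have TR: "T \<in> Rb" by (simp only: T_def mult.left_commute)
    \<comment> \<open>The two transforms together multiply the power n by \<open>cq q k1 n\<close>,
      undoing the division in \<open>borel_poly\<close>. The inner formula is needed on the ray
      only, where the outer transform integrates.\<close>
    have poly: "q_laplace q (kappa k1 k2) d (\<lambda>\<tau>. borel_poly q k1 N0 G \<epsilon> \<tau> m) \<tau> = (\<Sum>n\<le>N0. (G n m \<epsilon> / of_real (cq q k1 n) * of_real (cq q (kappa k1 k2) n)) * \<tau> ^ n)"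
      if \<tau>: "\<tau> \<in> ray d" for \<tau> m
    proof -
      have "\<tau> \<in> R_dom d \<delta>'" using \<tau> S by auto
      then have "\<tau> \<noteq> 0" "cis d / \<tau> \<notin> \<real>\<^sub>\<le>\<^sub>0" using R_dom_not_nonpos pos(3) by (auto simp: R_dom_def)
      from KA.q_laplace_polynomial[OF this, of "\<lambda>n. G n m \<epsilon> / of_real (cq q k1 n)" N0] show ?thesis by (simp add: borel_poly_def)
    qed
    have "q_laplace q (real k2) d (\<lambda>\<tau>. q_laplace q (kappa k1 k2) d (\<lambda>\<tau>. borel_poly q k1 N0 G \<epsilon> \<tau> m) \<tau>) T = (\<Sum>n\<le>N0. T ^ n * G n m \<epsilon>)" for m
    proof -
      have "q_laplace q (real k2) d (\<lambda>\<tau>. q_laplace q (kappa k1 k2) d (\<lambda>\<tau>. borel_poly q k1 N0 G \<epsilon> \<tau> m) \<tau>) T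
        = q_laplace q (real k2) d (\<lambda>\<tau>. \<Sum>n\<le>N0. (G n m \<epsilon> / of_real (cq q k1 n) * of_real (cq q (kappa k1 k2) n)) * \<tau> ^ n) T"
        unfolding K2.q_laplace_eq_ker
      proof (rule arg_cong2[of _ _ _ _ "(*)"], rule refl, rule Bochner_Integration.integral_cong, rule refl)
        fix r :: real
        have "q_laplace q (kappa k1 k2) d (\<lambda>\<tau>. borel_poly q k1 N0 G \<epsilon> \<tau> m) (of_real r * cis d)
          = (\<Sum>n\<le>N0. (G n m \<epsilon> / of_real (cq q k1 n) * of_real (cq q (kappa k1 k2) n)) * (of_real r * cis d) ^ n)" if "r > 0"
          using that by (intro poly) (auto simp: ray_def)
        then show "K2.laplace_ker d T r * q_laplace q (kappa k1 k2) d (\<lambda>\<tau>. borel_poly q k1 N0 G \<epsilon> \<tau> m) (of_real r * cis d)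
          = K2.laplace_ker d T r * (\<Sum>n\<le>N0. (G n m \<epsilon> / of_real (cq q k1 n) * of_real (cq q (kappa k1 k2) n)) * (of_real r * cis d) ^ n)"
          by (cases "r > 0") (simp_all add: K2.laplace_ker_def)
      qed
      also have "\<dots> = (\<Sum>n\<le>N0. (G n m \<epsilon> / of_real (cq q k1 n) * of_real (cq q (kappa k1 k2) n)) * of_real (cq q k2 n) * T ^ n)"
        by (rule K2.q_laplace_polynomial[OF RbD(3)[OF TR] R_dom_not_nonpos[OF RbD(1)[OF TR] pos(3)]])
      also have "\<dots> = (\<Sum>n\<le>N0. T ^ n * G n m \<epsilon>)"
      proof (intro sum.cong refl)
        fix n
        have "cq q k1 n > 0" using q by (simp add: cq_def)
        then have "G n m \<epsilon> / of_real (cq q k1 n) * of_real (cq q (kappa k1 k2) n * cq q k2 n) * T ^ n = T ^ n * G n m \<epsilon>"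
          unfolding cq_kappa[OF q k] by simp
        then show "(G n m \<epsilon> / of_real (cq q k1 n) * of_real (cq q (kappa k1 k2) n)) * of_real (cq q k2 n) * T ^ n = T ^ n * G n m \<epsilon>"
          by (simp only: of_real_mult mult.assoc)
      qed
      finally show ?thesis .
    qed
    then show ?thesis by (simp only: T_def)
  qed
  also have "\<dots> = (\<Sum>n\<le>N0. (of_real (q powr 1) * (\<epsilon> * t)) ^ n * inv_fourier (\<lambda>m. G n m \<epsilon>) z)"
    by (subst inv_fourier_sum[OF _ z]) (auto intro!: decay_cmult G simp: inv_fourier_cmult)
  also have "\<dots> = q_shift q 1 (forcing N0 G) t z \<epsilon>"
    unfolding q_shift_def forcing_def by (intro sum.cong refl) (simp only: mult_ac)
  finally show ?thesis .
qed

section \<open>Analyticity of the coefficients\<close>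

lemma holomorphic3_const: "holomorphic3_on (\<lambda>t z \<epsilon>. c) A"
  unfolding holomorphic3_on_def
  by (intro ballI exI[of _ 0]) (simp add: case_prod_unfold)

lemma holomorphic3_t: "holomorphic3_on (\<lambda>t z \<epsilon>. t) A"
  unfolding holomorphic3_on_def
proof (intro ballI exI)
  show "((\<lambda>(t, z, \<epsilon>). t) has_derivative (\<lambda>(h, k, l). 1 * h + 0 * k + 0 * l)) (at x)" for x :: "complex \<times> complex \<times> complex"
    by (auto simp: case_prod_unfold intro!: derivative_eq_intros)
qed

lemma holomorphic3_eps: "holomorphic3_on (\<lambda>t z \<epsilon>. \<epsilon>) A"
  unfolding holomorphic3_on_def
proof (intro ballI exI)
  show "((\<lambda>(t, z, \<epsilon>). \<epsilon>) has_derivative (\<lambda>(h, k, l). 0 * h + 0 * k + 1 * l)) (at x)" for x :: "complex \<times> complex \<times> complex"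
    by (auto simp: case_prod_unfold intro!: derivative_eq_intros)
qed

lemma holomorphic3_add:
  assumes "holomorphic3_on f A" "holomorphic3_on g A"
  shows "holomorphic3_on (\<lambda>t z \<epsilon>. f t z \<epsilon> + g t z \<epsilon>) A"
  unfolding holomorphic3_on_def
proof (intro ballI)
  fix x assume x: "x \<in> A"
  obtain a b c where f: "((\<lambda>(t, z, \<epsilon>). f t z \<epsilon>) has_derivative (\<lambda>(h, k, l). a * h + b * k + c * l)) (at x)"
    using assms(1) x unfolding holomorphic3_on_def by blast
  obtain a' b' c' where g: "((\<lambda>(t, z, \<epsilon>). g t z \<epsilon>) has_derivative (\<lambda>(h, k, l). a' * h + b' * k + c' * l)) (at x)"
    using assms(2) x unfolding holomorphic3_on_def by blast
  have "((\<lambda>(t, z, \<epsilon>). f t z \<epsilon> + g t z \<epsilon>) has_derivative (\<lambda>(h, k, l). (a + a') * h + (b + b') * k + (c + c') * l)) (at x)"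
    using has_derivative_add[OF f g] by (simp add: case_prod_unfold algebra_simps)
  then show "\<exists>a b c. ((\<lambda>(t, z, \<epsilon>). f t z \<epsilon> + g t z \<epsilon>) has_derivative (\<lambda>(h, k, l). a * h + b * k + c * l)) (at x)" by blast
qed

lemma holomorphic3_mult:
  assumes "holomorphic3_on f A" "holomorphic3_on g A"
  shows "holomorphic3_on (\<lambda>t z \<epsilon>. f t z \<epsilon> * g t z \<epsilon>) A"
  unfolding holomorphic3_on_def
proof (intro ballI)
  fix x assume x: "x \<in> A"
  obtain a b c where f: "((\<lambda>(t, z, \<epsilon>). f t z \<epsilon>) has_derivative (\<lambda>(h, k, l). a * h + b * k + c * l)) (at x)"
    using assms(1) x unfolding holomorphic3_on_def by blast
  obtain a' b' c' where g: "((\<lambda>(t, z, \<epsilon>). g t z \<epsilon>) has_derivative (\<lambda>(h, k, l). a' * h + b' * k + c' * l)) (at x)"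
    using assms(2) x unfolding holomorphic3_on_def by blast
  obtain t z \<epsilon> where xe: "x = (t, z, \<epsilon>)" by (metis surj_pair)
  have "((\<lambda>(t, z, \<epsilon>). f t z \<epsilon> * g t z \<epsilon>) has_derivative
    (\<lambda>(h, k, l). (f t z \<epsilon> * a' + a * g t z \<epsilon>) * h + (f t z \<epsilon> * b' + b * g t z \<epsilon>) * k + (f t z \<epsilon> * c' + c * g t z \<epsilon>) * l)) (at x)"
    using has_derivative_mult[OF f g] by (simp add: xe case_prod_unfold algebra_simps)
  then show "\<exists>a b c. ((\<lambda>(t, z, \<epsilon>). f t z \<epsilon> * g t z \<epsilon>) has_derivative (\<lambda>(h, k, l). a * h + b * k + c * l)) (at x)" by blast
qed

lemma holomorphic3_power: "holomorphic3_on f A \<Longrightarrow> holomorphic3_on (\<lambda>t z \<epsilon>. f t z \<epsilon> ^ n) A"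
  by (induction n) (auto intro: holomorphic3_const holomorphic3_mult)

lemma holomorphic3_sum: "(\<And>i. i \<in> I \<Longrightarrow> holomorphic3_on (f i) A) \<Longrightarrow> holomorphic3_on (\<lambda>t z \<epsilon>. \<Sum>i\<in>I. f i t z \<epsilon>) A"
  by (induction I rule: infinite_finite_induct) (auto intro: holomorphic3_const holomorphic3_add)

lemma holomorphic3_cong:
  assumes "open A" "holomorphic3_on g A" "\<And>t z \<epsilon>. (t, z, \<epsilon>) \<in> A \<Longrightarrow> f t z \<epsilon> = g t z \<epsilon>"
  shows "holomorphic3_on f A"
  unfolding holomorphic3_on_def
proof (intro ballI)
  fix x assume x: "x \<in> A"
  obtain a b c where g: "((\<lambda>(t, z, \<epsilon>). g t z \<epsilon>) has_derivative (\<lambda>(h, k, l). a * h + b * k + c * l)) (at x)"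
    using assms(2) x unfolding holomorphic3_on_def by blast
  have "((\<lambda>(t, z, \<epsilon>). f t z \<epsilon>) has_derivative (\<lambda>(h, k, l). a * h + b * k + c * l)) (at x)"
    by (rule has_derivative_transform_within_open[OF g assms(1) x]) (use assms(3) in auto)
  then show "\<exists>a b c. ((\<lambda>(t, z, \<epsilon>). f t z \<epsilon>) has_derivative (\<lambda>(h, k, l). a * h + b * k + c * l)) (at x)" by blast
qed

lemma holomorphic3_subset: "holomorphic3_on f A \<Longrightarrow> B \<subseteq> A \<Longrightarrow> holomorphic3_on f B"
  unfolding holomorphic3_on_def by blast

text \<open>The version of \<open>decay\<close> with a parameter: the constant depends on the rate
  b' but not on \<open>\<epsilon>\<close>, so that majorants of the Fourier integrals are uniform in
  \<open>\<epsilon>\<close>.\<close>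

definition uniform_decay :: "real \<Rightarrow> complex set \<Rightarrow> (real \<Rightarrow> complex \<Rightarrow> complex) \<Rightarrow> bool" where
  "uniform_decay b E h \<longleftrightarrow> (\<forall>\<epsilon>\<in>E. (\<lambda>m. h m \<epsilon>) \<in> borel_measurable borel) \<and> (\<forall>m. h m holomorphic_on E) \<and>
     (\<forall>b'<b. \<exists>K\<ge>0. \<forall>\<epsilon>\<in>E. \<forall>m. norm (h m \<epsilon>) \<le> K * exp (- b' * \<bar>m\<bar>))"

lemma uniform_decay_decay: "uniform_decay b E h \<Longrightarrow> \<epsilon> \<in> E \<Longrightarrow> decay b (\<lambda>m. h m \<epsilon>)"
  unfolding uniform_decay_def decay_def by blast

lemma uniform_decay_poly:
  assumes "uniform_decay b E h"
  shows "uniform_decay b E (\<lambda>m \<epsilon>. poly R (\<i> * of_real m) * h m \<epsilon>)"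
  unfolding uniform_decay_def
proof (intro conjI ballI allI impI)
  show "(\<lambda>m. poly R (\<i> * of_real m) * h m \<epsilon>) \<in> borel_measurable borel" if "\<epsilon> \<in> E" for \<epsilon>
    by (rule decay_measurable[OF decay_poly[OF uniform_decay_decay[OF assms that]]])
  show "(\<lambda>\<epsilon>. poly R (\<i> * of_real m) * h m \<epsilon>) holomorphic_on E" for m
    using assms unfolding uniform_decay_def by (intro holomorphic_intros) auto
  fix b' assume "b' < b"
  define c where "c = (b - b') / 2"
  have c: "c > 0" "b' + c < b" using \<open>b' < b\<close> by (simp_all add: c_def field_simps)
  obtain K1 where K1: "K1 \<ge> 0" "\<And>m. norm (poly R (\<i> * of_real m)) \<le> K1 * exp (c * \<bar>m\<bar>)"
    using poly_exp_bound[OF c(1)] by blast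
  obtain K2 where K2: "K2 \<ge> 0" "\<And>m \<epsilon>. \<epsilon> \<in> E \<Longrightarrow> norm (h m \<epsilon>) \<le> K2 * exp (- (b' + c) * \<bar>m\<bar>)"
    using assms c(2) unfolding uniform_decay_def by blast
  have "norm (poly R (\<i> * of_real m) * h m \<epsilon>) \<le> (K1 * K2) * exp (- b' * \<bar>m\<bar>)" if "\<epsilon> \<in> E" for m \<epsilon>
  proof -
    have "norm (poly R (\<i> * of_real m) * h m \<epsilon>) \<le> (K1 * exp (c * \<bar>m\<bar>)) * (K2 * exp (- (b' + c) * \<bar>m\<bar>))"
      unfolding norm_mult using K1 K2(1) K2(2)[OF that, of m] by (intro mult_mono) auto
    also have "\<dots> = (K1 * K2) * exp (c * \<bar>m\<bar> + - (b' + c) * \<bar>m\<bar>)" by (simp only: exp_add mult_ac)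
    also have "c * \<bar>m\<bar> + - (b' + c) * \<bar>m\<bar> = - b' * \<bar>m\<bar>" by (simp add: algebra_simps)
    finally show ?thesis .
  qed
  then show "\<exists>K\<ge>0. \<forall>\<epsilon>\<in>E. \<forall>m. norm (poly R (\<i> * of_real m) * h m \<epsilon>) \<le> K * exp (- b' * \<bar>m\<bar>)"
    using K1 K2 by (intro exI[of _ "K1 * K2"]) auto
qed

lemma holomorphic_family_uniform_decay:
  assumes "holomorphic_family \<beta> \<mu> \<epsilon>0 B h" "\<mu> \<ge> 0"
  shows "uniform_decay \<beta> (ball 0 \<epsilon>0) h"
  unfolding uniform_decay_def
proof (intro conjI ballI allI impI)
  have E: "(\<lambda>m. h m \<epsilon>) \<in> E_space \<beta> \<mu>" "E_norm \<beta> \<mu> (\<lambda>m. h m \<epsilon>) \<le> B" if "\<epsilon> \<in> ball 0 \<epsilon>0" for \<epsilon>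
    using assms(1) that by (auto simp: holomorphic_family_def)
  show "(\<lambda>m. h m \<epsilon>) \<in> borel_measurable borel" if "\<epsilon> \<in> ball 0 \<epsilon>0" for \<epsilon>
    by (rule decay_measurable[OF E_space_decay(2)[OF E(1)[OF that] assms(2)]])
  show "h m holomorphic_on ball 0 \<epsilon>0" for m
    using assms(1) unfolding holomorphic_family_def by blast
  fix b' assume b': "b' < \<beta>"
  have "norm (h m \<epsilon>) \<le> \<bar>B\<bar> * exp (- b' * \<bar>m\<bar>)" if e: "\<epsilon> \<in> ball 0 \<epsilon>0" for \<epsilon> m
  proof -
    have "fourier_weight \<beta> \<mu> m * norm (h m \<epsilon>) \<le> E_norm \<beta> \<mu> (\<lambda>m. h m \<epsilon>)"
      unfolding E_norm_def using E(1)[OF e] by (intro cSUP_upper) (auto simp: E_space_def)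
    then have f: "fourier_weight \<beta> \<mu> m * norm (h m \<epsilon>) \<le> \<bar>B\<bar>" using E(2)[OF e] by linarith
    have "norm (h m \<epsilon>) \<le> \<bar>B\<bar> * exp (- \<beta> * \<bar>m\<bar>)"
    proof (rule le_exp_neg)
      have "exp (\<beta> * \<bar>m\<bar>) * norm (h m \<epsilon>) \<le> fourier_weight \<beta> \<mu> m * norm (h m \<epsilon>)"
        using fourier_weight_ge[OF assms(2)] by (intro mult_right_mono) auto
      then show "norm (h m \<epsilon>) * exp (\<beta> * \<bar>m\<bar>) \<le> \<bar>B\<bar>" using f by (simp add: mult.commute)
    qed
    also have "\<dots> \<le> \<bar>B\<bar> * exp (- b' * \<bar>m\<bar>)"
    proof -
      have "b' * \<bar>m\<bar> \<le> \<beta> * \<bar>m\<bar>" using b' by (intro mult_right_mono) auto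
      then show ?thesis by (intro mult_left_mono) auto
    qed
    finally show ?thesis .
  qed
  then show "\<exists>K\<ge>0. \<forall>\<epsilon>\<in>ball 0 \<epsilon>0. \<forall>m. norm (h m \<epsilon>) \<le> K * exp (- b' * \<bar>m\<bar>)"
    by (intro exI[of _ "\<bar>B\<bar>"]) auto
qed

lemma uniform_decay_exp_bound:
  assumes "uniform_decay b E h" "a < b"
  obtains g where "integrable lborel g" "\<And>m z \<epsilon>. \<epsilon> \<in> E \<Longrightarrow> \<bar>Im z\<bar> \<le> a \<Longrightarrow> norm (h m \<epsilon> * exp (\<i> * of_real m * z)) \<le> g m"
proof -
  define c where "c = (b - a) / 2"
  have c: "c > 0" "a + c < b" using assms(2) by (simp_all add: c_def field_simps)
  obtain K where K: "K \<ge> 0" "\<And>m \<epsilon>. \<epsilon> \<in> E \<Longrightarrow> norm (h m \<epsilon>) \<le> K * exp (- (a + c) * \<bar>m\<bar>)"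
    using assms(1) c(2) unfolding uniform_decay_def by blast
  show ?thesis
  proof
    show "integrable lborel (\<lambda>m. K * exp (- c * \<bar>m\<bar>))" using integrable_exp_abs[OF c(1)] by auto
    fix m z \<epsilon> assume e: "\<epsilon> \<in> E" and z: "\<bar>Im z\<bar> \<le> a"
    have "norm (h m \<epsilon> * exp (\<i> * of_real m * z)) \<le> (K * exp (- (a + c) * \<bar>m\<bar>)) * exp (a * \<bar>m\<bar>)"
      unfolding norm_mult using K(1) K(2)[OF e, of m] norm_exp_le[OF z, of m] by (intro mult_mono) auto
    also have "\<dots> = K * exp (- (a + c) * \<bar>m\<bar> + a * \<bar>m\<bar>)" by (simp only: exp_add mult_ac)
    also have "- (a + c) * \<bar>m\<bar> + a * \<bar>m\<bar> = - c * \<bar>m\<bar>" by (simp add: algebra_simps)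
    finally show "norm (h m \<epsilon> * exp (\<i> * of_real m * z)) \<le> K * exp (- c * \<bar>m\<bar>)" .
  qed
qed

lemma uniform_decay_strip:
  assumes "z \<in> strip b"
  obtains a where "z \<in> strip a" "a < b"
proof -
  obtain a where "\<bar>Im z\<bar> < a" "a < b" using assms dense unfolding strip_def by blast
  then show ?thesis using that by (auto simp: strip_def)
qed

lemma inv_fourier_holomorphic_param:
  assumes h: "uniform_decay b E h" and E: "open E" and z: "z \<in> strip b"
  shows "(\<lambda>\<epsilon>. inv_fourier (\<lambda>m. h m \<epsilon>) z) holomorphic_on E"
proof -
  have "\<bar>Im z\<bar> < b" using z by (simp add: strip_def)
  then obtain g where g: "integrable lborel g" "\<And>m z' \<epsilon>. \<epsilon> \<in> E \<Longrightarrow> \<bar>Im z'\<bar> \<le> \<bar>Im z\<bar> \<Longrightarrow> norm (h m \<epsilon> * exp (\<i> * of_real m * z')) \<le> g m"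
    by (rule uniform_decay_exp_bound[OF h]) (rule that)
  have "(\<lambda>\<epsilon>. LBINT m. h m \<epsilon> * exp (\<i> * of_real m * z)) holomorphic_on E"
  proof (rule holomorphic_integral_on[OF E _ _ _ g(1)])
    show "(\<lambda>m. h m \<epsilon> * exp (\<i> * of_real m * z)) \<in> borel_measurable lborel" if "\<epsilon> \<in> E" for \<epsilon>
      using decay_exp_measurable[OF uniform_decay_decay[OF h that]] by simp
    show "(\<lambda>\<epsilon>. h m \<epsilon> * exp (\<i> * of_real m * z)) holomorphic_on E" for m
      using h unfolding uniform_decay_def by (intro holomorphic_intros) auto
  qed (use g(2) in auto)
  then show ?thesis unfolding inv_fourier_def by (intro holomorphic_intros)
qed

text \<open>Meant for the derivative in z, whose joint continuity is the extra condition under which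
  partial derivatives give a total one. The narrower strip provides an integrable majorant.\<close>

lemma inv_fourier_continuous_param:
  assumes h: "uniform_decay b E h" and a: "a < b" and x: "\<epsilon> \<in> E" "z \<in> strip a"
  shows "continuous (at (\<epsilon>, z) within E \<times> strip a) (\<lambda>(\<epsilon>, z). inv_fourier (\<lambda>m. h m \<epsilon>) z)"
  unfolding continuous_within_sequentially
proof (intro allI impI)
  fix X assume X: "(\<forall>n. X n \<in> E \<times> strip a) \<and> X \<longlonglongrightarrow> (\<epsilon>, z)"
  obtain g where g: "integrable lborel g" "\<And>m z \<epsilon>. \<epsilon> \<in> E \<Longrightarrow> \<bar>Im z\<bar> \<le> a \<Longrightarrow> norm (h m \<epsilon> * exp (\<i> * of_real m * z)) \<le> g m"
    by (rule uniform_decay_exp_bound[OF h a]) (rule that)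
  have XE: "fst (X n) \<in> E" "snd (X n) \<in> strip a" for n using X by (auto simp: mem_Times_iff)
  have l: "(\<lambda>n. fst (X n)) \<longlonglongrightarrow> \<epsilon>" "(\<lambda>n. snd (X n)) \<longlonglongrightarrow> z"
    using tendsto_fst[of X "(\<epsilon>, z)"] tendsto_snd[of X "(\<epsilon>, z)"] X by auto
  have "(\<lambda>n. LBINT m. h m (fst (X n)) * exp (\<i> * of_real m * snd (X n))) \<longlonglongrightarrow> (LBINT m. h m \<epsilon> * exp (\<i> * of_real m * z))"
  proof (rule integral_dominated_convergence[where w = g])
    show "(\<lambda>m. h m \<epsilon> * exp (\<i> * of_real m * z)) \<in> borel_measurable lborel"
      using decay_exp_measurable[OF uniform_decay_decay[OF h x(1)]] by simp
    show "(\<lambda>m. h m (fst (X n)) * exp (\<i> * of_real m * snd (X n))) \<in> borel_measurable lborel" for n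
      using decay_exp_measurable[OF uniform_decay_decay[OF h XE(1)]] by simp
    show "AE m in lborel. norm (h m (fst (X n)) * exp (\<i> * of_real m * snd (X n))) \<le> g m" for n
    proof -
      have "\<bar>Im (snd (X n))\<bar> \<le> a" using XE(2)[of n] by (simp add: strip_def)
      then show ?thesis by (intro AE_I2 g(2)[OF XE(1)])
    qed
    show "AE m in lborel. (\<lambda>n. h m (fst (X n)) * exp (\<i> * of_real m * snd (X n))) \<longlonglongrightarrow> h m \<epsilon> * exp (\<i> * of_real m * z)"
    proof (intro AE_I2 tendsto_intros l)
      fix m
      have "h m holomorphic_on E" using h unfolding uniform_decay_def by blast
      then have "continuous_on E (h m)" by (rule holomorphic_on_imp_continuous_on)
      then show "(\<lambda>n. h m (fst (X n))) \<longlonglongrightarrow> h m \<epsilon>"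
        using XE(1) l(1) x(1) unfolding continuous_on_sequentially by (auto simp: o_def)
    qed
  qed (use g in auto)
  then show "((\<lambda>(\<epsilon>, z). inv_fourier (\<lambda>m. h m \<epsilon>) z) \<circ> X) \<longlonglongrightarrow> (case (\<epsilon>, z) of (\<epsilon>, z) \<Rightarrow> inv_fourier (\<lambda>m. h m \<epsilon>) z)"
    unfolding inv_fourier_def o_def case_prod_unfold fst_conv snd_conv by (intro tendsto_intros)
qed

text \<open>The partial derivative in \<open>\<epsilon>\<close> exists, and the one in z exists and
  is jointly continuous, so there is a total derivative, with complex coefficients by its form. The
  criterion asks for a convex set of z, here the narrower strip.\<close>

theorem inv_fourier_holomorphic3:
  assumes h: "uniform_decay b E h" and E: "open E"
  shows "holomorphic3_on (\<lambda>t z \<epsilon>. inv_fourier (\<lambda>m. h m \<epsilon>) z) (UNIV \<times> strip b \<times> E)"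
  unfolding holomorphic3_on_def
proof safe
  fix t z \<epsilon> assume z: "z \<in> strip b" and e: "\<epsilon> \<in> E"
  obtain a where a: "z \<in> strip a" "a < b" by (rule uniform_decay_strip[OF z]) (rule that)
  \<comment> \<open>Multiplication by im, that is, the derivative in z.\<close>
  define h' where "h' m \<epsilon> = poly [:0, 1:] (\<i> * of_real m) * h m \<epsilon>" for m \<epsilon>
  have h': "uniform_decay b E h'" unfolding h'_def[abs_def] by (rule uniform_decay_poly[OF h])
  obtain c1 where c1: "((\<lambda>\<epsilon>. inv_fourier (\<lambda>m. h m \<epsilon>) z) has_field_derivative c1) (at \<epsilon>)"
    using inv_fourier_holomorphic_param[OF h E z] e E by (auto simp: holomorphic_on_open)
  have cs: "convex (strip a)"
  proof -
    have "strip a = Im -` {- a<..<a}" by (auto simp: strip_def)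
    then show ?thesis by (simp add: convex_linear_vimage[OF bounded_linear.linear[OF bounded_linear_Im]])
  qed
  have "((\<lambda>(\<epsilon>, z). inv_fourier (\<lambda>m. h m \<epsilon>) z) has_derivative
    (\<lambda>(k, l). c1 * k + blinfun_apply (blinfun_mult_right (inv_fourier (\<lambda>m. h' m \<epsilon>) z)) l)) (at (\<epsilon>, z) within E \<times> strip a)"
  proof (rule has_derivative_partialsI[where fy = "\<lambda>\<epsilon> z. blinfun_mult_right (inv_fourier (\<lambda>m. h' m \<epsilon>) z)"])
    show "((\<lambda>\<epsilon>. inv_fourier (\<lambda>m. h m \<epsilon>) z) has_derivative (*) c1) (at \<epsilon> within E)"
      using c1 by (simp add: has_field_derivative_def has_derivative_at_withinI)
    show "(inv_fourier (\<lambda>m. h m \<epsilon>) has_derivative blinfun_apply (blinfun_mult_right (inv_fourier (\<lambda>m. h' m \<epsilon>) z))) (at z within strip a)"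
      if "\<epsilon> \<in> E" "z \<in> strip a" for \<epsilon> z
    proof -
      have "z \<in> strip b" using that a by (auto simp: strip_def)
      from inv_fourier_has_derivative[OF uniform_decay_decay[OF h that(1)] this] show ?thesis
        by (simp add: h'_def has_field_derivative_def has_derivative_at_withinI)
    qed
    have "continuous (at (\<epsilon>, z) within E \<times> strip a) (\<lambda>(\<epsilon>, z). inv_fourier (\<lambda>m. h' m \<epsilon>) z)"
      by (rule inv_fourier_continuous_param[OF h' a(2) e a(1)])
    then show "continuous (at (\<epsilon>, z) within E \<times> strip a) (\<lambda>(\<epsilon>, z). blinfun_mult_right (inv_fourier (\<lambda>m. h' m \<epsilon>) z))"
      unfolding case_prod_unfold by (rule bounded_linear.continuous[OF bounded_linear_blinfun_mult_right])
  qed (use a cs in auto)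
  moreover have "at (\<epsilon>, z) within E \<times> strip a = at (\<epsilon>, z)"
    using e a E open_strip by (intro at_within_open) (auto intro: open_Times)
  ultimately have d: "((\<lambda>(\<epsilon>, z). inv_fourier (\<lambda>m. h m \<epsilon>) z) has_derivative
    (\<lambda>(k, l). c1 * k + inv_fourier (\<lambda>m. h' m \<epsilon>) z * l)) (at (\<epsilon>, z))" by simp
  have s: "((\<lambda>x :: complex \<times> complex \<times> complex. (snd (snd x), fst (snd x))) has_derivative (\<lambda>x. (snd (snd x), fst (snd x)))) (at (t, z, \<epsilon>))"
    by (auto intro!: derivative_eq_intros)
  have "((\<lambda>(t, z, \<epsilon>). inv_fourier (\<lambda>m. h m \<epsilon>) z) has_derivative (\<lambda>(x, k, l). 0 * x + inv_fourier (\<lambda>m. h' m \<epsilon>) z * k + c1 * l)) (at (t, z, \<epsilon>))"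
  proof -
    have "((\<lambda>(\<epsilon>, z). inv_fourier (\<lambda>m. h m \<epsilon>) z) has_derivative
      (\<lambda>(k, l). c1 * k + inv_fourier (\<lambda>m. h' m \<epsilon>) z * l)) (at (snd (snd (t, z, \<epsilon>)), fst (snd (t, z, \<epsilon>))))" using d by simp
    from has_derivative_compose[OF s this] show ?thesis by (simp add: case_prod_unfold add.commute)
  qed
  then show "\<exists>a b c. ((\<lambda>(t, z, \<epsilon>). inv_fourier (\<lambda>m. h m \<epsilon>) z) has_derivative (\<lambda>(h, k, l). a * h + b * k + c * l)) (at (t, z, \<epsilon>))" by blast
qed

text \<open>Derivatives in z and dilations in t are included because the composition of two
  operators has products of such functions as coefficients.\<close>

lemma op_coeffs_holomorphic3:
  assumes C: "\<And>l j. l \<in> {1..<topD X} \<Longrightarrow> j \<in> idx X l \<Longrightarrow> uniform_decay b E (Ccoef X l j)" and E: "open E"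
    and a: "a \<in> op_coeffs X"
  shows "holomorphic3_on (\<lambda>t z \<epsilon>. (deriv ^^ n) (\<lambda>z. a (c * t) z \<epsilon>) z) (UNIV \<times> strip b \<times> E)"
proof -
  have cd: "(deriv ^^ n) (\<lambda>z. w) z = (if n = 0 then w else 0)" for w z :: complex
    by simp
  consider "a = (\<lambda>t z \<epsilon>. 1)" | "a = (\<lambda>t z \<epsilon>. (\<epsilon> * t) ^ topd X)"
    | l j where "l \<in> {1..<topD X}" "j \<in> idx X l" "a = (\<lambda>t z \<epsilon>. t ^ texp X l j * \<epsilon> ^ eexp X l j * coef_c X l j z \<epsilon>)"
    using a unfolding op_coeffs_def by blast
  then show ?thesis
  proof cases
    case 1
    show ?thesis unfolding 1 cd by (rule holomorphic3_const)
  next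
    case 2
    show ?thesis unfolding 2 cd by (cases "n = 0") (auto intro!: holomorphic3_power holomorphic3_mult holomorphic3_const holomorphic3_t holomorphic3_eps)
  next
    case (3 l j)
    define h where "h m \<epsilon> = poly (monom 1 n) (\<i> * of_real m) * Ccoef X l j m \<epsilon>" for m \<epsilon>
    have h: "uniform_decay b E h" unfolding h_def[abs_def] by (rule uniform_decay_poly[OF C[OF 3(1,2)]])
    show ?thesis
    proof (rule holomorphic3_cong)
      show "open (UNIV \<times> strip b \<times> E)" by (intro open_Times open_strip E) auto
      show "holomorphic3_on (\<lambda>t z \<epsilon>. ((c * t) ^ texp X l j * \<epsilon> ^ eexp X l j) * inv_fourier (\<lambda>m. h m \<epsilon>) z) (UNIV \<times> strip b \<times> E)"
        by (intro holomorphic3_mult holomorphic3_power holomorphic3_const holomorphic3_t holomorphic3_eps inv_fourier_holomorphic3[OF h E])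
      fix t z \<epsilon> :: complex assume "(t, z, \<epsilon>) \<in> UNIV \<times> strip b \<times> E"
      then have z: "z \<in> strip b" and e: "\<epsilon> \<in> E" by auto
      define w where "w = (c * t) ^ texp X l j * \<epsilon> ^ eexp X l j"
      have "(\<lambda>z. a (c * t) z \<epsilon>) = inv_fourier (\<lambda>m. w * Ccoef X l j m \<epsilon>)"
        by (simp add: fun_eq_iff 3(3) w_def coef_c_def inv_fourier_cmult)
      then have "(deriv ^^ n) (\<lambda>z. a (c * t) z \<epsilon>) z = (deriv ^^ n) (inv_fourier (\<lambda>m. w * Ccoef X l j m \<epsilon>)) z"
        by simp
      also have "\<dots> = inv_fourier (\<lambda>m. (\<i> * of_real m) ^ n * (w * Ccoef X l j m \<epsilon>)) z"
        by (rule inv_fourier_higher_deriv[OF decay_cmult[OF uniform_decay_decay[OF C[OF 3(1,2)] e]] z])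
      also have "\<dots> = w * inv_fourier (\<lambda>m. h m \<epsilon>) z"
        by (subst inv_fourier_cmult[symmetric]) (simp add: h_def poly_monom mult_ac)
      finally show "(deriv ^^ n) (\<lambda>z. a (c * t) z \<epsilon>) z = ((c * t) ^ texp X l j * \<epsilon> ^ eexp X l j) * inv_fourier (\<lambda>m. h m \<epsilon>) z"
        by (simp only: w_def)
    qed
  qed
qed

lemma forcing_holomorphic3:
  assumes "\<And>n. n \<le> N0 \<Longrightarrow> uniform_decay b E (G n)" "open E"
  shows "holomorphic3_on (forcing N0 G) (UNIV \<times> strip b \<times> E)"
  unfolding forcing_def[abs_def]
  by (intro holomorphic3_sum holomorphic3_mult holomorphic3_power holomorphic3_t holomorphic3_eps inv_fourier_holomorphic3 assms) auto

section \<open>The formal solution\<close>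

text \<open>V is the domain of z, and E is a set of values of \<open>\<epsilon>\<close> accumulating
  at 0, in the application a segment of a ray. The unit ball makes \<open>\<epsilon>\<close> itself
  a bounded function; the limit point gives uniqueness of expansions.\<close>

locale asymptotics =
  fixes V E :: "complex set"
  assumes open_V: "open V" and E_ball: "E \<subseteq> ball 0 1" and E_0: "0 \<notin> E" and lim_E: "0 islimpt E"
begin

text \<open>Boundedness is local in z and uniform in \<open>\<epsilon>\<close>, so that Cauchy's
  inequality passes it on to derivatives in z.\<close>

definition loc_bdd :: "(complex \<Rightarrow> complex \<Rightarrow> complex) \<Rightarrow> bool" where
  "loc_bdd g \<longleftrightarrow> (\<forall>z\<in>V. \<exists>\<delta>>0. \<exists>C. \<forall>y\<in>ball z \<delta>. \<forall>\<epsilon>\<in>E. norm (g y \<epsilon>) \<le> C)"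

text \<open>An expansion up to order N with error \<open>O(\<epsilon>^N)\<close> means that this quotient is bounded.\<close>

definition remainder :: "nat \<Rightarrow> (complex \<Rightarrow> complex \<Rightarrow> complex) \<Rightarrow> (complex \<Rightarrow> complex fps) \<Rightarrow> complex \<Rightarrow> complex \<Rightarrow> complex" where
  "remainder N g G z \<epsilon> = (g z \<epsilon> - (\<Sum>n<N. fps_nth (G z) n * \<epsilon> ^ n)) / \<epsilon> ^ N"

definition expands :: "(complex \<Rightarrow> complex \<Rightarrow> complex) \<Rightarrow> (complex \<Rightarrow> complex fps) \<Rightarrow> bool" where
  "expands g G \<longleftrightarrow> (\<forall>\<epsilon>\<in>E. (\<lambda>z. g z \<epsilon>) holomorphic_on V) \<and> (\<forall>N. loc_bdd (remainder N g G))"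

lemma loc_bddI:
  assumes "\<And>z. z \<in> V \<Longrightarrow> \<exists>\<delta>>0. \<exists>C. \<forall>y\<in>ball z \<delta> \<inter> V. \<forall>\<epsilon>\<in>E. norm (g y \<epsilon>) \<le> C"
  shows "loc_bdd g"
  unfolding loc_bdd_def
proof
  fix z assume z: "z \<in> V"
  obtain \<delta> C where d: "\<delta> > 0" "\<And>y \<epsilon>. y \<in> ball z \<delta> \<inter> V \<Longrightarrow> \<epsilon> \<in> E \<Longrightarrow> norm (g y \<epsilon>) \<le> C" using assms[OF z] by blast
  obtain r where r: "r > 0" "ball z r \<subseteq> V" using open_V z open_contains_ball by blast
  have "norm (g y \<epsilon>) \<le> C" if "y \<in> ball z (min \<delta> r)" "\<epsilon> \<in> E" for y \<epsilon>
    using that r by (intro d(2)) auto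
  then show "\<exists>\<delta>>0. \<exists>C. \<forall>y\<in>ball z \<delta>. \<forall>\<epsilon>\<in>E. norm (g y \<epsilon>) \<le> C"
    using d(1) r(1) by (intro exI[of _ "min \<delta> r"] conjI exI[of _ C]) auto
qed

lemma loc_bdd_cong:
  assumes "loc_bdd g" "\<And>z \<epsilon>. z \<in> V \<Longrightarrow> \<epsilon> \<in> E \<Longrightarrow> f z \<epsilon> = g z \<epsilon>"
  shows "loc_bdd f"
proof (rule loc_bddI)
  fix z assume "z \<in> V"
  then obtain \<delta> C where "\<delta> > 0" "\<And>y \<epsilon>. y \<in> ball z \<delta> \<Longrightarrow> \<epsilon> \<in> E \<Longrightarrow> norm (g y \<epsilon>) \<le> C"
    using assms(1) unfolding loc_bdd_def by blast
  then show "\<exists>\<delta>>0. \<exists>C. \<forall>y\<in>ball z \<delta> \<inter> V. \<forall>\<epsilon>\<in>E. norm (f y \<epsilon>) \<le> C"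
    using assms(2) by (intro exI[of _ \<delta>] conjI exI[of _ C]) auto
qed

lemma loc_bdd_add:
  assumes "loc_bdd f" "loc_bdd g"
  shows "loc_bdd (\<lambda>z \<epsilon>. f z \<epsilon> + g z \<epsilon>)"
  unfolding loc_bdd_def
proof
  fix z assume z: "z \<in> V"
  obtain \<delta>1 C1 where 1: "\<delta>1 > 0" "\<And>y \<epsilon>. y \<in> ball z \<delta>1 \<Longrightarrow> \<epsilon> \<in> E \<Longrightarrow> norm (f y \<epsilon>) \<le> C1"
    using assms(1) z unfolding loc_bdd_def by blast
  obtain \<delta>2 C2 where 2: "\<delta>2 > 0" "\<And>y \<epsilon>. y \<in> ball z \<delta>2 \<Longrightarrow> \<epsilon> \<in> E \<Longrightarrow> norm (g y \<epsilon>) \<le> C2"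
    using assms(2) z unfolding loc_bdd_def by blast
  have "norm (f y \<epsilon> + g y \<epsilon>) \<le> C1 + C2" if "y \<in> ball z (min \<delta>1 \<delta>2)" "\<epsilon> \<in> E" for y \<epsilon>
    using that by (intro norm_triangle_le add_mono 1 2) auto
  then show "\<exists>\<delta>>0. \<exists>C. \<forall>y\<in>ball z \<delta>. \<forall>\<epsilon>\<in>E. norm (f y \<epsilon> + g y \<epsilon>) \<le> C"
    using 1(1) 2(1) by (intro exI[of _ "min \<delta>1 \<delta>2"] conjI exI[of _ "C1 + C2"]) auto
qed

lemma loc_bdd_mult:
  assumes "loc_bdd f" "loc_bdd g"
  shows "loc_bdd (\<lambda>z \<epsilon>. f z \<epsilon> * g z \<epsilon>)"
  unfolding loc_bdd_def
proof
  fix z assume z: "z \<in> V"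
  obtain \<delta>1 C1 where 1: "\<delta>1 > 0" "\<And>y \<epsilon>. y \<in> ball z \<delta>1 \<Longrightarrow> \<epsilon> \<in> E \<Longrightarrow> norm (f y \<epsilon>) \<le> C1"
    using assms(1) z unfolding loc_bdd_def by blast
  obtain \<delta>2 C2 where 2: "\<delta>2 > 0" "\<And>y \<epsilon>. y \<in> ball z \<delta>2 \<Longrightarrow> \<epsilon> \<in> E \<Longrightarrow> norm (g y \<epsilon>) \<le> C2"
    using assms(2) z unfolding loc_bdd_def by blast
  have "norm (f y \<epsilon> * g y \<epsilon>) \<le> C1 * C2" if y: "y \<in> ball z (min \<delta>1 \<delta>2)" and e: "\<epsilon> \<in> E" for y \<epsilon>
  proof -
    have "norm (f y \<epsilon>) \<le> C1" "norm (g y \<epsilon>) \<le> C2" using 1(2)[OF _ e] 2(2)[OF _ e] y by auto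
    then show ?thesis unfolding norm_mult by (intro mult_mono) (auto intro: order.trans[OF norm_ge_zero])
  qed
  then show "\<exists>\<delta>>0. \<exists>C. \<forall>y\<in>ball z \<delta>. \<forall>\<epsilon>\<in>E. norm (f y \<epsilon> * g y \<epsilon>) \<le> C"
    using 1(1) 2(1) by (intro exI[of _ "min \<delta>1 \<delta>2"] conjI exI[of _ "C1 * C2"]) auto
qed

lemma loc_bdd_eps: "loc_bdd (\<lambda>z \<epsilon>. \<epsilon>)"
  unfolding loc_bdd_def using E_ball by (intro ballI exI[of _ 1] conjI exI[of _ 1]) (auto simp: subset_iff less_imp_le)

lemma loc_bdd_const: "loc_bdd (\<lambda>z \<epsilon>. c)"
  unfolding loc_bdd_def by (intro ballI exI[of _ 1] conjI exI[of _ "norm c"]) auto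

lemma loc_bdd_diff: "loc_bdd f \<Longrightarrow> loc_bdd g \<Longrightarrow> loc_bdd (\<lambda>z \<epsilon>. f z \<epsilon> - g z \<epsilon>)"
  using loc_bdd_add[of f "\<lambda>z \<epsilon>. - 1 * g z \<epsilon>"] loc_bdd_mult[OF loc_bdd_const[of "- 1"], of g] by simp

lemma loc_bdd_holomorphic:
  assumes "c holomorphic_on V"
  shows "loc_bdd (\<lambda>z \<epsilon>. c z)"
  unfolding loc_bdd_def
proof
  fix z assume z: "z \<in> V"
  then obtain r where r: "r > 0" "cball z r \<subseteq> V" using open_V open_contains_cball by blast
  have "compact (c ` cball z r)"
    by (intro compact_continuous_image holomorphic_on_imp_continuous_on holomorphic_on_subset[OF assms r(2)]) auto
  then obtain B where B: "\<And>x. x \<in> c ` cball z r \<Longrightarrow> norm x \<le> B" using compact_imp_bounded bounded_iff by metis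
  have "norm (c y) \<le> B" if "y \<in> ball z r" for y
    using that by (intro B imageI) (simp add: less_imp_le)
  then show "\<exists>\<delta>>0. \<exists>C. \<forall>y\<in>ball z \<delta>. \<forall>\<epsilon>\<in>E. norm (c y) \<le> C"
    using r(1) by (intro exI[of _ r] conjI exI[of _ B]) auto
qed

lemma remainder_0: "remainder 0 g G = g" by (simp add: remainder_def fun_eq_iff)

lemma remainder_step: "\<epsilon> \<noteq> 0 \<Longrightarrow> remainder n g G z \<epsilon> = fps_nth (G z) n + \<epsilon> * remainder (Suc n) g G z \<epsilon>"
  by (simp add: remainder_def field_simps)

text \<open>Removing the constant term and dividing by \<open>\<epsilon>\<close> lowers the order by
  one; inductions on the order of the expansion proceed this way.\<close>

lemma remainder_Suc:
  assumes "\<epsilon> \<noteq> 0"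
  shows "remainder (Suc N) g G z \<epsilon> = remainder N (\<lambda>z \<epsilon>. (g z \<epsilon> - fps_nth (G z) 0) / \<epsilon>) (\<lambda>z. fps_shift 1 (G z)) z \<epsilon>"
proof -
  have "(\<Sum>n<Suc N. fps_nth (G z) n * \<epsilon> ^ n) = fps_nth (G z) 0 + \<epsilon> * (\<Sum>n<N. fps_nth (G z) (Suc n) * \<epsilon> ^ n)"
    unfolding sum.lessThan_Suc_shift by (simp add: sum_distrib_left mult_ac)
  then show ?thesis using assms by (simp add: remainder_def divide_simps)
qed

lemma remainder_add: "remainder N (\<lambda>z \<epsilon>. f z \<epsilon> + g z \<epsilon>) (\<lambda>z. F z + G z) z \<epsilon> = remainder N f F z \<epsilon> + remainder N g G z \<epsilon>"
  by (simp add: remainder_def sum.distrib distrib_right add_divide_distrib[symmetric] algebra_simps)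

lemma remainder_cmult: "remainder N (\<lambda>z \<epsilon>. c z * g z \<epsilon>) (\<lambda>z. fps_const (c z) * G z) z \<epsilon> = c z * remainder N g G z \<epsilon>"
  by (simp add: remainder_def sum_distrib_left right_diff_distrib mult.assoc)

lemma E_nz: "\<epsilon> \<in> E \<Longrightarrow> \<epsilon> \<noteq> 0" using E_0 by auto

text \<open>A coefficient is the difference of the remainder of its order and
  \<open>\<epsilon>\<close> times the next remainder, both of which are bounded.\<close>

lemma coeff_loc_bdd:
  assumes "\<And>N. loc_bdd (remainder N g G)"
  shows "loc_bdd (\<lambda>z \<epsilon>. fps_nth (G z) n)"
proof (rule loc_bdd_cong[OF loc_bdd_diff[OF assms[of n] loc_bdd_mult[OF loc_bdd_eps assms[of "Suc n"]]]])
  show "fps_nth (G z) n = remainder n g G z \<epsilon> - \<epsilon> * remainder (Suc n) g G z \<epsilon>" if "\<epsilon> \<in> E" for z \<epsilon>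
    unfolding remainder_step[OF E_nz[OF that], of n g G z] by simp
qed

text \<open>Induction on the order. If g1 and h1 arise from g and h by removing the constant terms
  G0, H0 and dividing by \<open>\<epsilon>\<close>, then
  \<open>(g h - G0 H0) / \<epsilon> = g1 h + G0 h1\<close>, and the product of the formal series
  shifts in the same way.\<close>

lemma loc_bdd_remainder_mult:
  assumes "\<And>N. loc_bdd (remainder N g G)" "\<And>N. loc_bdd (remainder N h H)"
  shows "loc_bdd (remainder N (\<lambda>z \<epsilon>. g z \<epsilon> * h z \<epsilon>) (\<lambda>z. G z * H z))"
  using assms
proof (induction N arbitrary: g G)
  case 0
  then show ?case using loc_bdd_mult[of g h] "0.prems"(1)[of 0] "0.prems"(2)[of 0] by (simp add: remainder_0)
next
  case (Suc N)
  define g1 where "g1 z \<epsilon> = (g z \<epsilon> - fps_nth (G z) 0) / \<epsilon>" for z \<epsilon>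
  define h1 where "h1 z \<epsilon> = (h z \<epsilon> - fps_nth (H z) 0) / \<epsilon>" for z \<epsilon>
  have g1: "loc_bdd (remainder N g1 (\<lambda>z. fps_shift 1 (G z)))" for N
    by (rule loc_bdd_cong[OF Suc.prems(1)[of "Suc N"]]) (simp add: remainder_Suc[OF E_nz] g1_def[abs_def])
  have h1: "loc_bdd (remainder N h1 (\<lambda>z. fps_shift 1 (H z)))" for N
    by (rule loc_bdd_cong[OF Suc.prems(2)[of "Suc N"]]) (simp add: remainder_Suc[OF E_nz] h1_def[abs_def])
  have "loc_bdd (\<lambda>z \<epsilon>. remainder N (\<lambda>z \<epsilon>. g1 z \<epsilon> * h z \<epsilon>) (\<lambda>z. fps_shift 1 (G z) * H z) z \<epsilon>
      + fps_nth (G z) 0 * remainder N h1 (\<lambda>z. fps_shift 1 (H z)) z \<epsilon>)"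
    by (intro loc_bdd_add loc_bdd_mult coeff_loc_bdd[OF Suc.prems(1)] h1 Suc.IH g1 Suc.prems(2))
  then show ?case
  proof (rule loc_bdd_cong)
    fix z \<epsilon> assume e: "\<epsilon> \<in> E"
    have sh: "fps_shift 1 (G z * H z) = fps_shift 1 (G z) * H z + fps_const (fps_nth (G z) 0) * fps_shift 1 (H z)" for z
    proof (rule fps_ext)
      fix n
      have "fps_nth (fps_shift 1 (G z * H z)) n = (\<Sum>i=0..Suc n. fps_nth (G z) i * fps_nth (H z) (Suc n - i))"
        by (simp add: fps_mult_nth)
      also have "\<dots> = fps_nth (G z) 0 * fps_nth (H z) (Suc n) + (\<Sum>i=0..n. fps_nth (G z) (Suc i) * fps_nth (H z) (n - i))"
        by (subst sum.atLeast0_atMost_Suc_shift) simp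
      also have "(\<Sum>i=0..n. fps_nth (G z) (Suc i) * fps_nth (H z) (n - i)) = fps_nth (fps_shift 1 (G z) * H z) n"
        by (simp add: fps_mult_nth)
      finally show "fps_nth (fps_shift 1 (G z * H z)) n = fps_nth (fps_shift 1 (G z) * H z + fps_const (fps_nth (G z) 0) * fps_shift 1 (H z)) n"
        by simp
    qed
    have fn: "(\<lambda>z \<epsilon>. (g z \<epsilon> * h z \<epsilon> - fps_nth (G z * H z) 0) / \<epsilon>) = (\<lambda>z \<epsilon>. g1 z \<epsilon> * h z \<epsilon> + fps_nth (G z) 0 * h1 z \<epsilon>)"
      by (simp add: fun_eq_iff g1_def h1_def fps_mult_nth_0 add_divide_distrib[symmetric] algebra_simps)
    show "remainder (Suc N) (\<lambda>z \<epsilon>. g z \<epsilon> * h z \<epsilon>) (\<lambda>z. G z * H z) z \<epsilon> = remainder N (\<lambda>z \<epsilon>. g1 z \<epsilon> * h z \<epsilon>) (\<lambda>z. fps_shift 1 (G z) * H z) z \<epsilon>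
      + fps_nth (G z) 0 * remainder N h1 (\<lambda>z. fps_shift 1 (H z)) z \<epsilon>"
      unfolding remainder_Suc[OF E_nz[OF e]] fn sh remainder_add remainder_cmult[of N "\<lambda>z. fps_nth (G z) 0"] ..
  qed
qed

lemma expands_mult: "expands g G \<Longrightarrow> expands h H \<Longrightarrow> expands (\<lambda>z \<epsilon>. g z \<epsilon> * h z \<epsilon>) (\<lambda>z. G z * H z)"
  unfolding expands_def using loc_bdd_remainder_mult by (auto intro: holomorphic_intros)

lemma expands_add: "expands g G \<Longrightarrow> expands h H \<Longrightarrow> expands (\<lambda>z \<epsilon>. g z \<epsilon> + h z \<epsilon>) (\<lambda>z. G z + H z)"
  unfolding expands_def by (auto intro!: holomorphic_intros intro: loc_bdd_cong[OF loc_bdd_add] simp: remainder_add)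

lemma expands_const: "c holomorphic_on V \<Longrightarrow> expands (\<lambda>z \<epsilon>. c z) (\<lambda>z. fps_const (c z))"
  unfolding expands_def
proof (intro conjI allI ballI)
  assume c: "c holomorphic_on V"
  show "loc_bdd (remainder N (\<lambda>z \<epsilon>. c z) (\<lambda>z. fps_const (c z)))" for N
  proof (cases N)
    case 0
    then show ?thesis using loc_bdd_holomorphic[OF c] by (simp add: remainder_0)
  next
    case (Suc M)
    show ?thesis unfolding Suc
      by (rule loc_bdd_cong[OF loc_bdd_const[of 0]]) (simp only: remainder_def sum.lessThan_Suc_shift, simp)
  qed
qed

lemma expands_eps: "expands (\<lambda>z \<epsilon>. \<epsilon>) (\<lambda>z. fps_X)"
  unfolding expands_def
proof (intro conjI allI ballI)
  show "loc_bdd (remainder N (\<lambda>z \<epsilon>. \<epsilon>) (\<lambda>z. fps_X))" for N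
  proof -
    consider "N = 0" | "N = 1" | M where "N = Suc (Suc M)" by (metis One_nat_def not0_implies_Suc)
    then show ?thesis
    proof cases
      case 1
      then show ?thesis using loc_bdd_eps by (simp add: remainder_0)
    next
      case 2
      show ?thesis by (rule loc_bdd_cong[OF loc_bdd_const[of 1]]) (use E_nz 2 in \<open>simp add: remainder_def\<close>)
    next
      case (3 M)
      show ?thesis unfolding 3 by (rule loc_bdd_cong[OF loc_bdd_const[of 0]]) (simp add: remainder_def sum.lessThan_Suc_shift del: sum.lessThan_Suc)
    qed
  qed
qed (auto intro: holomorphic_intros)

lemma expands_cong:
  assumes g: "expands g G" and eq: "\<And>z \<epsilon>. z \<in> V \<Longrightarrow> \<epsilon> \<in> E \<Longrightarrow> f z \<epsilon> = g z \<epsilon>"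
  shows "expands f G"
  unfolding expands_def
proof (intro conjI allI ballI)
  fix \<epsilon> assume e: "\<epsilon> \<in> E"
  have "(\<lambda>z. g z \<epsilon>) holomorphic_on V" using g e unfolding expands_def by blast
  then show "(\<lambda>z. f z \<epsilon>) holomorphic_on V"
    by (rule holomorphic_transform) (rule eq[OF _ e, symmetric])
next
  fix N
  show "loc_bdd (remainder N f G)"
  proof (rule loc_bdd_cong)
    show "loc_bdd (remainder N g G)" using g unfolding expands_def by blast
    show "remainder N f G z \<epsilon> = remainder N g G z \<epsilon>" if "z \<in> V" "\<epsilon> \<in> E" for z \<epsilon>
      unfolding remainder_def eq[OF that] ..
  qed
qed

lemma expands_power: "expands g G \<Longrightarrow> expands (\<lambda>z \<epsilon>. g z \<epsilon> ^ n) (\<lambda>z. G z ^ n)"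
proof (induction n)
  case 0
  then show ?case using expands_const[of "\<lambda>z. 1"] by simp
next
  case (Suc n)
  then show ?case using expands_mult[of g G] by simp
qed

lemma expands_sum: "(\<And>i. i \<in> I \<Longrightarrow> expands (g i) (G i)) \<Longrightarrow> expands (\<lambda>z \<epsilon>. \<Sum>i\<in>I. g i z \<epsilon>) (\<lambda>z. \<Sum>i\<in>I. G i z)"
proof (induction I rule: infinite_finite_induct)
  case (insert i I)
  then show ?case using expands_add[of "g i" "G i"] by simp
qed (use expands_const[of "\<lambda>z. 0"] in simp_all)

lemma expands_diff: "expands g G \<Longrightarrow> expands h H \<Longrightarrow> expands (\<lambda>z \<epsilon>. g z \<epsilon> - h z \<epsilon>) (\<lambda>z. G z - H z)"
  using expands_add[of g G "\<lambda>z \<epsilon>. - 1 * h z \<epsilon>" "\<lambda>z. fps_const (- 1) * H z"] expands_mult[OF expands_const[of "\<lambda>z. - 1"], of h H]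
  by (simp flip: fps_const_neg)

lemma E_sequence:
  obtains e :: "nat \<Rightarrow> complex" where "\<And>k. e k \<in> E" "e \<longlonglongrightarrow> 0"
  using lim_E unfolding islimpt_sequential by blast

text \<open>If all lower coefficients agree, those of index n differ by \<open>\<epsilon>\<close>
  times a difference of remainders of order n + 1. This is bounded, and \<open>\<epsilon>\<close>
  tends to 0 along a sequence in E.\<close>

lemma expands_unique:
  assumes g: "expands g G" "expands g H" and z: "z \<in> V"
  shows "G z = H z"
proof (rule fps_ext)
  fix n
  obtain e where e: "\<And>k. e k \<in> E" "e \<longlonglongrightarrow> (0::complex)" by (rule E_sequence) (rule that)
  show "fps_nth (G z) n = fps_nth (H z) n"
  proof (induction n rule: less_induct)
    case (less n)
    define d where "d k = remainder (Suc n) g G z (e k) - remainder (Suc n) g H z (e k)" for k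
    have "remainder n g G z (e k) = remainder n g H z (e k)" for k unfolding remainder_def using less by simp
    then have eq: "fps_nth (G z) n - fps_nth (H z) n = - (e k * d k)" for k
      using remainder_step[OF E_nz[OF e(1)[of k]], of n g G z] remainder_step[OF E_nz[OF e(1)[of k]], of n g H z]
      by (simp add: d_def algebra_simps)
    have "loc_bdd (\<lambda>z \<epsilon>. remainder (Suc n) g G z \<epsilon> - remainder (Suc n) g H z \<epsilon>)" using g unfolding expands_def by (intro loc_bdd_diff) auto
    then obtain \<delta> C where "\<delta> > 0" "\<forall>y\<in>ball z \<delta>. \<forall>\<epsilon>\<in>E. norm (remainder (Suc n) g G y \<epsilon> - remainder (Suc n) g H y \<epsilon>) \<le> C"
      using z unfolding loc_bdd_def by blast
    then have C: "norm (d k) \<le> C" for k using e(1) by (simp add: d_def)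
    have "(\<lambda>k. norm (e k) * C) \<longlonglongrightarrow> 0 * C" using e(2) by (intro tendsto_intros tendsto_norm_zero)
    moreover have "norm (fps_nth (G z) n - fps_nth (H z) n) \<le> norm (e k) * C" for k
      unfolding eq[of k] norm_minus_cancel norm_mult by (intro mult_left_mono C) auto
    ultimately have "norm (fps_nth (G z) n - fps_nth (H z) n) \<le> 0 * C"
      by (intro LIMSEQ_le_const[of "\<lambda>k. norm (e k) * C"]) auto
    then show ?case by simp
  qed
qed

text \<open>The coefficient of index n is the locally uniform limit, for \<open>\<epsilon>\<close>
  tending to 0 in E, of the remainders of order n, which involve lower coefficients only and are
  holomorphic by induction.\<close>

lemma expands_coeff_holomorphic:
  assumes g: "expands g G"
  shows "(\<lambda>z. fps_nth (G z) n) holomorphic_on V"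
proof (induction n rule: less_induct)
  case (less n)
  obtain e where e: "\<And>k. e k \<in> E" "e \<longlonglongrightarrow> (0::complex)" by (rule E_sequence) (rule that)
  show ?case
  proof (rule holomorphic_uniform_sequence[OF open_V])
    show "(\<lambda>z. remainder n g G z (e k)) holomorphic_on V" for k
      unfolding remainder_def using g e(1) E_nz[OF e(1)] less unfolding expands_def by (intro holomorphic_intros) auto
    fix z assume z: "z \<in> V"
    have "loc_bdd (remainder (Suc n) g G)" using g unfolding expands_def by blast
    then obtain \<delta> C where d: "\<delta> > 0" "\<forall>y\<in>ball z \<delta>. \<forall>\<epsilon>\<in>E. norm (remainder (Suc n) g G y \<epsilon>) \<le> C"
      using z unfolding loc_bdd_def by blast
    obtain r where r: "r > 0" "cball z r \<subseteq> V" using open_V z open_contains_cball by blast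
    define s where "s = min r (\<delta> / 2)"
    have s: "s > 0" "cball z s \<subseteq> V" "cball z s \<subseteq> ball z \<delta>" using d r by (auto simp: s_def)
    have "uniform_limit (cball z s) (\<lambda>k z. remainder n g G z (e k)) (\<lambda>z. fps_nth (G z) n) sequentially"
    proof (rule uniform_limitI)
      fix \<eta> :: real assume \<eta>: "\<eta> > 0"
      have "(\<lambda>k. norm (e k) * C) \<longlonglongrightarrow> 0 * C" using e(2) by (intro tendsto_intros tendsto_norm_zero)
      then have "eventually (\<lambda>k. norm (e k) * C < \<eta>) sequentially" using \<eta> by (intro order_tendstoD(2)[of _ "0 * C"]) auto
      then show "\<forall>\<^sub>F k in sequentially. \<forall>y\<in>cball z s. dist (remainder n g G y (e k)) (fps_nth (G y) n) < \<eta>"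
      proof eventually_elim
        case (elim k)
        show ?case
        proof
          fix y assume "y \<in> cball z s"
          then have "norm (remainder (Suc n) g G y (e k)) \<le> C" using d(2) s(3) e(1) by blast
          then have "norm (e k * remainder (Suc n) g G y (e k)) \<le> norm (e k) * C" unfolding norm_mult by (intro mult_left_mono) auto
          then show "dist (remainder n g G y (e k)) (fps_nth (G y) n) < \<eta>"
            using elim remainder_step[OF E_nz[OF e(1)[of k]], of n g G y] by (simp add: dist_norm)
        qed
      qed
    qed
    then show "\<exists>d>0. cball z d \<subseteq> V \<and> uniform_limit (cball z d) (\<lambda>k z. remainder n g G z (e k)) (\<lambda>z. fps_nth (G z) n) sequentially"
      using s by blast
  qed
qed

text \<open>The remainder of the derivative is the derivative of the remainder, and Cauchy's
  inequality bounds it on a smaller disc.\<close>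

lemma expands_deriv:
  assumes g: "expands g G"
  shows "expands (\<lambda>z \<epsilon>. deriv (\<lambda>z. g z \<epsilon>) z) (\<lambda>z. Abs_fps (\<lambda>n. deriv (\<lambda>z. fps_nth (G z) n) z))"
  unfolding expands_def
proof (intro conjI allI ballI)
  have hol: "(\<lambda>z. g z \<epsilon>) holomorphic_on V" if "\<epsilon> \<in> E" for \<epsilon> using g that unfolding expands_def by blast
  show "(\<lambda>z. deriv (\<lambda>z. g z \<epsilon>) z) holomorphic_on V" if "\<epsilon> \<in> E" for \<epsilon>
    using holomorphic_deriv[OF hol[OF that] open_V] .
  fix N
  have holr: "(\<lambda>z. remainder N g G z \<epsilon>) holomorphic_on V" if "\<epsilon> \<in> E" for \<epsilon>
    unfolding remainder_def using E_nz[OF that] by (intro holomorphic_intros hol that expands_coeff_holomorphic[OF g]) auto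
  have "loc_bdd (\<lambda>z \<epsilon>. deriv (\<lambda>z. remainder N g G z \<epsilon>) z)"
    unfolding loc_bdd_def
  proof
    fix z assume z: "z \<in> V"
    have "loc_bdd (remainder N g G)" using g unfolding expands_def by blast
    then obtain \<delta> C where d: "\<delta> > 0" "\<And>y \<epsilon>. y \<in> ball z \<delta> \<Longrightarrow> \<epsilon> \<in> E \<Longrightarrow> norm (remainder N g G y \<epsilon>) \<le> C"
      using z unfolding loc_bdd_def by blast
    obtain r where r: "r > 0" "ball z r \<subseteq> V" using open_V z open_contains_ball by blast
    define s where "s = min r \<delta> / 2"
    have s: "s > 0" using d r by (auto simp: s_def)
    have "norm (deriv (\<lambda>z. remainder N g G z \<epsilon>) y) \<le> C / s" if y: "y \<in> ball z s" and e: "\<epsilon> \<in> E" for y \<epsilon>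
    proof -
      have sub: "cball y s \<subseteq> ball z (min r \<delta>)"
      proof
        fix x assume "x \<in> cball y s"
        then have "dist z x < min r \<delta>" using y dist_triangle[of z x y] by (auto simp: s_def)
        then show "x \<in> ball z (min r \<delta>)" by simp
      qed
      have subV: "cball y s \<subseteq> V" using sub r by (auto simp: subset_iff)
      have "norm ((deriv ^^ 1) (\<lambda>z. remainder N g G z \<epsilon>) y) \<le> fact 1 * C / s ^ 1"
      proof (rule Cauchy_inequality)
        show "(\<lambda>z. remainder N g G z \<epsilon>) holomorphic_on ball y s"
          using holr[OF e] subV by (rule holomorphic_on_subset[OF _ subset_trans[OF ball_subset_cball]])
        show "continuous_on (cball y s) (\<lambda>z. remainder N g G z \<epsilon>)"
          by (rule holomorphic_on_imp_continuous_on[OF holomorphic_on_subset[OF holr[OF e] subV]])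
        show "norm (remainder N g G x \<epsilon>) \<le> C" if "norm (y - x) = s" for x
        proof (rule d(2)[OF _ e])
          have "x \<in> cball y s" using that by (simp add: dist_norm)
          then show "x \<in> ball z \<delta>" using sub by (auto simp: subset_iff)
        qed
      qed (rule s)
      then show ?thesis by simp
    qed
    then show "\<exists>\<delta>>0. \<exists>C. \<forall>y\<in>ball z \<delta>. \<forall>\<epsilon>\<in>E. norm (deriv (\<lambda>z. remainder N g G z \<epsilon>) y) \<le> C"
      using s by blast
  qed
  then show "loc_bdd (remainder N (\<lambda>z \<epsilon>. deriv (\<lambda>z. g z \<epsilon>) z) (\<lambda>z. Abs_fps (\<lambda>n. deriv (\<lambda>z. fps_nth (G z) n) z)))"
  proof (rule loc_bdd_cong)
    fix z \<epsilon> assume z: "z \<in> V" and e: "\<epsilon> \<in> E"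
    have 1: "((\<lambda>z. g z \<epsilon>) has_field_derivative deriv (\<lambda>z. g z \<epsilon>) z) (at z)"
      by (rule holomorphic_derivI[OF hol[OF e] open_V z])
    have 2: "((\<lambda>z. fps_nth (G z) n) has_field_derivative deriv (\<lambda>z. fps_nth (G z) n) z) (at z)" for n
      by (rule holomorphic_derivI[OF expands_coeff_holomorphic[OF g] open_V z])
    have "((\<lambda>z. remainder N g G z \<epsilon>) has_field_derivative
      (deriv (\<lambda>z. g z \<epsilon>) z - (\<Sum>n<N. deriv (\<lambda>z. fps_nth (G z) n) z * \<epsilon> ^ n)) / \<epsilon> ^ N) (at z)"
      unfolding remainder_def by (intro DERIV_cdivide DERIV_diff 1 DERIV_sum DERIV_cmult_right 2)
    then show "remainder N (\<lambda>z \<epsilon>. deriv (\<lambda>z. g z \<epsilon>) z) (\<lambda>z. Abs_fps (\<lambda>n. deriv (\<lambda>z. fps_nth (G z) n) z)) z \<epsilon> = deriv (\<lambda>z. remainder N g G z \<epsilon>) z"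
      by (simp add: DERIV_imp_deriv) (simp add: remainder_def)
  qed
qed

lemma expands_higher_deriv:
  assumes g: "expands g G"
  shows "expands (\<lambda>z \<epsilon>. (deriv ^^ j) (\<lambda>z. g z \<epsilon>) z) (\<lambda>z. Abs_fps (\<lambda>n. (deriv ^^ j) (\<lambda>z. fps_nth (G z) n) z))"
proof (induction j)
  case 0
  then show ?case using g by (simp add: fps_nth_inverse)
next
  case (Suc j)
  from expands_deriv[OF Suc] show ?case by simp
qed

lemma expands_dz:
  assumes g: "expands g G"
  shows "expands (\<lambda>z \<epsilon>. dz R (\<lambda>z. g z \<epsilon>) z) (\<lambda>z. fps_dz R G z)"
proof -
  have e: "fps_dz R G z = (\<Sum>j\<le>degree R. fps_const (coeff R j) * Abs_fps (\<lambda>n. (deriv ^^ j) (\<lambda>z. fps_nth (G z) n) z))" for z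
    by (simp add: fps_dz_def dz_def fps_eq_iff fps_sum_nth)
  show ?thesis unfolding dz_def e
    by (intro expands_sum expands_mult expands_higher_deriv g expands_const holomorphic_intros)
qed

text \<open>A convergent Taylor expansion is asymptotic: Cauchy's estimates for the coefficients,
  uniform for y near z, leave a geometric series as bound for the remainder.\<close>

lemma expands_taylor:
  assumes r: "r > 0" and E: "E \<subseteq> ball 0 (r / 2)"
    and holz: "\<And>\<epsilon>. \<epsilon> \<in> E \<Longrightarrow> (\<lambda>z. f z \<epsilon>) holomorphic_on V"
    and hole: "\<And>z. z \<in> V \<Longrightarrow> f z holomorphic_on ball 0 r"
    and bd: "\<And>z. z \<in> V \<Longrightarrow> \<exists>\<delta>>0. \<exists>C. \<forall>y\<in>ball z \<delta> \<inter> V. \<forall>\<epsilon>\<in>ball 0 r. norm (f y \<epsilon>) \<le> C"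
  shows "expands f (\<lambda>z. fps_expansion (f z) 0)"
  unfolding expands_def
proof (intro conjI allI ballI holz)
  fix N
  show "loc_bdd (remainder N f (\<lambda>z. fps_expansion (f z) 0))"
  proof (rule loc_bddI)
    fix z assume "z \<in> V"
    then obtain \<delta> C where d: "\<delta> > 0" "\<And>y \<epsilon>. y \<in> ball z \<delta> \<inter> V \<Longrightarrow> \<epsilon> \<in> ball 0 r \<Longrightarrow> norm (f y \<epsilon>) \<le> C"
      using bd by blast
    \<comment> \<open>A radius strictly between the bound r / 2 for E and the radius r of
      holomorphy; the ratio of the geometric series is then 2/3.\<close>
    define s where "s = 3 * r / 4"
    have s: "s > 0" "s < r" using r by (auto simp: s_def)
    have "norm (remainder N f (\<lambda>z. fps_expansion (f z) 0) y \<epsilon>) \<le> C / s ^ N * (\<Sum>n. (2/3) ^ n)" if y: "y \<in> ball z \<delta> \<inter> V" and e: "\<epsilon> \<in> E" for y \<epsilon>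
    proof -
      define a where "a n = fps_nth (fps_expansion (f y) 0) n" for n
      have en: "norm \<epsilon> < r / 2" "\<epsilon> \<noteq> 0" using e E E_nz by auto
      have yV: "y \<in> V" using y by simp
      have C: "C \<ge> 0" using d(2)[OF y, of 0] r by (auto intro: order.trans[OF norm_ge_zero])
      have a: "norm (a n) \<le> C / s ^ n" for n
      proof -
        have "norm ((deriv ^^ n) (f y) 0) \<le> fact n * C / s ^ n"
        proof (rule Cauchy_inequality)
          show "f y holomorphic_on ball 0 s" using hole[OF yV] s by (auto intro: holomorphic_on_subset)
          show "continuous_on (cball 0 s) (f y)"
            using hole[OF yV] s by (auto intro!: holomorphic_on_imp_continuous_on holomorphic_on_subset[of "f y" "ball 0 r"])
          show "norm (f y x) \<le> C" if "norm (0 - x) = s" for x using that s by (intro d(2)[OF y]) auto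
        qed (rule s(1))
        then show ?thesis by (simp add: a_def fps_expansion_def norm_divide field_simps)
      qed
      have "(\<lambda>n. (deriv ^^ n) (f y) 0 / fact n * (\<epsilon> - 0) ^ n) sums f y \<epsilon>"
        using en r by (intro holomorphic_power_series[OF hole[OF yV]]) auto
      then have su: "(\<lambda>n. a n * \<epsilon> ^ n) sums f y \<epsilon>" by (simp add: a_def fps_expansion_def)
      then have "(\<lambda>n. a (n + N) * \<epsilon> ^ (n + N)) sums (f y \<epsilon> - (\<Sum>n<N. a n * \<epsilon> ^ n))"
        by (rule sums_split_initial_segment)
      then have "(\<lambda>n. a (n + N) * \<epsilon> ^ (n + N) / \<epsilon> ^ N) sums remainder N f (\<lambda>z. fps_expansion (f z) 0) y \<epsilon>"
        unfolding remainder_def a_def[symmetric] by (rule sums_divide)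
      then have sr: "(\<lambda>n. a (n + N) * \<epsilon> ^ n) sums remainder N f (\<lambda>z. fps_expansion (f z) 0) y \<epsilon>"
        using en by (simp add: power_add)
      have b: "norm (a (n + N) * \<epsilon> ^ n) \<le> C / s ^ N * (2/3) ^ n" for n
      proof -
        have "norm (a (n + N) * \<epsilon> ^ n) \<le> (C / s ^ (n + N)) * (r / 2) ^ n"
          unfolding norm_mult norm_power using a en C s by (intro mult_mono power_mono) (auto intro: less_imp_le)
        also have "\<dots> = C / s ^ N * ((r / 2) / s) ^ n" using s by (simp add: power_add power_divide)
        also have "(r / 2) / s = 2 / 3" using r by (simp add: s_def)
        finally show ?thesis .
      qed
      have gs: "summable (\<lambda>n. C / s ^ N * (2/3) ^ n)" by (intro summable_mult summable_geometric) auto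
      have "norm (\<Sum>n. a (n + N) * \<epsilon> ^ n) \<le> (\<Sum>n. C / s ^ N * (2/3) ^ n)"
        by (rule norm_suminf_le[OF b gs])
      moreover have "(\<Sum>n. C / s ^ N * (2/3) ^ n) = C / s ^ N * (\<Sum>n. (2/3) ^ n)"
        by (rule suminf_mult) (auto intro: summable_geometric)
      ultimately show ?thesis using sums_unique[OF sr] by (simp only:)
    qed
    then show "\<exists>\<delta>>0. \<exists>C. \<forall>y\<in>ball z \<delta> \<inter> V. \<forall>\<epsilon>\<in>E. norm (remainder N f (\<lambda>z. fps_expansion (f z) 0) y \<epsilon>) \<le> C"
      using d(1) by blast
  qed
qed

end

section \<open>Expansions of the operators and of their coefficients\<close>

lemma formal_op_P_eq:
  "formal_op_P q k X U t z =
     fps_dz (Qpol X) (U (of_real (q powr 1) * t)) z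
     - (fps_X * fps_const t) ^ topd X * fps_dz (Rpol X (topD X)) (U (of_real (q powr (real (topd X) / real k + 1)) * t)) z
     - (\<Sum>l\<in>{1..<topD X}. \<Sum>j\<in>idx X l. fps_const (t ^ texp X l j) * fps_X ^ eexp X l j *
          (fps_expansion (coef_c X l j z) 0 * fps_dz (Rpol X l) (U (of_real (q powr real (qexp X l)) * t)) z))"
  by (simp only: formal_op_P_def q_shift_def)

lemma (in asymptotics) op_P_expands:
  assumes u: "\<And>s. s \<in> shifts k X \<Longrightarrow> expands (\<lambda>z \<epsilon>. u (of_real (q powr s) * t) z \<epsilon>) (\<lambda>z. U (of_real (q powr s) * t) z)"
    and c: "\<And>l j. l \<in> {1..<topD X} \<Longrightarrow> j \<in> idx X l \<Longrightarrow> expands (\<lambda>z \<epsilon>. coef_c X l j z \<epsilon>) (\<lambda>z. fps_expansion (coef_c X l j z) 0)"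
  shows "expands (\<lambda>z \<epsilon>. op_P q k X u t z \<epsilon>) (\<lambda>z. formal_op_P q k X U t z)"
proof -
  have d: "expands (\<lambda>z \<epsilon>. dz R (\<lambda>z. u (of_real (q powr s) * t) z \<epsilon>) z) (\<lambda>z. fps_dz R (U (of_real (q powr s) * t)) z)"
    if "s \<in> shifts k X" for s R using expands_dz[OF u[OF that]] by simp
  have ct: "expands (\<lambda>z \<epsilon>. w) (\<lambda>z. fps_const w)" for w by (rule expands_const) (rule holomorphic_on_const)
  show ?thesis
    unfolding op_P_eq formal_op_P_eq
    by (intro expands_diff expands_sum expands_mult expands_power expands_eps ct d shifts_mem c)
qed

lemma inv_fourier_bounded:
  assumes h: "uniform_decay b E h" and a: "a < b"
  shows "\<exists>B\<ge>0. \<forall>\<epsilon>\<in>E. \<forall>y. \<bar>Im y\<bar> \<le> a \<longrightarrow> norm (inv_fourier (\<lambda>m. h m \<epsilon>) y) \<le> B"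
proof -
  obtain g where g: "integrable lborel g" "\<And>m z \<epsilon>. \<epsilon> \<in> E \<Longrightarrow> \<bar>Im z\<bar> \<le> a \<Longrightarrow> norm (h m \<epsilon> * exp (\<i> * of_real m * z)) \<le> g m"
    by (rule uniform_decay_exp_bound[OF h a]) (rule that)
  define B where "B = norm (complex_of_real (1 / sqrt (2 * pi))) * \<bar>LBINT m. g m\<bar>"
  have "norm (inv_fourier (\<lambda>m. h m \<epsilon>) y) \<le> B" if e: "\<epsilon> \<in> E" and y: "\<bar>Im y\<bar> \<le> a" for \<epsilon> y
  proof -
    have "y \<in> strip b" using y a by (simp add: strip_def)
    then have "norm (LBINT m. h m \<epsilon> * exp (\<i> * of_real m * y)) \<le> (LBINT m. g m)"
      by (intro Bochner_Integration.integral_norm_bound_integral g e y decay_exp_integrable[OF uniform_decay_decay[OF h e]])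
    then have "norm (LBINT m. h m \<epsilon> * exp (\<i> * of_real m * y)) \<le> \<bar>LBINT m. g m\<bar>" by linarith
    then show ?thesis unfolding inv_fourier_def norm_mult B_def by (intro mult_left_mono) auto
  qed
  then show ?thesis by (intro exI[of _ B]) (auto simp: B_def)
qed

text \<open>The forcing term is holomorphic in \<open>\<epsilon>\<close> on a full disc, and bounded
  there uniformly for y in a slightly narrower strip, so its Taylor series is its asymptotic
  expansion.\<close>

lemma (in asymptotics) forcing_expands:
  assumes V: "V \<subseteq> strip b" and r: "0 < r" "r \<le> 1" "E \<subseteq> ball 0 (r / 2)"
    and G: "\<And>n. n \<le> N0 \<Longrightarrow> uniform_decay b (ball 0 r) (G n)"
  shows "expands (\<lambda>z \<epsilon>. forcing N0 G t z \<epsilon>) (\<lambda>z. fps_expansion (\<lambda>\<epsilon>. forcing N0 G t z \<epsilon>) 0)"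
proof (rule expands_taylor[OF r(1,3)])
  fix \<epsilon> assume "\<epsilon> \<in> E"
  then have e: "\<epsilon> \<in> ball 0 r" using r by auto
  have "inv_fourier (\<lambda>m. G n m \<epsilon>) holomorphic_on V" if "n \<le> N0" for n
    by (rule holomorphic_on_subset[OF inv_fourier_holomorphic[OF uniform_decay_decay[OF G[OF that] e]] V])
  then show "(\<lambda>z. forcing N0 G t z \<epsilon>) holomorphic_on V"
    unfolding forcing_def by (intro holomorphic_intros) auto
next
  fix z assume z: "z \<in> V"
  then have zb: "z \<in> strip b" using V by auto
  have "(\<lambda>\<epsilon>. inv_fourier (\<lambda>m. G n m \<epsilon>) z) holomorphic_on ball 0 r" if "n \<le> N0" for n
    by (rule inv_fourier_holomorphic_param[OF G[OF that] open_ball zb])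
  then show "(\<lambda>\<epsilon>. forcing N0 G t z \<epsilon>) holomorphic_on ball 0 r"
    unfolding forcing_def by (intro holomorphic_intros) auto
  obtain a where a: "\<bar>Im z\<bar> < a" "a < b" using zb dense unfolding strip_def by blast
  have "\<forall>n\<in>{..N0}. \<exists>B\<ge>0. \<forall>\<epsilon>\<in>ball 0 r. \<forall>y. \<bar>Im y\<bar> \<le> a \<longrightarrow> norm (inv_fourier (\<lambda>m. G n m \<epsilon>) y) \<le> B"
    using inv_fourier_bounded[OF G a(2)] by auto
  then obtain B where B: "\<And>n \<epsilon> y. n \<le> N0 \<Longrightarrow> \<epsilon> \<in> ball 0 r \<Longrightarrow> \<bar>Im y\<bar> \<le> a \<Longrightarrow> norm (inv_fourier (\<lambda>m. G n m \<epsilon>) y) \<le> B n"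
    "\<And>n. n \<le> N0 \<Longrightarrow> B n \<ge> 0"
    unfolding bchoice_iff by (metis atMost_iff)
  have "norm (forcing N0 G t y \<epsilon>) \<le> (\<Sum>n\<le>N0. B n * norm t ^ n)" if y: "y \<in> ball z (a - \<bar>Im z\<bar>) \<inter> V" and e: "\<epsilon> \<in> ball 0 r" for y \<epsilon>
  proof -
    have "\<bar>Im z - Im y\<bar> \<le> dist z y" using abs_Im_le_cmod[of "z - y"] by (simp add: dist_norm)
    then have ya: "\<bar>Im y\<bar> \<le> a" using y by auto
    have te: "norm (t * \<epsilon>) \<le> norm t" using e r by (auto simp: norm_mult mult_left_le)
    show ?thesis unfolding forcing_def
    proof (intro order.trans[OF norm_sum] sum_mono)
      fix n assume n: "n \<in> {..N0}"
      show "norm (inv_fourier (\<lambda>m. G n m \<epsilon>) y * (t * \<epsilon>) ^ n) \<le> B n * norm t ^ n"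
        unfolding norm_mult[of "inv_fourier (\<lambda>m. G n m \<epsilon>) y"] norm_power
        using n B(1)[OF _ e ya] B(2) te by (intro mult_mono power_mono) auto
    qed
  qed
  then show "\<exists>\<delta>>0. \<exists>C. \<forall>y\<in>ball z \<delta> \<inter> V. \<forall>\<epsilon>\<in>ball 0 r. norm (forcing N0 G t y \<epsilon>) \<le> C"
    using a by (intro exI[of _ "a - \<bar>Im z\<bar>"] conjI exI[of _ "\<Sum>n\<le>N0. B n * norm t ^ n"]) auto
qed

text \<open>A coefficient function is a forcing term whose only summand has n = 0.\<close>

lemma (in asymptotics) coef_c_expands:
  assumes "V \<subseteq> strip b" "0 < r" "r \<le> 1" "E \<subseteq> ball 0 (r / 2)" and C: "uniform_decay b (ball 0 r) (Ccoef X l j)"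
  shows "expands (\<lambda>z \<epsilon>. coef_c X l j z \<epsilon>) (\<lambda>z. fps_expansion (coef_c X l j z) 0)"
  using forcing_expands[of b r 0 "\<lambda>_. Ccoef X l j" 1] assms by (simp add: forcing_def coef_c_def[abs_def])

section \<open>From q-Gevrey expansions to the formal equation\<close>

lemma sector_mono: "a \<le> a' \<Longrightarrow> sector d a \<subseteq> sector d a'"
proof
  fix x assume "a \<le> a'" "x \<in> sector d a"
  then obtain r \<theta> where "x = of_real r * cis \<theta>" "r > 0" "\<bar>\<theta> - d\<bar> < a" by (auto simp: sector_def)
  then show "x \<in> sector d a'" using \<open>a \<le> a'\<close> unfolding sector_def
    by (intro CollectI exI[of _ r] exI[of _ \<theta>]) auto
qed

text \<open>In polar coordinates the smaller sector lies in the image of a compact rectangle, which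
  is closed, and whose nonzero points have argument and modulus strictly within the limits of the
  larger sector.\<close>

lemma subsector:
  assumes "0 < a" "0 < e"
  shows "closure (sector d (a / 2) \<inter> ball 0 (e / 2)) - {0} \<subseteq> sector d a \<inter> ball 0 e"
proof -
  define K where "K = (\<lambda>(r, \<theta>). complex_of_real r * cis \<theta>) ` ({0..e / 2} \<times> {d - a / 2..d + a / 2})"
  have "compact K" unfolding K_def
    by (intro compact_continuous_image compact_Times) (auto intro!: continuous_intros simp: case_prod_unfold)
  moreover have "sector d (a / 2) \<inter> ball 0 (e / 2) \<subseteq> K"
  proof
    fix x assume "x \<in> sector d (a / 2) \<inter> ball 0 (e / 2)"
    then obtain r \<theta> where x: "x = of_real r * cis \<theta>" "r > 0" "\<bar>\<theta> - d\<bar> < a / 2" "norm x < e / 2" by (auto simp: sector_def)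
    then have "r < e / 2" by (simp add: norm_mult)
    moreover have "d - a / 2 \<le> \<theta>" "\<theta> \<le> d + a / 2" using x(3) unfolding abs_less_iff by linarith+
    ultimately show "x \<in> K" unfolding K_def using x by (intro image_eqI[of _ _ "(r, \<theta>)"]) auto
  qed
  ultimately have "closure (sector d (a / 2) \<inter> ball 0 (e / 2)) \<subseteq> K"
    by (intro closure_minimal compact_imp_closed)
  moreover have "K - {0} \<subseteq> sector d a \<inter> ball 0 e"
  proof
    fix x assume "x \<in> K - {0}"
    then obtain r \<theta> where x: "x = of_real r * cis \<theta>" "0 \<le> r" "r \<le> e / 2" "d - a / 2 \<le> \<theta>" "\<theta> \<le> d + a / 2" "x \<noteq> 0"
      by (auto simp: K_def)
    then have "r > 0" by (cases "r = 0") auto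
    moreover have "\<bar>\<theta> - d\<bar> < a" using x(4,5) assms by (auto simp: abs_if)
    moreover have "norm x < e" using x assms by (simp add: norm_mult)
    ultimately show "x \<in> sector d a \<inter> ball 0 e" using x(1) by (auto simp: sector_def)
  qed
  ultimately show ?thesis by blast
qed

lemma holomorphic2_section:
  assumes "holomorphic2_on f (A \<times> B)" "t \<in> A" "open B"
  shows "(\<lambda>z. f (t, z)) holomorphic_on B"
proof -
  have "\<exists>D. ((\<lambda>z. f (t, z)) has_field_derivative D) (at z)" if "z \<in> B" for z
  proof -
    have "(t, z) \<in> A \<times> B" using assms(2) that by simp
    with assms(1) have "\<exists>a b. (f has_derivative (\<lambda>(h, k). a * h + b * k)) (at (t, z))"
      unfolding holomorphic2_on_def by (rule bspec)
    then obtain a b where f: "(f has_derivative (\<lambda>(h, k). a * h + b * k)) (at (t, z))"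
      by (elim exE)
    have "((\<lambda>z. (t, z)) has_derivative (\<lambda>k. (0, k))) (at z)"
      by (auto intro!: derivative_eq_intros)
    from has_derivative_compose[OF this f] have "((\<lambda>z. f (t, z)) has_derivative (\<lambda>k. b * k)) (at z)" by simp
    then show ?thesis by (auto simp: has_field_derivative_def)
  qed
  then show ?thesis using assms(3) by (simp add: holomorphic_on_open)
qed

lemma Gevrey_expands:
  assumes gev: "q_Gevrey_expansion q k (A \<times> strip b) (sector d a \<inter> ball 0 e) g uh" and ae: "0 < a" "a \<le> pi" "0 < e"
    and E: "E \<subseteq> sector d (a / 2) \<inter> ball 0 (e / 2)" and as: "asymptotics (strip b) E" and t: "t \<in> A"
  shows "asymptotics.expands (strip b) E (\<lambda>z \<epsilon>. g \<epsilon> (t, z)) (\<lambda>z. Abs_fps (\<lambda>n. uh n (t, z)))"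
proof -
  interpret asymptotics "strip b" E by (rule as)
  define A' where "A' = A \<times> strip b"
  define U where "U = sector d (a / 2) \<inter> ball 0 (e / 2)"
  have U: "bounded_sector (e / 2) U" "closure U - {0} \<subseteq> sector d a \<inter> ball 0 e" "U \<subseteq> sector d a \<inter> ball 0 e"
  proof -
    show "bounded_sector (e / 2) U" unfolding bounded_sector_def U_def using ae by (intro exI[of _ d] exI[of _ "a / 2"]) auto
    show "closure U - {0} \<subseteq> sector d a \<inter> ball 0 e" unfolding U_def by (rule subsector[OF ae(1,3)])
    show "U \<subseteq> sector d a \<inter> ball 0 e" unfolding U_def using sector_mono[of "a / 2" a d] ae by auto
  qed
  have bh: "g \<epsilon> \<in> bounded_holo A'" if "\<epsilon> \<in> E" for \<epsilon>
    using gev that E U(3) unfolding q_Gevrey_expansion_def holomorphic_valued_def A'_def U_def by blast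
  have bu: "uh n \<in> bounded_holo A'" for n
    using gev unfolding q_Gevrey_expansion_def A'_def by blast
  obtain K C where KC: "K > 0" "C > 0" "\<And>\<epsilon> N. \<epsilon> \<in> U \<Longrightarrow> sup_norm_on A' (\<lambda>x. g \<epsilon> x - (\<Sum>n\<le>N. uh n x * \<epsilon> ^ n))
             \<le> C * K ^ (N + 1) * q powr (real N * (real N + 1) / (2 * k)) * cmod \<epsilon> ^ (N + 1)"
    using gev U(1,2) unfolding q_Gevrey_expansion_def A'_def by blast
  \<comment> \<open>A supremum bounds its members only if they are bounded above; this follows from
    the boundedness of g and of the coefficients on the domain.\<close>
  have pt: "norm (g \<epsilon> x - (\<Sum>n\<le>N. uh n x * \<epsilon> ^ n)) \<le> C * K ^ (N + 1) * q powr (real N * (real N + 1) / (2 * k)) * cmod \<epsilon> ^ (N + 1)"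
    if e: "\<epsilon> \<in> E" and x: "x \<in> A'" for \<epsilon> x N
  proof -
    obtain B0 where B0: "\<And>x. x \<in> A' \<Longrightarrow> norm (g \<epsilon> x) \<le> B0"
      using bh[OF e] by (auto simp: bounded_holo_def bounded_iff)
    have "\<forall>n. \<exists>B. \<forall>x\<in>A'. norm (uh n x) \<le> B" using bu by (auto simp: bounded_holo_def bounded_iff)
    then obtain B where B: "\<And>n x. x \<in> A' \<Longrightarrow> norm (uh n x) \<le> B n" by metis
    have "norm (g \<epsilon> x - (\<Sum>n\<le>N. uh n x * \<epsilon> ^ n)) \<le> B0 + (\<Sum>n\<le>N. B n * norm \<epsilon> ^ n)" if "x \<in> A'" for x
    proof (rule order.trans[OF norm_triangle_ineq4], rule add_mono[OF B0[OF that]], rule order.trans[OF norm_sum], rule sum_mono)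
      fix n show "norm (uh n x * \<epsilon> ^ n) \<le> B n * norm \<epsilon> ^ n"
        unfolding norm_mult norm_power by (intro mult_right_mono B that) auto
    qed
    then have "bdd_above ((\<lambda>x. norm (g \<epsilon> x - (\<Sum>n\<le>N. uh n x * \<epsilon> ^ n))) ` A')" by (intro bdd_aboveI2)
    then have "norm (g \<epsilon> x - (\<Sum>n\<le>N. uh n x * \<epsilon> ^ n)) \<le> sup_norm_on A' (\<lambda>x. g \<epsilon> x - (\<Sum>n\<le>N. uh n x * \<epsilon> ^ n))"
      unfolding sup_norm_on_def by (rule cSUP_upper[OF x])
    also have "\<dots> \<le> C * K ^ (N + 1) * q powr (real N * (real N + 1) / (2 * k)) * cmod \<epsilon> ^ (N + 1)"
      using KC(3) e E unfolding U_def by blast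
    finally show ?thesis .
  qed
  \<comment> \<open>The estimate for the sum up to index N concerns the remainder of order N + 1.
    Order 0 is recovered below from order 1 and the boundedness of the first coefficient.\<close>
  have remS: "loc_bdd (remainder (Suc N) (\<lambda>z \<epsilon>. g \<epsilon> (t, z)) (\<lambda>z. Abs_fps (\<lambda>n. uh n (t, z))))" for N
  proof (rule loc_bddI)
    fix z
    have "norm (remainder (Suc N) (\<lambda>z \<epsilon>. g \<epsilon> (t, z)) (\<lambda>z. Abs_fps (\<lambda>n. uh n (t, z))) y \<epsilon>) \<le> C * K ^ (N + 1) * q powr (real N * (real N + 1) / (2 * k))"
      if "y \<in> ball z 1 \<inter> strip b" "\<epsilon> \<in> E" for y \<epsilon>
    proof -
      have "(t, y) \<in> A'" using that t by (simp add: A'_def)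
      from pt[OF that(2) this, of N]
      have "norm (g \<epsilon> (t, y) - (\<Sum>n<Suc N. uh n (t, y) * \<epsilon> ^ n)) \<le> C * K ^ (N + 1) * q powr (real N * (real N + 1) / (2 * k)) * norm (\<epsilon> ^ Suc N)"
        unfolding lessThan_Suc_atMost norm_power by simp
      then show ?thesis unfolding remainder_def norm_divide using E_nz[OF that(2)]
        by (subst pos_divide_le_eq) auto
    qed
    then show "\<exists>\<delta>>0. \<exists>C. \<forall>y\<in>ball z \<delta> \<inter> strip b. \<forall>\<epsilon>\<in>E. norm (remainder (Suc N) (\<lambda>z \<epsilon>. g \<epsilon> (t, z)) (\<lambda>z. Abs_fps (\<lambda>n. uh n (t, z))) y \<epsilon>) \<le> C"
      by (intro exI[of _ 1] conjI exI[of _ "C * K ^ (N + 1) * q powr (real N * (real N + 1) / (2 * k))"]) auto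
  qed
  show ?thesis
    unfolding expands_def
  proof (intro conjI allI ballI)
    fix \<epsilon> assume "\<epsilon> \<in> E"
    then show "(\<lambda>z. g \<epsilon> (t, z)) holomorphic_on strip b"
      using bh t open_strip unfolding bounded_holo_def A'_def by (intro holomorphic2_section[of _ A]) auto
  next
    fix N
    have "(\<lambda>z. uh 0 (t, z)) holomorphic_on strip b"
      using bu[of 0] t open_strip unfolding bounded_holo_def A'_def by (intro holomorphic2_section[of _ A]) auto
    note h0 = loc_bdd_holomorphic[OF this]
    show "loc_bdd (remainder N (\<lambda>z \<epsilon>. g \<epsilon> (t, z)) (\<lambda>z. Abs_fps (\<lambda>n. uh n (t, z))))"
    proof (cases N)
      case 0
      show ?thesis unfolding 0
      proof (rule loc_bdd_cong[OF loc_bdd_add[OF h0 loc_bdd_mult[OF loc_bdd_eps remS[of 0]]]])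
        fix z \<epsilon> assume "\<epsilon> \<in> E"
        from remainder_step[OF E_nz[OF this], of 0 "\<lambda>z \<epsilon>. g \<epsilon> (t, z)" "\<lambda>z. Abs_fps (\<lambda>n. uh n (t, z))" z]
        show "remainder 0 (\<lambda>z \<epsilon>. g \<epsilon> (t, z)) (\<lambda>z. Abs_fps (\<lambda>n. uh n (t, z))) z \<epsilon> = uh 0 (t, z) + \<epsilon> * remainder (Suc 0) (\<lambda>z \<epsilon>. g \<epsilon> (t, z)) (\<lambda>z. Abs_fps (\<lambda>n. uh n (t, z))) z \<epsilon>"
          by (simp only: fps_nth_Abs_fps)
      qed
    next
      case (Suc M)
      then show ?thesis using remS by simp
    qed
  qed
qed

lemma ray_asymptotics:
  fixes a e d b :: real
  assumes "0 < a" "0 < e" "e \<le> 1"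
  defines "E \<equiv> {complex_of_real r * cis d | r. 0 < r \<and> r < e / 2}"
  shows "asymptotics (strip b) E" "E \<subseteq> sector d (a / 2) \<inter> ball 0 (e / 2)"
proof -
  show 1: "E \<subseteq> sector d (a / 2) \<inter> ball 0 (e / 2)"
  proof
    fix x assume "x \<in> E"
    then obtain r where r: "x = of_real r * cis d" "0 < r" "r < e / 2" by (auto simp: E_def)
    then have "x \<in> sector d (a / 2)" unfolding sector_def using assms(1)
      by (intro CollectI exI[of _ r] exI[of _ d]) auto
    then show "x \<in> sector d (a / 2) \<inter> ball 0 (e / 2)" using r by (simp add: norm_mult)
  qed
  show "asymptotics (strip b) E"
  proof
    show "open (strip b)" by (rule open_strip)
    show "E \<subseteq> ball 0 1" using assms(1-3) by (auto simp: E_def norm_mult)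
    show "0 \<notin> E" by (auto simp: E_def)
    show "0 islimpt E" unfolding islimpt_approachable
    proof (intro allI impI)
      fix \<eta> :: real assume \<eta>: "\<eta> > 0"
      define r where "r = min (e / 4) (\<eta> / 2)"
      have "r > 0" "r < e / 2" "r < \<eta>" using \<eta> assms(2) by (auto simp: r_def)
      then show "\<exists>x'\<in>E. x' \<noteq> 0 \<and> dist x' 0 < \<eta>"
        unfolding E_def by (intro bexI[of _ "of_real r * cis d"]) (auto simp: norm_mult)
    qed
  qed
qed

theorem formal_solution:
  assumes gev: "q_Gevrey_expansion q (real k1) (\<T> \<times> strip b) \<E> (\<lambda>\<epsilon> (t, z). u t z \<epsilon>) uh"
    and \<E>: "bounded_sector e \<E>" and e: "0 < e" "e \<le> 1" and b: "b \<le> \<beta>"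
    and solves: "\<And>z \<epsilon>. z \<in> strip b \<Longrightarrow> \<epsilon> \<in> \<E> \<Longrightarrow> op_P q k1 Y (q_shift q (- 1) (op_P q k2 X u)) t z \<epsilon> = q_shift q 1 (forcing N0 G) t z \<epsilon>"
    and CX: "\<And>l j. l \<in> {1..<topD X} \<Longrightarrow> j \<in> idx X l \<Longrightarrow> uniform_decay \<beta> (ball 0 e) (Ccoef X l j)"
    and CY: "\<And>l j. l \<in> {1..<topD Y} \<Longrightarrow> j \<in> idx Y l \<Longrightarrow> uniform_decay \<beta> (ball 0 e) (Ccoef Y l j)"
    and G: "\<And>n. n \<le> N0 \<Longrightarrow> uniform_decay \<beta> (ball 0 e) (G n)"
    and t: "\<And>a c. a \<in> shifts k1 Y \<Longrightarrow> c \<in> shifts k2 X \<Longrightarrow> of_real (q powr (a - 1 + c)) * t \<in> \<T>"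
    and z: "z \<in> strip b"
  shows "formal_op_P q k1 Y (q_shift q (- 1) (formal_op_P q k2 X (\<lambda>t z. Abs_fps (\<lambda>n. uh n (t, z))))) t z
    = fps_expansion (\<lambda>\<epsilon>. q_shift q 1 (forcing N0 G) t z \<epsilon>) 0"
proof -
  obtain d a where da: "0 < a" "a \<le> pi" "\<E> = sector d a \<inter> ball 0 e" using \<E> unfolding bounded_sector_def by blast
  \<comment> \<open>The bisecting ray up to half the radius lies in the closed subsector where the
    Gevrey estimates hold and in the half disc where the Taylor series are controlled.\<close>
  define E where "E = {complex_of_real r * cis d | r. 0 < r \<and> r < e / 2}"
  have E: "asymptotics (strip b) E" "E \<subseteq> sector d (a / 2) \<inter> ball 0 (e / 2)"
    unfolding E_def by (rule ray_asymptotics[OF da(1) e])+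
  interpret asymptotics "strip b" E by (rule E(1))
  have Ee: "E \<subseteq> ball 0 (e / 2)" "E \<subseteq> \<E>"
    using E(2) da sector_mono[of "a / 2" a d] e by auto
  have sb: "strip b \<subseteq> strip \<beta>" using b by (auto simp: strip_def)
  let ?U = "\<lambda>t z. Abs_fps (\<lambda>n. uh n (t, z))"
  have u: "expands (\<lambda>z \<epsilon>. u t z \<epsilon>) (\<lambda>z. ?U t z)" if "t \<in> \<T>" for t
    using Gevrey_expands[OF gev[unfolded da(3)] da(1,2) e(1) E(2,1) that] by simp
  have "expands (\<lambda>z \<epsilon>. op_P q k1 Y (q_shift q (- 1) (op_P q k2 X u)) t z \<epsilon>)
    (\<lambda>z. formal_op_P q k1 Y (q_shift q (- 1) (formal_op_P q k2 X ?U)) t z)"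
  proof (rule op_P_expands)
    fix s assume s: "s \<in> shifts k1 Y"
    define t' where "t' = of_real (q powr - 1) * (of_real (q powr s) * t)"
    have t'e: "t' = of_real (q powr (s - 1)) * t" by (simp add: t'_def powr_diff powr_minus divide_inverse mult_ac)
    have "expands (\<lambda>z \<epsilon>. op_P q k2 X u t' z \<epsilon>) (\<lambda>z. formal_op_P q k2 X ?U t' z)"
    proof (rule op_P_expands)
      fix c assume c: "c \<in> shifts k2 X"
      have "of_real (q powr c) * t' = of_real (q powr (s - 1 + c)) * t"
        unfolding t'e powr_add by (simp add: mult_ac)
      then have "of_real (q powr c) * t' \<in> \<T>" using t[OF s c] by simp
      then show "expands (\<lambda>z \<epsilon>. u (of_real (q powr c) * t') z \<epsilon>) (\<lambda>z. ?U (of_real (q powr c) * t') z)" by (rule u)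
    qed (rule coef_c_expands[OF sb e Ee(1) CX])
    then show "expands (\<lambda>z \<epsilon>. q_shift q (- 1) (op_P q k2 X u) (of_real (q powr s) * t) z \<epsilon>)
      (\<lambda>z. q_shift q (- 1) (formal_op_P q k2 X ?U) (of_real (q powr s) * t) z)"
      by (simp only: q_shift_def t'_def)
  qed (rule coef_c_expands[OF sb e Ee(1) CY])
  \<comment> \<open>By the equation on the sector the function just expanded is the forcing term, so
    it has the Taylor series of the latter as a second expansion.\<close>
  moreover have "expands (\<lambda>z \<epsilon>. op_P q k1 Y (q_shift q (- 1) (op_P q k2 X u)) t z \<epsilon>)
    (\<lambda>z. fps_expansion (\<lambda>\<epsilon>. q_shift q 1 (forcing N0 G) t z \<epsilon>) 0)"
  proof (rule expands_cong)
    show "expands (\<lambda>z \<epsilon>. q_shift q 1 (forcing N0 G) t z \<epsilon>) (\<lambda>z. fps_expansion (\<lambda>\<epsilon>. q_shift q 1 (forcing N0 G) t z \<epsilon>) 0)"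
      unfolding q_shift_def by (rule forcing_expands[OF sb e Ee(1) G])
  qed (use solves Ee in blast)
  ultimately show ?thesis by (rule expands_unique[OF _ _ z])
qed

theorem theorem5:
  fixes q \<beta> \<beta>' \<mu> \<epsilon>0 \<rho> \<alpha> \<nu> \<delta> \<delta>' r\<^sub>T \<omega> :: real
    and k1 k2 \<sigma> N0 :: nat
    and X Y :: qdd_data
    and F G :: "nat \<Rightarrow> real \<Rightarrow> complex \<Rightarrow> complex"
    and \<E> U S :: "nat \<Rightarrow> complex set" and \<T> :: "complex set"
    and d :: "nat \<Rightarrow> real" and \<gamma> :: "nat \<Rightarrow> complex \<Rightarrow> real"
    and rX rY :: "nat \<Rightarrow> real \<Rightarrow> complex"
    and \<psi>1 \<psi>2 w1 w2 :: "nat \<Rightarrow> complex \<Rightarrow> complex \<Rightarrow> real \<Rightarrow> complex"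
    and Rb :: "nat \<Rightarrow> complex set"
    and u :: "nat \<Rightarrow> complex \<Rightarrow> complex \<Rightarrow> complex \<Rightarrow> complex"
  assumes "Rb = (\<lambda>p. R_dom (d p) \<delta>' \<inter> ball 0 (\<epsilon>0 * r\<^sub>T))"
    and "\<psi>2 = (\<lambda>p \<epsilon> \<tau> m. q_laplace q (kappa k1 k2) (d p) (\<lambda>h. \<psi>1 p \<epsilon> h m) \<tau>)"
    and "u = (\<lambda>p. solution q k2 (\<gamma> p) (w2 p))"
  \<comment> \<open>parameters and data of the first operator\<close>
    and "q > 1" "1 \<le> k1" "k1 < k2"
    and "0 < \<epsilon>0" "\<epsilon>0 < 1" "0 < r\<^sub>T" "r\<^sub>T < 1" "\<rho> > 0" "\<delta> > 0" "\<delta>' > 0" "\<alpha> > 0" "\<omega> > 0"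
    and "0 < \<beta>'" "\<beta>' < \<beta>"
    and "\<mu> > real (degree (Rpol X (topD X))) + 1"
    and "admissible_exponents (real k2) X" "admissible_polynomials X" "admissible_coefficients \<beta> \<mu> \<epsilon>0 X"
    and "\<exists>CF. \<forall>n. holomorphic_family \<beta> \<mu> \<epsilon>0
           (CF * \<rho> powi (- int n) * q powr (real n * (real n - 1) / (2 * real k1))) (F n)"
  \<comment> \<open>good covering and associated family\<close>
    and "good_covering \<sigma> \<epsilon>0 \<E>" "bounded_sector r\<^sub>T \<T>"
    and "\<forall>p<\<sigma>. unbounded_sector (d p) (U p) \<and> unbounded_sector (d p) (S p) \<and>
           infdist (- of_real \<delta>) (U p \<union> ball 0 \<rho>) > 0 \<and>
           Rb p \<subseteq> cball 0 \<rho> \<and> S p \<subseteq> R_dom (d p) \<delta>' \<and>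
           Rb p \<inter> Rb (Suc p mod \<sigma>) \<noteq> {} \<and> (\<forall>t\<in>\<T>. \<forall>\<epsilon>\<in>\<E> p. \<epsilon> * t \<in> Rb p)"
    and "\<nu> + real k2 / ln q * ln r\<^sub>T < 0"
    and "\<alpha> + kappa k1 k2 / ln q * ln (\<epsilon>0 * r\<^sub>T) < 0"
    and "\<epsilon>0 * r\<^sub>T \<le> q powr ((1/2 - \<nu>) / real k2) / 2"
    and "root_enumeration q k2 X rX" "roots_avoid X rX (\<Union>p<\<sigma>. S p \<union> cball 0 \<rho>)"
  \<comment> \<open>forcing term of the first operator\<close>
    and "\<exists>\<zeta>. \<forall>p<\<sigma>. \<forall>\<epsilon>\<in>ball 0 \<epsilon>0.
           \<psi>1 p \<epsilon> \<in> Exp_disc q (real k1) \<beta> \<mu> \<alpha> \<rho> \<delta> (U p) \<and>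
           Exp_disc_norm q (real k1) \<beta> \<mu> \<alpha> \<rho> \<delta> (U p) (\<psi>1 p \<epsilon>) \<le> \<zeta>"
    and "\<forall>p<\<sigma>. \<forall>\<epsilon>\<in>ball 0 \<epsilon>0. \<forall>m. \<forall>\<tau>\<in>ball 0 \<rho>.
           (\<lambda>n. F n m \<epsilon> * \<tau> ^ n / of_real (cq q (real k1) n)) sums \<psi>1 p \<epsilon> \<tau> m"
    and "\<exists>\<zeta>. \<forall>p<\<sigma>. \<forall>\<epsilon>\<in>ball 0 \<epsilon>0.
           \<psi>2 p \<epsilon> \<in> Exp_sect q (real k2) \<beta> \<mu> \<nu> (S p) (Rb p) \<and>
           Exp_sect_norm q (real k2) \<beta> \<mu> \<nu> (S p) (Rb p) (\<psi>2 p \<epsilon>) \<le> \<zeta>"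
  \<comment> \<open>construction of the solutions\<close>
    and "\<forall>p<\<sigma>. \<forall>\<epsilon>\<in>ball 0 \<epsilon>0.
           unique_solution
             {h \<in> Exp_disc q (kappa k1 k2) \<beta> \<mu> \<alpha> \<rho> \<delta> (U p).
                Exp_disc_norm q (kappa k1 k2) \<beta> \<mu> \<alpha> \<rho> \<delta> (U p) h \<le> \<omega>}
             (dom_disc \<rho> (U p))
             (conv_equation q k1 (- real (topd X) / kappa k1 k2) X \<epsilon> (dom_disc \<rho> (U p)) (\<psi>1 p \<epsilon>))
             (w1 p \<epsilon>)"
    and "\<forall>p<\<sigma>. \<forall>\<epsilon>\<in>ball 0 \<epsilon>0.
           unique_solution
             (Exp_sect q (real k2) \<beta> \<mu> \<nu> (S p) (Rb p))
             (dom_sect (S p) (Rb p))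
             (conv_equation q k2 0 X \<epsilon> (dom_sect (S p) (Rb p)) (\<psi>2 p \<epsilon>))
             (w2 p \<epsilon>) \<and>
           Exp_sect_norm q (real k2) \<beta> \<mu> \<nu> (S p) (Rb p) (w2 p \<epsilon>) \<le> \<omega>"
    and "\<forall>p<\<sigma>. \<forall>m.
           (\<forall>\<tau>\<in>dom_disc \<rho> (U p). (\<lambda>\<epsilon>. w1 p \<epsilon> \<tau> m) holomorphic_on ball 0 \<epsilon>0) \<and>
           (\<forall>\<tau>\<in>dom_sect (S p) (Rb p). (\<lambda>\<epsilon>. w2 p \<epsilon> \<tau> m) holomorphic_on ball 0 \<epsilon>0)"
    and "\<forall>p<\<sigma>. \<forall>\<epsilon>\<in>ball 0 \<epsilon>0. \<forall>m. \<forall>\<tau>\<in>Rb p.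
           w2 p \<epsilon> \<tau> m = q_laplace q (kappa k1 k2) (d p) (\<lambda>h. w1 p \<epsilon> h m) \<tau>"
    and "\<forall>p<\<sigma>. \<forall>t\<in>\<T>. \<forall>\<epsilon>\<in>\<E> p. admissible_direction (S p) (d p) (\<epsilon> * t) (\<gamma> p (\<epsilon> * t))"
  \<comment> \<open>data of the second operator\<close>
    and "\<mu> > real (degree (Qpol Y)) + 1"
    and "admissible_exponents (real k1) Y" "admissible_polynomials Y" "admissible_coefficients \<beta> \<mu> \<epsilon>0 Y"
    and "\<exists>K0>0. \<exists>T0>0. \<forall>n\<le>N0. holomorphic_family \<beta> \<mu> \<epsilon>0 (K0 * T0 powi (- int n)) (G n)"
    and "\<exists>C. \<forall>p<\<sigma>. \<forall>\<epsilon>\<in>ball 0 \<epsilon>0.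
           borel_poly q k1 N0 G \<epsilon> \<in> Exp_disc q (real k1) \<beta> \<mu> \<alpha> \<rho> \<delta> (U p) \<and>
           Exp_disc_norm q (real k1) \<beta> \<mu> \<alpha> \<rho> \<delta> (U p) (borel_poly q k1 N0 G \<epsilon>) \<le> C"
    and "\<forall>\<epsilon>\<in>ball 0 \<epsilon>0. formal_T_equation q k1 Y N0 G F \<epsilon>"
    and "root_enumeration q k1 Y rY" "roots_avoid Y rY (\<Union>p<\<sigma>. U p \<union> cball 0 \<rho>)"
    and "\<forall>p<\<sigma>. \<forall>\<epsilon>\<in>ball 0 \<epsilon>0.
           unique_solution
             (Exp_disc q (real k1) \<beta> \<mu> \<alpha> \<rho> \<delta> (U p))
             (dom_disc \<rho> (U p))
             (conv_equation q k1 0 Y \<epsilon> (dom_disc \<rho> (U p)) (borel_poly q k1 N0 G \<epsilon>))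
             (\<psi>1 p \<epsilon>)"
    and "\<forall>p<\<sigma>. \<forall>m. \<forall>\<tau>\<in>dom_disc \<rho> (U p). (\<lambda>\<epsilon>. \<psi>1 p \<epsilon> \<tau> m) holomorphic_on ball 0 \<epsilon>0"
  shows
    \<comment> \<open>the functions u p solve the equation wherever all its terms are defined\<close>
    "(\<forall>p<\<sigma>. \<forall>t. \<forall>z\<in>strip \<beta>'. \<forall>\<epsilon>\<in>\<E> p.
        (\<forall>a\<in>shifts k1 Y. \<forall>b\<in>shifts k2 X. of_real (q powr (a - 1 + b)) * t \<in> \<T>) \<longrightarrow>
        op_P q k1 Y (q_shift q (-1) (op_P q k2 X (u p))) t z \<epsilon> = q_shift q 1 (forcing N0 G) t z \<epsilon>)
   \<and>
    \<comment> \<open>the coefficients of both operators and of their composition, and the forcing term, are analytic\<close>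
     ((\<forall>a\<in>op_coeffs X \<union> op_coeffs Y. holomorphic3_on a (ball 0 r\<^sub>T \<times> strip \<beta>' \<times> ball 0 \<epsilon>0)) \<and>
      (\<forall>b\<in>op_coeffs Y. \<forall>a\<in>op_coeffs X. \<forall>s\<in>shifts k1 Y. \<forall>j.
         holomorphic3_on
           (\<lambda>t z \<epsilon>. b t z \<epsilon> * q_shift q (s - 1) (\<lambda>t. (deriv ^^ j) (\<lambda>z. a t z \<epsilon>) z) t)
           (ball 0 r\<^sub>T \<times> strip \<beta>' \<times> ball 0 \<epsilon>0)) \<and>
      holomorphic3_on (forcing N0 G) (ball 0 r\<^sub>T \<times> strip \<beta>' \<times> ball 0 \<epsilon>0))
   \<and>
    \<comment> \<open>the common q-Gevrey asymptotic expansion is a formal solution\<close>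
     (\<forall>uh. (\<forall>p<\<sigma>. q_Gevrey_expansion q (real k1) (\<T> \<times> strip \<beta>') (\<E> p)
                      (\<lambda>\<epsilon> (t, z). u p t z \<epsilon>) uh) \<longrightarrow>
        (\<forall>t. \<forall>z\<in>strip \<beta>'.
           (\<forall>a\<in>shifts k1 Y. \<forall>b\<in>shifts k2 X. of_real (q powr (a - 1 + b)) * t \<in> \<T>) \<longrightarrow>
           formal_op_P q k1 Y (q_shift q (-1) (formal_op_P q k2 X (\<lambda>t z. Abs_fps (\<lambda>n. uh n (t, z))))) t z
             = fps_expansion (\<lambda>\<epsilon>. q_shift q 1 (forcing N0 G) t z \<epsilon>) 0))"
proof -
  have q: "q > 1" and k: "1 \<le> k1" "k1 < k2" and e0: "0 < \<epsilon>0" "\<epsilon>0 \<le> 1" and rT: "0 < r\<^sub>T" "r\<^sub>T \<le> 1"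
    and \<beta>: "0 < \<beta>" and \<beta>': "\<beta>' \<le> \<beta>" and \<mu>: "\<mu> \<ge> 0"
    using assms(4-10,16-18) by auto
  have exX: "texp X l j \<le> eexp X l j" if "l \<in> {1..<topD X}" "j \<in> idx X l" for l j
    using assms(19) that unfolding admissible_exponents_def by blast
  have exY: "texp Y l j \<le> eexp Y l j" if "l \<in> {1..<topD Y}" "j \<in> idx Y l" for l j
    using assms(40) that unfolding admissible_exponents_def by blast
  have CX: "uniform_decay \<beta> (ball 0 \<epsilon>0) (Ccoef X l j)" if "l \<in> {1..<topD X}" "j \<in> idx X l" for l j
    using assms(21) that holomorphic_family_uniform_decay[OF _ \<mu>] unfolding admissible_coefficients_def by blast
  have CY: "uniform_decay \<beta> (ball 0 \<epsilon>0) (Ccoef Y l j)" if "l \<in> {1..<topD Y}" "j \<in> idx Y l" for l j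
    using assms(42) that holomorphic_family_uniform_decay[OF _ \<mu>] unfolding admissible_coefficients_def by blast
  have G: "uniform_decay \<beta> (ball 0 \<epsilon>0) (G n)" if "n \<le> N0" for n
    using assms(43) that holomorphic_family_uniform_decay[OF _ \<mu>] by blast
  have cover: "\<sigma> \<ge> 2" "\<And>p. p < \<sigma> \<Longrightarrow> bounded_sector \<epsilon>0 (\<E> p)"
    using assms(23) unfolding good_covering_def by blast+
  have \<E>: "\<E> p \<subseteq> ball 0 \<epsilon>0" if "p < \<sigma>" for p
    using cover(2)[OF that] unfolding bounded_sector_def by blast
  have strip: "strip \<beta>' \<subseteq> strip \<beta>" using \<beta>' by (auto simp: strip_def)
  have R: "0 < \<epsilon>0 * r\<^sub>T" "\<epsilon>0 * r\<^sub>T \<le> 1"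
    using e0 rT by (auto intro: mult_le_one)
  have solves: "op_P q k1 Y (q_shift q (- 1) (op_P q k2 X (u p))) t z \<epsilon> = q_shift q 1 (forcing N0 G) t z \<epsilon>"
    if p: "p < \<sigma>" and z: "z \<in> strip \<beta>'" and \<epsilon>: "\<epsilon> \<in> \<E> p"
      and t: "\<And>a b. a \<in> shifts k1 Y \<Longrightarrow> b \<in> shifts k2 X \<Longrightarrow> of_real (q powr (a - 1 + b)) * t \<in> \<T>"
    for p t z \<epsilon>
  proof -
    have e: "\<epsilon> \<in> ball 0 \<epsilon>0" using \<E>[OF p] \<epsilon> by blast
    note S = assms(25)[rule_format, OF p]
    note w1 = assms(34)[rule_format, OF p e, unfolded unique_solution_def]
    note w2 = assms(35)[rule_format, OF p e, unfolded unique_solution_def]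
    note psi1 = assms(48)[rule_format, OF p e, unfolded unique_solution_def]
    show ?thesis
      unfolding assms(3)
    proof (rule solution_solves[OF q k \<beta> \<mu> assms(14,12,13) R assms(27,28) _ _ _ _ assms(1)[THEN fun_cong]])
      show "ray (d p) \<subseteq> S p" "ray (d p) \<subseteq> U p" "S p \<subseteq> R_dom (d p) \<delta>'"
        "infdist (- complex_of_real \<delta>) (U p \<union> ball 0 \<rho>) > 0"
        using S unbounded_sector_ray by blast+
      show "\<psi>1 p \<epsilon> \<in> Exp_disc q (real k1) \<beta> \<mu> \<alpha> \<rho> \<delta> (U p)"
        "conv_equation q k1 0 Y \<epsilon> (dom_disc \<rho> (U p)) (borel_poly q k1 N0 G \<epsilon>) (\<psi>1 p \<epsilon>)"
        using psi1 by blast+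
      show "\<psi>2 p \<epsilon> = (\<lambda>\<tau> m. q_laplace q (kappa k1 k2) (d p) (\<lambda>h. \<psi>1 p \<epsilon> h m) \<tau>)"
        by (simp only: assms(2))
      show "\<psi>2 p \<epsilon> \<in> Exp_sect q (real k2) \<beta> \<mu> \<nu> (S p) (Rb p)"
        using assms(33) p e by blast
      show "w1 p \<epsilon> \<in> Exp_disc q (kappa k1 k2) \<beta> \<mu> \<alpha> \<rho> \<delta> (U p)"
        using w1 by blast
      show "w2 p \<epsilon> \<in> Exp_sect q (real k2) \<beta> \<mu> \<nu> (S p) (Rb p)"
        "conv_equation q k2 0 X \<epsilon> (dom_sect (S p) (Rb p)) (\<psi>2 p \<epsilon>) (w2 p \<epsilon>)"
        using w2 by blast+
      show "w2 p \<epsilon> \<tau> m = q_laplace q (kappa k1 k2) (d p) (\<lambda>h. w1 p \<epsilon> h m) \<tau>" if "\<tau> \<in> Rb p" for m \<tau>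
        using assms(37) p e that by blast
      show "\<epsilon> * t \<in> Rb p \<and> admissible_direction (S p) (d p) (\<epsilon> * t) (\<gamma> p (\<epsilon> * t))" if "t \<in> \<T>" for t
        using S assms(38) p \<epsilon> that by blast
    qed (use uniform_decay_decay[OF CX e] uniform_decay_decay[OF CY e] uniform_decay_decay[OF G e] exX exY t z strip in blast)+
  qed
  have sub: "ball 0 r\<^sub>T \<times> strip \<beta>' \<times> ball 0 \<epsilon>0 \<subseteq> UNIV \<times> strip \<beta> \<times> ball 0 \<epsilon>0"
    using strip by auto
  note h3X = holomorphic3_subset[OF op_coeffs_holomorphic3[OF CX open_ball] sub]
  note h3Y = holomorphic3_subset[OF op_coeffs_holomorphic3[OF CY open_ball] sub]
  \<comment> \<open>The instances with derivative of order 0 and dilation factor 1.\<close>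
  have analytic: "holomorphic3_on a (ball 0 r\<^sub>T \<times> strip \<beta>' \<times> ball 0 \<epsilon>0)" if "a \<in> op_coeffs X \<union> op_coeffs Y" for a
    using that h3X[of a 0 1] h3Y[of a 0 1] by auto
  show ?thesis
  proof (intro conjI allI ballI impI)
    fix b a s j assume "b \<in> op_coeffs Y" "a \<in> op_coeffs X"
    then show "holomorphic3_on (\<lambda>t z \<epsilon>. b t z \<epsilon> * q_shift q (s - 1) (\<lambda>t. (deriv ^^ j) (\<lambda>z. a t z \<epsilon>) z) t)
        (ball 0 r\<^sub>T \<times> strip \<beta>' \<times> ball 0 \<epsilon>0)"
      unfolding q_shift_def by (intro holomorphic3_mult analytic h3X) auto
  next
    show "holomorphic3_on (forcing N0 G) (ball 0 r\<^sub>T \<times> strip \<beta>' \<times> ball 0 \<epsilon>0)"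
      by (rule holomorphic3_subset[OF forcing_holomorphic3[OF G open_ball] sub])
  next
    fix uh t z
    assume gev: "\<forall>p<\<sigma>. q_Gevrey_expansion q (real k1) (\<T> \<times> strip \<beta>') (\<E> p) (\<lambda>\<epsilon> (t, z). u p t z \<epsilon>) uh"
      and z: "z \<in> strip \<beta>'"
      and t: "\<forall>a\<in>shifts k1 Y. \<forall>b\<in>shifts k2 X. of_real (q powr (a - 1 + b)) * t \<in> \<T>"
    \<comment> \<open>The series is the expansion on every sector of the covering, so the equation
      on the sector of index 0 determines it.\<close>
    have p: "0 < \<sigma>" using cover(1) by simp
    show "formal_op_P q k1 Y (q_shift q (- 1) (formal_op_P q k2 X (\<lambda>t z. Abs_fps (\<lambda>n. uh n (t, z))))) t z
        = fps_expansion (\<lambda>\<epsilon>. q_shift q 1 (forcing N0 G) t z \<epsilon>) 0"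
    proof (rule formal_solution[OF gev[rule_format, OF p] cover(2)[OF p] e0 \<beta>' _ CX CY G _ z])
      fix z \<epsilon> assume "z \<in> strip \<beta>'" "\<epsilon> \<in> \<E> 0"
      then show "op_P q k1 Y (q_shift q (- 1) (op_P q k2 X (u 0))) t z \<epsilon> = q_shift q 1 (forcing N0 G) t z \<epsilon>"
        using solves[OF p] t by blast
    qed (assumption | rule t[rule_format])+
  qed (use solves analytic in blast)+
qed

end
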